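(* Let $(P_b,Y)$ be the basic bundle gerbe over $SU(n)$ and $p\colon T\times SU(n)/T\to SU(n)$, $p(t,gT)=gtg^{-1}$, the Weyl map. There is an $SU(n)$-equivariant isomorphism of bundle gerbes over $T\times SU(n)/T$ $$p^{-1}(P_b,Y)\;\cong_{SU(n)}\;\bigotimes_{i=1}^n{}_{R}\,\big(J_i^{\varepsilon_i},\,Y_T\times SU(n)/T\big),$$ where $\bigotimes_R$ denotes the reduced product.
   Context: Line bundles are complex Hermitian. For a surjective submersion $Y\to M$, $Y^{[p]}$ is the $p$-fold fibre product. A bundle gerbe $(P,Y)$ over $M$ is a surjective submersion $Y\to M$ with a line bundle $P\to Y^{[2]}$ and an associative multiplication $P_{(y_1,y_2)}\otimes P_{(y_2,y_3)}\to P_{(y_1,y_3)}$. The reduced product of $(P,Y)$ and $(Q,Y)$ is $P\otimes Q\to Y^{[2]}$ with the tensor product multiplication. The pullback by $f\colon N\to M$ is $(f^{-1}(P),f^{-1}(Y))$. It is $G$-equivariant if $G$ acts compatibly on $M,Y,P$ preserving all structure. A ($G$-equivariant) isomorphism of bundle gerbes over $M$ is a ($G$-equivariant) isomorphism of the surjective submersions together with a covering isomorphism of line bundles preserving the multiplication. Cup product bundle gerbe: if $L\to M$ is a line bundle and $g\colon Y^{[2]}\to\mathbb Z$ is locally constant with $g(y_2,y_3)-g(y_1,y_3)+g(y_1,y_2)=0$, then $(L^g,Y)$ has as fibre over $(y_1,y_2)$ above $m\in M$ the power $L_m^{g(y_1,y_2)}$ (negative powers are powers of the dual, zeroth power trivial),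 with multiplication by tensor product. $T\subset SU(n)$ is the group of diagonal matrices; $p_i\colon T\to U(1)$ is the $i$-th diagonal entry. $SU(n)$ acts on itself by conjugation and on $T\times SU(n)/T$ by left multiplication on $SU(n)/T$. $J_i\to SU(n)/T$ is the homogeneous line bundle associated to $SU(n)\to SU(n)/T$ via the action $t\cdot z=p_i(t^{-1})z$ on $\mathbb C$; equivalently its fibre over $gT$ is $\mathbb C\,ge_i\subset\mathbb C^n$. It is pulled back to $T\times SU(n)/T$. Basic bundle gerbe: $Z=U(1)\setminus\{1\}$, ordered by anticlockwise rotation from $1$; $Y=\{(z,g)\in Z\times SU(n):z\notin\mathrm{spec}(g)\}\to SU(n)$. For $(z_1,z_2,g)\in Y^{[2]}$: if $z_1>z_2$ and $g$ has eigenvalues between them, $(P_b)_{(z_1,z_2,g)}=\det L_{(z_1,z_2,g)}$ with $L_{(z_1,z_2,g)}=\bigoplus_{z_1>\lambda>z_2}E_{(g,\lambda)}$ (sum of eigenspaces); if there are no eigenvalues between $z_1$ and $z_2$ the fibre is $\mathbb C$; if $z_1<z_2$ and there are eigenvalues between them, it is $\det(L_{(z_2,z_1,g)})^*$. The multiplication is induced (with duals in the other cases) from $\det L_{(z_1,z_2,g)}\otimes\det L_{(z_2,z_3,g)}\cong\det(L_{(z_1,z_2,g)}\oplus L_{(z_2,z_3,g)})=\det L_{(z_1,z_3,g)}$ for $z_1>z_2>z_3$. $Y_T=\{(z,t)\in Z\times T:z\ne p_i(t)\ \forall i\}$, so that $p^{-1}(Y)=Y_T\times SU(n)/T$. $\varepsilon_i\colon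 Y_T^{[2]}\to\mathbb Z$ is $\varepsilon_i(z_1,z_2,t)=1$ if $z_1>p_i(t)>z_2$, $-1$ if $z_2>p_i(t)>z_1$, and $0$ otherwise; it is extended to $Y_T^{[2]}\times SU(n)/T$ by projection. *)

theory Defs
  imports "HOL-Analysis.Analysis"
begin

section \<open>Smooth spaces\<close>

text \<open>
  Smooth manifolds are handled through their diffeology: the smooth structure of \<open>X\<close> is given by
  its plots, the smooth maps into \<open>X\<close> from open subsets of all the spaces \<open>R^k\<close>. A map between
  manifolds is smooth iff it sends plots to plots. The manifolds that occur are obtained from
  embedded submanifolds of vector spaces by products, embedded subsets and the quotient
  \<open>SU(n) \<rightarrow> SU(n)/T\<close>; the usual smooth structures are those given by the constructions below.
  \<open>R^k\<close> is the set of sequences vanishing from index \<open>k\<close> on, as in \<^const>\<open>Euclidean_space\<close>.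
\<close>

text \<open>\<open>D [i\<^sub>1, \<dots>, i\<^sub>r]\<close> is the iterated partial derivative of \<open>f\<close> in the coordinates \<open>i\<^sub>1, \<dots>, i\<^sub>r\<close>.\<close>

definition C_infinity_on ::
  "nat \<Rightarrow> (nat \<Rightarrow> real) set \<Rightarrow> ((nat \<Rightarrow> real) \<Rightarrow> 'b::real_normed_vector) \<Rightarrow> bool" where
  "C_infinity_on k U f \<longleftrightarrow> openin (Euclidean_space k) U \<and>
     (\<exists>D :: nat list \<Rightarrow> (nat \<Rightarrow> real) \<Rightarrow> 'b.
        (\<forall>x\<in>U. D [] x = f x) \<and>
        (\<forall>is. set is \<subseteq> {..<k} \<longrightarrow>
           continuous_map (subtopology (Euclidean_space k) U) euclidean (D is) \<and>
           (\<forall>i<k. \<forall>x\<in>U.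
              ((\<lambda>h. D is (x(i := x i + h))) has_vector_derivative D (i # is) x) (at 0))))"

record 'a smooth_space =
  points :: "'a set"
  plot :: "nat \<Rightarrow> (nat \<Rightarrow> real) set \<Rightarrow> ((nat \<Rightarrow> real) \<Rightarrow> 'a) \<Rightarrow> bool"

definition embedded :: "'b::real_normed_vector set \<Rightarrow> 'b smooth_space" where
  "embedded A = \<lparr>points = A, plot = (\<lambda>k U \<alpha>. C_infinity_on k U \<alpha> \<and> \<alpha> ` U \<subseteq> A)\<rparr>"

definition coord_space :: "('i \<Rightarrow> complex) smooth_space" where
  "coord_space = \<lparr>points = UNIV,
     plot = (\<lambda>k U \<alpha>. openin (Euclidean_space k) U \<and> (\<forall>i. C_infinity_on k U (\<lambda>x. \<alpha> x i)))\<rparr>"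

definition subspace_of :: "'a smooth_space \<Rightarrow> 'a set \<Rightarrow> 'a smooth_space" where
  "subspace_of X A = \<lparr>points = points X \<inter> A, plot = (\<lambda>k U \<alpha>. plot X k U \<alpha> \<and> \<alpha> ` U \<subseteq> A)\<rparr>"

definition prod_space :: "'a smooth_space \<Rightarrow> 'b smooth_space \<Rightarrow> ('a \<times> 'b) smooth_space"
    (infixr "\<times>\<^sub>s" 75) where
  "X \<times>\<^sub>s Y = \<lparr>points = points X \<times> points Y,
     plot = (\<lambda>k U \<alpha>. plot X k U (\<lambda>x. fst (\<alpha> x)) \<and> plot Y k U (\<lambda>x. snd (\<alpha> x)))\<rparr>"

definition quotient_space :: "'a smooth_space \<Rightarrow> ('a \<Rightarrow> 'b) \<Rightarrow> 'b smooth_space" where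
  "quotient_space X q = \<lparr>points = q ` points X,
     plot = (\<lambda>k U \<alpha>. openin (Euclidean_space k) U \<and>
       (\<forall>u\<in>U. \<exists>V \<beta>. u \<in> V \<and> V \<subseteq> U \<and> plot X k V \<beta> \<and> (\<forall>x\<in>V. \<alpha> x = q (\<beta> x))))\<rparr>"

definition smooth_map :: "'a smooth_space \<Rightarrow> 'b smooth_space \<Rightarrow> ('a \<Rightarrow> 'b) \<Rightarrow> bool" where
  "smooth_map X Y f \<longleftrightarrow> f ` points X \<subseteq> points Y \<and>
     (\<forall>k U \<alpha>. plot X k U \<alpha> \<longrightarrow> plot Y k U (f \<circ> \<alpha>))"

definition diffeomorphism :: "'a smooth_space \<Rightarrow> 'b smooth_space \<Rightarrow> ('a \<Rightarrow> 'b) \<Rightarrow> bool" where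
  "diffeomorphism X Y f \<longleftrightarrow> bij_betw f (points X) (points Y) \<and>
     smooth_map X Y f \<and> smooth_map Y X (inv_into (points X) f)"

text \<open>
  A smooth map of manifolds is a submersion iff every smooth family of points downstairs lifts
  locally, with prescribed value at one parameter (take charts downstairs as plots to obtain
  local sections through every point).
\<close>

definition surjective_submersion :: "'y smooth_space \<Rightarrow> 'm smooth_space \<Rightarrow> ('y \<Rightarrow> 'm) \<Rightarrow> bool" where
  "surjective_submersion Y M \<pi> \<longleftrightarrow> smooth_map Y M \<pi> \<and> \<pi> ` points Y = points M \<and>
     (\<forall>k U \<alpha> u y. plot M k U \<alpha> \<and> u \<in> U \<and> y \<in> points Y \<and> \<pi> y = \<alpha> u \<longrightarrow>
        (\<exists>V \<beta>. u \<in> V \<and> V \<subseteq> U \<and> plot Y k V \<beta> \<and> \<beta> u = y \<and> (\<forall>x\<in>V. \<pi> (\<beta> x) = \<alpha> x)))"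

definition fibre_square :: "'y smooth_space \<Rightarrow> ('y \<Rightarrow> 'm) \<Rightarrow> ('y \<times> 'y) smooth_space" where
  "fibre_square Y \<pi> = subspace_of (Y \<times>\<^sub>s Y) {(y1, y2). \<pi> y1 = \<pi> y2}"


section \<open>Hermitian line bundles\<close>

text \<open>
  A Hermitian line bundle over \<open>X\<close> is presented as a subbundle of a trivial bundle \<open>X \<times> C^I\<close> with the
  induced metric, by its fibres \<open>F x \<subseteq> C^I\<close>. Over a manifold every Hermitian line bundle is isometric
  to one of this form. The index type may be infinite, but all vectors in the fibres have finite
  support.
\<close>

type_synonym 'i cvec = "'i \<Rightarrow> complex"

definition herm :: "'i cvec \<Rightarrow> 'i cvec \<Rightarrow> complex" where
  "herm v w = (\<Sum>i\<in>{i. v i \<noteq> 0}. v i * cnj (w i))"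

definition complex_line :: "'i cvec set \<Rightarrow> bool" where
  "complex_line l \<longleftrightarrow> (\<exists>v. finite {i. v i \<noteq> 0} \<and> v \<noteq> (\<lambda>i. 0) \<and> l = {(\<lambda>i. c * v i) | c. True})"

definition total_space :: "'x smooth_space \<Rightarrow> ('x \<Rightarrow> 'i cvec set) \<Rightarrow> ('x \<times> 'i cvec) smooth_space" where
  "total_space X F = subspace_of (X \<times>\<^sub>s coord_space) {(x, v). v \<in> F x}"

text \<open>Local triviality: there are smooth unit frames locally along every plot (hence, using charts
  as plots, locally on a manifold).\<close>

definition hermitian_line_bundle :: "'x smooth_space \<Rightarrow> ('x \<Rightarrow> 'i cvec set) \<Rightarrow> bool" where
  "hermitian_line_bundle X F \<longleftrightarrow> (\<forall>x\<in>points X. complex_line (F x)) \<and>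
     (\<forall>k U \<alpha> u. plot X k U \<alpha> \<and> u \<in> U \<longrightarrow>
        (\<exists>V e. u \<in> V \<and> V \<subseteq> U \<and> plot coord_space k V e \<and>
           (\<forall>x\<in>V. e x \<in> F (\<alpha> x) \<and> herm (e x) (e x) = 1)))"

definition linear_isometry_on :: "'i cvec set \<Rightarrow> 'j cvec set \<Rightarrow> ('i cvec \<Rightarrow> 'j cvec) \<Rightarrow> bool" where
  "linear_isometry_on l l' \<phi> \<longleftrightarrow> bij_betw \<phi> l l' \<and>
     (\<forall>v\<in>l. \<forall>w\<in>l. \<forall>c. \<phi> (\<lambda>i. v i + c * w i) = (\<lambda>j. \<phi> v j + c * \<phi> w j)) \<and>
     (\<forall>v\<in>l. \<forall>w\<in>l. herm (\<phi> v) (\<phi> w) = herm v w)"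

text \<open>\<open>\<Phi> x\<close> is the map of the fibre over \<open>x\<close>, covering \<open>f\<close>.\<close>

definition line_bundle_iso ::
  "'x smooth_space \<Rightarrow> ('x \<Rightarrow> 'i cvec set) \<Rightarrow> 'z smooth_space \<Rightarrow> ('z \<Rightarrow> 'j cvec set) \<Rightarrow>
   ('x \<Rightarrow> 'z) \<Rightarrow> ('x \<Rightarrow> 'i cvec \<Rightarrow> 'j cvec) \<Rightarrow> bool" where
  "line_bundle_iso X F Z H f \<Phi> \<longleftrightarrow> diffeomorphism X Z f \<and>
     (\<forall>x\<in>points X. linear_isometry_on (F x) (H (f x)) (\<Phi> x)) \<and>
     diffeomorphism (total_space X F) (total_space Z H) (\<lambda>(x, v). (f x, \<Phi> x v))"

subsection \<open>Duals, tensor products and powers of lines\<close>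

definition pairing :: "('i::finite) cvec \<Rightarrow> 'i cvec \<Rightarrow> complex" where
  "pairing f v = (\<Sum>i\<in>UNIV. f i * v i)"

text \<open>
  A linear functional on \<open>C^I\<close> is identified with its coordinates. Functionals on the line \<open>l\<close> are
  extended by \<open>0\<close> to the orthogonal complement of \<open>l\<close>, which preserves the norm.
\<close>

definition dual_line :: "('i::finite) cvec set \<Rightarrow> 'i cvec set" where
  "dual_line l = {f. \<forall>w. (\<forall>v\<in>l. herm w v = 0) \<longrightarrow> pairing f w = 0}"

text \<open>The contragredient of an isomorphism \<open>\<rho> : l \<rightarrow> l'\<close>, that is, \<open>f \<mapsto> f \<circ> \<rho>\<^sup>-\<^sup>1\<close>.\<close>

definition dual_map ::
  "('i cvec \<Rightarrow> 'j cvec) \<Rightarrow> ('i::finite) cvec set \<Rightarrow> ('j::finite) cvec set \<Rightarrow> 'i cvec \<Rightarrow> 'j cvec" where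
  "dual_map \<rho> l l' f = (THE f'. f' \<in> dual_line l' \<and> (\<forall>v\<in>l. pairing f' (\<rho> v) = pairing f v))"

text \<open>\<open>c vs\<^sub>0 \<otimes> \<dots> \<otimes> vs\<^sub>m\<^sub>-\<^sub>1\<close>, in the coordinates of \<open>(C^I)^{\<otimes>m}\<close> indexed by lists of length \<open>m\<close>. For a line
  \<open>l\<close> all elements of \<open>l^{\<otimes>m}\<close> are of this form.\<close>

definition pure_power :: "nat \<Rightarrow> complex \<Rightarrow> (nat \<Rightarrow> 'i cvec) \<Rightarrow> 'i list cvec" where
  "pure_power m c vs = (\<lambda>xs. if length xs = m then c * (\<Prod>j<m. vs j (xs ! j)) else 0)"

definition tensor_power :: "nat \<Rightarrow> 'i cvec set \<Rightarrow> 'i list cvec set" where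
  "tensor_power m l = {pure_power m c vs | c vs. \<forall>j<m. vs j \<in> l}"

definition tensor_power_map ::
  "nat \<Rightarrow> ('i cvec \<Rightarrow> 'j cvec) \<Rightarrow> 'i cvec set \<Rightarrow> 'i list cvec \<Rightarrow> 'j list cvec" where
  "tensor_power_map m \<rho> l S = (THE S'. \<exists>c vs. (\<forall>j<m. vs j \<in> l) \<and>
      S = pure_power m c vs \<and> S' = pure_power m c (\<lambda>j. \<rho> (vs j)))"

definition line_power :: "int \<Rightarrow> ('i::finite) cvec set \<Rightarrow> 'i list cvec set" where
  "line_power a l =
     (if a \<ge> 0 then tensor_power (nat a) l else tensor_power (nat (- a)) (dual_line l))"

definition line_power_map ::
  "int \<Rightarrow> ('i cvec \<Rightarrow> 'j cvec) \<Rightarrow> ('i::finite) cvec set \<Rightarrow> ('j::finite) cvec set \<Rightarrow>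
   'i list cvec \<Rightarrow> 'j list cvec" where
  "line_power_map a \<rho> l l' =
     (if a \<ge> 0 then tensor_power_map (nat a) \<rho> l
      else tensor_power_map (nat (- a)) (dual_map \<rho> l l') (dual_line l))"

text \<open>\<open>l^a \<otimes> l^b \<rightarrow> l^{a+b}\<close>: the tensor product, followed for opposite signs by the contraction of the
  last \<open>r\<close> factors of the first tensor with the first \<open>r\<close> factors of the second.\<close>

definition line_power_mult :: "int \<Rightarrow> int \<Rightarrow> ('i::finite) list cvec \<Rightarrow> 'i list cvec \<Rightarrow> 'i list cvec" where
  "line_power_mult a b S S' =
     (let p = nat \<bar>a\<bar>; q = nat \<bar>b\<bar>; r = (if a * b < 0 then min p q else 0) in
      (\<lambda>xs. if length xs = nat \<bar>a + b\<bar>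
            then \<Sum>ys\<in>{ys. length ys = r}. S (take (p - r) xs @ ys) * S' (ys @ drop (p - r) xs)
            else 0))"

text \<open>The tensor product \<open>\<Otimes>\<^sub>i v\<^sub>i\<close> over a finite index type; for lines \<open>l\<^sub>i\<close> all elements of
  \<open>\<Otimes>\<^sub>i l\<^sub>i\<close> are of this form.\<close>

definition pure_tensor :: "('n::finite \<Rightarrow> 'j cvec) \<Rightarrow> ('n \<Rightarrow> 'j) cvec" where
  "pure_tensor v = (\<lambda>\<sigma>. \<Prod>i\<in>UNIV. v i (\<sigma> i))"


section \<open>Bundle gerbes\<close>

record 'g lie_group =
  group_space :: "'g smooth_space"
  group_mult :: "'g \<Rightarrow> 'g \<Rightarrow> 'g"
  group_one :: 'g

record ('g, 'm, 'y) equivariant_submersion =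
  base :: "'m smooth_space"
  cover :: "'y smooth_space"
  proj :: "'y \<Rightarrow> 'm"
  act_base :: "'g \<Rightarrow> 'm \<Rightarrow> 'm"
  act_cover :: "'g \<Rightarrow> 'y \<Rightarrow> 'y"

text \<open>\<open>fibre B y1 y2\<close> is the fibre over \<open>(y1, y2)\<close>, \<open>mult B y1 y2 y3\<close> the multiplication over
  \<open>(y1, y2, y3)\<close>, and \<open>act_fibre B h y1 y2\<close> maps the fibre over \<open>(y1, y2)\<close> to that over
  \<open>(h y1, h y2)\<close>.\<close>

record ('g, 'm, 'y, 'i) gerbe = "('g, 'm, 'y) equivariant_submersion" +
  fibre :: "'y \<Rightarrow> 'y \<Rightarrow> 'i cvec set"
  mult :: "'y \<Rightarrow> 'y \<Rightarrow> 'y \<Rightarrow> 'i cvec \<Rightarrow> 'i cvec \<Rightarrow> 'i cvec"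
  act_fibre :: "'g \<Rightarrow> 'y \<Rightarrow> 'y \<Rightarrow> 'i cvec \<Rightarrow> 'i cvec"

definition same_fibre :: "('g, 'm, 'y, 'z) equivariant_submersion_scheme \<Rightarrow> 'y list \<Rightarrow> bool" where
  "same_fibre B ys \<longleftrightarrow> set ys \<subseteq> points (cover B) \<and> (\<forall>y\<in>set ys. \<forall>y'\<in>set ys. proj B y = proj B y')"

definition pair_fibre :: "('g, 'm, 'y, 'i) gerbe \<Rightarrow> 'y \<times> 'y \<Rightarrow> 'i cvec set" where
  "pair_fibre B = (\<lambda>(y1, y2). fibre B y1 y2)"

text \<open>The multiplication is smooth, bilinear, isometric and associative; being isometric, it is an
  isomorphism of line bundles.\<close>

definition bundle_gerbe :: "('g, 'm, 'y, 'i) gerbe \<Rightarrow> bool" where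
  "bundle_gerbe B \<longleftrightarrow>
     surjective_submersion (cover B) (base B) (proj B) \<and>
     hermitian_line_bundle (fibre_square (cover B) (proj B)) (pair_fibre B) \<and>
     smooth_map
       (subspace_of (cover B \<times>\<^sub>s cover B \<times>\<^sub>s cover B \<times>\<^sub>s coord_space \<times>\<^sub>s coord_space)
          {(y1, y2, y3, p, q). same_fibre B [y1, y2, y3] \<and> p \<in> fibre B y1 y2 \<and> q \<in> fibre B y2 y3})
       coord_space (\<lambda>(y1, y2, y3, p, q). mult B y1 y2 y3 p q) \<and>
     (\<forall>y1 y2 y3. same_fibre B [y1, y2, y3] \<longrightarrow>
        (\<forall>p\<in>fibre B y1 y2. \<forall>q\<in>fibre B y2 y3.
           mult B y1 y2 y3 p q \<in> fibre B y1 y3 \<and>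
           (\<forall>p'\<in>fibre B y1 y2. \<forall>c. mult B y1 y2 y3 (\<lambda>i. p i + c * p' i) q =
              (\<lambda>i. mult B y1 y2 y3 p q i + c * mult B y1 y2 y3 p' q i)) \<and>
           (\<forall>q'\<in>fibre B y2 y3. \<forall>c. mult B y1 y2 y3 p (\<lambda>i. q i + c * q' i) =
              (\<lambda>i. mult B y1 y2 y3 p q i + c * mult B y1 y2 y3 p q' i)) \<and>
           (\<forall>p'\<in>fibre B y1 y2. \<forall>q'\<in>fibre B y2 y3.
              herm (mult B y1 y2 y3 p q) (mult B y1 y2 y3 p' q') = herm p p' * herm q q'))) \<and>
     (\<forall>y1 y2 y3 y4. same_fibre B [y1, y2, y3, y4] \<longrightarrow>
        (\<forall>p\<in>fibre B y1 y2. \<forall>q\<in>fibre B y2 y3. \<forall>r\<in>fibre B y3 y4.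
           mult B y1 y3 y4 (mult B y1 y2 y3 p q) r = mult B y1 y2 y4 p (mult B y2 y3 y4 q r)))"

definition smooth_action :: "'g lie_group \<Rightarrow> 'a smooth_space \<Rightarrow> ('g \<Rightarrow> 'a \<Rightarrow> 'a) \<Rightarrow> bool" where
  "smooth_action G X act \<longleftrightarrow> smooth_map (group_space G \<times>\<^sub>s X) X (\<lambda>(h, x). act h x) \<and>
     (\<forall>x\<in>points X. act (group_one G) x = x) \<and>
     (\<forall>h\<in>points (group_space G). \<forall>k\<in>points (group_space G). \<forall>x\<in>points X.
        act (group_mult G h k) x = act h (act k x))"

definition equivariant_bundle_gerbe :: "'g lie_group \<Rightarrow> ('g, 'm, 'y, 'i) gerbe \<Rightarrow> bool" where
  "equivariant_bundle_gerbe G B \<longleftrightarrow> bundle_gerbe B \<and>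
     smooth_action G (base B) (act_base B) \<and>
     smooth_action G (cover B) (act_cover B) \<and>
     smooth_action G (total_space (fibre_square (cover B) (proj B)) (pair_fibre B))
       (\<lambda>h ((y1, y2), p). ((act_cover B h y1, act_cover B h y2), act_fibre B h y1 y2 p)) \<and>
     (\<forall>h\<in>points (group_space G).
        (\<forall>y\<in>points (cover B). proj B (act_cover B h y) = act_base B h (proj B y)) \<and>
        (\<forall>y1 y2. same_fibre B [y1, y2] \<longrightarrow>
           linear_isometry_on (fibre B y1 y2) (fibre B (act_cover B h y1) (act_cover B h y2))
             (act_fibre B h y1 y2)) \<and>
        (\<forall>y1 y2 y3. same_fibre B [y1, y2, y3] \<longrightarrow>
           (\<forall>p\<in>fibre B y1 y2. \<forall>q\<in>fibre B y2 y3.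
              act_fibre B h y1 y3 (mult B y1 y2 y3 p q) =
              mult B (act_cover B h y1) (act_cover B h y2) (act_cover B h y3)
                (act_fibre B h y1 y2 p) (act_fibre B h y2 y3 q))))"

text \<open>Isomorphism of \<open>G\<close>-equivariant bundle gerbes over the same \<open>G\<close>-manifold.\<close>

definition equivariant_gerbe_iso ::
  "'g lie_group \<Rightarrow> ('g, 'm, 'y, 'i) gerbe \<Rightarrow> ('g, 'm, 'z, 'j) gerbe \<Rightarrow> bool" where
  "equivariant_gerbe_iso G A B \<longleftrightarrow>
     equivariant_bundle_gerbe G A \<and> equivariant_bundle_gerbe G B \<and>
     base A = base B \<and>
     (\<forall>h\<in>points (group_space G). \<forall>x\<in>points (base A). act_base A h x = act_base B h x) \<and>
     (\<exists>\<phi> \<Phi>.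
        diffeomorphism (cover A) (cover B) \<phi> \<and>
        (\<forall>y\<in>points (cover A). proj B (\<phi> y) = proj A y) \<and>
        line_bundle_iso (fibre_square (cover A) (proj A)) (pair_fibre A)
          (fibre_square (cover B) (proj B)) (pair_fibre B)
          (\<lambda>(y1, y2). (\<phi> y1, \<phi> y2)) (\<lambda>(y1, y2). \<Phi> y1 y2) \<and>
        (\<forall>y1 y2 y3. same_fibre A [y1, y2, y3] \<longrightarrow>
           (\<forall>p\<in>fibre A y1 y2. \<forall>q\<in>fibre A y2 y3.
              \<Phi> y1 y3 (mult A y1 y2 y3 p q) =
              mult B (\<phi> y1) (\<phi> y2) (\<phi> y3) (\<Phi> y1 y2 p) (\<Phi> y2 y3 q))) \<and>
        (\<forall>h\<in>points (group_space G).
           (\<forall>y\<in>points (cover A). \<phi> (act_cover A h y) = act_cover B h (\<phi> y)) \<and>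
           (\<forall>y1 y2. same_fibre A [y1, y2] \<longrightarrow> (\<forall>p\<in>fibre A y1 y2.
              \<Phi> (act_cover A h y1) (act_cover A h y2) (act_fibre A h y1 y2 p) =
              act_fibre B h (\<phi> y1) (\<phi> y2) (\<Phi> y1 y2 p)))))"

text \<open>Pullback along an equivariant map \<open>f : N \<rightarrow> M\<close>, where \<open>act\<close> is the action on \<open>N\<close>.\<close>

definition pullback_gerbe ::
  "'k smooth_space \<Rightarrow> ('g \<Rightarrow> 'k \<Rightarrow> 'k) \<Rightarrow> ('k \<Rightarrow> 'm) \<Rightarrow> ('g, 'm, 'y, 'i) gerbe \<Rightarrow>
   ('g, 'k, 'k \<times> 'y, 'i) gerbe" where
  "pullback_gerbe N act f B = \<lparr>
     base = N,
     cover = subspace_of (N \<times>\<^sub>s cover B) {(x, y). f x = proj B y},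
     proj = fst,
     act_base = act,
     act_cover = (\<lambda>h (x, y). (act h x, act_cover B h y)),
     fibre = (\<lambda>(x1, y1) (x2, y2). fibre B y1 y2),
     mult = (\<lambda>(x1, y1) (x2, y2) (x3, y3). mult B y1 y2 y3),
     act_fibre = (\<lambda>h (x1, y1) (x2, y2). act_fibre B h y1 y2)\<rparr>"

text \<open>The reduced product of finitely many gerbes with the same equivariant submersion.\<close>

definition reduced_product ::
  "('n::finite \<Rightarrow> ('g, 'm, 'y, 'j) gerbe) \<Rightarrow> ('g, 'm, 'y, 'n \<Rightarrow> 'j) gerbe" where
  "reduced_product B = (let S = B (SOME i. True) in \<lparr>
     base = base S, cover = cover S, proj = proj S, act_base = act_base S, act_cover = act_cover S,
     fibre = (\<lambda>y1 y2. {pure_tensor v | v. \<forall>i. v i \<in> fibre (B i) y1 y2}),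
     mult = (\<lambda>y1 y2 y3 p q. THE r. \<exists>v w.
       (\<forall>i. v i \<in> fibre (B i) y1 y2 \<and> w i \<in> fibre (B i) y2 y3) \<and>
       p = pure_tensor v \<and> q = pure_tensor w \<and>
       r = pure_tensor (\<lambda>i. mult (B i) y1 y2 y3 (v i) (w i))),
     act_fibre = (\<lambda>h y1 y2 p. THE r. \<exists>v. (\<forall>i. v i \<in> fibre (B i) y1 y2) \<and>
       p = pure_tensor v \<and> r = pure_tensor (\<lambda>i. act_fibre (B i) h y1 y2 (v i)))\<rparr>)"

text \<open>The cup product gerbe of a line bundle \<open>L\<close> on the base, on which \<open>h\<close> acts by
  \<open>\<rho> h x : L x \<rightarrow> L (h x)\<close>, with an integer cocycle \<open>g\<close>.\<close>

definition cup_gerbe ::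
  "('g, 'm, 'y) equivariant_submersion \<Rightarrow> ('m \<Rightarrow> ('i::finite) cvec set) \<Rightarrow>
   ('g \<Rightarrow> 'm \<Rightarrow> 'i cvec \<Rightarrow> 'i cvec) \<Rightarrow> ('y \<Rightarrow> 'y \<Rightarrow> int) \<Rightarrow> ('g, 'm, 'y, 'i list) gerbe" where
  "cup_gerbe S L \<rho> g = \<lparr>
     base = base S, cover = cover S, proj = proj S, act_base = act_base S, act_cover = act_cover S,
     fibre = (\<lambda>y1 y2. line_power (g y1 y2) (L (proj S y1))),
     mult = (\<lambda>y1 y2 y3. line_power_mult (g y1 y2) (g y2 y3)),
     act_fibre = (\<lambda>h y1 y2. line_power_map (g y1 y2) (\<rho> h (proj S y1))
       (L (proj S y1)) (L (act_base S h (proj S y1))))\<rparr>"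


section \<open>The special unitary group and the Weyl map\<close>

type_synonym 'n cmat = "complex ^ 'n ^ 'n"

definition adj :: "('n::finite) cmat \<Rightarrow> 'n cmat" where
  "adj g = (\<chi> i j. cnj (g $ j $ i))"

definition SU :: "('n::finite) cmat set" where
  "SU = {g. adj g ** g = mat 1 \<and> det g = 1}"

definition SU_group :: "('n::finite) cmat lie_group" where
  "SU_group = \<lparr>group_space = embedded SU, group_mult = (**), group_one = mat 1\<rparr>"

definition torus :: "('n::finite) cmat set" where
  "torus = {t \<in> SU. \<forall>i j. i \<noteq> j \<longrightarrow> t $ i $ j = 0}"

definition coset :: "('n::finite) cmat \<Rightarrow> 'n cmat set" where
  "coset g = {g ** t | t. t \<in> torus}"

definition flag_space :: "('n::finite) cmat set smooth_space" where
  "flag_space = quotient_space (embedded SU) coset"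

definition weyl_domain :: "(('n::finite) cmat \<times> 'n cmat set) smooth_space" where
  "weyl_domain = embedded torus \<times>\<^sub>s flag_space"

definition weyl_act :: "('n::finite) cmat \<Rightarrow> 'n cmat \<times> 'n cmat set \<Rightarrow> 'n cmat \<times> 'n cmat set" where
  "weyl_act h = (\<lambda>(t, C). (t, (\<lambda>g. h ** g) ` C))"

text \<open>\<open>p(t, gT) = g t g\<^sup>-\<^sup>1\<close>, where \<open>g\<^sup>-\<^sup>1 = g\<^sup>*\<close>.\<close>

definition weyl_map :: "('n::finite) cmat \<times> 'n cmat set \<Rightarrow> 'n cmat" where
  "weyl_map = (\<lambda>(t, C). THE x. \<exists>g\<in>C. x = g ** t ** adj g)"

definition cut_circle :: "complex set" where
  "cut_circle = {z. norm z = 1 \<and> z \<noteq> 1}"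

text \<open>The order by anticlockwise rotation from \<open>1\<close>; the number \<open>1\<close> itself is never between two
  points of the cut circle, as its argument is \<open>0\<close>.\<close>

definition ccw_greater :: "complex \<Rightarrow> complex \<Rightarrow> bool" (infix "\<succ>" 50) where
  "z \<succ> w \<longleftrightarrow> Arg2pi z > Arg2pi w"

definition torus_cover ::
  "('n::finite cmat, 'n cmat \<times> 'n cmat set, (complex \<times> 'n cmat) \<times> 'n cmat set)
   equivariant_submersion" where
  "torus_cover = \<lparr>
     base = weyl_domain,
     cover = subspace_of (embedded cut_circle \<times>\<^sub>s embedded torus) {(z, t). \<forall>i. z \<noteq> t $ i $ i}
       \<times>\<^sub>s flag_space,
     proj = (\<lambda>((z, t), C). (t, C)),
     act_base = weyl_act,
     act_cover = (\<lambda>h ((z, t), C). ((z, t), (\<lambda>g. h ** g) ` C))\<rparr>"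

definition eps ::
  "'n \<Rightarrow> (complex \<times> ('n::finite) cmat) \<times> 'n cmat set \<Rightarrow> (complex \<times> 'n cmat) \<times> 'n cmat set \<Rightarrow> int" where
  "eps i = (\<lambda>((z1, t), C) ((z2, _), _).
     if z1 \<succ> t $ i $ i \<and> t $ i $ i \<succ> z2 then 1
     else if z2 \<succ> t $ i $ i \<and> t $ i $ i \<succ> z1 then - 1 else 0)"

text \<open>The fibre of \<open>J\<^sub>i\<close> over \<open>gT\<close> is \<open>C g e\<^sub>i\<close>; the line bundle is pulled back to the domain of the
  Weyl map.\<close>

definition J_bundle :: "'n \<Rightarrow> ('n::finite) cmat \<times> 'n cmat set \<Rightarrow> 'n cvec set" where
  "J_bundle i = (\<lambda>(t, C). {($) (c *s (g *v axis i 1)) | c g. g \<in> C})"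

definition J_act :: "('n::finite) cmat \<Rightarrow> 'n cmat \<times> 'n cmat set \<Rightarrow> 'n cvec \<Rightarrow> 'n cvec" where
  "J_act h = (\<lambda>_ v. ($) (h *v vec_lambda v))"


section \<open>The exterior algebra\<close>

text \<open>
  \<open>\<Lambda> C^n\<close> has the orthonormal basis \<open>e\<^sub>S\<close>, the increasing wedge product of the \<open>e\<^sub>i\<close> with \<open>i \<in> S\<close>,
  so its elements are functions of \<open>S\<close>. Functionals on \<open>\<Lambda> C^n\<close> have the same kind of coordinates
  with respect to the dual basis.
\<close>

definition shuffle_sign :: "('n::{finite,linorder}) set \<Rightarrow> 'n set \<Rightarrow> complex" where
  "shuffle_sign A B = (- 1) ^ card {(a, b). a \<in> A \<and> b \<in> B \<and> b < a}"

definition wedge :: "('n::{finite,linorder}) set cvec \<Rightarrow> 'n set cvec \<Rightarrow> 'n set cvec" where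
  "wedge a b = (\<lambda>S. \<Sum>A\<in>Pow S. shuffle_sign A (S - A) * a A * b (S - A))"

definition ext_scalar :: "complex \<Rightarrow> ('n::{finite,linorder}) set cvec" where
  "ext_scalar c = (\<lambda>S. if S = {} then c else 0)"

definition ext_vector :: "complex ^ ('n::{finite,linorder}) \<Rightarrow> 'n set cvec" where
  "ext_vector v = (\<lambda>S. \<Sum>i | S = {i}. v $ i)"

definition wedge_list :: "(complex ^ ('n::{finite,linorder})) list \<Rightarrow> 'n set cvec" where
  "wedge_list vs = foldr (\<lambda>v. wedge (ext_vector v)) vs (ext_scalar 1)"

text \<open>
  If \<open>f\<close> is a functional and \<open>x = b\<close> an element of \<open>\<Lambda> C^n\<close>, the result is the functional
  \<open>a \<mapsto> f (a \<and> b)\<close>. The same coordinate formula, with an element \<open>f = c\<close> and a functional \<open>x\<close>, gives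
  the contraction of \<open>c\<close> by \<open>x\<close> from the right: if \<open>c = a \<and> b\<close> with \<open>a \<in> \<Lambda>^top V\<close>, \<open>b \<in> \<Lambda>^top W\<close>,
  \<open>V\<close> orthogonal to \<open>W\<close>, and \<open>x \<in> (\<Lambda>^top W)\<^sup>*\<close> is extended by \<open>0\<close> as in \<^const>\<open>dual_line\<close>, it is
  \<open>x(b) a\<close>.
\<close>

definition contract_right :: "('n::{finite,linorder}) set cvec \<Rightarrow> 'n set cvec \<Rightarrow> 'n set cvec" where
  "contract_right f x = (\<lambda>S. \<Sum>B\<in>Pow (- S). shuffle_sign S B * f (S \<union> B) * x B)"

text \<open>The same from the left: \<open>a \<mapsto> f (b \<and> a)\<close> for \<open>x = b\<close>, and \<open>x(b) a\<close> for \<open>f = b \<and> a\<close>.\<close>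

definition contract_left :: "('n::{finite,linorder}) set cvec \<Rightarrow> 'n set cvec \<Rightarrow> 'n set cvec" where
  "contract_left x f = (\<lambda>S. \<Sum>B\<in>Pow (- S). shuffle_sign B S * x B * f (B \<union> S))"

text \<open>\<open>\<Lambda>^top L\<close>; being a line spanned by any nonzero product it consists of decomposable elements.\<close>

definition det_line :: "(complex ^ ('n::{finite,linorder})) set \<Rightarrow> 'n set cvec set" where
  "det_line L = {(\<lambda>S. c * wedge_list vs S) | c vs. set vs \<subseteq> L \<and> length vs = vec.dim L}"

text \<open>The algebra endomorphism \<open>\<Lambda> h\<close> of \<open>\<Lambda> C^n\<close>.\<close>

definition ext_map :: "('n::{finite,linorder}) cmat \<Rightarrow> 'n set cvec \<Rightarrow> 'n set cvec" where
  "ext_map h w = (\<lambda>S. \<Sum>A\<in>UNIV.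
     w A * wedge_list (map (\<lambda>i. h *v axis i 1) (sorted_list_of_set A)) S)"


section \<open>The basic bundle gerbe\<close>

definition eigenspace :: "('n::finite) cmat \<Rightarrow> complex \<Rightarrow> (complex ^ 'n) set" where
  "eigenspace g \<mu> = {v. g *v v = \<mu> *s v}"

definition spec :: "('n::finite) cmat \<Rightarrow> complex set" where
  "spec g = {\<mu>. \<exists>v\<in>eigenspace g \<mu>. v \<noteq> 0}"

definition eigenvalues_between :: "complex \<Rightarrow> complex \<Rightarrow> ('n::finite) cmat \<Rightarrow> complex set" where
  "eigenvalues_between z1 z2 g = {\<mu> \<in> spec g. z1 \<succ> \<mu> \<and> \<mu> \<succ> z2}"

definition L_sum :: "complex \<Rightarrow> complex \<Rightarrow> ('n::finite) cmat \<Rightarrow> (complex ^ 'n) set" where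
  "L_sum z1 z2 g = vec.span (\<Union>\<mu>\<in>eigenvalues_between z1 z2 g. eigenspace g \<mu>)"

definition basic_fibre :: "complex \<Rightarrow> complex \<Rightarrow> ('n::{finite,linorder}) cmat \<Rightarrow> 'n set cvec set" where
  "basic_fibre z1 z2 g =
     (if z1 \<succ> z2 \<and> eigenvalues_between z1 z2 g \<noteq> {} then det_line (L_sum z1 z2 g)
      else if z2 \<succ> z1 \<and> eigenvalues_between z2 z1 g \<noteq> {} then dual_line (det_line (L_sum z2 z1 g))
      else range ext_scalar)"

text \<open>
  The wedge product for \<open>z1 > z2 > z3\<close>; the other cases are induced from it and the evaluation of
  functionals. With \<open>L\<^sub>j\<^sub>k = L_sum zj zk g\<close>, they are, in the order below:
  \<open>(a \<and> b) \<otimes> f \<mapsto> f(b) a\<close> for \<open>f \<in> (det L\<^sub>3\<^sub>2)\<^sup>*\<close>, as \<open>L\<^sub>1\<^sub>2 = L\<^sub>1\<^sub>3 \<oplus> L\<^sub>3\<^sub>2\<close>;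
  \<open>b \<otimes> f \<mapsto> (a \<mapsto> f(a \<and> b))\<close> for \<open>f \<in> (det L\<^sub>3\<^sub>2)\<^sup>*\<close>, as \<open>L\<^sub>3\<^sub>2 = L\<^sub>3\<^sub>1 \<oplus> L\<^sub>1\<^sub>2\<close>;
  \<open>f \<otimes> (b \<and> a) \<mapsto> f(b) a\<close> for \<open>f \<in> (det L\<^sub>2\<^sub>1)\<^sup>*\<close>, as \<open>L\<^sub>2\<^sub>3 = L\<^sub>2\<^sub>1 \<oplus> L\<^sub>1\<^sub>3\<close>;
  \<open>f \<otimes> b \<mapsto> (a \<mapsto> f(b \<and> a))\<close> for \<open>f \<in> (det L\<^sub>2\<^sub>1)\<^sup>*\<close>, as \<open>L\<^sub>2\<^sub>1 = L\<^sub>2\<^sub>3 \<oplus> L\<^sub>3\<^sub>1\<close>;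
  \<open>f \<otimes> f' \<mapsto> (b \<and> a \<mapsto> f'(b) f(a))\<close> for \<open>f \<in> (det L\<^sub>2\<^sub>1)\<^sup>*\<close>, \<open>f' \<in> (det L\<^sub>3\<^sub>2)\<^sup>*\<close>, as
  \<open>L\<^sub>3\<^sub>1 = L\<^sub>3\<^sub>2 \<oplus> L\<^sub>2\<^sub>1\<close>. Where points coincide the cases agree.
\<close>

definition basic_mult ::
  "complex \<Rightarrow> complex \<Rightarrow> complex \<Rightarrow> ('n::{finite,linorder}) set cvec \<Rightarrow> 'n set cvec \<Rightarrow> 'n set cvec" where
  "basic_mult z1 z2 z3 p q =
     (if \<not> z2 \<succ> z1 \<and> \<not> z3 \<succ> z2 then wedge p q
      else if \<not> z3 \<succ> z1 \<and> \<not> z2 \<succ> z3 then contract_right p q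
      else if \<not> z1 \<succ> z3 \<and> \<not> z2 \<succ> z1 then contract_right q p
      else if \<not> z1 \<succ> z2 \<and> \<not> z3 \<succ> z1 then contract_left p q
      else if \<not> z3 \<succ> z2 \<and> \<not> z1 \<succ> z3 then contract_left q p
      else wedge q p)"

definition basic_gerbe ::
  "('n::{finite,linorder} cmat, 'n cmat, complex \<times> 'n cmat, 'n set) gerbe" where
  "basic_gerbe = \<lparr>
     base = embedded SU,
     cover = subspace_of (embedded cut_circle \<times>\<^sub>s embedded SU) {(z, g). z \<notin> spec g},
     proj = snd,
     act_base = (\<lambda>h g. h ** g ** adj h),
     act_cover = (\<lambda>h (z, g). (z, h ** g ** adj h)),
     fibre = (\<lambda>(z1, g) (z2, _). basic_fibre z1 z2 g),
     mult = (\<lambda>(z1, _) (z2, _) (z3, _). basic_mult z1 z2 z3),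
     act_fibre = (\<lambda>h (z1, g) (z2, _).
       if z2 \<succ> z1
       then dual_map (ext_map h) (det_line (L_sum z2 z1 g))
              (det_line (L_sum z2 z1 (h ** g ** adj h)))
       else ext_map h)\<rparr>"

end

theory Submission
  imports Defs
begin

text \<open>
  Let \<open>(t, C)\<close> be a point of \<open>T \<times> SU(n)/T\<close> and \<open>g \<in> C\<close>. The vectors \<open>v\<^sub>i = g e\<^sub>i\<close> are an orthonormal basis of
  eigenvectors of \<open>g t g\<^sup>*\<close> with eigenvalues \<open>t\<^sub>i\<close>. For \<open>z > w\<close> the fibre of the basic gerbe is spanned by the
  increasing wedge product of the \<open>v\<^sub>i\<close> with \<open>i \<in> I(z, w) = {i. z > t\<^sub>i > w}\<close>, and the fibre of the product of
  the cup product gerbes by the tensor product of the same vectors. For \<open>z < w\<close> the dual vectors span. If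
  \<open>g\<close> is replaced by \<open>g s\<close> with \<open>s \<in> T\<close>, both frames are multiplied by the same character of \<open>s\<close>, and the
  action of \<open>h\<close> takes the frames of \<open>g\<close> to those of \<open>h g\<close>. So sending frame to frame is a well defined, smooth
  and equivariant isomorphism of line bundles.

  This map does not preserve the multiplication. For \<open>z\<^sub>1 > z\<^sub>2 > z\<^sub>3\<close> the wedge product of the frames over
  \<open>(z\<^sub>1, z\<^sub>2)\<close> and \<open>(z\<^sub>2, z\<^sub>3)\<close> is the frame over \<open>(z\<^sub>1, z\<^sub>3)\<close> up to the sign of the shuffle of \<open>I(z\<^sub>1, z\<^sub>2)\<close> with
  \<open>I(z\<^sub>2, z\<^sub>3)\<close> (\<open>wedge_family_wedge\<close>), while tensor products produce no sign. Ordering the eigenvectors by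
  their eigenvalues removes the sign, but is discontinuous where two eigenvalues cross, and for \<open>n \<ge> 3\<close>
  the sign cocycle is not even the coboundary of a locally constant function. It is, however, the
  coboundary of a smooth function with values in \<open>U(1)\<close>. The exponent of the sign is
  \<open>\<Sum>\<^sub>b\<^sub><\<^sub>a \<epsilon>\<^sub>a(z\<^sub>1, z\<^sub>2) \<epsilon>\<^sub>b(z\<^sub>2, z\<^sub>3)\<close>, a sum of cup products, and each \<open>\<epsilon>\<^sub>a\<close> is a coboundary of real functions:
  \<open>\<epsilon>\<^sub>a(z, w) = f\<^sub>a(z) - f\<^sub>a(w)\<close>, where \<open>2 \<pi> i f\<^sub>a(z)\<close> is the logarithm of \<open>t\<^sub>a\<close> with branch cut at \<open>z\<close>. Hence
  the frame of the basic gerbe multiplied by \<open>exp (i \<pi> \<Sum>\<^sub>b\<^sub><\<^sub>a f\<^sub>a(z) \<epsilon>\<^sub>b(z, w))\<close> is multiplicative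
  (\<open>half_root_jump\<close>, \<open>phase_cocycle\<close>, \<open>basic_mult_frame\<close>). This phase depends only on \<open>z\<close>, \<open>w\<close> and \<open>t\<close>, so
  equivariance and the transition functions are unaffected (\<open>frame_transition\<close>), and it is smooth since
  the square roots \<open>exp (i \<pi> f\<^sub>a(z))\<close> are smooth wherever \<open>z \<noteq> t\<^sub>a\<close>.

  That two such frames suffice, for the gerbe axioms as well as for the isomorphism, is a general fact about
  gerbes framed along a submersion (\<open>framed_gerbe\<close>, \<open>framed_gerbe_iso\<close>). The one point of smoothness that is
  not formal is that the index set \<open>I(z, w)\<close> is locally constant, also where an eigenvalue
  passes through \<open>1\<close> (\<open>arc_indices_locally_constant\<close>).
\<close>

section \<open>Calculus of smooth functions\<close>

definition has_partial ::
  "(nat \<Rightarrow> real) set \<Rightarrow> nat \<Rightarrow> ((nat \<Rightarrow> real) \<Rightarrow> 'b::real_normed_vector) \<Rightarrow> ((nat \<Rightarrow> real) \<Rightarrow> 'b) \<Rightarrow> bool"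
  where "has_partial U i f f' \<longleftrightarrow>
    (\<forall>x\<in>U. ((\<lambda>h. f (x(i := x i + h))) has_vector_derivative f' x) (at 0))"

lemma Euclidean_space_eq: "Euclidean_space k = top_of_set {x. \<forall>m\<ge>k. x m = 0}"
  by (simp add: Euclidean_space_def euclidean_product_topology)

lemma openin_Euclidean_space_subset:
  "openin (Euclidean_space k) U \<Longrightarrow> U \<subseteq> {x. \<forall>m\<ge>k. x m = 0}"
  using openin_subset topspace_Euclidean_space by metis

lemma continuous_map_Euclidean_subspace:
  assumes "openin (Euclidean_space k) U"
  shows "continuous_map (subtopology (Euclidean_space k) U) euclidean f \<longleftrightarrow> continuous_on U f"
  using openin_Euclidean_space_subset[OF assms]
  by (simp add: Euclidean_space_eq subtopology_subtopology Int_absorb1)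

lemma openin_Euclidean_space_trans:
  assumes "openin (Euclidean_space k) U" and "openin (top_of_set U) V"
  shows "openin (Euclidean_space k) V"
  using assms openin_trans unfolding Euclidean_space_eq by blast

lemma openin_Euclidean_subset_openin:
  assumes "openin (Euclidean_space k) V" and "V \<subseteq> U" and "openin (Euclidean_space k) U"
  shows "openin (top_of_set U) V"
  using assms openin_subset_trans[of "{x. \<forall>m\<ge>k. x m = 0}" V U]
    openin_Euclidean_space_subset
  unfolding Euclidean_space_eq by blast

text \<open>Difference quotients only see nearby points, and these stay in the open set; so partial derivatives
  depend only on the restriction of a function to it.\<close>

lemma eventually_coordinate_line_in:
  assumes "openin (Euclidean_space k) U" and "x \<in> U" and "i < k"
  shows "\<forall>\<^sub>F h in at 0. x(i := x i + h) \<in> U"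
proof -
  obtain T where T: "open T" "U = {x. \<forall>m\<ge>k. x m = 0} \<inter> T"
    using assms(1) unfolding Euclidean_space_eq openin_open by blast
  have "continuous_on UNIV (\<lambda>h::real. x(i := x i + h))"
  proof (rule continuous_on_coordinatewise_then_product)
    fix j
    show "continuous_on UNIV (\<lambda>h. (x(i := x i + h)) j)"
      by (cases "j = i") (auto intro!: continuous_intros)
  qed
  then have "open ((\<lambda>h. x(i := x i + h)) -` T)"
    using T(1) open_vimage by blast
  moreover have "0 \<in> (\<lambda>h. x(i := x i + h)) -` T"
    using assms(2) T(2) by simp
  ultimately have "\<forall>\<^sub>F h in nhds 0. h \<in> (\<lambda>h. x(i := x i + h)) -` T"
    by (rule eventually_nhds_in_open)
  then have "\<forall>\<^sub>F h in at 0. x(i := x i + h) \<in> T"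
    unfolding eventually_at_filter by (auto elim: eventually_mono)
  then show ?thesis
    by eventually_elim (use assms(2,3) T(2) in auto)
qed

lemma has_partial_cong:
  assumes "openin (Euclidean_space k) U" and "i < k"
    and "has_partial U i f f'" and "\<And>x. x \<in> U \<Longrightarrow> f x = g x" and "\<And>x. x \<in> U \<Longrightarrow> f' x = g' x"
  shows "has_partial U i g g'"
  unfolding has_partial_def
proof
  fix x assume x: "x \<in> U"
  have "((\<lambda>h. f (x(i := x i + h))) has_vector_derivative g' x) (at 0)"
    using assms(3,5) x unfolding has_partial_def by metis
  moreover have "\<forall>\<^sub>F h in nhds 0. f (x(i := x i + h)) = g (x(i := x i + h))"
    using eventually_coordinate_line_in[OF assms(1) x assms(2)]
    unfolding eventually_at_filter by (rule eventually_mono) (metis x assms(4) UNIV_I add.right_neutral fun_upd_triv)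
  ultimately show "((\<lambda>h. g (x(i := x i + h))) has_vector_derivative g' x) (at 0)"
    by (subst (asm) has_vector_derivative_cong_ev) (use x assms(4) in \<open>auto elim: eventually_mono\<close>)
qed

lemma C_infinity_on_openin: "C_infinity_on k U f \<Longrightarrow> openin (Euclidean_space k) U"
  unfolding C_infinity_on_def by blast

text \<open>This turns every closure property below into the check that a class of functions is closed under
  partial derivatives.\<close>

lemma C_infinity_on_coinduct:
  assumes U: "openin (Euclidean_space k) U" and "f \<in> \<F>"
    and cont: "\<And>f. f \<in> \<F> \<Longrightarrow> continuous_on U f"
    and part: "\<And>f i. f \<in> \<F> \<Longrightarrow> i < k \<Longrightarrow> \<exists>f'\<in>\<F>. has_partial U i f f'"
  shows "C_infinity_on k U f"
proof -
  define d where "d i f = (SOME f'. f' \<in> \<F> \<and> has_partial U i f f')" for i f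
  have d: "d i f \<in> \<F>" "has_partial U i f (d i f)" if "f \<in> \<F>" "i < k" for f i
    using someI_ex[of "\<lambda>f'. f' \<in> \<F> \<and> has_partial U i f f'"] part[OF that] unfolding d_def by blast+
  define D where "D is = foldr d is f" for "is"
  have D: "D is \<in> \<F>" if "set is \<subseteq> {..<k}" for "is"
    using that by (induction "is") (auto simp: D_def d assms(2))
  show ?thesis
    unfolding C_infinity_on_def continuous_map_Euclidean_subspace[OF U]
  proof (intro conjI exI[of _ D] U allI impI)
    show "\<forall>x\<in>U. D [] x = f x" by (simp add: D_def)
    fix "is" assume s: "set is \<subseteq> {..<k}"
    show "continuous_on U (D is)" using D[OF s] cont by blast
    fix i assume "i < k"
    then show "\<forall>x\<in>U. ((\<lambda>h. D is (x(i := x i + h))) has_vector_derivative D (i # is) x) (at 0)"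
      using d(2)[OF D[OF s]] unfolding has_partial_def D_def by simp
  qed
qed

lemma C_infinity_on_derivatives:
  assumes "C_infinity_on k U f"
  shows "\<exists>D. (\<forall>x\<in>U. D [] x = f x) \<and> (\<forall>is. set is \<subseteq> {..<k} \<longrightarrow>
    continuous_on U (D is) \<and> (\<forall>i<k. has_partial U i (D is) (D (i # is))))"
  using assms
  unfolding C_infinity_on_def has_partial_def
    continuous_map_Euclidean_subspace[OF C_infinity_on_openin[OF assms]]
  by (rule conjunct2)

lemma C_infinity_on_continuous:
  assumes "C_infinity_on k U f"
  shows "continuous_on U f"
proof -
  obtain D where "\<forall>x\<in>U. D [] x = f x"
    and "\<forall>is. set is \<subseteq> {..<k} \<longrightarrow>
      continuous_on U (D is) \<and> (\<forall>i<k. has_partial U i (D is) (D (i # is)))"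
    using C_infinity_on_derivatives[OF assms] by (elim exE conjE)
  from this(2)[rule_format, of "[]"] this(1) show ?thesis by (simp cong: continuous_on_cong)
qed

lemma C_infinity_on_partial:
  assumes "C_infinity_on k U f" and "i < k"
  shows "\<exists>f'. C_infinity_on k U f' \<and> has_partial U i f f'"
proof -
  have U: "openin (Euclidean_space k) U" using assms(1) by (rule C_infinity_on_openin)
  obtain D where D0: "\<forall>x\<in>U. D [] x = f x"
    and D: "\<forall>is. set is \<subseteq> {..<k} \<longrightarrow>
      continuous_on U (D is) \<and> (\<forall>i<k. has_partial U i (D is) (D (i # is)))"
    using C_infinity_on_derivatives[OF assms(1)] by (elim exE conjE)
  have "C_infinity_on k U (D [i])"
    unfolding C_infinity_on_def continuous_map_Euclidean_subspace[OF U]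
  proof (intro conjI exI[of _ "\<lambda>is. D (is @ [i])"] U allI impI)
    fix "is" assume "set is \<subseteq> {..<k}"
    then have s: "set (is @ [i]) \<subseteq> {..<k}" using assms(2) by simp
    show "continuous_on U (D (is @ [i]))" using D[rule_format, OF s] by simp
    fix j assume "j < k"
    then show "\<forall>x\<in>U. ((\<lambda>h. D (is @ [i]) (x(j := x j + h))) has_vector_derivative D ((j # is) @ [i]) x) (at 0)"
      using D[rule_format, OF s] unfolding has_partial_def by simp
  qed simp
  moreover have "has_partial U i f (D [i])"
  proof (rule has_partial_cong[OF U assms(2)])
    show "has_partial U i (D []) (D [i])" using D[rule_format, of "[]"] assms(2) by simp
  qed (use D0 in simp_all)
  ultimately show ?thesis by blast
qed

lemma C_infinity_on_cong:
  assumes "C_infinity_on k U f" and "\<And>x. x \<in> U \<Longrightarrow> f x = g x"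
  shows "C_infinity_on k U g"
proof -
  have "(\<forall>x\<in>U. D [] x = f x) \<longleftrightarrow> (\<forall>x\<in>U. D [] x = g x)" for D :: "nat list \<Rightarrow> _"
    using assms(2) by simp
  then show ?thesis using assms(1) unfolding C_infinity_on_def by simp
qed

lemma C_infinity_on_subset:
  assumes "C_infinity_on k U f" and "openin (Euclidean_space k) V" and "V \<subseteq> U"
  shows "C_infinity_on k V f"
proof (rule C_infinity_on_coinduct[OF assms(2), of f "{f. C_infinity_on k U f}"])
  fix f assume f: "f \<in> {f. C_infinity_on k U f}"
  then show "continuous_on V f"
    using C_infinity_on_continuous assms(3) continuous_on_subset by blast
  fix i assume "i < k"
  then obtain f' where "C_infinity_on k U f'" "has_partial U i f f'"
    using C_infinity_on_partial f by blast
  then show "\<exists>f'\<in>{f. C_infinity_on k U f}. has_partial V i f f'"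
    using assms(3) by (intro bexI[of _ f']) (auto simp: has_partial_def)
qed (use assms(1) in simp)

lemma continuous_on_locally:
  assumes "\<And>u. u \<in> U \<Longrightarrow> \<exists>V. u \<in> V \<and> openin (top_of_set U) V \<and> continuous_on V f"
  shows "continuous_on U f"
  unfolding continuous_openin_preimage_eq
proof (intro allI impI)
  fix S :: "'b set" assume S: "open S"
  show "openin (top_of_set U) (U \<inter> f -` S)"
  proof (subst openin_subopen, intro ballI)
    fix u assume u: "u \<in> U \<inter> f -` S"
    then obtain V where V: "u \<in> V" "openin (top_of_set U) V" "continuous_on V f" using assms by blast
    have "openin (top_of_set V) (V \<inter> f -` S)"
      using V(3) S continuous_openin_preimage_gen by blast
    then have "openin (top_of_set U) (V \<inter> f -` S)" using V(2) openin_trans by blast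
    then show "\<exists>T. openin (top_of_set U) T \<and> u \<in> T \<and> T \<subseteq> U \<inter> f -` S"
      using V u openin_imp_subset by blast
  qed
qed

text \<open>Partial derivatives are unique, so the local families of iterated derivatives agree where they overlap:
  the class of locally smooth functions is itself closed under partial derivatives.\<close>

lemma C_infinity_on_locally:
  fixes f :: "(nat \<Rightarrow> real) \<Rightarrow> 'b::real_normed_vector"
  assumes U: "openin (Euclidean_space k) U"
    and "\<And>u. u \<in> U \<Longrightarrow> \<exists>V. u \<in> V \<and> V \<subseteq> U \<and> C_infinity_on k V f"
  shows "C_infinity_on k U f"
proof (rule C_infinity_on_coinduct[OF U])
  let ?F = "{f :: (nat \<Rightarrow> real) \<Rightarrow> 'b. \<forall>u\<in>U. \<exists>V. u \<in> V \<and> V \<subseteq> U \<and> C_infinity_on k V f}"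
  show "f \<in> ?F" using assms(2) by blast
  fix f assume f: "f \<in> ?F"
  show "continuous_on U f"
  proof (rule continuous_on_locally)
    fix u assume "u \<in> U"
    then obtain V where V: "u \<in> V" "V \<subseteq> U" "C_infinity_on k V f" using f by blast
    show "\<exists>V. u \<in> V \<and> openin (top_of_set U) V \<and> continuous_on V f"
      using V(1) openin_Euclidean_subset_openin[OF C_infinity_on_openin[OF V(3)] V(2) U]
        C_infinity_on_continuous[OF V(3)] by (intro exI[of _ V] conjI)
  qed
  fix i assume i: "i < k"
  define f' where "f' x = vector_derivative (\<lambda>h. f (x(i := x i + h))) (at 0)" for x
  have f': "C_infinity_on k V f'" "has_partial V i f f'" if V: "C_infinity_on k V f" for V
  proof -
    obtain g where g: "C_infinity_on k V g" "has_partial V i f g"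
      using C_infinity_on_partial[OF V i] by blast
    then have eq: "g x = f' x" if "x \<in> V" for x
      using g(2) that vector_derivative_at[symmetric] by (auto simp: has_partial_def f'_def)
    show "C_infinity_on k V f'" by (rule C_infinity_on_cong[OF g(1) eq])
    show "has_partial V i f f'"
      by (rule has_partial_cong[OF C_infinity_on_openin[OF V] i g(2) refl eq])
  qed
  have "f' \<in> ?F"
  proof (intro CollectI ballI)
    fix u assume "u \<in> U"
    then obtain V where V: "u \<in> V" "V \<subseteq> U" "C_infinity_on k V f" using f by blast
    show "\<exists>V. u \<in> V \<and> V \<subseteq> U \<and> C_infinity_on k V f'"
      by (intro exI[of _ V] conjI V(1,2) f'(1)[OF V(3)])
  qed
  moreover have "has_partial U i f f'"
    unfolding has_partial_def
  proof
    fix x assume "x \<in> U"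
    then obtain V where "x \<in> V" "C_infinity_on k V f" using f by blast
    from f'(2)[OF this(2)] this(1)
    show "((\<lambda>h. f (x(i := x i + h))) has_vector_derivative f' x) (at 0)"
      by (simp add: has_partial_def)
  qed
  ultimately show "\<exists>f'\<in>?F. has_partial U i f f'" by (intro bexI[of _ f'])
qed

lemma C_infinity_on_const:
  assumes "openin (Euclidean_space k) U"
  shows "C_infinity_on k U (\<lambda>x. c)"
proof (rule C_infinity_on_coinduct[OF assms, of _ "range (\<lambda>c x. c)"])
  fix f :: "(nat \<Rightarrow> real) \<Rightarrow> 'a" and i assume "f \<in> range (\<lambda>c x. c)"
  then show "\<exists>f'\<in>range (\<lambda>c x. c). has_partial U i f f'"
    by (intro bexI[of _ "\<lambda>x. 0"]) (auto simp: has_partial_def)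
qed auto

lemma C_infinity_on_bounded_linear:
  assumes "C_infinity_on k U f" and L: "bounded_linear L"
  shows "C_infinity_on k U (\<lambda>x. L (f x))"
proof (rule C_infinity_on_coinduct[OF C_infinity_on_openin[OF assms(1)]])
  let ?F = "{\<lambda>x. L (f x) | f. C_infinity_on k U f}"
  show "(\<lambda>x. L (f x)) \<in> ?F" using assms(1) by blast
  fix g assume "g \<in> ?F"
  then obtain f where f: "g = (\<lambda>x. L (f x))" "C_infinity_on k U f" by blast
  show "continuous_on U g"
    unfolding f(1) by (rule bounded_linear.continuous_on[OF L C_infinity_on_continuous[OF f(2)]])
  fix i assume "i < k"
  then obtain f' where f': "C_infinity_on k U f'" "has_partial U i f f'"
    using C_infinity_on_partial f(2) by blast
  then have "has_partial U i g (\<lambda>x. L (f' x))"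
    by (auto simp: has_partial_def f(1) intro: bounded_linear.has_vector_derivative[OF L])
  then show "\<exists>f'\<in>?F. has_partial U i g f'" using f'(1) by blast
qed

lemma C_infinity_on_add:
  fixes f g :: "(nat \<Rightarrow> real) \<Rightarrow> 'b::real_normed_vector"
  assumes "C_infinity_on k U f" and "C_infinity_on k U g"
  shows "C_infinity_on k U (\<lambda>x. f x + g x)"
proof (rule C_infinity_on_coinduct[OF C_infinity_on_openin[OF assms(1)]])
  let ?F = "{\<lambda>x. f x + g x | f g :: (nat \<Rightarrow> real) \<Rightarrow> 'b. C_infinity_on k U f \<and> C_infinity_on k U g}"
  show "(\<lambda>x. f x + g x) \<in> ?F" using assms by blast
  fix s assume "s \<in> ?F"
  then obtain f g where s: "s = (\<lambda>x. f x + g x)" "C_infinity_on k U f" "C_infinity_on k U g" by blast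
  show "continuous_on U s"
    unfolding s(1)
    by (rule continuous_on_add[OF C_infinity_on_continuous[OF s(2)] C_infinity_on_continuous[OF s(3)]])
  fix i assume "i < k"
  then obtain f' g' where f': "C_infinity_on k U f'" "has_partial U i f f'"
    "C_infinity_on k U g'" "has_partial U i g g'"
    using C_infinity_on_partial[OF s(2)] C_infinity_on_partial[OF s(3)] by blast
  then have "has_partial U i s (\<lambda>x. f' x + g' x)"
    by (auto simp: has_partial_def s(1) intro: has_vector_derivative_add)
  then show "\<exists>f'\<in>?F. has_partial U i s f'" using f'(1,3) by blast
qed

lemma C_infinity_on_sum:
  assumes "openin (Euclidean_space k) U" and "\<And>i. i \<in> I \<Longrightarrow> C_infinity_on k U (f i)"
  shows "C_infinity_on k U (\<lambda>x. \<Sum>i\<in>I. f i x)"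
proof (cases "finite I")
  case True
  then show ?thesis
    using assms(2) by (induction I) (simp_all add: C_infinity_on_const[OF assms(1)] C_infinity_on_add)
qed (simp add: C_infinity_on_const[OF assms(1)])

text \<open>The algebra of functions generated by the smooth ones and a set \<open>R\<close>. With \<open>R\<close> empty it gives
  closure under products; with \<open>R\<close> a reciprocal square root, closure under square roots.\<close>

inductive_set smooth_algebra ::
  "nat \<Rightarrow> (nat \<Rightarrow> real) set \<Rightarrow> ((nat \<Rightarrow> real) \<Rightarrow> complex) set \<Rightarrow> ((nat \<Rightarrow> real) \<Rightarrow> complex) set"
  for k U R where
  smooth: "C_infinity_on k U f \<Longrightarrow> f \<in> smooth_algebra k U R"
| generator: "f \<in> R \<Longrightarrow> f \<in> smooth_algebra k U R"
| add: "f \<in> smooth_algebra k U R \<Longrightarrow> g \<in> smooth_algebra k U R \<Longrightarrow> (\<lambda>x. f x + g x) \<in> smooth_algebra k U R"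
| mult: "f \<in> smooth_algebra k U R \<Longrightarrow> g \<in> smooth_algebra k U R \<Longrightarrow> (\<lambda>x. f x * g x) \<in> smooth_algebra k U R"

lemma smooth_algebra_C_infinity_on:
  assumes U: "openin (Euclidean_space k) U"
    and R: "\<And>r. r \<in> R \<Longrightarrow> continuous_on U r"
      "\<And>r i. r \<in> R \<Longrightarrow> i < k \<Longrightarrow> \<exists>r'\<in>smooth_algebra k U R. has_partial U i r r'"
    and "f \<in> smooth_algebra k U R"
  shows "C_infinity_on k U f"
proof (rule C_infinity_on_coinduct[OF U assms(4)])
  fix f assume "f \<in> smooth_algebra k U R"
  then show "continuous_on U f"
    by induction (simp_all add: C_infinity_on_continuous R(1) continuous_on_add continuous_on_mult)
next
  fix f i assume "f \<in> smooth_algebra k U R" and i: "i < k"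
  then show "\<exists>f'\<in>smooth_algebra k U R. has_partial U i f f'"
  proof induction
    case (smooth f)
    then obtain f' where "C_infinity_on k U f'" "has_partial U i f f'"
      using C_infinity_on_partial[OF _ i] by blast
    then show ?case by (intro bexI[of _ f'] smooth_algebra.smooth)
  next
    case (generator f)
    then show ?case using R(2) i by blast
  next
    case (add f g)
    then obtain f' g' where "f' \<in> smooth_algebra k U R" "has_partial U i f f'"
      "g' \<in> smooth_algebra k U R" "has_partial U i g g'" by blast
    then show ?case
      by (intro bexI[of _ "\<lambda>x. f' x + g' x"] smooth_algebra.add)
         (auto simp: has_partial_def intro: has_vector_derivative_add)
  next
    case (mult f g)
    then obtain f' g' where *: "f' \<in> smooth_algebra k U R" "has_partial U i f f'"
      "g' \<in> smooth_algebra k U R" "has_partial U i g g'" by blast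
    show ?case
    proof (intro bexI[of _ "\<lambda>x. f x * g' x + f' x * g x"])
      show "(\<lambda>x. f x * g' x + f' x * g x) \<in> smooth_algebra k U R"
        using * mult.hyps by (intro smooth_algebra.add smooth_algebra.mult)
      show "has_partial U i (\<lambda>x. f x * g x) (\<lambda>x. f x * g' x + f' x * g x)"
        unfolding has_partial_def
      proof
        fix x assume x: "x \<in> U"
        have "((\<lambda>h. f (x(i := x i + h))) has_vector_derivative f' x) (at 0)"
          "((\<lambda>h. g (x(i := x i + h))) has_vector_derivative g' x) (at 0)"
          using *(2,4) x by (simp_all add: has_partial_def)
        from has_vector_derivative_mult[OF this]
        show "((\<lambda>h. f (x(i := x i + h)) * g (x(i := x i + h))) has_vector_derivative
            f x * g' x + f' x * g x) (at 0)" by simp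
      qed
    qed
  qed
qed

lemma C_infinity_on_mult:
  assumes "C_infinity_on k U f" and "C_infinity_on k U g"
  shows "C_infinity_on k U (\<lambda>x. f x * g x :: complex)"
  by (rule smooth_algebra_C_infinity_on[OF C_infinity_on_openin[OF assms(1)], of "{}"])
     (auto intro: smooth_algebra.mult smooth_algebra.smooth assms)

lemma C_infinity_on_prod:
  assumes "openin (Euclidean_space k) U" and "\<And>i. i \<in> I \<Longrightarrow> C_infinity_on k U (f i)"
  shows "C_infinity_on k U (\<lambda>x. \<Prod>i\<in>I. f i x :: complex)"
proof (cases "finite I")
  case True
  then show ?thesis
    using assms(2) by (induction I) (simp_all add: C_infinity_on_const[OF assms(1)] C_infinity_on_mult)
qed (simp add: C_infinity_on_const[OF assms(1)])

lemma C_infinity_on_cnj: "C_infinity_on k U f \<Longrightarrow> C_infinity_on k U (\<lambda>x. cnj (f x))"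
  using C_infinity_on_bounded_linear bounded_linear_cnj by blast

lemma C_infinity_on_uminus: "C_infinity_on k U f \<Longrightarrow> C_infinity_on k U (\<lambda>x. - f x)"
  by (rule C_infinity_on_bounded_linear[OF _ bounded_linear_minus[OF bounded_linear_ident]])

text \<open>The square root is smooth because \<open>\<rho> = 1 / \<surd>f\<close> satisfies \<open>\<rho>' = - f' \<rho>\<^sup>3 / 2\<close>, a polynomial
  expression in \<open>\<rho>\<close> and smooth functions.\<close>

lemma C_infinity_on_csqrt:
  assumes f: "C_infinity_on k U f" and slit: "\<And>x. x \<in> U \<Longrightarrow> f x \<notin> \<real>\<^sub>\<le>\<^sub>0"
  shows "C_infinity_on k U (\<lambda>x. csqrt (f x))"
proof -
  note U = C_infinity_on_openin[OF f]
  define \<rho> where "\<rho> x = inverse (csqrt (f x))" for x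
  have nz: "csqrt (f x) \<noteq> 0" "f x \<noteq> 0" if "x \<in> U" for x using slit[OF that] by auto
  have gen: "\<rho> \<in> smooth_algebra k U {\<rho>}" by (rule smooth_algebra.generator) simp
  have "C_infinity_on k U (\<lambda>x. f x * \<rho> x)"
  proof (rule smooth_algebra_C_infinity_on[OF U, where R = "{\<rho>}"])
    show "(\<lambda>x. f x * \<rho> x) \<in> smooth_algebra k U {\<rho>}"
      by (intro smooth_algebra.mult gen smooth_algebra.smooth[OF f])
  next
    fix r assume "r \<in> {\<rho>}"
    moreover have "continuous_on (f ` U) csqrt"
      using slit continuous_at_csqrt by (intro continuous_at_imp_continuous_on) blast
    then have "continuous_on U (\<lambda>x. csqrt (f x))"
      by (rule continuous_on_compose2[OF _ C_infinity_on_continuous[OF f]]) simp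
    then have "continuous_on U \<rho>"
      unfolding \<rho>_def using nz by (intro continuous_on_inverse) auto
    ultimately show "continuous_on U r" by simp
  next
    fix r i assume r: "r \<in> {\<rho>}" and i: "i < k"
    obtain f' where f': "C_infinity_on k U f'" "has_partial U i f f'"
      using C_infinity_on_partial[OF f i] by blast
    show "\<exists>r'\<in>smooth_algebra k U {\<rho>}. has_partial U i r r'"
    proof (intro bexI)
      show "(\<lambda>x. - (1 / 2) * (f' x * (\<rho> x * (\<rho> x * \<rho> x)))) \<in> smooth_algebra k U {\<rho>}"
        by (intro smooth_algebra.mult gen smooth_algebra.smooth[OF f'(1)]
            smooth_algebra.smooth[OF C_infinity_on_const[OF U]])
      have "((\<lambda>h. \<rho> (x(i := x i + h))) has_vector_derivative
          - (1 / 2) * (f' x * (\<rho> x * (\<rho> x * \<rho> x)))) (at 0)" if x: "x \<in> U" for x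
      proof -
        have 1: "((\<lambda>h. f (x(i := x i + h))) has_vector_derivative f' x) (at 0)"
          using f'(2) x unfolding has_partial_def by blast
        have "((\<lambda>w. inverse (csqrt w)) has_field_derivative
            - (inverse (csqrt (f x)) * (inverse (2 * csqrt (f x))) * inverse (csqrt (f x))))
            (at (f (x(i := x i + 0))))"
          using has_field_derivative_csqrt[OF slit[OF x]] nz[OF x] slit[OF x]
          by (auto intro!: derivative_eq_intros simp: field_simps)
        from field_vector_diff_chain_at[OF 1 this]
        show ?thesis unfolding \<rho>_def o_def by (simp add: field_simps)
      qed
      then show "has_partial U i r (\<lambda>x. - (1 / 2) * (f' x * (\<rho> x * (\<rho> x * \<rho> x))))"
        using r unfolding has_partial_def by auto
    qed
  qed
  moreover have "f x * \<rho> x = csqrt (f x)" if "x \<in> U" for x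
    using nz[OF that] power2_csqrt[of "f x"] unfolding \<rho>_def power2_eq_square by (simp add: divide_simps)
  ultimately show ?thesis by (rule C_infinity_on_cong)
qed

lemma C_infinity_on_matrix_entry:
  fixes f :: "(nat \<Rightarrow> real) \<Rightarrow> complex ^ 'm::finite ^ 'n::finite"
  assumes "C_infinity_on k U f"
  shows "C_infinity_on k U (\<lambda>x. f x $ i $ j)"
  using C_infinity_on_bounded_linear[OF C_infinity_on_bounded_linear[OF assms bounded_linear_vec_nth[of i]]
      bounded_linear_vec_nth[of j]] .

text \<open>A matrix is the sum of its entries placed in elementary matrices, which is linear in the entries.\<close>

lemma C_infinity_on_matrixI:
  fixes f :: "(nat \<Rightarrow> real) \<Rightarrow> complex ^ 'm::finite ^ 'n::finite"
  assumes "openin (Euclidean_space k) U" and "\<And>i j. C_infinity_on k U (\<lambda>x. f x $ i $ j)"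
  shows "C_infinity_on k U f"
proof -
  have "bounded_linear (\<lambda>c. axis i (axis j c) :: complex ^ 'm ^ 'n)" for i j
    by (rule linear_conv_bounded_linear[THEN iffD1]) (auto intro!: linearI simp: vec_eq_iff axis_def)
  then have "C_infinity_on k U (\<lambda>x. \<Sum>i\<in>UNIV. \<Sum>j\<in>UNIV. axis i (axis j (f x $ i $ j)))"
    using C_infinity_on_bounded_linear[OF assms(2)] by (intro C_infinity_on_sum assms(1)) blast
  moreover have "(\<Sum>i\<in>UNIV. \<Sum>j\<in>UNIV. axis i (axis j (M $ i $ j))) = M" for M :: "complex ^ 'm ^ 'n"
  proof -
    have "(\<Sum>j\<in>UNIV. axis i (axis j (M $ i $ j)) $ a $ b) = (if i = a then M $ i $ b else 0)" for i a b
      by (cases "i = a") (simp_all add: axis_def)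
    then show ?thesis by (simp add: vec_eq_iff)
  qed
  ultimately show ?thesis by simp
qed

lemma C_infinity_on_matrix_mult:
  fixes f :: "(nat \<Rightarrow> real) \<Rightarrow> complex ^ 'm::finite ^ 'n::finite"
    and g :: "(nat \<Rightarrow> real) \<Rightarrow> complex ^ 'l::finite ^ 'm"
  assumes "C_infinity_on k U f" and "C_infinity_on k U g"
  shows "C_infinity_on k U (\<lambda>x. f x ** g x)"
  using C_infinity_on_openin[OF assms(1)] assms
  by (intro C_infinity_on_matrixI)
     (auto simp: matrix_matrix_mult_def intro!: C_infinity_on_sum C_infinity_on_mult C_infinity_on_matrix_entry)

lemma C_infinity_on_adj:
  assumes "C_infinity_on k U f"
  shows "C_infinity_on k U (\<lambda>x. adj (f x))"
  using C_infinity_on_openin[OF assms] assms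
  by (intro C_infinity_on_matrixI) (auto simp: adj_def intro!: C_infinity_on_cnj C_infinity_on_matrix_entry)

section \<open>Diffeologies\<close>

text \<open>The axioms of a diffeology used below. They make smoothness a local property and insensitive to
  the values of plots outside their domains.\<close>

definition diffeology :: "'a smooth_space \<Rightarrow> bool" where
  "diffeology X \<longleftrightarrow>
     (\<forall>k U \<alpha>. plot X k U \<alpha> \<longrightarrow> openin (Euclidean_space k) U \<and> \<alpha> ` U \<subseteq> points X) \<and>
     (\<forall>k U \<alpha> \<beta>. plot X k U \<alpha> \<longrightarrow> (\<forall>x\<in>U. \<alpha> x = \<beta> x) \<longrightarrow> plot X k U \<beta>) \<and>
     (\<forall>k U V \<alpha>. plot X k U \<alpha> \<longrightarrow> V \<subseteq> U \<longrightarrow> openin (Euclidean_space k) V \<longrightarrow> plot X k V \<alpha>) \<and>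
     (\<forall>k U \<alpha>. openin (Euclidean_space k) U \<longrightarrow>
        (\<forall>u\<in>U. \<exists>V. u \<in> V \<and> V \<subseteq> U \<and> plot X k V \<alpha>) \<longrightarrow> plot X k U \<alpha>)"

lemma diffeologyI:
  assumes "\<And>k U \<alpha>. plot X k U \<alpha> \<Longrightarrow> openin (Euclidean_space k) U"
    and "\<And>k U \<alpha> x. plot X k U \<alpha> \<Longrightarrow> x \<in> U \<Longrightarrow> \<alpha> x \<in> points X"
    and "\<And>k U \<alpha> \<beta>. plot X k U \<alpha> \<Longrightarrow> (\<And>x. x \<in> U \<Longrightarrow> \<alpha> x = \<beta> x) \<Longrightarrow> plot X k U \<beta>"
    and "\<And>k U V \<alpha>. plot X k U \<alpha> \<Longrightarrow> V \<subseteq> U \<Longrightarrow> openin (Euclidean_space k) V \<Longrightarrow> plot X k V \<alpha>"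
    and "\<And>k U \<alpha>. openin (Euclidean_space k) U \<Longrightarrow>
      (\<And>u. u \<in> U \<Longrightarrow> \<exists>V. u \<in> V \<and> V \<subseteq> U \<and> plot X k V \<alpha>) \<Longrightarrow> plot X k U \<alpha>"
  shows "diffeology X"
  unfolding diffeology_def
proof (intro conjI allI impI)
  fix k U \<alpha> assume *: "plot X k U \<alpha>"
  show "openin (Euclidean_space k) U" by (rule assms(1)[OF *])
  show "\<alpha> ` U \<subseteq> points X" using assms(2)[OF *] by blast
  show "plot X k U \<beta>" if "\<forall>x\<in>U. \<alpha> x = \<beta> x" for \<beta> using that by (intro assms(3)[OF *]) simp
  show "plot X k V \<alpha>" if "V \<subseteq> U" "openin (Euclidean_space k) V" for V by (rule assms(4)[OF * that])
next
  fix k U \<alpha>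
  assume "openin (Euclidean_space k) U" "\<forall>u\<in>U. \<exists>V. u \<in> V \<and> V \<subseteq> U \<and> plot X k V \<alpha>"
  then show "plot X k U \<alpha>" by (intro assms(5)) simp_all
qed

lemma plot_openin:
  assumes "diffeology X" and "plot X k U \<alpha>"
  shows "openin (Euclidean_space k) U"
  by (rule conjunct1[OF assms(1)[unfolded diffeology_def, THEN conjunct1, rule_format, OF assms(2)]])

lemma plot_in_points:
  assumes "diffeology X" and "plot X k U \<alpha>" and "x \<in> U"
  shows "\<alpha> x \<in> points X"
  using conjunct2[OF assms(1)[unfolded diffeology_def, THEN conjunct1, rule_format, OF assms(2)]] assms(3)
  by (rule subsetD[OF _ imageI])

lemma plot_cong:
  assumes "diffeology X" and "plot X k U \<alpha>" and "\<And>x. x \<in> U \<Longrightarrow> \<alpha> x = \<beta> x"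
  shows "plot X k U \<beta>"
  by (rule assms(1)[unfolded diffeology_def, THEN conjunct2, THEN conjunct1, rule_format, OF assms(2,3)])

lemma plot_subset:
  assumes "diffeology X" and "plot X k U \<alpha>" and "V \<subseteq> U" and "openin (Euclidean_space k) V"
  shows "plot X k V \<alpha>"
  by (rule assms(1)[unfolded diffeology_def, THEN conjunct2, THEN conjunct2, THEN conjunct1, rule_format,
        OF assms(2,3,4)])

lemma plot_locally:
  assumes "diffeology X" and "openin (Euclidean_space k) U"
    and "\<And>u. u \<in> U \<Longrightarrow> \<exists>V. u \<in> V \<and> V \<subseteq> U \<and> plot X k V \<alpha>"
  shows "plot X k U \<alpha>"
  by (rule assms(1)[unfolded diffeology_def, THEN conjunct2, THEN conjunct2, THEN conjunct2, rule_format,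
        OF assms(2,3)])

lemma points_embedded [simp]: "points (embedded A) = A"
  by (simp add: embedded_def)

lemma plot_embedded [simp]: "plot (embedded A) k U \<alpha> \<longleftrightarrow> C_infinity_on k U \<alpha> \<and> \<alpha> ` U \<subseteq> A"
  by (simp add: embedded_def)

lemma points_coord_space [simp]: "points coord_space = UNIV"
  by (simp add: coord_space_def)

lemma plot_coord_space:
  "plot coord_space k U \<alpha> \<longleftrightarrow> openin (Euclidean_space k) U \<and> (\<forall>i. C_infinity_on k U (\<lambda>x. \<alpha> x i))"
  by (simp add: coord_space_def)

lemma points_subspace_of [simp]: "points (subspace_of X A) = points X \<inter> A"
  by (simp add: subspace_of_def)

lemma plot_subspace_of [simp]: "plot (subspace_of X A) k U \<alpha> \<longleftrightarrow> plot X k U \<alpha> \<and> \<alpha> ` U \<subseteq> A"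
  by (simp add: subspace_of_def)

lemma points_prod_space [simp]: "points (X \<times>\<^sub>s Y) = points X \<times> points Y"
  by (simp add: prod_space_def)

lemma plot_prod_space [simp]:
  "plot (X \<times>\<^sub>s Y) k U \<alpha> \<longleftrightarrow> plot X k U (\<lambda>x. fst (\<alpha> x)) \<and> plot Y k U (\<lambda>x. snd (\<alpha> x))"
  by (simp add: prod_space_def)

lemma points_quotient_space [simp]: "points (quotient_space X q) = q ` points X"
  by (simp add: quotient_space_def)

lemma plot_quotient_space:
  "plot (quotient_space X q) k U \<alpha> \<longleftrightarrow> openin (Euclidean_space k) U \<and>
     (\<forall>u\<in>U. \<exists>V \<beta>. u \<in> V \<and> V \<subseteq> U \<and> plot X k V \<beta> \<and> (\<forall>x\<in>V. \<alpha> x = q (\<beta> x)))"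
  by (simp add: quotient_space_def)

lemma diffeology_embedded: "diffeology (embedded A)"
proof (rule diffeologyI, goal_cases)
  case (3 k U \<alpha> \<beta>)
  then have "C_infinity_on k U \<alpha>" and "\<alpha> ` U \<subseteq> A" by simp_all
  then show ?case
    using C_infinity_on_cong[of k U \<alpha> \<beta>] 3(2) by (simp add: image_subset_iff)
next
  case (4 k U V \<alpha>)
  then show ?case using C_infinity_on_subset[of k U \<alpha> V] by auto
next
  case (5 k U \<alpha>)
  have "\<exists>V. u \<in> V \<and> V \<subseteq> U \<and> C_infinity_on k V \<alpha>" if "u \<in> U" for u
    using 5(2)[OF that] by auto
  then have "C_infinity_on k U \<alpha>" by (rule C_infinity_on_locally[OF 5(1)])
  moreover have "\<alpha> u \<in> A" if "u \<in> U" for u using 5(2)[OF that] by auto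
  ultimately show ?case by (simp add: image_subset_iff)
qed (auto dest: C_infinity_on_openin)

lemma diffeology_coord_space: "diffeology coord_space"
proof (rule diffeologyI, goal_cases)
  case (3 k U \<alpha> \<beta>)
  have "C_infinity_on k U (\<lambda>x. \<beta> x i)" for i
    by (rule C_infinity_on_cong[of k U "\<lambda>x. \<alpha> x i"]) (use 3 in \<open>simp_all add: plot_coord_space\<close>)
  then show ?case using 3(1) by (simp add: plot_coord_space)
next
  case (4 k U V \<alpha>)
  then have "C_infinity_on k V (\<lambda>x. \<alpha> x i)" for i
    using C_infinity_on_subset[of k U "\<lambda>x. \<alpha> x i" V] by (simp add: plot_coord_space)
  then show ?case using 4(3) by (simp add: plot_coord_space)
next
  case (5 k U \<alpha>)
  have "C_infinity_on k U (\<lambda>x. \<alpha> x i)" for i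
  proof (rule C_infinity_on_locally[OF 5(1)])
    show "\<exists>V. u \<in> V \<and> V \<subseteq> U \<and> C_infinity_on k V (\<lambda>x. \<alpha> x i)" if "u \<in> U" for u
      using 5(2)[OF that] by (auto simp: plot_coord_space)
  qed
  then show ?case using 5(1) by (simp add: plot_coord_space)
qed (auto simp: plot_coord_space)

lemma diffeology_subspace_of:
  assumes "diffeology X"
  shows "diffeology (subspace_of X A)"
proof (rule diffeologyI, goal_cases)
  case (1 k U \<alpha>)
  then show ?case using plot_openin[OF assms, of k U \<alpha>] by simp
next
  case (2 k U \<alpha> x)
  then show ?case using plot_in_points[OF assms, of k U \<alpha> x] by auto
next
  case (3 k U \<alpha> \<beta>)
  have "plot X k U \<beta>" by (rule plot_cong[OF assms, of k U \<alpha> \<beta>]) (use 3 in simp_all)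
  then show ?case using 3 by (simp add: image_subset_iff)
next
  case (4 k U V \<alpha>)
  then show ?case using plot_subset[OF assms, of k U \<alpha> V] by auto
next
  case (5 k U \<alpha>)
  have "\<exists>V. u \<in> V \<and> V \<subseteq> U \<and> plot X k V \<alpha>" if "u \<in> U" for u using 5(2)[OF that] by auto
  then have "plot X k U \<alpha>" by (rule plot_locally[OF assms 5(1)])
  moreover have "\<alpha> u \<in> A" if "u \<in> U" for u using 5(2)[OF that] by auto
  ultimately show ?case by (simp add: image_subset_iff)
qed

lemma diffeology_prod_space:
  assumes X: "diffeology X" and Y: "diffeology Y"
  shows "diffeology (X \<times>\<^sub>s Y)"
proof (rule diffeologyI, goal_cases)
  case (1 k U \<alpha>)
  then show ?case using plot_openin[OF X, of k U "\<lambda>x. fst (\<alpha> x)"] by simp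
next
  case (2 k U \<alpha> x)
  then show ?case
    using plot_in_points[OF X, of k U "\<lambda>x. fst (\<alpha> x)" x] plot_in_points[OF Y, of k U "\<lambda>x. snd (\<alpha> x)" x]
    by (simp add: mem_Times_iff)
next
  case (3 k U \<alpha> \<beta>)
  have "plot X k U (\<lambda>x. fst (\<beta> x))"
    by (rule plot_cong[OF X, of k U "\<lambda>x. fst (\<alpha> x)"]) (use 3 in simp_all)
  moreover have "plot Y k U (\<lambda>x. snd (\<beta> x))"
    by (rule plot_cong[OF Y, of k U "\<lambda>x. snd (\<alpha> x)"]) (use 3 in simp_all)
  ultimately show ?case by simp
next
  case (4 k U V \<alpha>)
  then show ?case
    using plot_subset[OF X, of k U "\<lambda>x. fst (\<alpha> x)" V] plot_subset[OF Y, of k U "\<lambda>x. snd (\<alpha> x)" V]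
    by simp
next
  case (5 k U \<alpha>)
  have "plot X k U (\<lambda>x. fst (\<alpha> x))"
  proof (rule plot_locally[OF X 5(1)])
    show "\<exists>V. u \<in> V \<and> V \<subseteq> U \<and> plot X k V (\<lambda>x. fst (\<alpha> x))" if "u \<in> U" for u
      using 5(2)[OF that] by auto
  qed
  moreover have "plot Y k U (\<lambda>x. snd (\<alpha> x))"
  proof (rule plot_locally[OF Y 5(1)])
    show "\<exists>V. u \<in> V \<and> V \<subseteq> U \<and> plot Y k V (\<lambda>x. snd (\<alpha> x))" if "u \<in> U" for u
      using 5(2)[OF that] by auto
  qed
  ultimately show ?case by simp
qed

lemma diffeology_quotient_space:
  assumes X: "diffeology X"
  shows "diffeology (quotient_space X q)"
proof (rule diffeologyI, goal_cases)
  case (1 k U \<alpha>)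
  then show ?case by (simp add: plot_quotient_space)
next
  case (2 k U \<alpha> x)
  then obtain V \<beta> where "x \<in> V" "plot X k V \<beta>" "\<forall>x\<in>V. \<alpha> x = q (\<beta> x)"
    unfolding plot_quotient_space by blast
  then show ?case using plot_in_points[OF X, of k V \<beta> x] by simp
next
  case (3 k U \<alpha> \<beta>)
  show ?case
    unfolding plot_quotient_space
  proof (intro conjI ballI)
    show "openin (Euclidean_space k) U" using 3(1) by (simp add: plot_quotient_space)
    fix u assume "u \<in> U"
    then obtain V \<gamma> where V: "u \<in> V" "V \<subseteq> U" "plot X k V \<gamma>" "\<forall>x\<in>V. \<alpha> x = q (\<gamma> x)"
      using 3(1) unfolding plot_quotient_space by blast
    moreover from this have "\<forall>x\<in>V. \<beta> x = q (\<gamma> x)" using 3(2) by (metis subsetD)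
    ultimately show "\<exists>V \<gamma>. u \<in> V \<and> V \<subseteq> U \<and> plot X k V \<gamma> \<and> (\<forall>x\<in>V. \<beta> x = q (\<gamma> x))"
      by (intro exI[of _ V] exI[of _ \<gamma>] conjI)
  qed
next
  case (4 k U W \<alpha>)
  show ?case
    unfolding plot_quotient_space
  proof (intro conjI ballI)
    show W: "openin (Euclidean_space k) W" by (rule 4(3))
    fix u assume u: "u \<in> W"
    then obtain V \<gamma> where V: "u \<in> V" "V \<subseteq> U" "plot X k V \<gamma>" "\<forall>x\<in>V. \<alpha> x = q (\<gamma> x)"
      using 4(1,2) unfolding plot_quotient_space by blast
    have "plot X k (V \<inter> W) \<gamma>"
      using plot_subset[OF X V(3)] plot_openin[OF X V(3)] W by (simp add: openin_Int)
    then show "\<exists>V \<gamma>. u \<in> V \<and> V \<subseteq> W \<and> plot X k V \<gamma> \<and> (\<forall>x\<in>V. \<alpha> x = q (\<gamma> x))"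
      using V u by (intro exI[of _ "V \<inter> W"] exI[of _ \<gamma>]) auto
  qed
next
  case (5 k U \<alpha>)
  show ?case
    unfolding plot_quotient_space
  proof (intro conjI ballI 5(1))
    fix u assume "u \<in> U"
    then obtain W where W: "u \<in> W" "W \<subseteq> U" "plot (quotient_space X q) k W \<alpha>" using 5(2) by blast
    then obtain V \<gamma> where V: "u \<in> V" "V \<subseteq> W" "plot X k V \<gamma>" "\<forall>x\<in>V. \<alpha> x = q (\<gamma> x)"
      unfolding plot_quotient_space by blast
    then show "\<exists>V \<gamma>. u \<in> V \<and> V \<subseteq> U \<and> plot X k V \<gamma> \<and> (\<forall>x\<in>V. \<alpha> x = q (\<gamma> x))"
      using W(2) by (intro exI[of _ V] exI[of _ \<gamma>]) auto
  qed
qed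

lemma smooth_map_plot: "smooth_map X Y f \<Longrightarrow> plot X k U \<alpha> \<Longrightarrow> plot Y k U (\<lambda>x. f (\<alpha> x))"
  unfolding smooth_map_def by (simp add: o_def)

lemma smooth_map_in_points: "smooth_map X Y f \<Longrightarrow> x \<in> points X \<Longrightarrow> f x \<in> points Y"
  unfolding smooth_map_def by blast

lemma smooth_mapI:
  assumes "\<And>x. x \<in> points X \<Longrightarrow> f x \<in> points Y"
    and "\<And>k U \<alpha>. plot X k U \<alpha> \<Longrightarrow> plot Y k U (\<lambda>x. f (\<alpha> x))"
  shows "smooth_map X Y f"
  using assms(1) unfolding smooth_map_def by (auto simp: o_def intro: assms(2))

lemma smooth_map_locallyI:
  assumes X: "diffeology X" and Y: "diffeology Y"
    and "\<And>x. x \<in> points X \<Longrightarrow> f x \<in> points Y"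
    and "\<And>k U \<alpha> u. plot X k U \<alpha> \<Longrightarrow> u \<in> U \<Longrightarrow> \<exists>V. u \<in> V \<and> V \<subseteq> U \<and> plot Y k V (\<lambda>x. f (\<alpha> x))"
  shows "smooth_map X Y f"
  using assms(3)
proof (rule smooth_mapI)
  fix k U \<alpha> assume *: "plot X k U \<alpha>"
  show "plot Y k U (\<lambda>x. f (\<alpha> x))"
    by (rule plot_locally[OF Y plot_openin[OF X *] assms(4)[OF *]])
qed

lemma smooth_map_cong:
  assumes "diffeology X" and "diffeology Y" and "smooth_map X Y f" and "\<And>x. x \<in> points X \<Longrightarrow> f x = g x"
  shows "smooth_map X Y g"
proof (rule smooth_mapI)
  show "g x \<in> points Y" if "x \<in> points X" for x
    using smooth_map_in_points[OF assms(3) that] assms(4)[OF that] by simp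
  show "plot Y k U (\<lambda>x. g (\<alpha> x))" if "plot X k U \<alpha>" for k U \<alpha>
    by (rule plot_cong[OF assms(2) smooth_map_plot[OF assms(3) that]])
       (use assms(4) plot_in_points[OF assms(1) that] in simp)
qed

lemma diffeomorphismI:
  assumes X: "diffeology X" and Y: "diffeology Y"
    and f: "smooth_map X Y f" and g: "smooth_map Y X g"
    and gf: "\<And>x. x \<in> points X \<Longrightarrow> g (f x) = x" and fg: "\<And>y. y \<in> points Y \<Longrightarrow> f (g y) = y"
  shows "diffeomorphism X Y f"
proof -
  have bij: "bij_betw f (points X) (points Y)"
    using smooth_map_in_points[OF f] smooth_map_in_points[OF g] gf fg
    by (intro bij_betw_byWitness[where f' = g]) auto
  have "g y = inv_into (points X) f y" if "y \<in> points Y" for y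
    using inv_into_f_eq[OF bij_betw_imp_inj_on[OF bij] smooth_map_in_points[OF g that] fg[OF that]] by simp
  then have "smooth_map Y X (inv_into (points X) f)" by (rule smooth_map_cong[OF Y X g])
  then show ?thesis using bij f by (simp add: diffeomorphism_def)
qed

lemma diffeomorphismE:
  assumes "diffeomorphism X Y f"
  obtains g where "smooth_map X Y f" and "smooth_map Y X g"
    and "\<forall>x\<in>points X. g (f x) = x" and "\<forall>y\<in>points Y. f (g y) = y"
proof (rule that[of "inv_into (points X) f"])
  have bij: "bij_betw f (points X) (points Y)" using assms by (simp add: diffeomorphism_def)
  then show "\<forall>x\<in>points X. inv_into (points X) f (f x) = x"
    by (simp add: bij_betw_inv_into_left)
  show "\<forall>y\<in>points Y. f (inv_into (points X) f y) = y"
    using bij by (simp add: bij_betw_inv_into_right)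
qed (use assms in \<open>simp_all add: diffeomorphism_def\<close>)

text \<open>The pullback of the basic gerbe lives on a cover diffeomorphic to the one of the cup product gerbes.
  This and the next lemma carry the submersion and the action over to it.\<close>

lemma surjective_submersion_transfer:
  assumes X: "diffeology X" and Y: "diffeology Y" and M: "diffeology M"
    and \<phi>: "diffeomorphism X Y \<phi>" and sub: "surjective_submersion Y M \<pi>" and \<rho>: "\<And>x. x \<in> points X \<Longrightarrow> \<pi> (\<phi> x) = \<rho> x"
  shows "surjective_submersion X M \<rho>"
proof -
  obtain \<psi> where \<psi>: "smooth_map X Y \<phi>" "smooth_map Y X \<psi>"
    "\<forall>x\<in>points X. \<psi> (\<phi> x) = x" "\<forall>y\<in>points Y. \<phi> (\<psi> y) = y"
    using diffeomorphismE[OF \<phi>] .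
  have \<pi>: "smooth_map Y M \<pi>" "\<pi> ` points Y = points M" using sub by (simp_all add: surjective_submersion_def)
  have \<rho>\<psi>: "\<rho> (\<psi> y) = \<pi> y" if "y \<in> points Y" for y
    using \<rho>[OF smooth_map_in_points[OF \<psi>(2) that]] \<psi>(4) that by simp
  show ?thesis
    unfolding surjective_submersion_def
  proof (intro conjI allI impI)
    show smooth: "smooth_map X M \<rho>"
    proof (rule smooth_map_cong[OF X M])
      show "smooth_map X M (\<lambda>x. \<pi> (\<phi> x))"
        by (rule smooth_mapI)
           (rule smooth_map_in_points[OF \<pi>(1) smooth_map_in_points[OF \<psi>(1)]] smooth_map_plot[OF \<pi>(1) smooth_map_plot[OF \<psi>(1)]]; assumption)+
    qed (rule \<rho>)
    show "\<rho> ` points X = points M"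
    proof
      show "\<rho> ` points X \<subseteq> points M" using smooth_map_in_points[OF smooth] by blast
      show "points M \<subseteq> \<rho> ` points X"
      proof
        fix m assume "m \<in> points M"
        then obtain y where "y \<in> points Y" "m = \<pi> y" using \<pi>(2) by blast
        then show "m \<in> \<rho> ` points X"
          using \<rho>\<psi> smooth_map_in_points[OF \<psi>(2)] by (metis imageI)
      qed
    qed
    fix k U \<alpha> u x
    assume *: "plot M k U \<alpha> \<and> u \<in> U \<and> x \<in> points X \<and> \<rho> x = \<alpha> u"
    then have "plot M k U \<alpha> \<and> u \<in> U \<and> \<phi> x \<in> points Y \<and> \<pi> (\<phi> x) = \<alpha> u"
      using \<rho> smooth_map_in_points[OF \<psi>(1)] by simp
    then obtain V \<beta> where V: "u \<in> V" "V \<subseteq> U" "plot Y k V \<beta>" "\<beta> u = \<phi> x" "\<forall>x\<in>V. \<pi> (\<beta> x) = \<alpha> x"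
      using sub unfolding surjective_submersion_def by blast
    have Y: "\<beta> v \<in> points Y" if "v \<in> V" for v
      by (rule plot_in_points[OF Y V(3) that])
    show "\<exists>V \<beta>. u \<in> V \<and> V \<subseteq> U \<and> plot X k V \<beta> \<and> \<beta> u = x \<and> (\<forall>x\<in>V. \<rho> (\<beta> x) = \<alpha> x)"
      using V * \<psi>(3) smooth_map_plot[OF \<psi>(2) V(3)] Y \<rho>\<psi>
      by (intro exI[of _ V] exI[of _ "\<lambda>x. \<psi> (\<beta> x)"]) auto
  qed
qed

lemma smooth_action_transfer:
  assumes G: "diffeology (group_space G)" and X: "diffeology X" and \<phi>: "diffeomorphism X Y \<phi>"
    and act: "smooth_action G Y b"
    and closed: "\<And>h x. h \<in> points (group_space G) \<Longrightarrow> x \<in> points X \<Longrightarrow> a h x \<in> points X"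
    and eq: "\<And>h x. h \<in> points (group_space G) \<Longrightarrow> x \<in> points X \<Longrightarrow> \<phi> (a h x) = b h (\<phi> x)"
    and one: "group_one G \<in> points (group_space G)"
    and mult: "\<And>h k. h \<in> points (group_space G) \<Longrightarrow> k \<in> points (group_space G) \<Longrightarrow>
      group_mult G h k \<in> points (group_space G)"
  shows "smooth_action G X a"
proof -
  obtain \<psi> where \<psi>: "smooth_map X Y \<phi>" "smooth_map Y X \<psi>"
    "\<forall>x\<in>points X. \<psi> (\<phi> x) = x" "\<forall>y\<in>points Y. \<phi> (\<psi> y) = y"
    using diffeomorphismE[OF \<phi>] .
  have a: "\<psi> (b h (\<phi> x)) = a h x" if "h \<in> points (group_space G)" "x \<in> points X" for h x
    using eq[OF that] closed[OF that] \<psi>(3) by metis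
  have b: "smooth_map (group_space G \<times>\<^sub>s Y) Y (\<lambda>(h, x). b h x)"
    "\<forall>x\<in>points Y. b (group_one G) x = x"
    "\<forall>h\<in>points (group_space G). \<forall>k\<in>points (group_space G). \<forall>x\<in>points Y.
        b (group_mult G h k) x = b h (b k x)"
    using act by (simp_all add: smooth_action_def)
  show ?thesis
    unfolding smooth_action_def
  proof (intro conjI ballI)
    show "smooth_map (group_space G \<times>\<^sub>s X) X (\<lambda>(h, x). a h x)"
    proof (rule smooth_map_cong[OF diffeology_prod_space[OF G X] X])
      show "smooth_map (group_space G \<times>\<^sub>s X) X (\<lambda>p. \<psi> (b (fst p) (\<phi> (snd p))))"
      proof (rule smooth_mapI)
        show "\<psi> (b (fst p) (\<phi> (snd p))) \<in> points X" if "p \<in> points (group_space G \<times>\<^sub>s X)" for p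
          using that a closed by auto
        fix k U \<alpha> assume "plot (group_space G \<times>\<^sub>s X) k U \<alpha>"
        then have "plot (group_space G \<times>\<^sub>s Y) k U (\<lambda>x. (fst (\<alpha> x), \<phi> (snd (\<alpha> x))))"
          using smooth_map_plot[OF \<psi>(1)] by simp
        from smooth_map_plot[OF \<psi>(2) smooth_map_plot[OF b(1) this]]
        show "plot X k U (\<lambda>x. \<psi> (b (fst (\<alpha> x)) (\<phi> (snd (\<alpha> x)))))" by simp
      qed
    qed (auto simp: a)
    show "a (group_one G) x = x" if "x \<in> points X" for x
      using a[OF one that] b(2) \<psi>(3) that smooth_map_in_points[OF \<psi>(1) that] by simp
    fix h k x assume hk: "h \<in> points (group_space G)" "k \<in> points (group_space G)" and x: "x \<in> points X"
    have "a (group_mult G h k) x = \<psi> (b (group_mult G h k) (\<phi> x))" using a[OF mult[OF hk] x] by simp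
    also have "\<dots> = \<psi> (b h (b k (\<phi> x)))" using b(3) hk smooth_map_in_points[OF \<psi>(1) x] by simp
    also have "\<dots> = a h (a k x)" using eq[OF hk(2) x] a[OF hk(1) closed[OF hk(2) x]] by simp
    finally show "a (group_mult G h k) x = a h (a k x)" .
  qed
qed

section \<open>Lines spanned by unit vectors\<close>

definition cline :: "'i cvec \<Rightarrow> 'i cvec set" where
  "cline v = range (\<lambda>c i. c * v i)"

definition unit_vector :: "'i cvec \<Rightarrow> bool" where
  "unit_vector v \<longleftrightarrow> finite {i. v i \<noteq> 0} \<and> herm v v = 1"

lemma herm_scale: "herm (\<lambda>i. c * v i) (\<lambda>i. d * w i) = c * cnj d * herm v w"
proof (cases "c = 0")
  case False
  then have "{i. c * v i \<noteq> 0} = {i. v i \<noteq> 0}" by simp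
  then show ?thesis by (simp add: herm_def sum_distrib_left mult_ac)
qed (simp add: herm_def)

lemma herm_scale_left: "herm (\<lambda>i. c * v i) w = c * herm v w"
  using herm_scale[of c v 1 w] by simp

lemma herm_finite_support:
  assumes "finite F" and "\<And>i. i \<notin> F \<Longrightarrow> v i = 0"
  shows "herm v w = (\<Sum>i\<in>F. v i * cnj (w i))"
  unfolding herm_def by (rule sum.mono_neutral_left) (use assms in auto)

lemma herm_UNIV: "herm v w = (\<Sum>i\<in>UNIV. v i * cnj (w i))" for v :: "('i::finite) cvec"
  by (rule herm_finite_support) simp_all

lemma cline_scale_mem [simp]: "(\<lambda>i. c * v i) \<in> cline v"
  by (simp add: cline_def)

lemma cline_self_mem [simp]: "v \<in> cline v"
  using cline_scale_mem[of 1 v] by simp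

lemma unit_vector_nonzero: "unit_vector v \<Longrightarrow> v \<noteq> (\<lambda>i. 0)"
  by (auto simp: unit_vector_def herm_def)

lemma unit_vector_scale_inject:
  assumes "unit_vector v"
  shows "(\<lambda>i. c * v i) = (\<lambda>i. d * v i) \<longleftrightarrow> c = d"
proof
  assume eq: "(\<lambda>i. c * v i) = (\<lambda>i. d * v i)"
  obtain i where "v i \<noteq> 0" using unit_vector_nonzero[OF assms] by blast
  then show "c = d" using fun_cong[OF eq, of i] by simp
qed simp

lemma unit_vector_coordinate:
  assumes "unit_vector v" and "p \<in> cline v"
  shows "p = (\<lambda>i. herm p v * v i)"
  using assms by (auto simp: cline_def unit_vector_def herm_scale_left)

lemma complex_line_cline: "unit_vector v \<Longrightarrow> complex_line (cline v)"
  using unit_vector_nonzero[of v] unfolding complex_line_def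
  by (intro exI[of _ v]) (auto simp: unit_vector_def cline_def)

lemma linear_isometry_on_cline:
  assumes v: "unit_vector v" and w: "unit_vector w"
    and \<phi>: "\<And>c. \<phi> (\<lambda>i. c * v i) = (\<lambda>i. c * w i)"
  shows "linear_isometry_on (cline v) (cline w) \<phi>"
  unfolding linear_isometry_on_def
proof (intro conjI ballI allI)
  show "bij_betw \<phi> (cline v) (cline w)"
    unfolding bij_betw_def
  proof
    show "inj_on \<phi> (cline v)"
    proof (rule inj_onI)
      fix p q assume "p \<in> cline v" "q \<in> cline v" and eq: "\<phi> p = \<phi> q"
      then obtain a b where pq: "p = (\<lambda>i. a * v i)" "q = (\<lambda>i. b * v i)" by (auto simp: cline_def)
      show "p = q" using eq unit_vector_scale_inject[OF w] by (simp add: pq \<phi>)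
    qed
    show "\<phi> ` cline v = cline w"
      unfolding cline_def by (simp add: image_image \<phi>)
  qed
  fix p q assume "p \<in> cline v" "q \<in> cline v"
  then obtain a b where pq: "p = (\<lambda>i. a * v i)" "q = (\<lambda>i. b * v i)" by (auto simp: cline_def)
  show "herm (\<phi> p) (\<phi> q) = herm p q"
    using v w by (simp add: pq \<phi> herm_scale unit_vector_def)
  fix c
  have "(\<lambda>i. p i + c * q i) = (\<lambda>i. (a + c * b) * v i)" by (simp add: pq algebra_simps)
  then show "\<phi> (\<lambda>i. p i + c * q i) = (\<lambda>i. \<phi> p i + c * \<phi> q i)"
    by (simp only: pq \<phi>) (simp add: algebra_simps)
qed


section \<open>Framed gerbes\<close>

lemma same_fibre_simps:
  "same_fibre B [y1, y2] \<longleftrightarrow>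
     (y1 \<in> points (cover B) \<and> y2 \<in> points (cover B)) \<and> proj B y1 = proj B y2"
  "same_fibre B [y1, y2, y3] \<longleftrightarrow>
     (y1 \<in> points (cover B) \<and> y2 \<in> points (cover B) \<and> y3 \<in> points (cover B)) \<and>
     proj B y1 = proj B y2 \<and> proj B y2 = proj B y3"
  "same_fibre B [y1, y2, y3, y4] \<longleftrightarrow>
     (y1 \<in> points (cover B) \<and> y2 \<in> points (cover B) \<and> y3 \<in> points (cover B) \<and> y4 \<in> points (cover B)) \<and>
     proj B y1 = proj B y2 \<and> proj B y2 = proj B y3 \<and> proj B y3 = proj B y4"
  unfolding same_fibre_def list.set by (metis (full_types) empty_iff empty_subsetI insert_iff insert_subset)+

text \<open>
  The line bundles of the two gerbes of the theorem need not have global frames, but they acquire them after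
  pulling back along a submersion \<open>Q \<rightarrow> M\<close> to which the group action lifts (here
  \<open>T \<times> SU(n) \<rightarrow> T \<times> SU(n)/T\<close>), and multiplication and action send frames to frames. This makes all
  axioms of an equivariant gerbe consequences of smoothness of the frame: in the frame, every
  structure map is multiplication of complex coordinates. The set \<open>lifts m\<close> is the fibre of
  \<open>Q\<close> over \<open>m\<close>.
\<close>

locale framed_gerbe =
  fixes G :: "'g lie_group" and B :: "('g, 'm, 'y, 'i) gerbe"
    and Q :: "'q smooth_space" and lifts :: "'m \<Rightarrow> 'q set" and act_lift :: "'g \<Rightarrow> 'q \<Rightarrow> 'q"
    and frame :: "'q \<Rightarrow> 'y \<Rightarrow> 'y \<Rightarrow> 'i cvec"
  assumes diffeology_G: "diffeology (group_space G)"
    and diffeology_cover: "diffeology (cover B)"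
    and diffeology_base: "diffeology (base B)"
    and diffeology_Q: "diffeology Q"
    and submersion: "surjective_submersion (cover B) (base B) (proj B)"
    and smooth_act_base: "smooth_action G (base B) (act_base B)"
    and smooth_act_cover: "smooth_action G (cover B) (act_cover B)"
    and one_in: "group_one G \<in> points (group_space G)"
    and mult_in: "\<And>h k. h \<in> points (group_space G) \<Longrightarrow> k \<in> points (group_space G) \<Longrightarrow>
      group_mult G h k \<in> points (group_space G)"
    and proj_act: "\<And>h y. h \<in> points (group_space G) \<Longrightarrow> y \<in> points (cover B) \<Longrightarrow>
      proj B (act_cover B h y) = act_base B h (proj B y)"
    and smooth_act_lift: "smooth_map (group_space G \<times>\<^sub>s Q) Q (\<lambda>(h, g). act_lift h g)"
    and act_lift_one: "\<And>g. g \<in> points Q \<Longrightarrow> act_lift (group_one G) g = g"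
    and act_lift_mult: "\<And>h k g. h \<in> points (group_space G) \<Longrightarrow> k \<in> points (group_space G) \<Longrightarrow>
      g \<in> points Q \<Longrightarrow> act_lift (group_mult G h k) g = act_lift h (act_lift k g)"
    and act_lift_lifts: "\<And>h g m. h \<in> points (group_space G) \<Longrightarrow> m \<in> points (base B) \<Longrightarrow>
      g \<in> lifts m \<Longrightarrow> act_lift h g \<in> lifts (act_base B h m)"
    and lifts_Q: "\<And>m. m \<in> points (base B) \<Longrightarrow> lifts m \<subseteq> points Q"
    and lifts_nonempty: "\<And>m. m \<in> points (base B) \<Longrightarrow> lifts m \<noteq> {}"
    and local_lift: "\<And>k U \<alpha> u. plot (base B) k U \<alpha> \<Longrightarrow> u \<in> U \<Longrightarrow>
      \<exists>V \<beta>. u \<in> V \<and> V \<subseteq> U \<and> plot Q k V \<beta> \<and> (\<forall>x\<in>V. \<beta> x \<in> lifts (\<alpha> x))"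
    and unit_frame: "\<And>g y1 y2. same_fibre B [y1, y2] \<Longrightarrow> g \<in> lifts (proj B y1) \<Longrightarrow>
      unit_vector (frame g y1 y2)"
    and fibre_frame: "\<And>g y1 y2. same_fibre B [y1, y2] \<Longrightarrow> g \<in> lifts (proj B y1) \<Longrightarrow>
      fibre B y1 y2 = cline (frame g y1 y2)"
    and frame_smooth: "\<And>k U \<alpha> \<beta> u. plot (fibre_square (cover B) (proj B)) k U \<alpha> \<Longrightarrow> plot Q k U \<beta> \<Longrightarrow>
      \<forall>x\<in>U. \<beta> x \<in> lifts (proj B (fst (\<alpha> x))) \<Longrightarrow> u \<in> U \<Longrightarrow>
      \<exists>V F. u \<in> V \<and> V \<subseteq> U \<and> plot coord_space k V (\<lambda>x. frame (\<beta> x) (fst (\<alpha> x)) (snd (\<alpha> x))) \<and>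
        finite F \<and> (\<forall>x\<in>V. \<forall>i. i \<notin> F \<longrightarrow> frame (\<beta> x) (fst (\<alpha> x)) (snd (\<alpha> x)) i = 0)"
    and mult_frame: "\<And>y1 y2 y3 g c d. same_fibre B [y1, y2, y3] \<Longrightarrow> g \<in> lifts (proj B y1) \<Longrightarrow>
      mult B y1 y2 y3 (\<lambda>i. c * frame g y1 y2 i) (\<lambda>i. d * frame g y2 y3 i) =
        (\<lambda>i. c * d * frame g y1 y3 i)"
    and act_frame: "\<And>h y1 y2 g c. h \<in> points (group_space G) \<Longrightarrow> same_fibre B [y1, y2] \<Longrightarrow>
      g \<in> lifts (proj B y1) \<Longrightarrow> act_fibre B h y1 y2 (\<lambda>i. c * frame g y1 y2 i) =
        (\<lambda>i. c * frame (act_lift h g) (act_cover B h y1) (act_cover B h y2) i)"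
begin

abbreviation "FS \<equiv> fibre_square (cover B) (proj B)"
abbreviation "TS \<equiv> total_space FS (pair_fibre B)"

lemma smooth_proj: "smooth_map (cover B) (base B) (proj B)"
  using submersion by (simp add: surjective_submersion_def)

lemma proj_in: "y \<in> points (cover B) \<Longrightarrow> proj B y \<in> points (base B)"
  by (rule smooth_map_in_points[OF smooth_proj])

lemma lift_exists: "y \<in> points (cover B) \<Longrightarrow> \<exists>g. g \<in> lifts (proj B y)"
  using lifts_nonempty[OF proj_in] by blast

lemma FS_iff: "(y1, y2) \<in> points FS \<longleftrightarrow> same_fibre B [y1, y2]"
  by (simp add: fibre_square_def same_fibre_simps)

lemma diffeology_FS: "diffeology FS"
  unfolding fibre_square_def by (intro diffeology_subspace_of diffeology_prod_space diffeology_cover)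

lemma diffeology_TS: "diffeology TS"
  unfolding total_space_def
  by (intro diffeology_subspace_of diffeology_prod_space diffeology_FS diffeology_coord_space)

lemma local_lift_cover:
  assumes "plot (cover B) k U \<alpha>" and "u \<in> U"
  shows "\<exists>V \<beta>. u \<in> V \<and> V \<subseteq> U \<and> plot Q k V \<beta> \<and> (\<forall>x\<in>V. \<beta> x \<in> lifts (proj B (\<alpha> x)))"
  by (rule local_lift[OF smooth_map_plot[OF smooth_proj assms(1)] assms(2)])

lemma plot_FS:
  assumes "plot FS k U \<alpha>"
  shows "plot (cover B) k U (\<lambda>x. fst (\<alpha> x))" and "plot (cover B) k U (\<lambda>x. snd (\<alpha> x))"
    and "x \<in> U \<Longrightarrow> same_fibre B [fst (\<alpha> x), snd (\<alpha> x)]"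
proof -
  show "plot (cover B) k U (\<lambda>x. fst (\<alpha> x))" "plot (cover B) k U (\<lambda>x. snd (\<alpha> x))"
    using assms by (simp_all add: fibre_square_def)
  show "same_fibre B [fst (\<alpha> x), snd (\<alpha> x)]" if "x \<in> U"
    using plot_in_points[OF diffeology_FS assms that] by (simp flip: FS_iff)
qed

text \<open>The coordinate of a smooth section in the frame is its inner product with the frame.\<close>

lemma frame_coordinate_smooth:
  assumes \<alpha>: "plot FS k U \<alpha>" and \<beta>: "plot Q k U \<beta>" "\<forall>x\<in>U. \<beta> x \<in> lifts (proj B (fst (\<alpha> x)))"
    and p: "plot coord_space k U p" "\<forall>x\<in>U. p x \<in> pair_fibre B (\<alpha> x)" and u: "u \<in> U"
  shows "\<exists>V c. u \<in> V \<and> V \<subseteq> U \<and> C_infinity_on k V c \<and>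
    (\<forall>x\<in>V. p x = (\<lambda>i. c x * frame (\<beta> x) (fst (\<alpha> x)) (snd (\<alpha> x)) i))"
proof -
  obtain V F where V: "u \<in> V" "V \<subseteq> U"
    and e: "plot coord_space k V (\<lambda>x. frame (\<beta> x) (fst (\<alpha> x)) (snd (\<alpha> x)))"
    and F: "finite F" "\<forall>x\<in>V. \<forall>i. i \<notin> F \<longrightarrow> frame (\<beta> x) (fst (\<alpha> x)) (snd (\<alpha> x)) i = 0"
    using frame_smooth[OF \<alpha> \<beta> u] by (elim exE conjE)
  have openV: "openin (Euclidean_space k) V" using plot_openin[OF diffeology_coord_space e] .
  define c where "c x = (\<Sum>i\<in>F. p x i * cnj (frame (\<beta> x) (fst (\<alpha> x)) (snd (\<alpha> x)) i))" for x
  have "C_infinity_on k V c"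
    unfolding c_def
  proof (rule C_infinity_on_sum[OF openV])
    fix i
    have "C_infinity_on k V (\<lambda>x. p x i)"
      using plot_subset[OF diffeology_coord_space p(1) V(2) openV] by (simp add: plot_coord_space)
    moreover have "C_infinity_on k V (\<lambda>x. cnj (frame (\<beta> x) (fst (\<alpha> x)) (snd (\<alpha> x)) i))"
      using e by (intro C_infinity_on_cnj) (simp add: plot_coord_space)
    ultimately show "C_infinity_on k V (\<lambda>x. p x i * cnj (frame (\<beta> x) (fst (\<alpha> x)) (snd (\<alpha> x)) i))"
      by (rule C_infinity_on_mult)
  qed
  moreover have "p x = (\<lambda>i. c x * frame (\<beta> x) (fst (\<alpha> x)) (snd (\<alpha> x)) i)" if x: "x \<in> V" for x
  proof -
    let ?e = "frame (\<beta> x) (fst (\<alpha> x)) (snd (\<alpha> x))"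
    have sf: "same_fibre B [fst (\<alpha> x), snd (\<alpha> x)]" using plot_FS(3)[OF \<alpha>] V(2) x by blast
    have g: "\<beta> x \<in> lifts (proj B (fst (\<alpha> x)))" using \<beta>(2) V(2) x by blast
    have "p x \<in> cline ?e"
      using p(2) V(2) x fibre_frame[OF sf g] by (auto simp: pair_fibre_def split_beta)
    then have *: "p x = (\<lambda>i. herm (p x) ?e * ?e i)"
      by (rule unit_vector_coordinate[OF unit_frame[OF sf g]])
    then have "herm (p x) ?e = c x"
      unfolding c_def by (intro herm_finite_support F(1)) (metis F(2) x mult_zero_right)
    then show ?thesis using * by simp
  qed
  ultimately show ?thesis using V by (intro exI[of _ V] exI[of _ c]) simp
qed

lemma scaled_frame_smooth:
  assumes \<alpha>: "plot FS k U \<alpha>" and \<beta>: "plot Q k U \<beta>" "\<forall>x\<in>U. \<beta> x \<in> lifts (proj B (fst (\<alpha> x)))"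
    and c: "C_infinity_on k U c"
    and p: "\<forall>x\<in>U. p x = (\<lambda>i. c x * frame (\<beta> x) (fst (\<alpha> x)) (snd (\<alpha> x)) i)"
  shows "plot coord_space k U p"
proof (rule plot_locally[OF diffeology_coord_space plot_openin[OF diffeology_Q \<beta>(1)]])
  fix u assume u: "u \<in> U"
  obtain V F where V: "u \<in> V" "V \<subseteq> U"
    and e: "plot coord_space k V (\<lambda>x. frame (\<beta> x) (fst (\<alpha> x)) (snd (\<alpha> x)))"
    using frame_smooth[OF \<alpha> \<beta> u] by (elim exE conjE)
  have openV: "openin (Euclidean_space k) V" using plot_openin[OF diffeology_coord_space e] .
  have "plot coord_space k V (\<lambda>x i. c x * frame (\<beta> x) (fst (\<alpha> x)) (snd (\<alpha> x)) i)"
    unfolding plot_coord_space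
  proof (intro conjI openV allI)
    fix i
    have "C_infinity_on k V (\<lambda>x. frame (\<beta> x) (fst (\<alpha> x)) (snd (\<alpha> x)) i)"
      using e by (simp add: plot_coord_space)
    then show "C_infinity_on k V (\<lambda>x. c x * frame (\<beta> x) (fst (\<alpha> x)) (snd (\<alpha> x)) i)"
      by (rule C_infinity_on_mult[OF C_infinity_on_subset[OF c openV V(2)]])
  qed
  then have "plot coord_space k V p"
    by (rule plot_cong[OF diffeology_coord_space]) (use p V(2) in auto)
  then show "\<exists>V. u \<in> V \<and> V \<subseteq> U \<and> plot coord_space k V p" using V by blast
qed

lemma act_cover_in:
  assumes "h \<in> points (group_space G)" and "y \<in> points (cover B)"
  shows "act_cover B h y \<in> points (cover B)"
proof -
  have "smooth_map (group_space G \<times>\<^sub>s cover B) (cover B) (\<lambda>(h, y). act_cover B h y)"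
    using smooth_act_cover by (simp add: smooth_action_def)
  from smooth_map_in_points[OF this, of "(h, y)"] show ?thesis using assms by simp
qed

lemma same_fibre_act:
  assumes h: "h \<in> points (group_space G)" and sf: "same_fibre B ys"
  shows "same_fibre B (map (act_cover B h) ys)"
proof -
  have ys: "y \<in> points (cover B)" if "y \<in> set ys" for y using sf that by (auto simp: same_fibre_def)
  have "proj B (act_cover B h y) = proj B (act_cover B h y')" if y: "y \<in> set ys" "y' \<in> set ys" for y y'
  proof -
    have "proj B y = proj B y'" using sf y unfolding same_fibre_def by blast
    then show ?thesis using proj_act[OF h ys[OF y(1)]] proj_act[OF h ys[OF y(2)]] by simp
  qed
  then show ?thesis
    using act_cover_in[OF h ys] unfolding same_fibre_def set_map by blast
qed

lemma hermitian_line_bundle: "hermitian_line_bundle FS (pair_fibre B)"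
  unfolding hermitian_line_bundle_def
proof (intro conjI ballI allI impI)
  fix y assume "y \<in> points FS"
  then have sf: "same_fibre B [fst y, snd y]" by (simp flip: FS_iff)
  then obtain g where g: "g \<in> lifts (proj B (fst y))"
    using lift_exists[of "fst y"] by (auto simp: same_fibre_simps)
  show "complex_line (pair_fibre B y)"
    using complex_line_cline[OF unit_frame[OF sf g]] fibre_frame[OF sf g]
    by (simp add: pair_fibre_def split_beta)
next
  fix k U \<alpha> u assume "plot FS k U \<alpha> \<and> u \<in> U"
  then have \<alpha>: "plot FS k U \<alpha>" and u: "u \<in> U" by simp_all
  obtain W \<beta> where W: "u \<in> W" "W \<subseteq> U" "plot Q k W \<beta>" "\<forall>x\<in>W. \<beta> x \<in> lifts (proj B (fst (\<alpha> x)))"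
    using local_lift_cover[OF plot_FS(1)[OF \<alpha>] u] by (elim exE conjE)
  have \<alpha>W: "plot FS k W \<alpha>"
    using plot_subset[OF diffeology_FS \<alpha> W(2) plot_openin[OF diffeology_Q W(3)]] .
  obtain V F where V: "u \<in> V" "V \<subseteq> W"
    and e: "plot coord_space k V (\<lambda>x. frame (\<beta> x) (fst (\<alpha> x)) (snd (\<alpha> x)))"
    using frame_smooth[OF \<alpha>W W(3,4,1)] by (elim exE conjE)
  have "frame (\<beta> x) (fst (\<alpha> x)) (snd (\<alpha> x)) \<in> pair_fibre B (\<alpha> x) \<and>
      herm (frame (\<beta> x) (fst (\<alpha> x)) (snd (\<alpha> x))) (frame (\<beta> x) (fst (\<alpha> x)) (snd (\<alpha> x))) = 1"
    if "x \<in> V" for x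
  proof -
    have x: "x \<in> W" using that V(2) by blast
    have sf: "same_fibre B [fst (\<alpha> x), snd (\<alpha> x)]" using plot_FS(3)[OF \<alpha>W x] .
    show ?thesis
      using unit_frame[OF sf W(4)[rule_format, OF x]] fibre_frame[OF sf W(4)[rule_format, OF x]]
      by (simp add: pair_fibre_def split_beta unit_vector_def)
  qed
  then show "\<exists>V e. u \<in> V \<and> V \<subseteq> U \<and> plot coord_space k V e \<and>
      (\<forall>x\<in>V. e x \<in> pair_fibre B (\<alpha> x) \<and> herm (e x) (e x) = 1)"
    using V W(2) e by (intro exI[of _ V] exI[of _ "\<lambda>x. frame (\<beta> x) (fst (\<alpha> x)) (snd (\<alpha> x))"]) auto
qed

text \<open>In coordinates with respect to the frames along a common lift, the multiplication is the product of
  two smooth functions.\<close>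

lemma mult_smooth:
  "smooth_map
     (subspace_of (cover B \<times>\<^sub>s cover B \<times>\<^sub>s cover B \<times>\<^sub>s coord_space \<times>\<^sub>s coord_space)
        {(y1, y2, y3, p, q). same_fibre B [y1, y2, y3] \<and> p \<in> fibre B y1 y2 \<and> q \<in> fibre B y2 y3})
     coord_space (\<lambda>(y1, y2, y3, p, q). mult B y1 y2 y3 p q)"
    (is "smooth_map ?X _ ?f")
proof (rule smooth_map_locallyI)
  show X: "diffeology ?X"
    by (intro diffeology_subspace_of diffeology_prod_space diffeology_cover diffeology_coord_space)
  show "diffeology (coord_space :: 'i cvec smooth_space)" by (rule diffeology_coord_space)
  show "?f x \<in> points coord_space" if "x \<in> points ?X" for x by simp
  fix k U \<alpha> u assume \<alpha>: "plot ?X k U \<alpha>" and u: "u \<in> U"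
  define y1 where "y1 x = fst (\<alpha> x)" for x
  define y2 where "y2 x = fst (snd (\<alpha> x))" for x
  define y3 where "y3 x = fst (snd (snd (\<alpha> x)))" for x
  define p where "p x = fst (snd (snd (snd (\<alpha> x))))" for x
  define q where "q x = snd (snd (snd (snd (\<alpha> x))))" for x
  have \<alpha>_eq: "\<alpha> x = (y1 x, y2 x, y3 x, p x, q x)" for x
    by (simp add: y1_def y2_def y3_def p_def q_def)
  have ys: "plot (cover B) k U y1" "plot (cover B) k U y2" "plot (cover B) k U y3"
    and pq: "plot coord_space k U p" "plot coord_space k U q"
    using \<alpha> by (simp_all add: \<alpha>_eq)
  have fib: "same_fibre B [y1 x, y2 x, y3 x]" "p x \<in> fibre B (y1 x) (y2 x)" "q x \<in> fibre B (y2 x) (y3 x)"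
    if "x \<in> U" for x
    using plot_in_points[OF X \<alpha> that] by (simp_all add: \<alpha>_eq)
  have FSs: "plot FS k U (\<lambda>x. (y1 x, y2 x))" "plot FS k U (\<lambda>x. (y2 x, y3 x))"
    "plot FS k U (\<lambda>x. (y1 x, y3 x))"
    using ys fib(1) by (auto simp: fibre_square_def same_fibre_simps)
  obtain W \<beta> where W: "u \<in> W" "W \<subseteq> U" "plot Q k W \<beta>" "\<forall>x\<in>W. \<beta> x \<in> lifts (proj B (y1 x))"
    using local_lift_cover[OF ys(1) u] by (elim exE conjE)
  have openW: "openin (Euclidean_space k) W" using plot_openin[OF diffeology_Q W(3)] .
  have W2: "\<forall>x\<in>W. \<beta> x \<in> lifts (proj B (y2 x))"
  proof
    fix x assume x: "x \<in> W"
    then have "proj B (y1 x) = proj B (y2 x)" using fib(1)[of x] W(2) by (auto simp: same_fibre_simps)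
    then show "\<beta> x \<in> lifts (proj B (y2 x))" using W(4)[rule_format, OF x] by simp
  qed
  have sub: "plot FS k V a" if "plot FS k U a" "V \<subseteq> W" "openin (Euclidean_space k) V" for a V
    using plot_subset[OF diffeology_FS that(1) _ that(3)] W(2) that(2) by blast
  obtain V1 c where V1: "u \<in> V1" "V1 \<subseteq> W" "C_infinity_on k V1 c"
    and c: "\<forall>x\<in>V1. p x = (\<lambda>i. c x * frame (\<beta> x) (y1 x) (y2 x) i)"
    using frame_coordinate_smooth[OF sub[OF FSs(1) order_refl openW] W(3), of p u] W pq(1) fib(2)
      plot_subset[OF diffeology_coord_space pq(1) W(2) openW]
    by (auto simp: pair_fibre_def subset_iff)
  have open1: "openin (Euclidean_space k) V1" using C_infinity_on_openin[OF V1(3)] .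
  have V1U: "V1 \<subseteq> U" using V1(2) W(2) by blast
  obtain V d where V: "u \<in> V" "V \<subseteq> V1" "C_infinity_on k V d"
    and d: "\<forall>x\<in>V. q x = (\<lambda>i. d x * frame (\<beta> x) (y2 x) (y3 x) i)"
    using frame_coordinate_smooth[OF sub[OF FSs(2) V1(2) open1]
        plot_subset[OF diffeology_Q W(3) V1(2) open1], of q u] V1 W2 fib(3) V1U
      plot_subset[OF diffeology_coord_space pq(2) V1U open1]
    by (auto simp: pair_fibre_def subset_iff)
  have openV: "openin (Euclidean_space k) V" using C_infinity_on_openin[OF V(3)] .
  have VW: "V \<subseteq> W" using V(2) V1(2) by blast
  have "plot coord_space k V (\<lambda>x. mult B (y1 x) (y2 x) (y3 x) (p x) (q x))"
  proof (rule scaled_frame_smooth[OF sub[OF FSs(3) VW openV] plot_subset[OF diffeology_Q W(3) VW openV]])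
    show "\<forall>x\<in>V. \<beta> x \<in> lifts (proj B (fst (y1 x, y3 x)))" using W(4) VW by auto
    show "C_infinity_on k V (\<lambda>x. c x * d x)"
      by (rule C_infinity_on_mult[OF C_infinity_on_subset[OF V1(3) openV V(2)] V(3)])
    show "\<forall>x\<in>V. mult B (y1 x) (y2 x) (y3 x) (p x) (q x) =
        (\<lambda>i. c x * d x * frame (\<beta> x) (fst (y1 x, y3 x)) (snd (y1 x, y3 x)) i)"
    proof
      fix x assume x: "x \<in> V"
      then have "same_fibre B [y1 x, y2 x, y3 x]" "\<beta> x \<in> lifts (proj B (y1 x))"
        using fib(1) V(2) V1U VW W(4) by auto
      from mult_frame[OF this]
      show "mult B (y1 x) (y2 x) (y3 x) (p x) (q x) =
          (\<lambda>i. c x * d x * frame (\<beta> x) (fst (y1 x, y3 x)) (snd (y1 x, y3 x)) i)"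
        using c d x V(2) by auto
    qed
  qed
  then show "\<exists>V. u \<in> V \<and> V \<subseteq> U \<and> plot coord_space k V (\<lambda>x. ?f (\<alpha> x))"
    using V(1) VW W(2) by (intro exI[of _ V]) (auto simp: \<alpha>_eq)
qed

lemma bundle_gerbe: "bundle_gerbe B"
  unfolding bundle_gerbe_def
proof (intro conjI submersion hermitian_line_bundle mult_smooth allI impI ballI)
  fix y1 y2 y3 p q
  assume sf: "same_fibre B [y1, y2, y3]" and p: "p \<in> fibre B y1 y2" and q: "q \<in> fibre B y2 y3"
  have sfs: "same_fibre B [y1, y2]" "same_fibre B [y2, y3]" "same_fibre B [y1, y3]"
    and eq: "proj B y2 = proj B y1"
    using sf by (auto simp: same_fibre_simps)
  obtain g where g: "g \<in> lifts (proj B y1)" using lift_exists[of y1] sf by (auto simp: same_fibre_simps)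
  then have g2: "g \<in> lifts (proj B y2)" using eq by simp
  note fibs = fibre_frame[OF sfs(1) g] fibre_frame[OF sfs(2) g2] fibre_frame[OF sfs(3) g]
  note units = unit_frame[OF sfs(1) g] unit_frame[OF sfs(2) g2] unit_frame[OF sfs(3) g]
  obtain a b where a: "p = (\<lambda>i. a * frame g y1 y2 i)" and b: "q = (\<lambda>i. b * frame g y2 y3 i)"
    using p q fibs by (auto simp: cline_def)
  note mult = mult_frame[OF sf g]
  show "mult B y1 y2 y3 p q \<in> fibre B y1 y3"
    by (simp add: a b mult fibs)
  show "mult B y1 y2 y3 (\<lambda>i. p i + c * p' i) q =
      (\<lambda>i. mult B y1 y2 y3 p q i + c * mult B y1 y2 y3 p' q i)" if p': "p' \<in> fibre B y1 y2" for p' c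
  proof -
    obtain a' where a': "p' = (\<lambda>i. a' * frame g y1 y2 i)" using p' fibs by (auto simp: cline_def)
    have "(\<lambda>i. p i + c * p' i) = (\<lambda>i. (a + c * a') * frame g y1 y2 i)"
      by (simp add: a a' algebra_simps)
    then show ?thesis by (simp only: a a' b mult) (simp add: algebra_simps)
  qed
  show "mult B y1 y2 y3 p (\<lambda>i. q i + c * q' i) =
      (\<lambda>i. mult B y1 y2 y3 p q i + c * mult B y1 y2 y3 p q' i)" if q': "q' \<in> fibre B y2 y3" for q' c
  proof -
    obtain b' where b': "q' = (\<lambda>i. b' * frame g y2 y3 i)" using q' fibs by (auto simp: cline_def)
    have "(\<lambda>i. q i + c * q' i) = (\<lambda>i. (b + c * b') * frame g y2 y3 i)"
      by (simp add: b b' algebra_simps)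
    then show ?thesis by (simp only: a b b' mult) (simp add: algebra_simps)
  qed
  show "herm (mult B y1 y2 y3 p q) (mult B y1 y2 y3 p' q') = herm p p' * herm q q'"
    if p': "p' \<in> fibre B y1 y2" and q': "q' \<in> fibre B y2 y3" for p' q'
  proof -
    obtain a' b' where "p' = (\<lambda>i. a' * frame g y1 y2 i)" "q' = (\<lambda>i. b' * frame g y2 y3 i)"
      using p' q' fibs by (auto simp: cline_def)
    then show ?thesis using units by (simp add: a b mult herm_scale unit_vector_def)
  qed
next
  fix y1 y2 y3 y4 p q r
  assume sf: "same_fibre B [y1, y2, y3, y4]" and p: "p \<in> fibre B y1 y2" and q: "q \<in> fibre B y2 y3"
    and r: "r \<in> fibre B y3 y4"
  have sfs: "same_fibre B [y1, y2]" "same_fibre B [y2, y3]" "same_fibre B [y3, y4]"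
    "same_fibre B [y1, y2, y3]" "same_fibre B [y1, y3, y4]" "same_fibre B [y2, y3, y4]"
    "same_fibre B [y1, y2, y4]"
    and eq: "proj B y2 = proj B y1" "proj B y3 = proj B y1"
    using sf by (auto simp: same_fibre_simps)
  obtain g where g: "g \<in> lifts (proj B y1)" using lift_exists[of y1] sf by (auto simp: same_fibre_simps)
  then have g': "g \<in> lifts (proj B y2)" "g \<in> lifts (proj B y3)" using eq by simp_all
  obtain a b c where "p = (\<lambda>i. a * frame g y1 y2 i)" "q = (\<lambda>i. b * frame g y2 y3 i)"
    "r = (\<lambda>i. c * frame g y3 y4 i)"
    using p q r fibre_frame[OF sfs(1) g] fibre_frame[OF sfs(2) g'(1)] fibre_frame[OF sfs(3) g'(2)]
    by (auto simp: cline_def)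
  then show "mult B y1 y3 y4 (mult B y1 y2 y3 p q) r = mult B y1 y2 y4 p (mult B y2 y3 y4 q r)"
    by (simp only: mult_frame[OF sfs(4) g] mult_frame[OF sfs(5) g] mult_frame[OF sfs(6) g'(1)]
        mult_frame[OF sfs(7) g]) (simp add: mult.assoc)
qed

lemma act_fibre_in:
  assumes h: "h \<in> points (group_space G)" and sf: "same_fibre B [y1, y2]" and p: "p \<in> fibre B y1 y2"
  shows "act_fibre B h y1 y2 p \<in> fibre B (act_cover B h y1) (act_cover B h y2)"
proof -
  have y1: "y1 \<in> points (cover B)" using sf by (simp add: same_fibre_simps)
  obtain g where g: "g \<in> lifts (proj B y1)" using lift_exists[OF y1] by blast
  have hg: "act_lift h g \<in> lifts (proj B (act_cover B h y1))"
    using act_lift_lifts[OF h proj_in[OF y1] g] proj_act[OF h y1] by simp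
  obtain c where "p = (\<lambda>i. c * frame g y1 y2 i)" using p fibre_frame[OF sf g] by (auto simp: cline_def)
  then show ?thesis
    using fibre_frame[OF _ hg] same_fibre_act[OF h sf] by (simp add: act_frame[OF h sf g])
qed

lemma smooth_act_total:
  "smooth_map (group_space G \<times>\<^sub>s TS) TS
     (\<lambda>(h, (y1, y2), p). ((act_cover B h y1, act_cover B h y2), act_fibre B h y1 y2 p))"
    (is "smooth_map _ _ ?f")
proof (rule smooth_map_locallyI)
  show X: "diffeology (group_space G \<times>\<^sub>s TS)"
    by (intro diffeology_prod_space diffeology_G diffeology_TS)
  show "diffeology TS" by (rule diffeology_TS)
  show f_in: "?f x \<in> points TS" if "x \<in> points (group_space G \<times>\<^sub>s TS)" for x
  proof -
    obtain h y1 y2 p where x: "x = (h, (y1, y2), p)" by (metis prod.collapse)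
    have h: "h \<in> points (group_space G)" and sf: "same_fibre B [y1, y2]" and p: "p \<in> fibre B y1 y2"
      using that by (auto simp: x total_space_def pair_fibre_def FS_iff)
    show ?thesis
      using act_fibre_in[OF h sf p] same_fibre_act[OF h sf]
      by (simp add: x total_space_def pair_fibre_def FS_iff)
  qed
  fix k U \<alpha> u assume \<alpha>: "plot (group_space G \<times>\<^sub>s TS) k U \<alpha>" and u: "u \<in> U"
  define h where "h x = fst (\<alpha> x)" for x
  define y1 where "y1 x = fst (fst (snd (\<alpha> x)))" for x
  define y2 where "y2 x = snd (fst (snd (\<alpha> x)))" for x
  define p where "p x = snd (snd (\<alpha> x))" for x
  have \<alpha>_eq: "\<alpha> x = (h x, (y1 x, y2 x), p x)" for x
    by (simp add: y1_def y2_def p_def h_def)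
  have h: "plot (group_space G) k U h" and y: "plot FS k U (\<lambda>x. (y1 x, y2 x))"
    and p: "plot coord_space k U p" "\<forall>x\<in>U. p x \<in> pair_fibre B (y1 x, y2 x)"
    using \<alpha> by (auto simp: \<alpha>_eq total_space_def)
  note ys = plot_FS[OF y, simplified]
  have h_in: "h x \<in> points (group_space G)" if "x \<in> U" for x
    using plot_in_points[OF diffeology_G h that] .
  obtain W \<beta> where W: "u \<in> W" "W \<subseteq> U" "plot Q k W \<beta>" "\<forall>x\<in>W. \<beta> x \<in> lifts (proj B (y1 x))"
    using local_lift_cover[OF ys(1) u] by (elim exE conjE)
  have openW: "openin (Euclidean_space k) W" using plot_openin[OF diffeology_Q W(3)] .
  obtain V c where V: "u \<in> V" "V \<subseteq> W" "C_infinity_on k V c"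
    and c: "\<forall>x\<in>V. p x = (\<lambda>i. c x * frame (\<beta> x) (y1 x) (y2 x) i)"
    using frame_coordinate_smooth[OF plot_subset[OF diffeology_FS y W(2) openW] W(3), of p u] W p(2)
      plot_subset[OF diffeology_coord_space p(1) W(2) openW]
    by (auto simp: subset_iff)
  have openV: "openin (Euclidean_space k) V" using C_infinity_on_openin[OF V(3)] .
  have VU: "V \<subseteq> U" using V(2) W(2) by blast
  have hV: "plot (group_space G) k V h" using plot_subset[OF diffeology_G h VU openV] .
  have act: "smooth_map (group_space G \<times>\<^sub>s cover B) (cover B) (\<lambda>(h, y). act_cover B h y)"
    using smooth_act_cover by (simp add: smooth_action_def)
  have act_plot: "plot (cover B) k V (\<lambda>x. act_cover B (h x) (a x))" if "plot (cover B) k U a" for a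
    using smooth_map_plot[OF act, of k V "\<lambda>x. (h x, a x)"] hV
      plot_subset[OF diffeology_cover that VU openV] by simp
  have FSV: "plot FS k V (\<lambda>x. (act_cover B (h x) (y1 x), act_cover B (h x) (y2 x)))"
    using act_plot[OF ys(1)] act_plot[OF ys(2)] same_fibre_act[OF h_in ys(3)] VU
    by (auto simp: fibre_square_def same_fibre_simps)
  have lift: "plot Q k V (\<lambda>x. act_lift (h x) (\<beta> x))"
    using smooth_map_plot[OF smooth_act_lift, of k V "\<lambda>x. (h x, \<beta> x)"] hV
      plot_subset[OF diffeology_Q W(3) V(2) openV] by simp
  have "plot coord_space k V (\<lambda>x. act_fibre B (h x) (y1 x) (y2 x) (p x))"
  proof (rule scaled_frame_smooth[OF FSV lift _ V(3)])
    show "\<forall>x\<in>V. act_lift (h x) (\<beta> x) \<in>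
        lifts (proj B (fst (act_cover B (h x) (y1 x), act_cover B (h x) (y2 x))))"
    proof
      fix x assume x: "x \<in> V"
      then have y1: "y1 x \<in> points (cover B)" using ys(3) VU by (auto simp: same_fibre_simps)
      show "act_lift (h x) (\<beta> x) \<in>
          lifts (proj B (fst (act_cover B (h x) (y1 x), act_cover B (h x) (y2 x))))"
        using act_lift_lifts[OF h_in proj_in[OF y1], of x "\<beta> x"] proj_act[OF h_in y1, of x]
          W(4)[rule_format, of x] subsetD[OF VU x] subsetD[OF V(2) x] by simp
    qed
    show "\<forall>x\<in>V. act_fibre B (h x) (y1 x) (y2 x) (p x) = (\<lambda>i. c x * frame (act_lift (h x) (\<beta> x))
        (fst (act_cover B (h x) (y1 x), act_cover B (h x) (y2 x)))
        (snd (act_cover B (h x) (y1 x), act_cover B (h x) (y2 x))) i)"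
    proof
      fix x assume x: "x \<in> V"
      then have "h x \<in> points (group_space G)" "same_fibre B [y1 x, y2 x]" "\<beta> x \<in> lifts (proj B (y1 x))"
        using h_in ys(3) VU V(2) W(4) by auto
      from act_frame[OF this]
      show "act_fibre B (h x) (y1 x) (y2 x) (p x) = (\<lambda>i. c x * frame (act_lift (h x) (\<beta> x))
          (fst (act_cover B (h x) (y1 x), act_cover B (h x) (y2 x)))
          (snd (act_cover B (h x) (y1 x), act_cover B (h x) (y2 x))) i)"
        using c x by simp
    qed
  qed
  moreover have "act_fibre B (h x) (y1 x) (y2 x) (p x) \<in>
      fibre B (act_cover B (h x) (y1 x)) (act_cover B (h x) (y2 x))" if "x \<in> V" for x
    using act_fibre_in[OF h_in ys(3)] p(2) VU that by (auto simp: pair_fibre_def)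
  ultimately have "plot TS k V (\<lambda>x. ?f (\<alpha> x))"
    using FSV by (auto simp: \<alpha>_eq total_space_def pair_fibre_def)
  then show "\<exists>V. u \<in> V \<and> V \<subseteq> U \<and> plot TS k V (\<lambda>x. ?f (\<alpha> x))" using V(1) VU by blast
qed

lemma smooth_action_total:
  "smooth_action G TS
     (\<lambda>h ((y1, y2), p). ((act_cover B h y1, act_cover B h y2), act_fibre B h y1 y2 p))"
    (is "smooth_action _ _ ?act")
  unfolding smooth_action_def
proof (intro conjI ballI)
  show "smooth_map (group_space G \<times>\<^sub>s TS) TS (\<lambda>(h, x). ?act h x)"
    using smooth_act_total by (simp add: split_def)
next
  fix x assume x: "x \<in> points TS"
  obtain y1 y2 p where x_eq: "x = ((y1, y2), p)" by (metis prod.collapse)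
  have sf: "same_fibre B [y1, y2]" and p: "p \<in> fibre B y1 y2"
    using x by (auto simp: x_eq total_space_def pair_fibre_def FS_iff)
  have y: "y1 \<in> points (cover B)" "y2 \<in> points (cover B)" using sf by (simp_all add: same_fibre_simps)
  have one: "act_cover B (group_one G) y = y" if "y \<in> points (cover B)" for y
    using smooth_act_cover that by (simp add: smooth_action_def)
  obtain g where g: "g \<in> lifts (proj B y1)" using lift_exists[OF y(1)] by blast
  obtain c where c: "p = (\<lambda>i. c * frame g y1 y2 i)" using p fibre_frame[OF sf g] by (auto simp: cline_def)
  have "g \<in> points Q" using lifts_Q[OF proj_in[OF y(1)]] g by blast
  then show "?act (group_one G) x = x"
    by (simp add: x_eq c act_frame[OF one_in sf g] one y act_lift_one)
next
  fix h k x assume hk: "h \<in> points (group_space G)" "k \<in> points (group_space G)" and x: "x \<in> points TS"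
  obtain y1 y2 p where x_eq: "x = ((y1, y2), p)" by (metis prod.collapse)
  have sf: "same_fibre B [y1, y2]" and p: "p \<in> fibre B y1 y2"
    using x by (auto simp: x_eq total_space_def pair_fibre_def FS_iff)
  have y: "y1 \<in> points (cover B)" "y2 \<in> points (cover B)" using sf by (simp_all add: same_fibre_simps)
  have comp: "act_cover B (group_mult G h k) y = act_cover B h (act_cover B k y)"
    if "y \<in> points (cover B)" for y
    using smooth_act_cover that hk by (simp add: smooth_action_def)
  obtain g where g: "g \<in> lifts (proj B y1)" using lift_exists[OF y(1)] by blast
  obtain c where c: "p = (\<lambda>i. c * frame g y1 y2 i)" using p fibre_frame[OF sf g] by (auto simp: cline_def)
  have gQ: "g \<in> points Q" using lifts_Q[OF proj_in[OF y(1)]] g by blast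
  have kg: "act_lift k g \<in> lifts (proj B (act_cover B k y1))"
    using act_lift_lifts[OF hk(2) proj_in[OF y(1)] g] proj_act[OF hk(2) y(1)] by simp
  have sfk: "same_fibre B [act_cover B k y1, act_cover B k y2]" using same_fibre_act[OF hk(2) sf] by simp
  show "?act (group_mult G h k) x = ?act h (?act k x)"
    by (simp add: x_eq c act_frame[OF mult_in[OF hk] sf g] act_frame[OF hk(2) sf g]
        act_frame[OF hk(1) sfk kg] comp y act_lift_mult[OF hk gQ])
qed

theorem equivariant_bundle_gerbe: "equivariant_bundle_gerbe G B"
  unfolding equivariant_bundle_gerbe_def
proof (intro conjI ballI allI impI bundle_gerbe smooth_act_base smooth_act_cover smooth_action_total proj_act)
  fix h y1 y2 assume h: "h \<in> points (group_space G)" and sf: "same_fibre B [y1, y2]"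
  have y1: "y1 \<in> points (cover B)" using sf by (simp add: same_fibre_simps)
  obtain g where g: "g \<in> lifts (proj B y1)" using lift_exists[OF y1] by blast
  have hg: "act_lift h g \<in> lifts (proj B (act_cover B h y1))"
    using act_lift_lifts[OF h proj_in[OF y1] g] proj_act[OF h y1] by simp
  have sfh: "same_fibre B [act_cover B h y1, act_cover B h y2]" using same_fibre_act[OF h sf] by simp
  show "linear_isometry_on (fibre B y1 y2) (fibre B (act_cover B h y1) (act_cover B h y2))
      (act_fibre B h y1 y2)"
    unfolding fibre_frame[OF sf g] fibre_frame[OF sfh hg]
    by (rule linear_isometry_on_cline[OF unit_frame[OF sf g] unit_frame[OF sfh hg] act_frame[OF h sf g]])
next
  fix h y1 y2 y3 p q
  assume h: "h \<in> points (group_space G)" and sf: "same_fibre B [y1, y2, y3]"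
    and p: "p \<in> fibre B y1 y2" and q: "q \<in> fibre B y2 y3"
  have sfs: "same_fibre B [y1, y2]" "same_fibre B [y2, y3]" "same_fibre B [y1, y3]"
    and eq: "proj B y2 = proj B y1" and y1: "y1 \<in> points (cover B)"
    using sf by (auto simp: same_fibre_simps)
  obtain g where g: "g \<in> lifts (proj B y1)" using lift_exists[OF y1] by blast
  then have g2: "g \<in> lifts (proj B y2)" using eq by simp
  have hg: "act_lift h g \<in> lifts (proj B (act_cover B h y1))"
    using act_lift_lifts[OF h proj_in[OF y1] g] proj_act[OF h y1] by simp
  have sfh: "same_fibre B [act_cover B h y1, act_cover B h y2, act_cover B h y3]"
    using same_fibre_act[OF h sf] by simp
  obtain a b where "p = (\<lambda>i. a * frame g y1 y2 i)" "q = (\<lambda>i. b * frame g y2 y3 i)"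
    using p q fibre_frame[OF sfs(1) g] fibre_frame[OF sfs(2) g2] by (auto simp: cline_def)
  then show "act_fibre B h y1 y3 (mult B y1 y2 y3 p q) =
      mult B (act_cover B h y1) (act_cover B h y2) (act_cover B h y3)
        (act_fibre B h y1 y2 p) (act_fibre B h y2 y3 q)"
    by (simp add: mult_frame[OF sf g] mult_frame[OF sfh hg] act_frame[OF h sfs(1) g]
        act_frame[OF h sfs(2) g2] act_frame[OF h sfs(3) g])
qed

end


text \<open>
  A map of covers lifts to the map of line bundles that sends frame to frame. It does not depend on
  the choice of lift as soon as the transition functions of the two frames agree.
\<close>

locale framed_gerbe_map =
  A: framed_gerbe G A Q lifts act_lift fA + B: framed_gerbe G B Q lifts act_lift fB
  for G :: "'g lie_group" and A :: "('g, 'm, 'y, 'i) gerbe" and B :: "('g, 'm, 'z, 'j) gerbe"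
    and Q :: "'q smooth_space" and lifts :: "'m \<Rightarrow> 'q set" and act_lift :: "'g \<Rightarrow> 'q \<Rightarrow> 'q"
    and fA :: "'q \<Rightarrow> 'y \<Rightarrow> 'y \<Rightarrow> 'i cvec" and fB :: "'q \<Rightarrow> 'z \<Rightarrow> 'z \<Rightarrow> 'j cvec" +
  fixes \<phi> :: "'y \<Rightarrow> 'z"
  assumes smooth_cover_map: "smooth_map (cover A) (cover B) \<phi>"
    and proj_map: "\<And>y. y \<in> points (cover A) \<Longrightarrow> proj B (\<phi> y) = proj A y"
    and transition: "\<And>y1 y2 g g'. same_fibre A [y1, y2] \<Longrightarrow> g \<in> lifts (proj A y1) \<Longrightarrow>
      g' \<in> lifts (proj A y1) \<Longrightarrow>
      herm (fA g y1 y2) (fA g' y1 y2) = herm (fB g (\<phi> y1) (\<phi> y2)) (fB g' (\<phi> y1) (\<phi> y2))"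
begin

definition fibre_map :: "'y \<Rightarrow> 'y \<Rightarrow> 'i cvec \<Rightarrow> 'j cvec" where
  "fibre_map y1 y2 p = (let g = SOME g. g \<in> lifts (proj A y1) in
     (\<lambda>j. herm p (fA g y1 y2) * fB g (\<phi> y1) (\<phi> y2) j))"

lemma cover_map_in: "y \<in> points (cover A) \<Longrightarrow> \<phi> y \<in> points (cover B)"
  by (rule smooth_map_in_points[OF smooth_cover_map])

lemma same_fibre_map: "same_fibre A [y1, y2] \<Longrightarrow> same_fibre B [\<phi> y1, \<phi> y2]"
  by (simp add: same_fibre_simps cover_map_in proj_map)

lemma fibre_map_frame:
  assumes sf: "same_fibre A [y1, y2]" and g: "g \<in> lifts (proj A y1)"
  shows "fibre_map y1 y2 (\<lambda>i. c * fA g y1 y2 i) = (\<lambda>j. c * fB g (\<phi> y1) (\<phi> y2) j)"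
proof -
  define g' where "g' = (SOME g. g \<in> lifts (proj A y1))"
  have g': "g' \<in> lifts (proj A y1)" unfolding g'_def using g by (rule someI)
  have sfB: "same_fibre B [\<phi> y1, \<phi> y2]" by (rule same_fibre_map[OF sf])
  have "proj B (\<phi> y1) = proj A y1" using sf by (simp add: same_fibre_simps proj_map)
  then have gB: "g \<in> lifts (proj B (\<phi> y1))" "g' \<in> lifts (proj B (\<phi> y1))" using g g' by simp_all
  have "fB g (\<phi> y1) (\<phi> y2) \<in> cline (fB g' (\<phi> y1) (\<phi> y2))"
    using B.fibre_frame[OF sfB gB(1)] B.fibre_frame[OF sfB gB(2)] cline_self_mem by metis
  then have "fB g (\<phi> y1) (\<phi> y2) =
      (\<lambda>j. herm (fB g (\<phi> y1) (\<phi> y2)) (fB g' (\<phi> y1) (\<phi> y2)) * fB g' (\<phi> y1) (\<phi> y2) j)"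
    by (rule unit_vector_coordinate[OF B.unit_frame[OF sfB gB(2)]])
  then have "(\<lambda>j. c * fB g (\<phi> y1) (\<phi> y2) j) =
      (\<lambda>j. c * (herm (fA g y1 y2) (fA g' y1 y2) * fB g' (\<phi> y1) (\<phi> y2) j))"
    unfolding transition[OF sf g g'] by (simp add: fun_eq_iff)
  then show ?thesis
    unfolding fibre_map_def Let_def g'_def[symmetric] herm_scale_left by (simp add: mult.assoc)
qed

lemma fibre_map_in:
  assumes sf: "same_fibre A [y1, y2]" and p: "p \<in> fibre A y1 y2"
  shows "fibre_map y1 y2 p \<in> fibre B (\<phi> y1) (\<phi> y2)"
proof -
  have y1: "y1 \<in> points (cover A)" using sf by (simp add: same_fibre_simps)
  obtain g where g: "g \<in> lifts (proj A y1)" using A.lift_exists[OF y1] by blast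
  have gB: "g \<in> lifts (proj B (\<phi> y1))" using g proj_map[OF y1] by simp
  obtain c where "p = (\<lambda>i. c * fA g y1 y2 i)" using p A.fibre_frame[OF sf g] by (auto simp: cline_def)
  then show ?thesis
    by (simp add: fibre_map_frame[OF sf g] B.fibre_frame[OF same_fibre_map[OF sf] gB])
qed

lemma square_map_smooth: "smooth_map A.FS B.FS (\<lambda>(y1, y2). (\<phi> y1, \<phi> y2))"
proof (rule smooth_mapI)
  show "(case y of (y1, y2) \<Rightarrow> (\<phi> y1, \<phi> y2)) \<in> points B.FS" if "y \<in> points A.FS" for y
    using that same_fibre_map by (cases y) (simp add: A.FS_iff B.FS_iff)
  fix k U \<alpha> assume \<alpha>: "plot A.FS k U \<alpha>"
  have "same_fibre B [\<phi> (fst (\<alpha> x)), \<phi> (snd (\<alpha> x))]" if "x \<in> U" for x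
    by (rule same_fibre_map[OF A.plot_FS(3)[OF \<alpha> that]])
  then show "plot B.FS k U (\<lambda>x. case \<alpha> x of (y1, y2) \<Rightarrow> (\<phi> y1, \<phi> y2))"
    using smooth_map_plot[OF smooth_cover_map A.plot_FS(1)[OF \<alpha>]]
      smooth_map_plot[OF smooth_cover_map A.plot_FS(2)[OF \<alpha>]]
    by (simp add: fibre_square_def split_beta same_fibre_simps image_subset_iff)
qed

lemma total_map_smooth:
  "smooth_map A.TS B.TS
     (\<lambda>(y, p). ((case y of (y1, y2) \<Rightarrow> (\<phi> y1, \<phi> y2)), (case y of (y1, y2) \<Rightarrow> fibre_map y1 y2) p))"
    (is "smooth_map _ _ ?f")
proof (rule smooth_map_locallyI[OF A.diffeology_TS B.diffeology_TS])
  show "?f x \<in> points B.TS" if "x \<in> points A.TS" for x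
  proof -
    obtain y1 y2 p where x: "x = ((y1, y2), p)" by (metis prod.collapse)
    then have "same_fibre A [y1, y2]" "p \<in> fibre A y1 y2"
      using that by (simp_all add: total_space_def pair_fibre_def A.FS_iff)
    then show ?thesis
      using same_fibre_map[of y1 y2] fibre_map_in[of y1 y2 p]
      by (simp add: x total_space_def pair_fibre_def B.FS_iff)
  qed
  fix k U \<alpha> u assume \<alpha>: "plot A.TS k U \<alpha>" and u: "u \<in> U"
  define y where "y x = fst (\<alpha> x)" for x
  define p where "p x = snd (\<alpha> x)" for x
  have \<alpha>_eq: "\<alpha> x = (y x, p x)" for x by (simp add: y_def p_def)
  have y: "plot A.FS k U y" and p: "plot coord_space k U p" "\<forall>x\<in>U. p x \<in> pair_fibre A (y x)"
    using \<alpha> by (auto simp: \<alpha>_eq total_space_def)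
  note ys = A.plot_FS[OF y]
  obtain W \<beta> where W: "u \<in> W" "W \<subseteq> U" "plot Q k W \<beta>" "\<forall>x\<in>W. \<beta> x \<in> lifts (proj A (fst (y x)))"
    using A.local_lift_cover[OF ys(1) u] by (elim exE conjE)
  have openW: "openin (Euclidean_space k) W" using plot_openin[OF A.diffeology_Q W(3)] .
  have pW: "\<forall>x\<in>W. p x \<in> pair_fibre A (y x)" using p(2) W(2) by blast
  obtain V c where V: "u \<in> V" "V \<subseteq> W" "C_infinity_on k V c"
    and c: "\<forall>x\<in>V. p x = (\<lambda>i. c x * fA (\<beta> x) (fst (y x)) (snd (y x)) i)"
    using A.frame_coordinate_smooth[OF plot_subset[OF A.diffeology_FS y W(2) openW] W(3,4)
        plot_subset[OF diffeology_coord_space p(1) W(2) openW] pW W(1)] by (elim exE conjE)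
  have openV: "openin (Euclidean_space k) V" using C_infinity_on_openin[OF V(3)] .
  have VU: "V \<subseteq> U" using V(2) W(2) by blast
  have yV: "plot B.FS k V (\<lambda>x. case y x of (y1, y2) \<Rightarrow> (\<phi> y1, \<phi> y2))"
    by (rule smooth_map_plot[OF square_map_smooth plot_subset[OF A.diffeology_FS y VU openV]])
  have pV: "plot coord_space k V (\<lambda>x. fibre_map (fst (y x)) (snd (y x)) (p x))"
  proof (rule B.scaled_frame_smooth[OF yV plot_subset[OF A.diffeology_Q W(3) V(2) openV] _ V(3)])
    show "\<forall>x\<in>V. \<beta> x \<in> lifts (proj B (fst (case y x of (y1, y2) \<Rightarrow> (\<phi> y1, \<phi> y2))))"
    proof
      fix x assume x: "x \<in> V"
      have "fst (y x) \<in> points (cover A)" using ys(3)[OF subsetD[OF VU x]] by (simp add: same_fibre_simps)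
      then show "\<beta> x \<in> lifts (proj B (fst (case y x of (y1, y2) \<Rightarrow> (\<phi> y1, \<phi> y2))))"
        using W(4)[rule_format, OF subsetD[OF V(2) x]] by (simp add: split_beta proj_map)
    qed
    show "\<forall>x\<in>V. fibre_map (fst (y x)) (snd (y x)) (p x) = (\<lambda>i. c x * fB (\<beta> x)
        (fst (case y x of (y1, y2) \<Rightarrow> (\<phi> y1, \<phi> y2))) (snd (case y x of (y1, y2) \<Rightarrow> (\<phi> y1, \<phi> y2))) i)"
    proof
      fix x assume x: "x \<in> V"
      show "fibre_map (fst (y x)) (snd (y x)) (p x) = (\<lambda>i. c x * fB (\<beta> x)
          (fst (case y x of (y1, y2) \<Rightarrow> (\<phi> y1, \<phi> y2))) (snd (case y x of (y1, y2) \<Rightarrow> (\<phi> y1, \<phi> y2))) i)"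
        using c[rule_format, OF x] fibre_map_frame[OF ys(3)[OF subsetD[OF VU x]]
            W(4)[rule_format, OF subsetD[OF V(2) x]]] by (simp add: split_beta)
    qed
  qed
  have "fibre_map (fst (y x)) (snd (y x)) (p x) \<in> fibre B (\<phi> (fst (y x))) (\<phi> (snd (y x)))" if x: "x \<in> V" for x
    using fibre_map_in[OF ys(3)[OF subsetD[OF VU x]], of "p x"] p(2)[rule_format, OF subsetD[OF VU x]]
    by (simp add: pair_fibre_def split_beta)
  then have "plot B.TS k V (\<lambda>x. ?f (\<alpha> x))"
    using yV pV by (simp add: \<alpha>_eq total_space_def pair_fibre_def split_beta image_subset_iff)
  then show "\<exists>V. u \<in> V \<and> V \<subseteq> U \<and> plot B.TS k V (\<lambda>x. ?f (\<alpha> x))"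
    using V(1) VU by (intro exI[of _ V] conjI)
qed

end

text \<open>The maps in both directions send frame to frame, so they are mutually inverse and respect every
  structure that is given by the frames.\<close>

theorem framed_gerbe_iso:
  assumes AB: "framed_gerbe_map G A B Q lifts act_lift fA fB \<phi>"
    and BA: "framed_gerbe_map G B A Q lifts act_lift fB fA \<psi>"
    and \<psi>\<phi>: "\<And>y. y \<in> points (cover A) \<Longrightarrow> \<psi> (\<phi> y) = y"
    and \<phi>\<psi>: "\<And>y. y \<in> points (cover B) \<Longrightarrow> \<phi> (\<psi> y) = y"
    and base: "base A = base B"
    and act_base: "\<And>h x. h \<in> points (group_space G) \<Longrightarrow> x \<in> points (base A) \<Longrightarrow>
      act_base A h x = act_base B h x"
    and act_cover: "\<And>h y. h \<in> points (group_space G) \<Longrightarrow> y \<in> points (cover A) \<Longrightarrow>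
      \<phi> (act_cover A h y) = act_cover B h (\<phi> y)"
  shows "equivariant_gerbe_iso G A B"
proof -
  interpret AB: framed_gerbe_map G A B Q lifts act_lift fA fB \<phi> by (rule AB)
  interpret BA: framed_gerbe_map G B A Q lifts act_lift fB fA \<psi> by (rule BA)
  have inverse1: "BA.fibre_map (\<phi> y1) (\<phi> y2) (AB.fibre_map y1 y2 p) = p"
    if sf: "same_fibre A [y1, y2]" and p: "p \<in> fibre A y1 y2" for y1 y2 p
  proof -
    have y: "y1 \<in> points (cover A)" "y2 \<in> points (cover A)" using sf by (simp_all add: same_fibre_simps)
    obtain g where g: "g \<in> lifts (proj A y1)" using AB.A.lift_exists[OF y(1)] by blast
    have gB: "g \<in> lifts (proj B (\<phi> y1))" using g AB.proj_map[OF y(1)] by simp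
    obtain c where "p = (\<lambda>i. c * fA g y1 y2 i)"
      using p AB.A.fibre_frame[OF sf g] by (auto simp: cline_def)
    then show ?thesis
      by (simp add: AB.fibre_map_frame[OF sf g] BA.fibre_map_frame[OF AB.same_fibre_map[OF sf] gB] \<psi>\<phi> y)
  qed
  have inverse2: "AB.fibre_map (\<psi> y1) (\<psi> y2) (BA.fibre_map y1 y2 p) = p"
    if sf: "same_fibre B [y1, y2]" and p: "p \<in> fibre B y1 y2" for y1 y2 p
  proof -
    have y: "y1 \<in> points (cover B)" "y2 \<in> points (cover B)" using sf by (simp_all add: same_fibre_simps)
    obtain g where g: "g \<in> lifts (proj B y1)" using AB.B.lift_exists[OF y(1)] by blast
    have gA: "g \<in> lifts (proj A (\<psi> y1))" using g BA.proj_map[OF y(1)] by simp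
    obtain c where "p = (\<lambda>i. c * fB g y1 y2 i)"
      using p AB.B.fibre_frame[OF sf g] by (auto simp: cline_def)
    then show ?thesis
      by (simp add: BA.fibre_map_frame[OF sf g] AB.fibre_map_frame[OF BA.same_fibre_map[OF sf] gA] \<phi>\<psi> y)
  qed
  have diffeo: "diffeomorphism (cover A) (cover B) \<phi>"
    by (rule diffeomorphismI[OF AB.A.diffeology_cover AB.B.diffeology_cover AB.smooth_cover_map
          BA.smooth_cover_map \<psi>\<phi> \<phi>\<psi>])
  have square: "diffeomorphism AB.A.FS AB.B.FS (\<lambda>(y1, y2). (\<phi> y1, \<phi> y2))"
    by (rule diffeomorphismI[OF AB.A.diffeology_FS AB.B.diffeology_FS AB.square_map_smooth
          BA.square_map_smooth])
       (auto simp: \<psi>\<phi> \<phi>\<psi> AB.A.FS_iff AB.B.FS_iff same_fibre_simps)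
  have total: "diffeomorphism AB.A.TS AB.B.TS
      (\<lambda>(y, p). ((case y of (y1, y2) \<Rightarrow> (\<phi> y1, \<phi> y2)), (case y of (y1, y2) \<Rightarrow> AB.fibre_map y1 y2) p))"
  proof (rule diffeomorphismI[OF AB.A.diffeology_TS AB.B.diffeology_TS AB.total_map_smooth
        BA.total_map_smooth], goal_cases)
    case (1 x)
    obtain y1 y2 p where x: "x = ((y1, y2), p)" by (metis prod.collapse)
    then have "same_fibre A [y1, y2]" "p \<in> fibre A y1 y2"
      using 1 by (simp_all add: total_space_def pair_fibre_def AB.A.FS_iff)
    then show ?case using inverse1[of y1 y2 p] by (simp add: x \<psi>\<phi> same_fibre_simps)
  next
    case (2 x)
    obtain y1 y2 p where x: "x = ((y1, y2), p)" by (metis prod.collapse)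
    then have "same_fibre B [y1, y2]" "p \<in> fibre B y1 y2"
      using 2 by (simp_all add: total_space_def pair_fibre_def AB.B.FS_iff)
    then show ?case using inverse2[of y1 y2 p] by (simp add: x \<phi>\<psi> same_fibre_simps)
  qed
  show ?thesis
    unfolding equivariant_gerbe_iso_def
  proof (intro conjI exI[of _ \<phi>] exI[of _ AB.fibre_map] AB.A.equivariant_bundle_gerbe
      AB.B.equivariant_bundle_gerbe base diffeo ballI allI impI)
    show "line_bundle_iso AB.A.FS (pair_fibre A) AB.B.FS (pair_fibre B)
        (\<lambda>(y1, y2). (\<phi> y1, \<phi> y2)) (\<lambda>(y1, y2). AB.fibre_map y1 y2)"
      unfolding line_bundle_iso_def
    proof (intro conjI square total ballI)
      fix y assume "y \<in> points AB.A.FS"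
      then obtain y1 y2 where y: "y = (y1, y2)" and sf: "same_fibre A [y1, y2]"
        by (cases y) (simp add: AB.A.FS_iff)
      have y1: "y1 \<in> points (cover A)" using sf by (simp add: same_fibre_simps)
      obtain g where g: "g \<in> lifts (proj A y1)" using AB.A.lift_exists[OF y1] by blast
      have gB: "g \<in> lifts (proj B (\<phi> y1))" using g AB.proj_map[OF y1] by simp
      note sfB = AB.same_fibre_map[OF sf]
      have "linear_isometry_on (cline (fA g y1 y2)) (cline (fB g (\<phi> y1) (\<phi> y2))) (AB.fibre_map y1 y2)"
        by (rule linear_isometry_on_cline[OF AB.A.unit_frame[OF sf g] AB.B.unit_frame[OF sfB gB]
              AB.fibre_map_frame[OF sf g]])
      then show "linear_isometry_on (pair_fibre A y) (pair_fibre B (case y of (y1, y2) \<Rightarrow> (\<phi> y1, \<phi> y2)))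
          (case y of (y1, y2) \<Rightarrow> AB.fibre_map y1 y2)"
        by (simp add: y pair_fibre_def AB.A.fibre_frame[OF sf g] AB.B.fibre_frame[OF sfB gB])
    qed
  next
    fix y1 y2 y3 p q
    assume sf: "same_fibre A [y1, y2, y3]" and p: "p \<in> fibre A y1 y2" and q: "q \<in> fibre A y2 y3"
    have sfs: "same_fibre A [y1, y2]" "same_fibre A [y2, y3]" "same_fibre A [y1, y3]"
      and eq: "proj A y2 = proj A y1" and y1: "y1 \<in> points (cover A)"
      using sf by (auto simp: same_fibre_simps)
    have sfB: "same_fibre B [\<phi> y1, \<phi> y2, \<phi> y3]"
      using sf by (simp add: same_fibre_simps AB.cover_map_in AB.proj_map)
    obtain g where g: "g \<in> lifts (proj A y1)" using AB.A.lift_exists[OF y1] by blast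
    have g2: "g \<in> lifts (proj A y2)" using g eq by simp
    have gB: "g \<in> lifts (proj B (\<phi> y1))" using g AB.proj_map[OF y1] by simp
    obtain a b where "p = (\<lambda>i. a * fA g y1 y2 i)" "q = (\<lambda>i. b * fA g y2 y3 i)"
      using p q AB.A.fibre_frame[OF sfs(1) g] AB.A.fibre_frame[OF sfs(2) g2] by (auto simp: cline_def)
    then show "AB.fibre_map y1 y3 (mult A y1 y2 y3 p q) =
        mult B (\<phi> y1) (\<phi> y2) (\<phi> y3) (AB.fibre_map y1 y2 p) (AB.fibre_map y2 y3 q)"
      by (simp only: AB.A.mult_frame[OF sf g] AB.B.mult_frame[OF sfB gB] AB.fibre_map_frame[OF sfs(1) g]
          AB.fibre_map_frame[OF sfs(2) g2] AB.fibre_map_frame[OF sfs(3) g])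
  next
    fix h y1 y2 p
    assume h: "h \<in> points (group_space G)" and sf: "same_fibre A [y1, y2]" and p: "p \<in> fibre A y1 y2"
    have y: "y1 \<in> points (cover A)" "y2 \<in> points (cover A)" using sf by (simp_all add: same_fibre_simps)
    obtain g where g: "g \<in> lifts (proj A y1)" using AB.A.lift_exists[OF y(1)] by blast
    have gB: "g \<in> lifts (proj B (\<phi> y1))" using g AB.proj_map[OF y(1)] by simp
    have hg: "act_lift h g \<in> lifts (proj A (act_cover A h y1))"
      using AB.A.act_lift_lifts[OF h AB.A.proj_in[OF y(1)] g] AB.A.proj_act[OF h y(1)] by simp
    have sfh: "same_fibre A [act_cover A h y1, act_cover A h y2]"
      using AB.A.same_fibre_act[OF h sf] by simp
    obtain c where "p = (\<lambda>i. c * fA g y1 y2 i)" using p AB.A.fibre_frame[OF sf g] by (auto simp: cline_def)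
    then show "AB.fibre_map (act_cover A h y1) (act_cover A h y2) (act_fibre A h y1 y2 p) =
        act_fibre B h (\<phi> y1) (\<phi> y2) (AB.fibre_map y1 y2 p)"
      by (simp only: AB.A.act_frame[OF h sf g] AB.fibre_map_frame[OF sfh hg] AB.fibre_map_frame[OF sf g]
          AB.B.act_frame[OF h AB.same_fibre_map[OF sf] gB] act_cover[OF h y(1)] act_cover[OF h y(2)])
  qed (use act_base act_cover AB.proj_map in simp_all)
qed

section \<open>The exterior algebra of an orthonormal frame\<close>

lemma shuffle_sign_empty [simp]: "shuffle_sign {} B = 1" "shuffle_sign A {} = 1"
  by (simp_all add: shuffle_sign_def)

lemma shuffle_sign_singleton: "shuffle_sign {i} B = (- 1) ^ card {b \<in> B. b < i}"
proof -
  have "{(a, b). a \<in> {i} \<and> b \<in> B \<and> b < a} = Pair i ` {b \<in> B. b < i}" by auto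
  then show ?thesis by (simp add: shuffle_sign_def card_image inj_on_def)
qed

lemma shuffle_sign_Un_left:
  assumes "A \<inter> A' = {}"
  shows "shuffle_sign (A \<union> A') B = shuffle_sign A B * shuffle_sign A' B"
proof -
  have "{(a, b). a \<in> A \<union> A' \<and> b \<in> B \<and> b < a} =
      {(a, b). a \<in> A \<and> b \<in> B \<and> b < a} \<union> {(a, b). a \<in> A' \<and> b \<in> B \<and> b < a}" by auto
  moreover have "card ({(a, b). a \<in> A \<and> b \<in> B \<and> b < a} \<union> {(a, b). a \<in> A' \<and> b \<in> B \<and> b < a}) =
      card {(a, b). a \<in> A \<and> b \<in> B \<and> b < a} + card {(a, b). a \<in> A' \<and> b \<in> B \<and> b < a}"
    by (rule card_Un_disjoint) (use assms in auto)
  ultimately show ?thesis by (simp add: shuffle_sign_def power_add)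
qed

lemma shuffle_sign_Un_right:
  assumes "B \<inter> B' = {}"
  shows "shuffle_sign A (B \<union> B') = shuffle_sign A B * shuffle_sign A B'"
proof -
  have "{(a, b). a \<in> A \<and> b \<in> B \<union> B' \<and> b < a} =
      {(a, b). a \<in> A \<and> b \<in> B \<and> b < a} \<union> {(a, b). a \<in> A \<and> b \<in> B' \<and> b < a}" by auto
  moreover have "card ({(a, b). a \<in> A \<and> b \<in> B \<and> b < a} \<union> {(a, b). a \<in> A \<and> b \<in> B' \<and> b < a}) =
      card {(a, b). a \<in> A \<and> b \<in> B \<and> b < a} + card {(a, b). a \<in> A \<and> b \<in> B' \<and> b < a}"
    by (rule card_Un_disjoint) (use assms in auto)
  ultimately show ?thesis by (simp add: shuffle_sign_def power_add)
qed

lemma shuffle_sign_square [simp]: "shuffle_sign A B * shuffle_sign A B = 1"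
  by (simp add: shuffle_sign_def flip: power_mult_distrib)

lemma shuffle_sign_square' [simp]: "shuffle_sign A B * (shuffle_sign A B * x) = x"
  by (simp flip: mult.assoc)

lemma cnj_shuffle_sign [simp]: "cnj (shuffle_sign A B) = shuffle_sign A B"
  by (simp add: shuffle_sign_def)

lemma ext_vector_singleton [simp]: "ext_vector v {i} = v $ i"
proof -
  have "{j. {i} = {j}} = {i}" by auto
  then show ?thesis by (simp add: ext_vector_def)
qed

lemma ext_vector_eq_0: "(\<And>i. S \<noteq> {i}) \<Longrightarrow> ext_vector v S = 0"
  by (simp add: ext_vector_def)

lemma wedge_ext_vector:
  "wedge (ext_vector v) w S = (\<Sum>i\<in>S. v $ i * (shuffle_sign {i} (S - {i}) * w (S - {i})))"
proof -
  have "wedge (ext_vector v) w S =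
      (\<Sum>A\<in>(\<lambda>i. {i}) ` S. shuffle_sign A (S - A) * ext_vector v A * w (S - A))"
    unfolding wedge_def
  proof (rule sum.mono_neutral_right)
    show "\<forall>A\<in>Pow S - (\<lambda>i. {i}) ` S. shuffle_sign A (S - A) * ext_vector v A * w (S - A) = 0"
    proof
      fix A assume "A \<in> Pow S - (\<lambda>i. {i}) ` S"
      then have "A \<noteq> {i}" for i by auto
      then show "shuffle_sign A (S - A) * ext_vector v A * w (S - A) = 0" by (simp add: ext_vector_eq_0)
    qed
  qed auto
  also have "\<dots> = (\<Sum>i\<in>S. v $ i * (shuffle_sign {i} (S - {i}) * w (S - {i})))"
    by (subst sum.reindex) (simp_all add: inj_on_def mult_ac)
  finally show ?thesis .
qed

text \<open>Both sides sum over partitions of \<open>S\<close> into three parts; the signs agree because each is the sign of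
  sorting the concatenation of the three parts.\<close>

lemma wedge_assoc: "wedge (wedge a b) c = wedge a (wedge b c)"
proof
  fix S
  have "wedge (wedge a b) c S = (\<Sum>(A, A1)\<in>(SIGMA A:Pow S. Pow A).
      shuffle_sign A (S - A) * shuffle_sign A1 (A - A1) * a A1 * b (A - A1) * c (S - A))"
    unfolding wedge_def by (subst sum.Sigma[symmetric]) (simp_all add: sum_distrib_left sum_distrib_right mult_ac)
  also have "\<dots> = (\<Sum>(A1, A2)\<in>(SIGMA A1:Pow S. Pow (S - A1)).
      shuffle_sign A1 (S - A1) * shuffle_sign A2 (S - A1 - A2) * a A1 * b A2 * c (S - A1 - A2))"
  proof (rule sum.reindex_bij_witness[where i = "\<lambda>(A1, A2). (A1 \<union> A2, A1)" and j = "\<lambda>(A, A1). (A1, A - A1)"],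
      goal_cases)
    case (5 p)
    then obtain A A1 where p: "p = (A, A1)" "A \<subseteq> S" "A1 \<subseteq> A" by auto
    define A2 and R where "A2 = A - A1" and "R = S - A"
    have A: "A = A1 \<union> A2" "A1 \<inter> A2 = {}" "S - A1 = A2 \<union> R" "A2 \<inter> R = {}" "S - A1 - A2 = R"
      "A2 \<union> R - A2 = R"
      using p(2,3) by (auto simp: A2_def R_def)
    have "shuffle_sign A R * shuffle_sign A1 A2 = shuffle_sign A1 (A2 \<union> R) * shuffle_sign A2 R"
      unfolding A(1) shuffle_sign_Un_left[OF A(2)] shuffle_sign_Un_right[OF A(4)] by simp
    then show ?case by (simp add: p(1) A(3,5,6) flip: A2_def R_def)
  qed auto
  also have "\<dots> = wedge a (wedge b c) S"
    unfolding wedge_def by (subst sum.Sigma[symmetric]) (simp_all add: sum_distrib_left mult_ac)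
  finally show "wedge (wedge a b) c S = wedge a (wedge b c) S" .
qed

lemma wedge_unit_left [simp]: "wedge (ext_scalar 1) w = w"
proof
  fix S
  have "wedge (ext_scalar 1) w S = (\<Sum>A\<in>{{}}. shuffle_sign A (S - A) * ext_scalar 1 A * w (S - A))"
    unfolding wedge_def by (rule sum.mono_neutral_right) (auto simp: ext_scalar_def)
  then show "wedge (ext_scalar 1) w S = w S" by (simp add: ext_scalar_def)
qed

lemma wedge_scale_left: "wedge (\<lambda>S. c * a S) b = (\<lambda>S. c * wedge a b S)"
  by (simp add: wedge_def sum_distrib_left mult_ac)

lemma wedge_scale_right: "wedge a (\<lambda>S. c * b S) = (\<lambda>S. c * wedge a b S)"
  by (simp add: wedge_def sum_distrib_left mult_ac)

lemma wedge_zero_right [simp]: "wedge a (\<lambda>S. 0) = (\<lambda>S. 0)"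
  by (simp add: wedge_def)

lemma wedge_sum_left: "wedge (\<lambda>S. \<Sum>i\<in>I. c i * f i S) b = (\<lambda>S. \<Sum>i\<in>I. c i * wedge (f i) b S)"
proof
  fix S
  have "wedge (\<lambda>S. \<Sum>i\<in>I. c i * f i S) b S =
      (\<Sum>A\<in>Pow S. \<Sum>i\<in>I. c i * (shuffle_sign A (S - A) * f i A * b (S - A)))"
    by (simp add: wedge_def sum_distrib_left sum_distrib_right mult_ac)
  also have "\<dots> = (\<Sum>i\<in>I. c i * wedge (f i) b S)"
    by (subst sum.swap) (simp add: wedge_def sum_distrib_left)
  finally show "wedge (\<lambda>S. \<Sum>i\<in>I. c i * f i S) b S = (\<Sum>i\<in>I. c i * wedge (f i) b S)" .
qed

lemma wedge_sum_right: "wedge a (\<lambda>S. \<Sum>i\<in>I. c i * f i S) = (\<lambda>S. \<Sum>i\<in>I. c i * wedge a (f i) S)"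
proof
  fix S
  have "wedge a (\<lambda>S. \<Sum>i\<in>I. c i * f i S) S =
      (\<Sum>A\<in>Pow S. \<Sum>i\<in>I. c i * (shuffle_sign A (S - A) * a A * f i (S - A)))"
    by (simp add: wedge_def sum_distrib_left sum_distrib_right mult_ac)
  also have "\<dots> = (\<Sum>i\<in>I. c i * wedge a (f i) S)"
    by (subst sum.swap) (simp add: wedge_def sum_distrib_left)
  finally show "wedge a (\<lambda>S. \<Sum>i\<in>I. c i * f i S) S = (\<Sum>i\<in>I. c i * wedge a (f i) S)" .
qed

lemma wedge_cnj: "wedge (\<lambda>S. cnj (a S)) (\<lambda>S. cnj (b S)) = (\<lambda>S. cnj (wedge a b S))"
  by (simp add: wedge_def cnj_sum)

lemma wedge_vectors_anticommute:
  fixes u v :: "complex ^ 'n::{finite,linorder}"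
  shows "wedge (ext_vector u) (ext_vector v) = (\<lambda>S. - wedge (ext_vector v) (ext_vector u) S)"
proof
  fix S :: "'n set"
  show "wedge (ext_vector u) (ext_vector v) S = - wedge (ext_vector v) (ext_vector u) S"
  proof (cases "\<exists>i j. i < j \<and> S = {i, j}")
    case True
    then obtain i j where ij: "i < j" and S: "S = {i, j}" by blast
    have d: "{i, j} - {i} = {j}" "{i, j} - {j} = {i}" using ij by auto
    have sets: "{b \<in> {j}. b < i} = {}" "{b \<in> {i}. b < j} = {i}" using ij by auto
    have s: "shuffle_sign {i} {j} = 1" "shuffle_sign {j} {i} = - 1"
      unfolding shuffle_sign_singleton sets by simp_all
    have two: "(\<Sum>k\<in>{i, j}. f k) = f i + f j" for f :: "'n \<Rightarrow> complex" using ij by simp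
    have "wedge (ext_vector x) (ext_vector y) S = x $ i * y $ j - x $ j * y $ i"
      for x y :: "complex ^ ('n::{finite,linorder})"
      unfolding wedge_ext_vector S two d s by simp
    then show ?thesis by simp
  next
    case False
    have no_pair: "S - {i} \<noteq> {j}" if "i \<in> S" for i j
    proof
      assume eq: "S - {i} = {j}"
      then have "S = {i, j}" "i \<noteq> j" using that by auto
      then show False using False by (metis insert_commute linorder_neqE)
    qed
    have "wedge (ext_vector x) (ext_vector y) S = 0" for x y :: "complex ^ ('n::{finite,linorder})"
      unfolding wedge_ext_vector by (rule sum.neutral) (simp add: ext_vector_eq_0 no_pair)
    then show ?thesis by simp
  qed
qed

lemma wedge_vector_swap:
  "wedge (ext_vector u) (wedge (ext_vector v) w) = (\<lambda>S. - wedge (ext_vector v) (wedge (ext_vector u) w) S)"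
proof -
  have "wedge (ext_vector u) (wedge (ext_vector v) w) = wedge (wedge (ext_vector u) (ext_vector v)) w"
    by (simp add: wedge_assoc)
  also have "\<dots> = wedge (\<lambda>S. (- 1) * wedge (ext_vector v) (ext_vector u) S) w"
    by (subst wedge_vectors_anticommute) simp
  finally show ?thesis unfolding wedge_scale_left wedge_assoc by simp
qed

lemma wedge_vector_twice: "wedge (ext_vector v) (wedge (ext_vector v) w) = (\<lambda>S. 0)"
proof
  fix S
  have "wedge (ext_vector v) (wedge (ext_vector v) w) S = - wedge (ext_vector v) (wedge (ext_vector v) w) S"
    by (rule fun_cong[OF wedge_vector_swap])
  then show "wedge (ext_vector v) (wedge (ext_vector v) w) S = 0" by simp
qed

definition wedge_family ::
  "('n \<Rightarrow> complex ^ ('n::{finite,linorder})) \<Rightarrow> 'n set \<Rightarrow> 'n set cvec" where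
  "wedge_family v A = wedge_list (map v (sorted_list_of_set A))"

lemma wedge_family_empty [simp]: "wedge_family v {} = ext_scalar 1"
  by (simp add: wedge_family_def wedge_list_def)

lemma wedge_family_insert_min:
  assumes "\<forall>a\<in>A. i < a"
  shows "wedge_family v (insert i A) = wedge (ext_vector (v i)) (wedge_family v A)"
proof -
  have "i \<notin> A" using assms by blast
  then have "sorted_list_of_set (insert i A) = insort i (sorted_list_of_set A)"
    by simp
  also have "\<dots> = i # sorted_list_of_set A"
    using assms by (intro insort_is_Cons) (simp add: order_less_imp_le)
  finally show ?thesis by (simp add: wedge_family_def wedge_list_def)
qed

text \<open>A vector is moved into its place by transpositions of neighbours.\<close>

lemma wedge_vector_family:
  fixes v :: "'n \<Rightarrow> complex ^ ('n::{finite,linorder})"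
  shows "wedge (ext_vector (v i)) (wedge_family v A) =
    (\<lambda>S. if i \<in> A then 0 else shuffle_sign {i} A * wedge_family v (insert i A) S)"
  using finite[of A]
proof (induction A rule: finite_linorder_min_induct)
  case empty
  show ?case using wedge_family_insert_min[of "{}" i v] by simp
next
  case (insert b A)
  consider "i < b" | "i = b" | "b < i" by (rule linorder_cases)
  then show ?case
  proof cases
    case 1
    then have lt: "\<forall>a\<in>insert b A. i < a" using insert.hyps(2) by auto
    then have "{a \<in> insert b A. a < i} = {}" by auto
    then have "shuffle_sign {i} (insert b A) = 1" unfolding shuffle_sign_singleton by (metis card.empty power_0)
    moreover have "i \<notin> insert b A" using lt by blast
    ultimately show ?thesis using wedge_family_insert_min[OF lt, of v] by simp
  next
    case 2
    then show ?thesis using wedge_family_insert_min[OF insert.hyps(2), of v] by (simp add: wedge_vector_twice)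
  next
    case 3
    have bA: "b \<notin> A" using insert.hyps(2) by blast
    have "{a \<in> insert b A. a < i} = insert b {a \<in> A. a < i}" using 3 by auto
    then have sign: "shuffle_sign {i} (insert b A) = - shuffle_sign {i} A"
      using bA by (simp add: shuffle_sign_singleton)
    have "wedge (ext_vector (v i)) (wedge_family v (insert b A)) =
        (\<lambda>S. - wedge (ext_vector (v b)) (wedge (ext_vector (v i)) (wedge_family v A)) S)"
      unfolding wedge_family_insert_min[OF insert.hyps(2)] by (rule wedge_vector_swap)
    also have "\<dots> = (\<lambda>S. if i \<in> insert b A then 0 else
        shuffle_sign {i} (insert b A) * wedge_family v (insert i (insert b A)) S)"
    proof (cases "i \<in> A")
      case True
      then show ?thesis unfolding insert.IH by simp
    next
      case False
      have "\<forall>a\<in>insert i A. b < a" using 3 insert.hyps(2) by auto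
      from wedge_family_insert_min[OF this, of v]
      show ?thesis unfolding insert.IH using False 3 sign
        by (auto simp: wedge_scale_right insert_commute)
    qed
    finally show ?thesis .
  qed
qed

lemma wedge_family_wedge:
  fixes v :: "'n \<Rightarrow> complex ^ ('n::{finite,linorder})"
  shows "wedge (wedge_family v A) (wedge_family v B) =
    (\<lambda>S. if A \<inter> B = {} then shuffle_sign A B * wedge_family v (A \<union> B) S else 0)"
  using finite[of A]
proof (induction A rule: finite_linorder_min_induct)
  case empty
  show ?case by simp
next
  case (insert b A)
  have bA: "b \<notin> A" using insert.hyps(2) by blast
  have "{a \<in> A. a < b} = {}" using insert.hyps(2) by auto
  then have s1: "shuffle_sign {b} A = 1" unfolding shuffle_sign_singleton by (metis card.empty power_0)
  have s2: "shuffle_sign (insert b A) B = shuffle_sign {b} B * shuffle_sign A B"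
    using shuffle_sign_Un_left[of "{b}" A B] bA by simp
  have s3: "shuffle_sign {b} (A \<union> B) = shuffle_sign {b} B" if "A \<inter> B = {}"
    using shuffle_sign_Un_right[OF that, of "{b}"] s1 by simp
  show ?case
    unfolding wedge_family_insert_min[OF insert.hyps(2)] wedge_assoc insert.IH
  proof (cases "A \<inter> B = {}")
    case True
    then show "wedge (ext_vector (v b))
        (\<lambda>S. if A \<inter> B = {} then shuffle_sign A B * wedge_family v (A \<union> B) S else 0) =
      (\<lambda>S. if insert b A \<inter> B = {} then shuffle_sign (insert b A) B * wedge_family v (insert b A \<union> B) S else 0)"
      using bA s3 by (auto simp: wedge_scale_right wedge_vector_family s2)
  next
    case False
    then show "wedge (ext_vector (v b))
        (\<lambda>S. if A \<inter> B = {} then shuffle_sign A B * wedge_family v (A \<union> B) S else 0) =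
      (\<lambda>S. if insert b A \<inter> B = {} then shuffle_sign (insert b A) B * wedge_family v (insert b A \<union> B) S else 0)"
      by auto
  qed
qed

lemma wedge_family_axis: "wedge_family (\<lambda>i. axis i 1) A = (\<lambda>S. if S = A then 1 else 0)"
  for A :: "'n::{finite,linorder} set"
  using finite[of A]
proof (induction A rule: finite_linorder_min_induct)
  case empty
  show ?case by (auto simp: ext_scalar_def)
next
  case (insert b A)
  have bA: "b \<notin> A" using insert.hyps(2) by blast
  have "{a \<in> A. a < b} = {}" using insert.hyps(2) by auto
  then have s: "shuffle_sign {b} A = 1" unfolding shuffle_sign_singleton by (metis card.empty power_0)
  show ?case
  proof
    fix S
    have "wedge_family (\<lambda>i. axis i 1) (insert b A) S =
        (\<Sum>i\<in>S. if i = b then shuffle_sign {b} (S - {b}) * (if S - {b} = A then 1 else 0) else 0)"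
      unfolding wedge_family_insert_min[OF insert.hyps(2)] wedge_ext_vector insert.IH
      by (rule sum.cong) (auto simp: axis_def)
    also have "\<dots> = (if b \<in> S \<and> S - {b} = A then 1 else 0)" using s by auto
    also have "b \<in> S \<and> S - {b} = A \<longleftrightarrow> S = insert b A" using bA by auto
    finally show "wedge_family (\<lambda>i. axis i 1) (insert b A) S = (if S = insert b A then 1 else 0)" .
  qed
qed

lemma ext_map_eq: "ext_map h w = (\<lambda>S. \<Sum>A\<in>UNIV. w A * wedge_family (\<lambda>i. h *v axis i 1) A S)"
  by (simp add: ext_map_def wedge_family_def comp_def)

lemma ext_map_scale: "ext_map h (\<lambda>S. c * w S) = (\<lambda>S. c * ext_map h w S)"
  by (simp add: ext_map_def sum_distrib_left mult_ac)

lemma ext_map_sum: "ext_map h (\<lambda>S. \<Sum>i\<in>I. c i * f i S) = (\<lambda>S. \<Sum>i\<in>I. c i * ext_map h (f i) S)"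
proof
  fix S
  have "ext_map h (\<lambda>S. \<Sum>i\<in>I. c i * f i S) S =
      (\<Sum>A\<in>UNIV. \<Sum>i\<in>I. c i * (f i A * wedge_family (\<lambda>i. h *v axis i 1) A S))"
    unfolding ext_map_eq by (simp add: sum_distrib_right mult_ac)
  also have "\<dots> = (\<Sum>i\<in>I. c i * ext_map h (f i) S)"
    unfolding ext_map_eq by (subst sum.swap) (simp add: sum_distrib_left)
  finally show "ext_map h (\<lambda>S. \<Sum>i\<in>I. c i * f i S) S = (\<Sum>i\<in>I. c i * ext_map h (f i) S)" .
qed

lemma ext_map_basis: "ext_map h (wedge_family (\<lambda>i. axis i 1) A) = wedge_family (\<lambda>i. h *v axis i 1) A"
  unfolding wedge_family_axis ext_map_eq by (simp add: if_distrib[of "\<lambda>x. x * _"] cong: if_cong)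

lemma cvec_expand: "w = (\<lambda>S. \<Sum>B\<in>UNIV. w B * wedge_family (\<lambda>i. axis i 1) B S)"
  for w :: "'n::{finite,linorder} set cvec"
  unfolding wedge_family_axis by (simp add: if_distrib[of "\<lambda>x. _ * x"] cong: if_cong)

lemma ext_vector_expand: "ext_vector (\<Sum>i\<in>I. c i *s x i) = (\<lambda>S. \<Sum>i\<in>I. c i * ext_vector (x i) S)"
proof
  fix S
  show "ext_vector (\<Sum>i\<in>I. c i *s x i) S = (\<Sum>i\<in>I. c i * ext_vector (x i) S)"
  proof (cases "\<exists>j. S = {j}")
    case True
    then show ?thesis by auto
  next
    case False
    then show ?thesis by (simp add: ext_vector_eq_0)
  qed
qed

text \<open>By bilinearity it suffices to compare the two sides on basis elements, where both are insertions into
  an increasing product.\<close>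

lemma ext_map_wedge_vector:
  fixes h :: "('n::{finite,linorder}) cmat"
  shows "ext_map h (wedge (ext_vector v) w) = wedge (ext_vector (h *v v)) (ext_map h w)"
proof -
  let ?e = "\<lambda>i. axis i 1 :: complex ^ ('n::{finite,linorder})"
  have basis: "ext_map h (wedge (ext_vector (?e i)) (wedge_family ?e B)) =
      wedge (ext_vector (h *v ?e i)) (ext_map h (wedge_family ?e B))" for i B
  proof (cases "i \<in> B")
    case True
    then show ?thesis
      using ext_map_scale[of h 0] by (simp add: ext_map_basis wedge_vector_family[of ?e] wedge_vector_family[of "\<lambda>i. h *v ?e i"])
  next
    case False
    then show ?thesis
      by (simp add: ext_map_basis wedge_vector_family[of ?e] wedge_vector_family[of "\<lambda>i. h *v ?e i"] ext_map_scale)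
  qed
  have v: "v = (\<Sum>i\<in>UNIV. v $ i *s ?e i)" by (simp add: basis_expansion)
  have hv: "h *v v = (\<Sum>i\<in>UNIV. v $ i *s (h *v ?e i))"
  proof -
    have "(h *v ?e i) $ a = h $ a $ i" for i a
      by (simp add: matrix_vector_mult_def axis_def if_distrib[of "\<lambda>x. _ * x"] cong: if_cong)
    then show ?thesis by (simp add: vec_eq_iff) (simp add: matrix_vector_mult_def mult.commute)
  qed
  have ev: "ext_vector v = (\<lambda>S. \<Sum>i\<in>UNIV. v $ i * ext_vector (?e i) S)"
    by (subst v) (rule ext_vector_expand)
  have ehv: "ext_vector (h *v v) = (\<lambda>S. \<Sum>i\<in>UNIV. v $ i * ext_vector (h *v ?e i) S)"
    unfolding hv by (rule ext_vector_expand)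
  have w: "wedge a w = (\<lambda>S. \<Sum>B\<in>UNIV. w B * wedge a (wedge_family ?e B) S)" for a
    by (subst cvec_expand[of w]) (rule wedge_sum_right)
  have hw: "ext_map h w = (\<lambda>S. \<Sum>B\<in>UNIV. w B * ext_map h (wedge_family ?e B) S)"
    by (subst cvec_expand[of w]) (rule ext_map_sum)
  have "ext_map h (wedge (ext_vector v) w) = (\<lambda>S. \<Sum>i\<in>UNIV. v $ i * (\<Sum>B\<in>UNIV. w B *
      wedge (ext_vector (h *v ?e i)) (ext_map h (wedge_family ?e B)) S))"
    by (simp only: ev wedge_sum_left w ext_map_sum basis)
  also have "\<dots> = wedge (ext_vector (h *v v)) (ext_map h w)"
    by (simp only: ehv hw wedge_sum_left wedge_sum_right)
  finally show ?thesis .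
qed

lemma ext_map_ext_scalar: "ext_map h (ext_scalar c) = ext_scalar c"
proof -
  have c: "ext_scalar c = (\<lambda>S. c * ext_scalar 1 S)" by (auto simp: ext_scalar_def)
  have one: "ext_map h (ext_scalar 1) = ext_scalar 1" using ext_map_basis[of h "{}"] by simp
  show ?thesis by (simp only: c ext_map_scale one)
qed

lemma ext_map_wedge_list: "ext_map h (wedge_list vs) = wedge_list (map ((*v) h) vs)"
  by (induction vs) (simp_all add: wedge_list_def ext_map_ext_scalar ext_map_wedge_vector)

lemma ext_map_wedge_family: "ext_map h (wedge_family v A) = wedge_family (\<lambda>i. h *v v i) A"
  by (simp add: wedge_family_def ext_map_wedge_list comp_def)

lemma wedge_family_scale:
  fixes v :: "'n \<Rightarrow> complex ^ ('n::{finite,linorder})"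
  shows "wedge_family (\<lambda>i. c i *s v i) A = (\<lambda>S. (\<Prod>i\<in>A. c i) * wedge_family v A S)"
  using finite[of A]
proof (induction A rule: finite_linorder_min_induct)
  case (insert b A)
  have "b \<notin> A" using insert.hyps(2) by blast
  moreover have "ext_vector (c b *s v b) = (\<lambda>S. c b * ext_vector (v b) S)"
    using ext_vector_expand[of "\<lambda>_. c b" "\<lambda>_. v b" "{b}"] by simp
  ultimately show ?case
    by (simp add: wedge_family_insert_min[OF insert.hyps(2)] insert.IH wedge_scale_left wedge_scale_right mult_ac)
qed simp

definition unitary :: "('n::finite) cmat \<Rightarrow> bool" where
  "unitary g \<longleftrightarrow> adj g ** g = mat 1"

lemma unitary_right: "unitary g \<Longrightarrow> g ** adj g = mat 1"
  unfolding unitary_def by (rule matrix_left_right_inverse[THEN iffD1])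

lemma column_entry: "(h *v axis i 1) $ a = h $ a $ i" for h :: "('n::finite) cmat"
  by (simp add: matrix_vector_mult_def axis_def if_distrib[of "\<lambda>x. _ * x"] cong: if_cong)

lemma unitary_columns:
  assumes "unitary g"
  shows "(\<Sum>k\<in>UNIV. (g *v axis i 1) $ k * cnj ((g *v axis j 1) $ k)) = (if i = j then 1 else 0)"
proof -
  have "(adj g ** g) $ j $ i = (if j = i then 1 else 0)"
    using assms by (simp add: unitary_def mat_def)
  then show ?thesis
    unfolding column_entry by (auto simp: matrix_matrix_mult_def adj_def mult.commute)
qed

text \<open>The adjoint of \<open>w \<mapsto> v \<and> w\<close>.\<close>

definition contract_vector :: "complex ^ ('n::{finite,linorder}) \<Rightarrow> 'n set cvec \<Rightarrow> 'n set cvec" where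
  "contract_vector v w = (\<lambda>S. \<Sum>i\<in>- S. cnj (v $ i) * (shuffle_sign {i} S * w (insert i S)))"

lemma herm_wedge_vector:
  "herm (wedge (ext_vector v) a) b = herm a (contract_vector v b)"
proof -
  have "herm (wedge (ext_vector v) a) b = (\<Sum>(S, i)\<in>(SIGMA S:UNIV. S).
      v $ i * shuffle_sign {i} (S - {i}) * a (S - {i}) * cnj (b S))"
    unfolding herm_UNIV wedge_ext_vector
    by (subst sum.Sigma[symmetric]) (simp_all add: sum_distrib_left sum_distrib_right mult_ac)
  also have "\<dots> = (\<Sum>(T, i)\<in>(SIGMA T:UNIV. - T).
      v $ i * shuffle_sign {i} T * a T * cnj (b (insert i T)))"
    by (rule sum.reindex_bij_witness[where i = "\<lambda>(T, i). (insert i T, i)" and j = "\<lambda>(S, i). (S - {i}, i)"])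
       (auto simp: insert_absorb)
  also have "\<dots> = herm a (contract_vector v b)"
    unfolding herm_UNIV contract_vector_def
    by (subst sum.Sigma[symmetric]) (simp_all add: sum_distrib_left cnj_sum mult_ac)
  finally show ?thesis .
qed

lemma shuffle_sign_insert_right: "j \<notin> T \<Longrightarrow> shuffle_sign A (insert j T) = shuffle_sign A {j} * shuffle_sign A T"
  using shuffle_sign_Un_right[of "{j}" T A] by simp

lemma shuffle_sign_swap_singletons:
  assumes "i \<noteq> j"
  shows "shuffle_sign {i} {j} = - shuffle_sign {j} {i}"
proof -
  have "{b \<in> {j}. b < i} = (if j < i then {j} else {})" "{b \<in> {i}. b < j} = (if i < j then {i} else {})"
    by auto
  then show ?thesis using assms unfolding shuffle_sign_singleton by auto
qed

text \<open>The canonical anticommutation relation of creation and annihilation operators.\<close>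

lemma contract_vector_wedge:
  fixes u v :: "complex ^ ('n::{finite,linorder})"
  shows "contract_vector u (wedge (ext_vector v) b) =
    (\<lambda>S. (\<Sum>k\<in>UNIV. v $ k * cnj (u $ k)) * b S - wedge (ext_vector v) (contract_vector u b) S)"
proof
  fix S :: "'n set"
  define X where "X = (\<Sum>i\<in>- S. \<Sum>j\<in>S. cnj (u $ i) * v $ j *
    (shuffle_sign {i} S * shuffle_sign {j} (insert i (S - {j})) * b (insert i (S - {j}))))"
  have left: "contract_vector u (wedge (ext_vector v) b) S = (\<Sum>i\<in>- S. v $ i * cnj (u $ i)) * b S + X"
  proof -
    have "cnj (u $ i) * (shuffle_sign {i} S * wedge (ext_vector v) b (insert i S)) =
        v $ i * cnj (u $ i) * b S + (\<Sum>j\<in>S. cnj (u $ i) * v $ j *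
          (shuffle_sign {i} S * shuffle_sign {j} (insert i (S - {j})) * b (insert i (S - {j}))))"
      if "i \<in> - S" for i
    proof -
      have i: "i \<notin> S" using that by simp
      have d: "insert i S - {i} = S" using i by auto
      have "(\<Sum>j\<in>S. v $ j * (shuffle_sign {j} (insert i S - {j}) * b (insert i S - {j}))) =
          (\<Sum>j\<in>S. v $ j * (shuffle_sign {j} (insert i (S - {j})) * b (insert i (S - {j}))))"
      proof (rule sum.cong[OF refl])
        fix j assume "j \<in> S"
        then have "insert i S - {j} = insert i (S - {j})" using i by auto
        then show "v $ j * (shuffle_sign {j} (insert i S - {j}) * b (insert i S - {j})) =
            v $ j * (shuffle_sign {j} (insert i (S - {j})) * b (insert i (S - {j})))" by simp
      qed
      then have "wedge (ext_vector v) b (insert i S) = v $ i * (shuffle_sign {i} S * b S) +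
          (\<Sum>j\<in>S. v $ j * (shuffle_sign {j} (insert i (S - {j})) * b (insert i (S - {j}))))"
        unfolding wedge_ext_vector using i d by simp
      then show ?thesis by (simp add: distrib_left sum_distrib_left mult_ac)
    qed
    then have "contract_vector u (wedge (ext_vector v) b) S = (\<Sum>i\<in>- S. v $ i * cnj (u $ i) * b S +
        (\<Sum>j\<in>S. cnj (u $ i) * v $ j *
          (shuffle_sign {i} S * shuffle_sign {j} (insert i (S - {j})) * b (insert i (S - {j})))))"
      unfolding contract_vector_def by (rule sum.cong[OF refl])
    then show ?thesis by (simp only: sum.distrib X_def sum_distrib_right)
  qed
  have right: "wedge (ext_vector v) (contract_vector u b) S = (\<Sum>j\<in>S. v $ j * cnj (u $ j)) * b S - X"
  proof -
    have "v $ j * (shuffle_sign {j} (S - {j}) * contract_vector u b (S - {j})) =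
        v $ j * cnj (u $ j) * b S - (\<Sum>i\<in>- S. cnj (u $ i) * v $ j *
          (shuffle_sign {i} S * shuffle_sign {j} (insert i (S - {j})) * b (insert i (S - {j}))))"
      if j: "j \<in> S" for j
    proof -
      have c: "- (S - {j}) = insert j (- S)" and S: "insert j (S - {j}) = S" using j by auto
      have "contract_vector u b (S - {j}) = cnj (u $ j) * (shuffle_sign {j} (S - {j}) * b S) +
          (\<Sum>i\<in>- S. cnj (u $ i) * (shuffle_sign {i} (S - {j}) * b (insert i (S - {j}))))"
        unfolding contract_vector_def c using j S by simp
      then have "v $ j * (shuffle_sign {j} (S - {j}) * contract_vector u b (S - {j})) =
          v $ j * cnj (u $ j) * b S + (\<Sum>i\<in>- S. cnj (u $ i) * v $ j *
            (shuffle_sign {j} (S - {j}) * shuffle_sign {i} (S - {j}) * b (insert i (S - {j}))))"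
        by (simp add: distrib_left sum_distrib_left mult_ac)
      moreover have sign: "shuffle_sign {j} (S - {j}) * shuffle_sign {i} (S - {j}) =
          - (shuffle_sign {i} S * shuffle_sign {j} (insert i (S - {j})))" if "i \<in> - S" for i
      proof -
        have ij: "i \<noteq> j" "i \<notin> S - {j}" using that j by auto
        have "shuffle_sign {i} S = shuffle_sign {i} {j} * shuffle_sign {i} (S - {j})"
          using shuffle_sign_insert_right[of j "S - {j}" "{i}"] S by simp
        moreover have "shuffle_sign {j} (insert i (S - {j})) = shuffle_sign {j} {i} * shuffle_sign {j} (S - {j})"
          using shuffle_sign_insert_right[OF ij(2)] .
        ultimately show ?thesis using shuffle_sign_swap_singletons[OF ij(1)] by (simp add: mult_ac)
      qed
      moreover have "(\<Sum>i\<in>- S. cnj (u $ i) * v $ j *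
            (shuffle_sign {j} (S - {j}) * shuffle_sign {i} (S - {j}) * b (insert i (S - {j})))) =
          - (\<Sum>i\<in>- S. cnj (u $ i) * v $ j *
            (shuffle_sign {i} S * shuffle_sign {j} (insert i (S - {j})) * b (insert i (S - {j}))))"
        unfolding sum_negf[symmetric] by (rule sum.cong[OF refl]) (simp only: sign, simp)
      ultimately show ?thesis by simp
    qed
    then have "wedge (ext_vector v) (contract_vector u b) S = (\<Sum>j\<in>S. v $ j * cnj (u $ j) * b S -
        (\<Sum>i\<in>- S. cnj (u $ i) * v $ j *
          (shuffle_sign {i} S * shuffle_sign {j} (insert i (S - {j})) * b (insert i (S - {j})))))"
      unfolding wedge_ext_vector by (rule sum.cong[OF refl])
    moreover have "X = (\<Sum>j\<in>S. \<Sum>i\<in>- S. cnj (u $ i) * v $ j *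
          (shuffle_sign {i} S * shuffle_sign {j} (insert i (S - {j})) * b (insert i (S - {j}))))"
      unfolding X_def by (rule sum.swap)
    ultimately show ?thesis by (simp only: sum_subtractf sum_distrib_right)
  qed
  have "(\<Sum>k\<in>UNIV. v $ k * cnj (u $ k)) = (\<Sum>k\<in>S. v $ k * cnj (u $ k)) + (\<Sum>k\<in>- S. v $ k * cnj (u $ k))"
    using sum.union_disjoint[of S "- S" "\<lambda>k. v $ k * cnj (u $ k)"] by simp
  then show "contract_vector u (wedge (ext_vector v) b) S =
      (\<Sum>k\<in>UNIV. v $ k * cnj (u $ k)) * b S - wedge (ext_vector v) (contract_vector u b) S"
    unfolding left right by (simp add: algebra_simps)
qed

lemma contract_vector_wedge_family:
  fixes v :: "'n \<Rightarrow> complex ^ ('n::{finite,linorder})"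
  assumes v: "\<And>i j. (\<Sum>k\<in>UNIV. v i $ k * cnj (v j $ k)) = (if i = j then 1 else 0)"
  shows "contract_vector (v j) (wedge_family v B) =
    (\<lambda>S. if j \<in> B then shuffle_sign {j} (B - {j}) * wedge_family v (B - {j}) S else 0)"
  using finite[of B]
proof (induction B rule: finite_linorder_min_induct)
  case empty
  show ?case by (simp add: contract_vector_def ext_scalar_def)
next
  case (insert b A)
  have bA: "b \<notin> A" using insert.hyps(2) by blast
  have step: "contract_vector (v j) (wedge_family v (insert b A)) =
      (\<lambda>S. (if b = j then 1 else 0) * wedge_family v A S -
        wedge (ext_vector (v b)) (contract_vector (v j) (wedge_family v A)) S)"
    unfolding wedge_family_insert_min[OF insert.hyps(2)] contract_vector_wedge v by simp
  show ?case
  proof (cases "j = b")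
    case True
    have e: "{a \<in> A. a < b} = {}" using insert.hyps(2) by auto
    have "shuffle_sign {b} A = 1" unfolding shuffle_sign_singleton e by simp
    then show ?thesis unfolding step insert.IH using True bA by simp
  next
    case False
    show ?thesis
    proof (cases "j \<in> A")
      case True
      have bj: "b < j" using insert.hyps(2) True by blast
      have e: "{a \<in> {b}. a < j} = {b}" using bj by auto
      have "shuffle_sign {j} {b} = - 1" unfolding shuffle_sign_singleton e by simp
      moreover have d: "insert b A - {j} = insert b (A - {j})" using False by auto
      ultimately have sign: "shuffle_sign {j} (insert b A - {j}) = - shuffle_sign {j} (A - {j})"
        using shuffle_sign_insert_right[of b "A - {j}" "{j}"] bA by simp
      have "\<forall>a\<in>A - {j}. b < a" using insert.hyps(2) by blast
      from wedge_family_insert_min[OF this, of v]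
      show ?thesis unfolding step insert.IH sign unfolding d using True False by (simp add: wedge_scale_right)
    next
      case notA: False
      then show ?thesis unfolding step insert.IH using False by simp
    qed
  qed
qed

lemma wedge_family_orthonormal:
  fixes v :: "'n \<Rightarrow> complex ^ ('n::{finite,linorder})"
  assumes v: "\<And>i j. (\<Sum>k\<in>UNIV. v i $ k * cnj (v j $ k)) = (if i = j then 1 else 0)"
  shows "herm (wedge_family v A) (wedge_family v B) = (if A = B then 1 else 0)"
  using finite[of A]
proof (induction A arbitrary: B rule: finite_linorder_min_induct)
  case empty
  have "herm (ext_scalar 1) w = cnj (w {})" for w :: "'n set cvec"
    by (subst herm_finite_support[of "{{}}"]) (auto simp: ext_scalar_def)
  moreover have "wedge_family v B {} = 0" if "B \<noteq> {}"
  proof -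
    have "Min B \<in> B" using that by simp
    then have "B = insert (Min B) (B - {Min B})" by auto
    moreover have "\<forall>a\<in>B - {Min B}. Min B < a"
      by (metis DiffD1 DiffD2 Min_le finite insertI1 order_le_imp_less_or_eq)
    ultimately have "wedge_family v B = wedge (ext_vector (v (Min B))) (wedge_family v (B - {Min B}))"
      using wedge_family_insert_min by metis
    then show ?thesis by (simp add: wedge_ext_vector)
  qed
  ultimately show ?case by (auto simp: ext_scalar_def)
next
  case (insert b A)
  have bA: "b \<notin> A" using insert.hyps(2) by blast
  have e: "{a \<in> A. a < b} = {}" using insert.hyps(2) by auto
  have s: "shuffle_sign {b} A = 1" unfolding shuffle_sign_singleton e by simp
  have "herm (wedge_family v (insert b A)) (wedge_family v B) =
      herm (wedge_family v A) (contract_vector (v b) (wedge_family v B))"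
    unfolding wedge_family_insert_min[OF insert.hyps(2)] by (rule herm_wedge_vector)
  also have "\<dots> = (if b \<in> B then shuffle_sign {b} (B - {b}) * (if A = B - {b} then 1 else 0) else 0)"
  proof (cases "b \<in> B")
    case True
    have "herm (\<lambda>S. 1 * wedge_family v A S) (\<lambda>S. shuffle_sign {b} (B - {b}) * wedge_family v (B - {b}) S) =
        shuffle_sign {b} (B - {b}) * herm (wedge_family v A) (wedge_family v (B - {b}))"
      unfolding herm_scale by simp
    then show ?thesis unfolding contract_vector_wedge_family[OF v] using True by (simp add: insert.IH)
  next
    case False
    then show ?thesis unfolding contract_vector_wedge_family[OF v] by (simp add: herm_def)
  qed
  also have "\<dots> = (if insert b A = B then 1 else 0)"
  proof -
    have iff: "insert b A = B \<longleftrightarrow> b \<in> B \<and> A = B - {b}" using bA by auto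
    show ?thesis
    proof (cases "b \<in> B \<and> A = B - {b}")
      case True
      then have "shuffle_sign {b} (B - {b}) = 1" using s by simp
      then show ?thesis unfolding iff using True by simp
    next
      case False
      then show ?thesis unfolding iff by simp
    qed
  qed
  finally show ?case .
qed

lemma wedge_family_unit_vector:
  fixes g :: "('n::{finite,linorder}) cmat"
  assumes "unitary g"
  shows "unit_vector (wedge_family (\<lambda>i. g *v axis i 1) A)"
  using wedge_family_orthonormal[OF unitary_columns[OF assms], of A A] by (simp add: unit_vector_def)

text \<open>Contraction by the dual of \<open>b\<close> is the adjoint of wedging with \<open>b\<close>; this reduces the contractions in the
  multiplication of the basic gerbe to wedge products.\<close>

lemma contract_right_adjoint:
  "contract_right f (\<lambda>S. cnj (b S)) S = herm f (wedge (wedge_family (\<lambda>i. axis i 1) S) b)"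
  for b :: "('n::{finite,linorder}) set cvec"
proof -
  have "wedge (wedge_family (\<lambda>i. axis i 1) S) b R =
      (if S \<subseteq> R then shuffle_sign S (R - S) * b (R - S) else 0)" for R
  proof -
    have "wedge (wedge_family (\<lambda>i. axis i 1) S) b R =
        (\<Sum>A\<in>Pow R. if A = S then shuffle_sign S (R - S) * b (R - S) else 0)"
      unfolding wedge_def wedge_family_axis by (rule sum.cong) auto
    then show ?thesis by simp
  qed
  then have "herm f (wedge (wedge_family (\<lambda>i. axis i 1) S) b) =
      (\<Sum>R\<in>UNIV. if S \<subseteq> R then f R * (shuffle_sign S (R - S) * cnj (b (R - S))) else 0)"
    unfolding herm_UNIV by (intro sum.cong) auto
  also have "\<dots> = (\<Sum>R | S \<subseteq> R. f R * (shuffle_sign S (R - S) * cnj (b (R - S))))"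
    by (subst sum.inter_filter[symmetric]) simp_all
  also have "\<dots> = contract_right f (\<lambda>S. cnj (b S)) S"
    unfolding contract_right_def
    by (rule sum.reindex_bij_witness[where i = "\<lambda>B. S \<union> B" and j = "\<lambda>R. R - S"])
       (auto simp: Un_absorb1 mult_ac)
  finally show ?thesis by simp
qed

lemma contract_left_adjoint:
  "contract_left (\<lambda>S. cnj (b S)) f S = herm f (wedge b (wedge_family (\<lambda>i. axis i 1) S))"
  for b :: "('n::{finite,linorder}) set cvec"
proof -
  have "wedge b (wedge_family (\<lambda>i. axis i 1) S) R =
      (if S \<subseteq> R then shuffle_sign (R - S) S * b (R - S) else 0)" for R
  proof (cases "S \<subseteq> R")
    case True
    have "wedge b (wedge_family (\<lambda>i. axis i 1) S) R =
        (\<Sum>A\<in>Pow R. if A = R - S then shuffle_sign (R - S) S * b (R - S) else 0)"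
      unfolding wedge_def wedge_family_axis
    proof (rule sum.cong[OF refl])
      fix A assume "A \<in> Pow R"
      then have "R - A = S \<longleftrightarrow> A = R - S" using True by auto
      then show "shuffle_sign A (R - A) * b A * (if R - A = S then 1 else 0) =
          (if A = R - S then shuffle_sign (R - S) S * b (R - S) else 0)" by auto
    qed
    then show ?thesis using True by simp
  next
    case False
    have "wedge b (wedge_family (\<lambda>i. axis i 1) S) R = 0"
      unfolding wedge_def wedge_family_axis using False by (intro sum.neutral) auto
    then show ?thesis using False by simp
  qed
  then have "herm f (wedge b (wedge_family (\<lambda>i. axis i 1) S)) =
      (\<Sum>R\<in>UNIV. if S \<subseteq> R then f R * (shuffle_sign (R - S) S * cnj (b (R - S))) else 0)"
    unfolding herm_UNIV by (intro sum.cong) auto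
  also have "\<dots> = (\<Sum>R | S \<subseteq> R. f R * (shuffle_sign (R - S) S * cnj (b (R - S))))"
    by (subst sum.inter_filter[symmetric]) simp_all
  also have "\<dots> = contract_left (\<lambda>S. cnj (b S)) f S"
    unfolding contract_left_def
    by (rule sum.reindex_bij_witness[where i = "\<lambda>B. B \<union> S" and j = "\<lambda>R. R - S"])
       (auto simp: Un_absorb1 Un_absorb2 mult_ac)
  finally show ?thesis by simp
qed

text \<open>The wedge products of an orthonormal basis are a basis of the exterior algebra: \<open>\<Lambda> g\<close> is inverted
  by \<open>\<Lambda> g\<^sup>*\<close>.\<close>

lemma wedge_family_expand:
  fixes g :: "('n::{finite,linorder}) cmat"
  assumes "unitary g"
  shows "w = (\<lambda>S. \<Sum>R\<in>UNIV. herm w (wedge_family (\<lambda>i. g *v axis i 1) R) * wedge_family (\<lambda>i. g *v axis i 1) R S)"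
proof -
  let ?E = "wedge_family (\<lambda>i. g *v axis i 1)"
  have basis: "wedge_family (\<lambda>i. axis i 1) A = ext_map g (wedge_family (\<lambda>i. adj g *v axis i 1) A)" for A
    by (simp add: ext_map_wedge_family matrix_vector_mul_assoc unitary_right[OF assms])
  obtain w' where w': "w = ext_map g w'"
  proof
    show "w = ext_map g (\<lambda>S. \<Sum>B\<in>UNIV. w B * wedge_family (\<lambda>i. adj g *v axis i 1) B S)"
      unfolding ext_map_sum basis[symmetric] by (rule cvec_expand)
  qed
  then have w: "w = (\<lambda>S. \<Sum>R\<in>UNIV. w' R * ?E R S)" by (simp add: ext_map_eq)
  have "herm w (?E R) = w' R" for R
  proof -
    have "herm w (?E R) = (\<Sum>S\<in>UNIV. \<Sum>R'\<in>UNIV. w' R' * (?E R' S * cnj (?E R S)))"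
      unfolding herm_UNIV by (subst w) (simp add: sum_distrib_right sum_distrib_left mult_ac)
    also have "\<dots> = (\<Sum>R'\<in>UNIV. w' R' * herm (?E R') (?E R))"
      unfolding herm_UNIV by (subst sum.swap) (simp add: sum_distrib_left)
    also have "\<dots> = w' R"
      unfolding wedge_family_orthonormal[OF unitary_columns[OF assms]]
      by (simp add: if_distrib[of "\<lambda>x. _ * x"] cong: if_cong)
    finally show ?thesis .
  qed
  then show ?thesis using w by simp
qed

lemma herm_sum_right: "herm f (\<lambda>S. \<Sum>i\<in>I. c i * h i S) = (\<Sum>i\<in>I. cnj (c i) * herm f (h i))"
  for f :: "('j::finite) cvec"
  unfolding herm_UNIV sum_distrib_left by (subst sum.swap) (simp add: cnj_sum sum_distrib_left mult_ac)

lemma herm_scale_right: "herm v (\<lambda>i. d * w i) = cnj d * herm v w"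
  using herm_scale[of 1 v d w] by simp

lemma herm_commute: "herm v w = cnj (herm w v)" for v w :: "('j::finite) cvec"
  by (simp add: herm_UNIV cnj_sum mult.commute)

lemma contract_wedge_family:
  fixes g :: "('n::{finite,linorder}) cmat"
  assumes g: "unitary g" and AB: "A \<inter> B = {}"
  defines "E \<equiv> wedge_family (\<lambda>i. g *v axis i 1)"
  shows "contract_right (wedge (E A) (E B)) (\<lambda>S. cnj (E B S)) = E A"
    and "contract_left (\<lambda>S. cnj (E B S)) (wedge (E B) (E A)) = E A"
proof -
  let ?e = "wedge_family (\<lambda>i. axis i 1) :: 'n set \<Rightarrow> 'n set cvec"
  have orth: "herm (E R) (E R') = (if R = R' then 1 else 0)" for R R'
    unfolding E_def by (rule wedge_family_orthonormal[OF unitary_columns[OF g]])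
  have expand: "?e S = (\<lambda>T. \<Sum>R\<in>UNIV. herm (?e S) (E R) * E R T)" for S
    unfolding E_def by (rule wedge_family_expand[OF g])
  have coeff: "cnj (herm (?e S) (E A)) = E A S" for S
  proof -
    have "herm (E A) (?e S) = E A S"
      by (simp add: herm_UNIV wedge_family_axis if_distrib[of "\<lambda>x. _ * x"] if_distrib[of cnj] cong: if_cong)
    then show ?thesis by (metis herm_commute)
  qed
  have EE: "wedge (E R) (E R') = (\<lambda>S. (if R \<inter> R' = {} then shuffle_sign R R' else 0) * E (R \<union> R') S)" for R R'
    unfolding E_def wedge_family_wedge by auto
  have r: "herm (wedge (E A) (E B)) (wedge (E R) (E B)) = (if A = R then 1 else 0)" for R
    unfolding EE herm_scale orth using AB by (auto simp: Int_Un_eq)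
  have l: "herm (wedge (E B) (E A)) (wedge (E B) (E R)) = (if A = R then 1 else 0)" for R
    unfolding EE herm_scale orth using AB by (auto simp: Int_Un_eq)
  show "contract_right (wedge (E A) (E B)) (\<lambda>S. cnj (E B S)) = E A"
  proof
    fix S
    have "contract_right (wedge (E A) (E B)) (\<lambda>S. cnj (E B S)) S =
        (\<Sum>R\<in>UNIV. cnj (herm (?e S) (E R)) * herm (wedge (E A) (E B)) (wedge (E R) (E B)))"
      unfolding contract_right_adjoint by (subst expand) (simp only: wedge_sum_left herm_sum_right)
    also have "\<dots> = cnj (herm (?e S) (E A))"
      unfolding r by (simp add: if_distrib[of "\<lambda>x. _ * x"] cong: if_cong)
    finally show "contract_right (wedge (E A) (E B)) (\<lambda>S. cnj (E B S)) S = E A S" unfolding coeff .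
  qed
  show "contract_left (\<lambda>S. cnj (E B S)) (wedge (E B) (E A)) = E A"
  proof
    fix S
    have "contract_left (\<lambda>S. cnj (E B S)) (wedge (E B) (E A)) S =
        (\<Sum>R\<in>UNIV. cnj (herm (?e S) (E R)) * herm (wedge (E B) (E A)) (wedge (E B) (E R)))"
      unfolding contract_left_adjoint by (subst expand) (simp only: wedge_sum_right herm_sum_right)
    also have "\<dots> = cnj (herm (?e S) (E A))"
      unfolding l by (simp add: if_distrib[of "\<lambda>x. _ * x"] cong: if_cong)
    finally show "contract_left (\<lambda>S. cnj (E B S)) (wedge (E B) (E A)) S = E A S" unfolding coeff .
  qed
qed

text \<open>In particular, a product of \<open>card I\<close> vectors in the coordinate subspace of \<open>I\<close> is a multiple of a single
  basis element.\<close>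

lemma wedge_list_support:
  fixes ws :: "(complex ^ ('n::{finite,linorder})) list"
  assumes "\<forall>w\<in>set ws. \<forall>i. i \<notin> I \<longrightarrow> w $ i = 0" and "wedge_list ws S \<noteq> 0"
  shows "S \<subseteq> I \<and> card S = length ws"
  using assms
proof (induction ws arbitrary: S)
  case Nil
  then show ?case by (auto simp: wedge_list_def ext_scalar_def split: if_splits)
next
  case (Cons w ws)
  have "(\<Sum>i\<in>S. w $ i * (shuffle_sign {i} (S - {i}) * wedge_list ws (S - {i}))) \<noteq> 0"
    using Cons.prems(2) by (simp add: wedge_list_def wedge_ext_vector)
  then obtain i where i: "i \<in> S" "w $ i * (shuffle_sign {i} (S - {i}) * wedge_list ws (S - {i})) \<noteq> 0"
    by (meson sum.neutral)
  then have "w $ i \<noteq> 0" "wedge_list ws (S - {i}) \<noteq> 0" by auto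
  then have *: "i \<in> I" "S - {i} \<subseteq> I" "card (S - {i}) = length ws"
    using Cons.prems(1) Cons.IH[of "S - {i}"] by auto
  have "card S = length (w # ws)" unfolding card.remove[OF finite i(1)] *(3) by simp
  moreover have "S \<subseteq> I" using *(1,2) by blast
  ultimately show ?case by blast
qed

text \<open>The unitary \<open>g\<close> reduces the claim to a coordinate subspace.\<close>

lemma det_line_span:
  fixes g :: "('n::{finite,linorder}) cmat"
  assumes g: "unitary g"
  shows "det_line (vec.span ((\<lambda>i. g *v axis i 1) ` I)) = cline (wedge_family (\<lambda>i. g *v axis i 1) I)"
    (is "det_line ?L = cline ?E")
proof -
  let ?v = "\<lambda>i. g *v axis i 1"
  have inv: "adj g *v (g *v x) = x" "g *v (adj g *v x) = x" for x
    using g unitary_right[OF g] by (simp_all add: matrix_vector_mul_assoc unitary_def)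
  have inj_g: "inj ((*v) g)" using inv(1) by (metis injI)
  have "vec.independent ((\<lambda>i. axis i 1 :: complex ^ ('n::{finite,linorder})) ` I)"
    by (rule vec.independent_mono[OF independent_cart_basis]) (auto simp: cart_basis_def)
  then have "vec.independent ((*v) g ` (\<lambda>i. axis i 1) ` I)"
    by (rule vec.linear_independent_injective_image[OF matrix_vector_mul_linear_gen])
       (rule inj_on_subset[OF inj_g], simp)
  then have "vec.independent (?v ` I)" by (simp add: image_image)
  then have "vec.dim ?L = card (?v ` I)" by (simp add: vec.dim_eq_card_independent)
  also have "\<dots> = card I"
  proof (rule card_image, rule inj_onI)
    fix i j assume "?v i = ?v j"
    then have "axis i 1 = (axis j 1 :: complex ^ ('n::{finite,linorder}))" using inj_g by (metis injD)
    then show "i = j" by (simp add: axis_eq_axis)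
  qed
  finally have dim: "vec.dim ?L = card I" .
  have support: "\<forall>i. i \<notin> I \<longrightarrow> (adj g *v x) $ i = 0" if "x \<in> ?L" for x
    using that
  proof (induction rule: vec.span_induct)
    case base
    then show ?case by (simp add: vec.subspace_def matrix_vector_right_distrib vec.linear_scale[OF matrix_vector_mul_linear_gen])
  next
    case (step x)
    then show ?case using inv(1) by (auto simp: axis_def)
  qed
  show ?thesis
  proof
    show "det_line ?L \<subseteq> cline ?E"
    proof
      fix p assume "p \<in> det_line ?L"
      then obtain c vs where p: "p = (\<lambda>S. c * wedge_list vs S)" "set vs \<subseteq> ?L" "length vs = card I"
        unfolding det_line_def dim by blast
      define ws where "ws = map ((*v) (adj g)) vs"
      have "\<forall>w\<in>set ws. \<forall>i. i \<notin> I \<longrightarrow> w $ i = 0" using support p(2) by (auto simp: ws_def)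
      then have supp: "wedge_list ws S = 0" if "S \<noteq> I" for S
        using wedge_list_support[of ws I S] that p(3) card_subset_eq[of I S] by (auto simp: ws_def)
      have "wedge_list ws = (\<lambda>S. wedge_list ws I * wedge_family (\<lambda>i. axis i 1) I S)"
        using supp by (auto simp: wedge_family_axis)
      then have "ext_map g (wedge_list ws) = (\<lambda>S. wedge_list ws I * ?E S)"
        by (metis ext_map_scale ext_map_basis)
      moreover have "ext_map g (wedge_list ws) = wedge_list vs"
        by (simp add: ext_map_wedge_list ws_def comp_def inv(2))
      ultimately have "p = (\<lambda>S. (c * wedge_list ws I) * ?E S)" by (simp add: p(1) mult.assoc)
      then show "p \<in> cline ?E" by (simp only: cline_scale_mem)
    qed
    show "cline ?E \<subseteq> det_line ?L"
    proof
      fix p assume "p \<in> cline ?E"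
      then obtain c where "p = (\<lambda>S. c * wedge_list (map ?v (sorted_list_of_set I)) S)"
        by (auto simp: cline_def wedge_family_def)
      then show "p \<in> det_line ?L"
        unfolding det_line_def dim by (auto intro!: exI[of _ c] exI[of _ "map ?v (sorted_list_of_set I)"] vec.span_base)
    qed
  qed
qed

section \<open>Duals, powers and tensor products of framed lines\<close>

lemma unit_vector_cnj: "unit_vector v \<Longrightarrow> unit_vector (\<lambda>i. cnj (v i))" for v :: "('i::finite) cvec"
  by (simp add: unit_vector_def herm_UNIV mult.commute)

lemma herm_self_eq_0:
  fixes w :: "('i::finite) cvec"
  assumes "herm w w = 0"
  shows "w = (\<lambda>i. 0)"
proof -
  have "complex_of_real (\<Sum>i\<in>UNIV. (cmod (w i))\<^sup>2) = 0"
    using assms unfolding herm_UNIV of_real_sum complex_norm_square .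
  then have "(\<Sum>i\<in>UNIV. (cmod (w i))\<^sup>2) = 0" by (simp only: of_real_eq_0_iff)
  then show ?thesis by (simp add: sum_nonneg_eq_0_iff fun_eq_iff)
qed

lemma dual_line_cline:
  fixes v :: "('i::finite) cvec"
  assumes v: "unit_vector v"
  shows "dual_line (cline v) = cline (\<lambda>i. cnj (v i))"
proof
  have vv: "herm v v = 1" using v by (simp add: unit_vector_def)
  show "cline (\<lambda>i. cnj (v i)) \<subseteq> dual_line (cline v)"
  proof
    fix f assume "f \<in> cline (\<lambda>i. cnj (v i))"
    then obtain c where f: "f = (\<lambda>i. c * cnj (v i))" by (auto simp: cline_def)
    show "f \<in> dual_line (cline v)"
      unfolding dual_line_def
    proof (intro CollectI allI impI)
      fix w assume "\<forall>u\<in>cline v. herm w u = 0"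
      then have "herm w v = 0" by simp
      then show "pairing f w = 0"
        by (simp add: f pairing_def herm_UNIV mult_ac flip: sum_distrib_left)
    qed
  qed
  show "dual_line (cline v) \<subseteq> cline (\<lambda>i. cnj (v i))"
  proof
    fix f assume f: "f \<in> dual_line (cline v)"
    \<comment> \<open>\<open>w\<close> is the component of \<open>f\<^sup>*\<close> orthogonal to \<open>v\<close>, on which \<open>f\<close> vanishes; hence \<open>w = 0\<close>.\<close>
    define a where "a = herm (\<lambda>i. cnj (f i)) v"
    define w where "w i = cnj (f i) - a * v i" for i
    have wv: "herm w v = 0"
      using vv unfolding a_def w_def herm_UNIV by (simp add: left_diff_distrib sum_subtractf mult.assoc flip: sum_distrib_left)
    have "herm w u = 0" if "u \<in> cline v" for u
    proof -
      obtain d where "u = (\<lambda>i. d * v i)" using \<open>u \<in> cline v\<close> by (auto simp: cline_def)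
      then show ?thesis using wv by (simp add: herm_scale_right)
    qed
    then have "pairing f w = 0" using f unfolding dual_line_def by blast
    moreover have "herm w w = pairing f w - cnj a * herm w v"
    proof -
      have "herm w w = (\<Sum>i\<in>UNIV. f i * w i - cnj a * (w i * cnj (v i)))"
        unfolding herm_UNIV by (rule sum.cong) (simp_all add: w_def algebra_simps)
      then show ?thesis by (simp add: sum_subtractf pairing_def herm_UNIV flip: sum_distrib_left)
    qed
    ultimately have w0: "w = (\<lambda>i. 0)" using wv by (intro herm_self_eq_0) simp
    have "cnj (f i) = a * v i" for i using fun_cong[OF w0, of i] by (simp add: w_def)
    then have "f i = cnj a * cnj (v i)" for i by (metis complex_cnj_cnj complex_cnj_mult)
    then have "f = (\<lambda>i. cnj a * cnj (v i))" by blast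
    then show "f \<in> cline (\<lambda>i. cnj (v i))" by (simp only: cline_scale_mem)
  qed
qed

lemma pairing_unit_vector:
  "unit_vector v \<Longrightarrow> pairing (\<lambda>i. c * cnj (v i)) (\<lambda>i. a * v i) = c * a" for v :: "('i::finite) cvec"
proof -
  assume v: "unit_vector v"
  have "pairing (\<lambda>i. c * cnj (v i)) (\<lambda>i. a * v i) = c * a * herm v v"
    by (simp add: pairing_def herm_UNIV sum_distrib_left mult_ac)
  then show ?thesis using v by (simp add: unit_vector_def)
qed

lemma dual_map_cline:
  fixes v :: "('i::finite) cvec" and w :: "('j::finite) cvec"
  assumes v: "unit_vector v" and w: "unit_vector w" and \<rho>: "\<And>c. \<rho> (\<lambda>i. c * v i) = (\<lambda>j. c * w j)"
  shows "dual_map \<rho> (cline v) (cline w) (\<lambda>i. c * cnj (v i)) = (\<lambda>j. c * cnj (w j))"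
  unfolding dual_map_def dual_line_cline[OF w]
proof (rule the_equality)
  show "(\<lambda>j. c * cnj (w j)) \<in> cline (\<lambda>j. cnj (w j)) \<and>
      (\<forall>u\<in>cline v. pairing (\<lambda>j. c * cnj (w j)) (\<rho> u) = pairing (\<lambda>i. c * cnj (v i)) u)"
    by (auto simp: cline_def \<rho> pairing_unit_vector[OF v] pairing_unit_vector[OF w])
  fix f assume f: "f \<in> cline (\<lambda>j. cnj (w j)) \<and>
      (\<forall>u\<in>cline v. pairing f (\<rho> u) = pairing (\<lambda>i. c * cnj (v i)) u)"
  then obtain d where d: "f = (\<lambda>j. d * cnj (w j))" by (auto simp: cline_def)
  have "pairing f (\<rho> (\<lambda>i. 1 * v i)) = pairing (\<lambda>i. c * cnj (v i)) (\<lambda>i. 1 * v i)"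
    using f cline_scale_mem[of 1 v] by blast
  then show "f = (\<lambda>j. c * cnj (w j))"
    unfolding \<rho> d pairing_unit_vector[OF v] pairing_unit_vector[OF w] by simp
qed

definition power_vector :: "nat \<Rightarrow> 'i cvec \<Rightarrow> 'i list cvec" where
  "power_vector m v = (\<lambda>xs. if length xs = m then prod_list (map v xs) else 0)"

lemma prod_nth_eq_prod_list: "(\<Prod>j<length xs. f (xs ! j)) = prod_list (map f xs)"
  for f :: "'i \<Rightarrow> complex"
proof (induction xs)
  case (Cons x xs)
  have "(\<Prod>j<length (x # xs). f ((x # xs) ! j)) = f x * (\<Prod>j<length xs. f (xs ! j))"
    unfolding list.size(4) add_0_right prod.lessThan_Suc_shift One_nat_def add_Suc_right by simp
  then show ?case using Cons by simp
qed simp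

lemma pure_power_scaled:
  assumes "\<forall>j<m. vs j = (\<lambda>i. a j * v i)"
  shows "pure_power m c vs = (\<lambda>xs. (c * (\<Prod>j<m. a j)) * power_vector m v xs)"
proof
  fix xs
  show "pure_power m c vs xs = (c * (\<Prod>j<m. a j)) * power_vector m v xs"
  proof (cases "length xs = m")
    case True
    have "(\<Prod>j<m. vs j (xs ! j)) = (\<Prod>j<m. a j) * (\<Prod>j<m. v (xs ! j))"
      using assms by (simp add: prod.distrib)
    then show ?thesis
      using True prod_nth_eq_prod_list[of v xs] by (simp add: pure_power_def power_vector_def mult.assoc)
  qed (simp add: pure_power_def power_vector_def)
qed

lemma finite_lists_length [simp]: "finite {xs :: ('i::finite) list. length xs = m}"
  using finite_lists_length_eq[of "UNIV :: 'i set" m] by simp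

lemma sum_lists_prod_list:
  "(\<Sum>xs | length xs = m. prod_list (map f xs)) = (\<Sum>i\<in>UNIV. f i) ^ m" for f :: "'i::finite \<Rightarrow> complex"
proof (induction m)
  case (Suc m)
  have lists: "{xs :: 'i list. length xs = Suc m} = (\<lambda>(x, xs). x # xs) ` (UNIV \<times> {xs. length xs = m})"
    by (auto simp: length_Suc_conv)
  have inj: "inj_on (\<lambda>(x, xs). x # xs) (UNIV \<times> {xs :: 'i list. length xs = m})"
    by (auto simp: inj_on_def)
  have "(\<Sum>xs | length xs = Suc m. prod_list (map f xs)) =
      (\<Sum>(x, xs)\<in>UNIV \<times> {xs. length xs = m}. f x * prod_list (map f xs))"
    unfolding lists by (subst sum.reindex[OF inj]) (simp add: case_prod_beta)
  also have "\<dots> = (\<Sum>i\<in>UNIV. f i) * (\<Sum>xs | length xs = m. prod_list (map f xs))"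
    by (simp add: sum_product sum.cartesian_product)
  finally show ?case using Suc by simp
qed simp

lemma unit_vector_power_vector:
  fixes v :: "('i::finite) cvec"
  assumes "unit_vector v"
  shows "unit_vector (power_vector m v)"
proof -
  have "herm (power_vector m v) (power_vector m v) =
      (\<Sum>xs | length xs = m. power_vector m v xs * cnj (power_vector m v xs))"
    by (rule herm_finite_support) (simp_all add: power_vector_def)
  also have "\<dots> = (\<Sum>xs | length xs = m. prod_list (map (\<lambda>i. v i * cnj (v i)) xs))"
  proof (rule sum.cong[OF refl])
    fix xs :: "'i list" assume "xs \<in> {xs. length xs = m}"
    moreover have "prod_list (map v xs) * cnj (prod_list (map v xs)) = prod_list (map (\<lambda>i. v i * cnj (v i)) xs)"
      by (induction xs) (simp_all add: mult_ac)
    ultimately show "power_vector m v xs * cnj (power_vector m v xs) = prod_list (map (\<lambda>i. v i * cnj (v i)) xs)"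
      by (simp add: power_vector_def)
  qed
  also have "\<dots> = 1" using assms by (simp add: sum_lists_prod_list unit_vector_def herm_UNIV)
  finally have "herm (power_vector m v) (power_vector m v) = 1" .
  moreover have "finite {xs. power_vector m v xs \<noteq> 0}"
    by (rule finite_subset[OF _ finite_lists_length[of m]]) (auto simp: power_vector_def)
  ultimately show ?thesis by (simp add: unit_vector_def)
qed

lemma cline_family:
  assumes "\<forall>j<m. vs j \<in> cline v"
  obtains a where "\<forall>j<m. vs j = (\<lambda>i. a j * v i)"
  using assms unfolding cline_def image_iff by (metis (mono_tags, lifting))

lemma tensor_power_cline: "tensor_power m (cline v) = cline (power_vector m v)"
proof
  show "tensor_power m (cline v) \<subseteq> cline (power_vector m v)"
  proof
    fix S assume "S \<in> tensor_power m (cline v)"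
    then obtain c vs where S: "S = pure_power m c vs" and "\<forall>j<m. vs j \<in> cline v"
      unfolding tensor_power_def by blast
    then obtain a where "\<forall>j<m. vs j = (\<lambda>i. a j * v i)" using cline_family by blast
    then show "S \<in> cline (power_vector m v)" unfolding S by (simp only: pure_power_scaled cline_scale_mem)
  qed
  show "cline (power_vector m v) \<subseteq> tensor_power m (cline v)"
  proof
    fix S assume "S \<in> cline (power_vector m v)"
    then obtain c where "S = (\<lambda>xs. c * power_vector m v xs)" by (auto simp: cline_def)
    then have "S = pure_power m c (\<lambda>_. v)" using pure_power_scaled[of m "\<lambda>_. v" "\<lambda>_. 1" v c] by simp
    then show "S \<in> tensor_power m (cline v)"
      unfolding tensor_power_def by (intro CollectI exI[of _ c] exI[of _ "\<lambda>_. v"]) simp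
  qed
qed

lemma tensor_power_map_cline:
  fixes v :: "('i::finite) cvec"
  assumes v: "unit_vector v" and \<rho>: "\<And>c. \<rho> (\<lambda>i. c * v i) = (\<lambda>j. c * w j)"
  shows "tensor_power_map m \<rho> (cline v) (\<lambda>xs. c * power_vector m v xs) = (\<lambda>xs. c * power_vector m w xs)"
  unfolding tensor_power_map_def
proof (rule the_equality)
  show "\<exists>c' vs. (\<forall>j<m. vs j \<in> cline v) \<and> (\<lambda>xs. c * power_vector m v xs) = pure_power m c' vs \<and>
      (\<lambda>xs. c * power_vector m w xs) = pure_power m c' (\<lambda>j. \<rho> (vs j))"
    using pure_power_scaled[of m "\<lambda>_. v" "\<lambda>_. 1" v c] pure_power_scaled[of m "\<lambda>_. \<rho> v" "\<lambda>_. 1" w c] \<rho>[of 1]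
    by (intro exI[of _ c] exI[of _ "\<lambda>_. v"]) simp
  fix S' assume "\<exists>c' vs. (\<forall>j<m. vs j \<in> cline v) \<and> (\<lambda>xs. c * power_vector m v xs) = pure_power m c' vs \<and>
      S' = pure_power m c' (\<lambda>j. \<rho> (vs j))"
  then obtain c' vs where vs: "\<forall>j<m. vs j \<in> cline v"
    and S: "(\<lambda>xs. c * power_vector m v xs) = pure_power m c' vs" and S': "S' = pure_power m c' (\<lambda>j. \<rho> (vs j))"
    by blast
  obtain a where a: "\<forall>j<m. vs j = (\<lambda>i. a j * v i)" using cline_family[OF vs] by blast
  have "c = c' * (\<Prod>j<m. a j)"
    using S unfolding pure_power_scaled[OF a] unit_vector_scale_inject[OF unit_vector_power_vector[OF v]] .
  moreover have "\<forall>j<m. \<rho> (vs j) = (\<lambda>i. a j * w i)" using a \<rho> by simp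
  ultimately show "S' = (\<lambda>xs. c * power_vector m w xs)" unfolding S' by (simp add: pure_power_scaled)
qed

text \<open>The frame \<open>v\<^sup>a\<close> of \<open>l\<^sup>a\<close>; the dual vector of a unit vector has conjugate coordinates.\<close>

definition int_power_vector :: "int \<Rightarrow> 'i cvec \<Rightarrow> 'i list cvec" where
  "int_power_vector a v = power_vector (nat \<bar>a\<bar>) (if a \<ge> 0 then v else (\<lambda>i. cnj (v i)))"

lemma unit_vector_int_power_vector:
  "unit_vector v \<Longrightarrow> unit_vector (int_power_vector a v)" for v :: "('i::finite) cvec"
  by (simp add: int_power_vector_def unit_vector_power_vector unit_vector_cnj)

lemma line_power_cline:
  "unit_vector v \<Longrightarrow> line_power a (cline v) = cline (int_power_vector a v)" for v :: "('i::finite) cvec"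
  by (simp add: line_power_def int_power_vector_def tensor_power_cline dual_line_cline)

lemma line_power_map_cline:
  fixes v :: "('i::finite) cvec" and w :: "('j::finite) cvec"
  assumes v: "unit_vector v" and w: "unit_vector w" and \<rho>: "\<And>c. \<rho> (\<lambda>i. c * v i) = (\<lambda>j. c * w j)"
  shows "line_power_map a \<rho> (cline v) (cline w) (\<lambda>xs. c * int_power_vector a v xs) =
    (\<lambda>xs. c * int_power_vector a w xs)"
proof (cases "a \<ge> 0")
  case True
  then show ?thesis
    using tensor_power_map_cline[of v \<rho> w "nat a" c, OF v \<rho>]
    by (simp add: line_power_map_def int_power_vector_def)
next
  case False
  then show ?thesis
    using tensor_power_map_cline[of "\<lambda>i. cnj (v i)" "dual_map \<rho> (cline v) (cline w)" "\<lambda>j. cnj (w j)" "nat (- a)" c,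
        OF unit_vector_cnj[OF v] dual_map_cline[of v w \<rho>, OF v w \<rho>]]
    by (simp add: line_power_map_def int_power_vector_def dual_line_cline[OF v])
qed

lemma line_power_mult_same_sign:
  assumes "a * b \<ge> 0"
  shows "line_power_mult a b (\<lambda>xs. c * int_power_vector a v xs) (\<lambda>xs. d * int_power_vector b v xs) =
    (\<lambda>xs. c * d * int_power_vector (a + b) v xs)"
proof
  fix xs
  have len: "nat \<bar>a + b\<bar> = nat \<bar>a\<bar> + nat \<bar>b\<bar>"
    using assms by (auto simp: zero_le_mult_iff)
  have product: "int_power_vector a v (take (nat \<bar>a\<bar>) xs) * int_power_vector b v (drop (nat \<bar>a\<bar>) xs) =
      int_power_vector (a + b) v xs" if xs: "length xs = nat \<bar>a + b\<bar>"
  proof -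
    let ?t = "take (nat \<bar>a\<bar>) xs" and ?d = "drop (nat \<bar>a\<bar>) xs"
    have l: "length ?t = nat \<bar>a\<bar>" "length ?d = nat \<bar>b\<bar>" using xs len by simp_all
    have *: "int_power_vector a v ?t = prod_list (map (if a \<ge> 0 then v else (\<lambda>i. cnj (v i))) ?t)"
      "int_power_vector b v ?d = prod_list (map (if b \<ge> 0 then v else (\<lambda>i. cnj (v i))) ?d)"
      "int_power_vector (a + b) v xs = prod_list (map (if a + b \<ge> 0 then v else (\<lambda>i. cnj (v i))) (?t @ ?d))"
      using l xs by (simp_all add: int_power_vector_def power_vector_def)
    consider "a = 0" | "b = 0" | "a > 0" "b > 0" | "a < 0" "b < 0"
      using assms by (force simp: zero_le_mult_iff)
    then show ?thesis
    proof cases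
      case 1
      then show ?thesis using l(1) unfolding * by simp
    next
      case 2
      then have "?d = []" using l(2) by simp
      then show ?thesis unfolding * using 2 by simp
    next
      case 3
      then show ?thesis unfolding * map_append prod_list.append by simp
    next
      case 4
      then show ?thesis unfolding * map_append prod_list.append by simp
    qed
  qed
  show "line_power_mult a b (\<lambda>xs. c * int_power_vector a v xs) (\<lambda>xs. d * int_power_vector b v xs) xs =
      c * d * int_power_vector (a + b) v xs"
  proof (cases "length xs = nat \<bar>a + b\<bar>")
    case True
    have nil: "{ys :: 'a list. length ys = 0} = {[]}" by auto
    have "line_power_mult a b (\<lambda>xs. c * int_power_vector a v xs) (\<lambda>xs. d * int_power_vector b v xs) xs =
        (\<Sum>ys\<in>{ys. length ys = 0}. c * int_power_vector a v (take (nat \<bar>a\<bar>) xs @ ys) *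
          (d * int_power_vector b v (ys @ drop (nat \<bar>a\<bar>) xs)))"
      unfolding line_power_mult_def Let_def if_P[OF True] using assms by simp
    also have "\<dots> = c * d * (int_power_vector a v (take (nat \<bar>a\<bar>) xs) * int_power_vector b v (drop (nat \<bar>a\<bar>) xs))"
      unfolding nil by simp
    finally show ?thesis unfolding product[OF True] .
  next
    case False
    then show ?thesis by (simp add: line_power_mult_def Let_def int_power_vector_def power_vector_def)
  qed
qed

text \<open>The \<open>r\<close> contracted pairs of factors \<open>v\<close>, \<open>v\<^sup>*\<close> contribute \<open>(herm v v)\<^sup>r = 1\<close>; the factors that remain
  all come from the longer of the two tensors.\<close>

lemma line_power_mult_opposite_sign:
  fixes v :: "('i::finite) cvec"
  assumes v: "unit_vector v" and ab: "a * b < 0"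
  shows "line_power_mult a b (\<lambda>xs. c * int_power_vector a v xs) (\<lambda>xs. d * int_power_vector b v xs) =
    (\<lambda>xs. c * d * int_power_vector (a + b) v xs)"
proof
  fix xs :: "'i list"
  define fa where "fa = (if a \<ge> 0 then v else (\<lambda>i. cnj (v i)))"
  define fb where "fb = (if b \<ge> 0 then v else (\<lambda>i. cnj (v i)))"
  define p where "p = nat \<bar>a\<bar>"
  define q where "q = nat \<bar>b\<bar>"
  define r where "r = min p q"
  have rp: "r \<le> p" "r \<le> q" by (simp_all add: r_def)
  have len: "nat \<bar>a + b\<bar> = (p - r) + (q - r)"
  proof -
    have "a = int p \<and> b = - int q \<or> a = - int p \<and> b = int q"
      using ab by (auto simp: p_def q_def mult_less_0_iff)
    then have "\<bar>a + b\<bar> = \<bar>int p - int q\<bar>" by auto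
    also have "\<dots> = int ((p - r) + (q - r))"
      by (cases "p \<le> q") (simp_all add: r_def of_nat_diff)
    finally show ?thesis by simp
  qed
  show "line_power_mult a b (\<lambda>xs. c * int_power_vector a v xs) (\<lambda>xs. d * int_power_vector b v xs) xs =
      c * d * int_power_vector (a + b) v xs"
  proof (cases "length xs = nat \<bar>a + b\<bar>")
    case True
    let ?t = "take (p - r) xs" and ?d = "drop (p - r) xs"
    have l: "length ?t = p - r" "length ?d = q - r" using True len by simp_all
    have fafb: "fa i * fb i = v i * cnj (v i)" for i
      using ab by (auto simp: fa_def fb_def mult_less_0_iff mult.commute)
    have "prod_list (map fa ys) * prod_list (map fb ys) = prod_list (map (\<lambda>i. v i * cnj (v i)) ys)" for ys
    proof (induction ys)
      case (Cons y ys)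
      have "prod_list (map fa (y # ys)) * prod_list (map fb (y # ys)) =
          (fa y * fb y) * (prod_list (map fa ys) * prod_list (map fb ys))" by (simp add: mult_ac)
      then show ?case unfolding Cons.IH fafb by simp
    qed simp
    then have contract: "(\<Sum>ys | length ys = r. prod_list (map fa ys) * prod_list (map fb ys)) = 1"
      using v by (simp add: sum_lists_prod_list unit_vector_def herm_UNIV)
    have "line_power_mult a b (\<lambda>xs. c * int_power_vector a v xs) (\<lambda>xs. d * int_power_vector b v xs) xs =
        (\<Sum>ys | length ys = r. c * int_power_vector a v (?t @ ys) * (d * int_power_vector b v (ys @ ?d)))"
    proof -
      have r: "(if a * b < 0 then min (nat \<bar>a\<bar>) (nat \<bar>b\<bar>) else 0) = r"
        using ab by (simp add: r_def p_def q_def)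
      show ?thesis
        unfolding line_power_mult_def Let_def if_P[OF True] unfolding r unfolding p_def[symmetric] ..
    qed
    also have "\<dots> = (\<Sum>ys | length ys = r. c * d * prod_list (map fa ?t) * prod_list (map fb ?d) *
        (prod_list (map fa ys) * prod_list (map fb ys)))"
    proof (rule sum.cong[OF refl])
      fix ys :: "'i list" assume "ys \<in> {ys. length ys = r}"
      then have "length ys = r" by simp
      then have lt: "length (?t @ ys) = p" and ld: "length (ys @ ?d) = q"
        unfolding length_append l using rp by simp_all
      have "int_power_vector a v (?t @ ys) = prod_list (map fa ?t) * prod_list (map fa ys)"
        "int_power_vector b v (ys @ ?d) = prod_list (map fb ys) * prod_list (map fb ?d)"
        unfolding int_power_vector_def power_vector_def p_def[symmetric] q_def[symmetric]
          fa_def[symmetric] fb_def[symmetric] if_P[OF lt] if_P[OF ld] by simp_all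
      then show "c * int_power_vector a v (?t @ ys) * (d * int_power_vector b v (ys @ ?d)) =
          c * d * prod_list (map fa ?t) * prod_list (map fb ?d) * (prod_list (map fa ys) * prod_list (map fb ys))"
        by simp
    qed
    also have "\<dots> = c * d * (prod_list (map fa ?t) * prod_list (map fb ?d))"
      unfolding sum_distrib_left[symmetric] contract by simp
    also have "prod_list (map fa ?t) * prod_list (map fb ?d) = int_power_vector (a + b) v xs"
    proof -
      have ipv: "int_power_vector (a + b) v xs = prod_list (map (if a + b \<ge> 0 then v else (\<lambda>i. cnj (v i))) xs)"
        using True by (simp add: int_power_vector_def power_vector_def)
      consider "p = q" | "q < p" | "p < q" by linarith
      then show ?thesis
      proof cases
        case 1
        then have "xs = []" using True len by (simp add: r_def)
        then show ?thesis unfolding ipv by simp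
      next
        case 2
        then have "?t = xs" "?d = []" using True len by (simp_all add: r_def)
        moreover have "(a + b \<ge> 0) = (a \<ge> 0)" using 2 ab by (auto simp: p_def q_def mult_less_0_iff)
        ultimately show ?thesis unfolding ipv by (simp add: fa_def)
      next
        case 3
        then have t: "?t = []" and d: "?d = xs" by (simp_all add: r_def)
        have "(a + b \<ge> 0) = (b \<ge> 0)" using 3 ab by (auto simp: p_def q_def mult_less_0_iff)
        then show ?thesis unfolding ipv t d by (simp add: fb_def)
      qed
    qed
    finally show ?thesis .
  next
    case False
    then show ?thesis by (simp add: line_power_mult_def Let_def int_power_vector_def power_vector_def)
  qed
qed

lemma line_power_mult_frame:
  fixes v :: "('i::finite) cvec"
  assumes "unit_vector v"
  shows "line_power_mult a b (\<lambda>xs. c * int_power_vector a v xs) (\<lambda>xs. d * int_power_vector b v xs) =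
    (\<lambda>xs. c * d * int_power_vector (a + b) v xs)"
  using line_power_mult_same_sign line_power_mult_opposite_sign[OF assms] by (metis linorder_not_le)

lemma int_power_vector_scale:
  assumes "a \<in> {-1, 0, 1}"
  shows "int_power_vector a (\<lambda>i. c * v i) =
    (\<lambda>xs. (if a = 1 then c else if a = - 1 then cnj c else 1) * int_power_vector a v xs)"
proof -
  have one: "power_vector 1 (\<lambda>i. c * v i) = (\<lambda>xs. c * power_vector 1 v xs)" for c :: complex and v :: "'i cvec"
  proof
    show "power_vector 1 (\<lambda>i. c * v i) xs = c * power_vector 1 v xs" for xs
      by (cases xs) (auto simp: power_vector_def)
  qed
  consider "a = 0" | "a = 1" | "a = - 1" using assms by blast
  then show ?thesis
  proof cases
    case 1
    then show ?thesis by (auto simp: int_power_vector_def power_vector_def)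
  next
    case 2
    then show ?thesis using one[of c v] by (simp add: int_power_vector_def)
  next
    case 3
    then show ?thesis using one[of "cnj c" "\<lambda>i. cnj (v i)"] by (simp add: int_power_vector_def)
  qed
qed

lemma pure_tensor_scale: "pure_tensor (\<lambda>i j. c i * v i j) = (\<lambda>\<sigma>. (\<Prod>i\<in>UNIV. c i) * pure_tensor v \<sigma>)"
  by (simp add: pure_tensor_def prod.distrib)

lemma herm_pure_tensor:
  assumes "\<And>i. finite {j. v i j \<noteq> 0}"
  shows "herm (pure_tensor v) (pure_tensor w) = (\<Prod>i\<in>UNIV. herm (v i) (w i))"
proof -
  have "herm (pure_tensor v) (pure_tensor w) =
      (\<Sum>\<sigma>\<in>PiE UNIV (\<lambda>i. {j. v i j \<noteq> 0}). pure_tensor v \<sigma> * cnj (pure_tensor w \<sigma>))"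
    by (rule herm_finite_support) (auto simp: assms pure_tensor_def intro!: finite_PiE)
  also have "\<dots> = (\<Sum>\<sigma>\<in>PiE UNIV (\<lambda>i. {j. v i j \<noteq> 0}). \<Prod>i\<in>UNIV. v i (\<sigma> i) * cnj (w i (\<sigma> i)))"
    by (simp add: pure_tensor_def cnj_prod prod.distrib)
  also have "\<dots> = (\<Prod>i\<in>UNIV. \<Sum>j | v i j \<noteq> 0. v i j * cnj (w i j))"
    by (rule prod_sum_PiE[symmetric]) (simp_all add: assms)
  finally show ?thesis by (simp add: herm_def)
qed

lemma unit_vector_pure_tensor:
  assumes "\<And>i. unit_vector (v i)"
  shows "unit_vector (pure_tensor v)"
proof -
  have "finite {\<sigma>. pure_tensor v \<sigma> \<noteq> 0}"
    by (rule finite_subset[of _ "PiE UNIV (\<lambda>i. {j. v i j \<noteq> 0})"])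
       (use assms in \<open>auto simp: pure_tensor_def unit_vector_def intro!: finite_PiE\<close>)
  then show ?thesis using assms by (simp add: unit_vector_def herm_pure_tensor)
qed

lemma pure_tensor_family:
  assumes "\<forall>i. v i \<in> cline (e i)"
  obtains c where "v = (\<lambda>i j. c i * e i j)"
  using assms unfolding cline_def image_iff by (metis (mono_tags, lifting) ext)

text \<open>The scalar is absorbed into an arbitrarily chosen factor; the index type is nonempty.\<close>

lemma pure_tensor_realize:
  fixes e :: "'n::finite \<Rightarrow> 'j cvec"
  shows "\<exists>c. (\<lambda>\<sigma>. a * pure_tensor e \<sigma>) = pure_tensor (\<lambda>i j. c i * e i j) \<and> (\<Prod>i\<in>UNIV. c i) = a"
proof (intro exI conjI)
  show *: "(\<Prod>i\<in>UNIV. if i = (SOME i :: 'n. True) then a else 1) = a" by simp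
  show "(\<lambda>\<sigma>. a * pure_tensor e \<sigma>) =
      pure_tensor (\<lambda>i j. (if i = (SOME i. True) then a else 1) * e i j)"
    unfolding pure_tensor_scale * ..
qed

lemma pure_tensors_cline:
  fixes e :: "'n::finite \<Rightarrow> 'j cvec"
  shows "{pure_tensor v | v. \<forall>i. v i \<in> cline (e i)} = cline (pure_tensor e)"
proof
  show "{pure_tensor v | v. \<forall>i. v i \<in> cline (e i)} \<subseteq> cline (pure_tensor e)"
  proof
    fix p assume "p \<in> {pure_tensor v | v. \<forall>i. v i \<in> cline (e i)}"
    then obtain v where p: "p = pure_tensor v" and "\<forall>i. v i \<in> cline (e i)" by blast
    then obtain c where "v = (\<lambda>i j. c i * e i j)" using pure_tensor_family by blast
    then show "p \<in> cline (pure_tensor e)" unfolding p by (simp only: pure_tensor_scale cline_scale_mem)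
  qed
  show "cline (pure_tensor e) \<subseteq> {pure_tensor v | v. \<forall>i. v i \<in> cline (e i)}"
  proof
    fix p assume "p \<in> cline (pure_tensor e)"
    then obtain a where "p = (\<lambda>\<sigma>. a * pure_tensor e \<sigma>)" by (auto simp: cline_def)
    then obtain c where "p = pure_tensor (\<lambda>i j. c i * e i j)"
      using pure_tensor_realize[of a e] by auto
    then show "p \<in> {pure_tensor v | v. \<forall>i. v i \<in> cline (e i)}"
      by (intro CollectI exI[of _ "\<lambda>i j. c i * e i j"]) simp
  qed
qed

lemma reduced_product_fibre:
  assumes "\<And>i. fibre (B i) y1 y2 = cline (e i)"
  shows "fibre (reduced_product B) y1 y2 = cline (pure_tensor e)"
  using pure_tensors_cline[of e] by (simp add: reduced_product_def Let_def assms)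

text \<open>The definite description is determined because the scalar in front of a nonzero pure tensor is: how it is
  distributed over the factors does not change the product.\<close>

lemma reduced_product_mult:
  assumes e: "\<And>i. fibre (B i) y1 y2 = cline (e i)" "\<And>i. unit_vector (e i)"
    and e': "\<And>i. fibre (B i) y2 y3 = cline (e' i)" "\<And>i. unit_vector (e' i)"
    and mult: "\<And>i c d. mult (B i) y1 y2 y3 (\<lambda>j. c * e i j) (\<lambda>j. d * e' i j) = (\<lambda>j. c * d * e'' i j)"
  shows "mult (reduced_product B) y1 y2 y3 (\<lambda>\<sigma>. a * pure_tensor e \<sigma>) (\<lambda>\<sigma>. b * pure_tensor e' \<sigma>) =
    (\<lambda>\<sigma>. a * b * pure_tensor e'' \<sigma>)"
proof -
  have key: "pure_tensor (\<lambda>i. mult (B i) y1 y2 y3 (\<lambda>j. c i * e i j) (\<lambda>j. d i * e' i j)) =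
      (\<lambda>\<sigma>. (\<Prod>i\<in>UNIV. c i) * (\<Prod>i\<in>UNIV. d i) * pure_tensor e'' \<sigma>)" for c d
    unfolding mult pure_tensor_scale prod.distrib ..
  have "(THE r. \<exists>v w. (\<forall>i. v i \<in> fibre (B i) y1 y2 \<and> w i \<in> fibre (B i) y2 y3) \<and>
       (\<lambda>\<sigma>. a * pure_tensor e \<sigma>) = pure_tensor v \<and> (\<lambda>\<sigma>. b * pure_tensor e' \<sigma>) = pure_tensor w \<and>
       r = pure_tensor (\<lambda>i. mult (B i) y1 y2 y3 (v i) (w i))) = (\<lambda>\<sigma>. a * b * pure_tensor e'' \<sigma>)"
  proof (rule the_equality)
    obtain c where c: "(\<lambda>\<sigma>. a * pure_tensor e \<sigma>) = pure_tensor (\<lambda>i j. c i * e i j)" "(\<Prod>i\<in>UNIV. c i) = a"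
      using pure_tensor_realize[of a e] by (elim exE conjE)
    obtain d where d: "(\<lambda>\<sigma>. b * pure_tensor e' \<sigma>) = pure_tensor (\<lambda>i j. d i * e' i j)" "(\<Prod>i\<in>UNIV. d i) = b"
      using pure_tensor_realize[of b e'] by (elim exE conjE)
    have "(\<lambda>\<sigma>. a * b * pure_tensor e'' \<sigma>) =
        pure_tensor (\<lambda>i. mult (B i) y1 y2 y3 (\<lambda>j. c i * e i j) (\<lambda>j. d i * e' i j))"
      unfolding key c(2) d(2) ..
    then show "\<exists>v w. (\<forall>i. v i \<in> fibre (B i) y1 y2 \<and> w i \<in> fibre (B i) y2 y3) \<and>
       (\<lambda>\<sigma>. a * pure_tensor e \<sigma>) = pure_tensor v \<and> (\<lambda>\<sigma>. b * pure_tensor e' \<sigma>) = pure_tensor w \<and>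
       (\<lambda>\<sigma>. a * b * pure_tensor e'' \<sigma>) = pure_tensor (\<lambda>i. mult (B i) y1 y2 y3 (v i) (w i))"
      by (intro exI[of _ "\<lambda>i j. c i * e i j"] exI[of _ "\<lambda>i j. d i * e' i j"] conjI allI)
         (simp_all only: e(1) e'(1) cline_scale_mem c(1) d(1))
  next
    fix r assume "\<exists>v w. (\<forall>i. v i \<in> fibre (B i) y1 y2 \<and> w i \<in> fibre (B i) y2 y3) \<and>
       (\<lambda>\<sigma>. a * pure_tensor e \<sigma>) = pure_tensor v \<and> (\<lambda>\<sigma>. b * pure_tensor e' \<sigma>) = pure_tensor w \<and>
       r = pure_tensor (\<lambda>i. mult (B i) y1 y2 y3 (v i) (w i))"
    then obtain v w where v: "\<forall>i. v i \<in> cline (e i)" and w: "\<forall>i. w i \<in> cline (e' i)"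
      and eqs: "(\<lambda>\<sigma>. a * pure_tensor e \<sigma>) = pure_tensor v" "(\<lambda>\<sigma>. b * pure_tensor e' \<sigma>) = pure_tensor w"
      and r: "r = pure_tensor (\<lambda>i. mult (B i) y1 y2 y3 (v i) (w i))"
      unfolding e(1) e'(1) by blast
    obtain c where c: "v = (\<lambda>i j. c i * e i j)" using pure_tensor_family[OF v] .
    obtain d where d: "w = (\<lambda>i j. d i * e' i j)" using pure_tensor_family[OF w] .
    have "a = (\<Prod>i\<in>UNIV. c i)"
      using eqs(1) unfolding c pure_tensor_scale unit_vector_scale_inject[OF unit_vector_pure_tensor[of e, OF e(2)]] .
    moreover have "b = (\<Prod>i\<in>UNIV. d i)"
      using eqs(2) unfolding d pure_tensor_scale unit_vector_scale_inject[OF unit_vector_pure_tensor[of e', OF e'(2)]] .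
    ultimately show "r = (\<lambda>\<sigma>. a * b * pure_tensor e'' \<sigma>)" unfolding r c d key by simp
  qed
  then show ?thesis by (simp add: reduced_product_def Let_def)
qed

lemma reduced_product_act:
  assumes e: "\<And>i. fibre (B i) y1 y2 = cline (e i)" "\<And>i. unit_vector (e i)"
    and act: "\<And>i c. act_fibre (B i) h y1 y2 (\<lambda>j. c * e i j) = (\<lambda>j. c * e' i j)"
  shows "act_fibre (reduced_product B) h y1 y2 (\<lambda>\<sigma>. a * pure_tensor e \<sigma>) = (\<lambda>\<sigma>. a * pure_tensor e' \<sigma>)"
proof -
  have key: "pure_tensor (\<lambda>i. act_fibre (B i) h y1 y2 (\<lambda>j. c i * e i j)) =
      (\<lambda>\<sigma>. (\<Prod>i\<in>UNIV. c i) * pure_tensor e' \<sigma>)" for c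
    unfolding act pure_tensor_scale ..
  have "(THE r. \<exists>v. (\<forall>i. v i \<in> fibre (B i) y1 y2) \<and> (\<lambda>\<sigma>. a * pure_tensor e \<sigma>) = pure_tensor v \<and>
       r = pure_tensor (\<lambda>i. act_fibre (B i) h y1 y2 (v i))) = (\<lambda>\<sigma>. a * pure_tensor e' \<sigma>)"
  proof (rule the_equality)
    obtain c where c: "(\<lambda>\<sigma>. a * pure_tensor e \<sigma>) = pure_tensor (\<lambda>i j. c i * e i j)" "(\<Prod>i\<in>UNIV. c i) = a"
      using pure_tensor_realize[of a e] by (elim exE conjE)
    have "(\<lambda>\<sigma>. a * pure_tensor e' \<sigma>) = pure_tensor (\<lambda>i. act_fibre (B i) h y1 y2 (\<lambda>j. c i * e i j))"
      unfolding key c(2) ..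
    then show "\<exists>v. (\<forall>i. v i \<in> fibre (B i) y1 y2) \<and> (\<lambda>\<sigma>. a * pure_tensor e \<sigma>) = pure_tensor v \<and>
       (\<lambda>\<sigma>. a * pure_tensor e' \<sigma>) = pure_tensor (\<lambda>i. act_fibre (B i) h y1 y2 (v i))"
      by (intro exI[of _ "\<lambda>i j. c i * e i j"] conjI allI) (simp_all only: e(1) cline_scale_mem c(1))
  next
    fix r assume "\<exists>v. (\<forall>i. v i \<in> fibre (B i) y1 y2) \<and> (\<lambda>\<sigma>. a * pure_tensor e \<sigma>) = pure_tensor v \<and>
       r = pure_tensor (\<lambda>i. act_fibre (B i) h y1 y2 (v i))"
    then obtain v where v: "\<forall>i. v i \<in> cline (e i)" and eq: "(\<lambda>\<sigma>. a * pure_tensor e \<sigma>) = pure_tensor v"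
      and r: "r = pure_tensor (\<lambda>i. act_fibre (B i) h y1 y2 (v i))"
      unfolding e(1) by blast
    obtain c where c: "v = (\<lambda>i j. c i * e i j)" using pure_tensor_family[OF v] .
    have "a = (\<Prod>i\<in>UNIV. c i)"
      using eq unfolding c pure_tensor_scale unit_vector_scale_inject[OF unit_vector_pure_tensor[of e, OF e(2)]] .
    then show "r = (\<lambda>\<sigma>. a * pure_tensor e' \<sigma>)" unfolding r c key by simp
  qed
  then show ?thesis by (simp add: reduced_product_def Let_def)
qed

section \<open>The Weyl map\<close>

lemma adj_mult: "adj (g ** h) = adj h ** adj g" for g h :: "('n::finite) cmat"
  by (simp add: adj_def matrix_matrix_mult_def vec_eq_iff cnj_sum mult.commute)

lemma adj_adj [simp]: "adj (adj g) = g"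
  by (simp add: adj_def vec_eq_iff)

lemma adj_one [simp]: "adj (mat 1) = mat 1"
  by (simp add: adj_def mat_def vec_eq_iff)

lemma det_adj: "det (adj g) = cnj (det g)" for g :: "('n::finite) cmat"
proof -
  have "det (adj g) = det (transpose (\<chi> i j. cnj (g $ i $ j)))"
    by (simp add: adj_def transpose_def)
  also have "\<dots> = cnj (det g)"
    by (simp add: det_transpose) (simp add: det_def cnj_sum cnj_prod)
  finally show ?thesis .
qed

lemma SU_unitary: "g \<in> SU \<Longrightarrow> unitary g"
  by (simp add: SU_def unitary_def)

lemma SU_left_inverse: "g \<in> SU \<Longrightarrow> adj g ** g = mat 1"
  by (simp add: SU_def)

lemma SU_right_inverse: "g \<in> SU \<Longrightarrow> g ** adj g = mat 1"
  by (rule unitary_right[OF SU_unitary])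

lemma one_in_SU: "mat 1 \<in> SU"
  by (simp add: SU_def)

lemma mult_in_SU: "g \<in> SU \<Longrightarrow> h \<in> SU \<Longrightarrow> g ** h \<in> SU"
  by (auto simp: SU_def adj_mult det_mul) (metis matrix_mul_assoc matrix_mul_lid)

lemma adj_in_SU: "g \<in> SU \<Longrightarrow> adj g \<in> SU"
  using SU_right_inverse by (auto simp: SU_def det_adj)

lemma torus_SU: "t \<in> torus \<Longrightarrow> t \<in> SU"
  by (simp add: torus_def)

lemma torus_mult_entry:
  "s \<in> torus \<Longrightarrow> (s ** g) $ i $ j = s $ i $ i * g $ i $ j"
proof -
  assume s: "s \<in> torus"
  have "(s ** g) $ i $ j = (\<Sum>k\<in>UNIV. s $ i $ k * g $ k $ j)" by (simp add: matrix_matrix_mult_def)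
  also have "\<dots> = (\<Sum>k\<in>UNIV. if k = i then s $ i $ i * g $ i $ j else 0)"
    by (rule sum.cong) (use s in \<open>auto simp: torus_def\<close>)
  finally show ?thesis by simp
qed

lemma torus_commute:
  assumes "s \<in> torus" and "t \<in> torus"
  shows "s ** t = t ** s"
proof -
  have "s $ i $ i * t $ i $ j = t $ i $ i * s $ i $ j" for i j
    using assms by (cases "i = j") (simp_all add: torus_def)
  then show ?thesis by (simp add: vec_eq_iff torus_mult_entry assms)
qed

lemma one_in_torus: "(mat 1 :: ('n::finite) cmat) \<in> torus"
proof -
  have "(mat 1 :: complex ^ 'n ^ 'n) $ i $ j = 0" if "i \<noteq> j" for i j :: "'n::finite"
    using that by (simp add: mat_def)
  then show "(mat 1 :: complex ^ 'n ^ 'n) \<in> torus" by (simp add: torus_def one_in_SU)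
qed

lemma mult_in_torus:
  assumes "s \<in> torus" and "t \<in> torus"
  shows "s ** t \<in> torus"
  using assms mult_in_SU[of s t] torus_mult_entry[OF assms(1), of t] by (auto simp: torus_def)

lemma adj_in_torus: "t \<in> torus \<Longrightarrow> adj t \<in> torus"
  using adj_in_SU by (auto simp: torus_def adj_def)

lemma torus_entry_norm:
  assumes "t \<in> torus"
  shows "cmod (t $ i $ i) = 1"
proof -
  have "(adj t ** t) $ i $ i = 1" using SU_left_inverse[OF torus_SU[OF assms]] by (simp add: mat_def)
  then have "cnj (t $ i $ i) * t $ i $ i = 1"
    using torus_mult_entry[OF adj_in_torus[OF assms], of t i i] by (simp add: adj_def)
  then have "(cmod (t $ i $ i))\<^sup>2 = 1"
    by (metis complex_norm_square mult.commute of_real_eq_1_iff)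
  then show ?thesis by (simp add: power2_eq_1_iff) (metis norm_not_less_zero neg_less_0_iff_less zero_less_one)
qed

lemma torus_column: "t \<in> torus \<Longrightarrow> t *v axis i 1 = t $ i $ i *s axis i 1"
  unfolding vec_eq_iff column_entry by (auto simp: torus_def axis_def)

lemma coset_self: "g \<in> coset g"
  using one_in_torus by (auto simp: coset_def intro!: exI[of _ "mat 1"])

lemma coset_SU: "g \<in> SU \<Longrightarrow> x \<in> coset g \<Longrightarrow> x \<in> SU"
  by (auto simp: coset_def mult_in_SU torus_SU)

lemma coset_eq:
  assumes "x \<in> coset g"
  shows "coset x = coset g"
proof -
  obtain t where t: "t \<in> torus" "x = g ** t" using assms by (auto simp: coset_def)
  have g_eq: "g = x ** adj t"
    by (simp add: t(2) matrix_mul_assoc[symmetric] SU_right_inverse[OF torus_SU[OF t(1)]])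
  show ?thesis
  proof
    show "coset x \<subseteq> coset g"
    proof
      fix y assume "y \<in> coset x"
      then obtain s where s: "s \<in> torus" "y = x ** s" by (auto simp: coset_def)
      then have "y = g ** (t ** s)" by (simp add: t(2) matrix_mul_assoc)
      then show "y \<in> coset g" using mult_in_torus[OF t(1) s(1)] by (auto simp: coset_def)
    qed
    show "coset g \<subseteq> coset x"
    proof
      fix y assume "y \<in> coset g"
      then obtain s where s: "s \<in> torus" "y = g ** s" by (auto simp: coset_def)
      have "y = x ** (adj t ** s)" unfolding s(2) by (subst g_eq) (simp add: matrix_mul_assoc)
      then show "y \<in> coset x" using mult_in_torus[OF adj_in_torus[OF t(1)] s(1)] by (auto simp: coset_def)
    qed
  qed
qed

lemma coset_image: "(\<lambda>x. h ** x) ` coset g = coset (h ** g)"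
  by (auto simp: coset_def image_iff matrix_mul_assoc) (metis matrix_mul_assoc)

lemma points_flag_space [simp]: "points flag_space = coset ` SU"
  by (simp add: flag_space_def)

lemma points_weyl_domain [simp]: "points weyl_domain = torus \<times> coset ` SU"
  by (simp add: weyl_domain_def)

lemma flag_point:
  assumes "C \<in> coset ` SU" and "g \<in> C"
  shows "g \<in> SU" and "C = coset g"
proof -
  obtain x where x: "x \<in> SU" "C = coset x" using assms(1) by blast
  then show "g \<in> SU" using coset_SU[OF x(1)] assms(2) by simp
  show "C = coset g" using coset_eq[of g x] assms(2) x(2) by simp
qed

text \<open>The representative does not matter since the torus is commutative.\<close>

lemma weyl_map_eq:
  assumes t: "t \<in> torus" and C: "C \<in> coset ` SU" "g \<in> C"
  shows "weyl_map (t, C) = g ** t ** adj g"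
proof -
  have "(THE x. \<exists>g\<in>C. x = g ** t ** adj g) = g ** t ** adj g"
  proof (rule the_equality)
    show "\<exists>g'\<in>C. g ** t ** adj g = g' ** t ** adj g'" using C(2) by blast
    fix x assume "\<exists>g'\<in>C. x = g' ** t ** adj g'"
    then obtain s where s: "s \<in> torus" "x = (g ** s) ** t ** adj (g ** s)"
      using flag_point[OF C] by (auto simp: coset_def)
    have "s ** t ** adj s = t"
      unfolding torus_commute[OF s(1) t] matrix_mul_assoc[symmetric] SU_right_inverse[OF torus_SU[OF s(1)]]
      by simp
    then show "x = g ** t ** adj g"
      unfolding s(2) adj_mult by (metis matrix_mul_assoc)
  qed
  then show ?thesis by (simp add: weyl_map_def)
qed

lemma matrix_vector_expand: "g *v w = (\<Sum>i\<in>UNIV. w $ i *s (g *v axis i 1))" for g :: "('n::finite) cmat"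
  by (simp add: vec_eq_iff column_entry) (simp add: matrix_vector_mult_def mult.commute)

lemma conjugate_column:
  assumes "g \<in> SU" and "t \<in> torus"
  shows "(g ** t ** adj g) *v (g *v axis i 1) = t $ i $ i *s (g *v axis i 1)"
proof -
  have "(g ** t ** adj g) *v (g *v axis i 1) = g *v (t *v ((adj g ** g) *v axis i 1))"
    by (simp add: matrix_vector_mul_assoc matrix_mul_assoc)
  then show ?thesis
    by (simp add: SU_left_inverse[OF assms(1)] torus_column[OF assms(2)]
        vec.linear_scale[OF matrix_vector_mul_linear_gen])
qed

lemma SU_column_nonzero:
  assumes "g \<in> SU"
  shows "g *v axis i 1 \<noteq> 0"
proof
  assume "g *v axis i 1 = 0"
  then have "adj g *v (g *v axis i 1) = 0" by simp
  then show False
    using SU_left_inverse[OF assms] by (simp add: matrix_vector_mul_assoc axis_eq_0_iff)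
qed

text \<open>In the coordinates given by the columns of \<open>g\<close> the matrix is \<open>t\<close>.\<close>

lemma eigenspace_conjugate:
  assumes g: "g \<in> SU" and t: "t \<in> torus" and v: "v \<in> eigenspace (g ** t ** adj g) \<mu>"
  shows "v \<in> vec.span ((\<lambda>i. g *v axis i 1) ` {i. t $ i $ i = \<mu>})"
    and "v \<noteq> 0 \<Longrightarrow> \<exists>i. t $ i $ i = \<mu>"
proof -
  define w where "w = adj g *v v"
  have gw: "g *v w = v" using SU_right_inverse[OF g] by (simp add: w_def matrix_vector_mul_assoc)
  have "g *v (t *v w) = \<mu> *s v"
    using v by (simp add: eigenspace_def w_def matrix_vector_mul_assoc matrix_mul_assoc)
  then have "adj g *v (g *v (t *v w)) = adj g *v (\<mu> *s v)" by simp
  then have "t *v w = \<mu> *s w"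
    using SU_left_inverse[OF g]
    by (simp add: matrix_vector_mul_assoc w_def vec.linear_scale[OF matrix_vector_mul_linear_gen] matrix_mul_assoc)
  moreover have "(t *v w) $ i = t $ i $ i * w $ i" for i
  proof -
    have "(t *v w) $ i = (\<Sum>k\<in>UNIV. t $ i $ k * w $ k)" by (simp add: matrix_vector_mult_def)
    also have "\<dots> = (\<Sum>k\<in>UNIV. if k = i then t $ i $ i * w $ i else 0)"
      by (rule sum.cong) (use t in \<open>auto simp: torus_def\<close>)
    finally show ?thesis by simp
  qed
  ultimately have "t $ i $ i * w $ i = \<mu> * w $ i" for i by (metis vector_smult_component)
  then have w: "w $ i = 0" if "t $ i $ i \<noteq> \<mu>" for i using that by (metis mult_right_cancel)
  have "v = (\<Sum>i\<in>UNIV. w $ i *s (g *v axis i 1))" unfolding gw[symmetric] by (rule matrix_vector_expand)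
  also have "\<dots> \<in> vec.span ((\<lambda>i. g *v axis i 1) ` {i. t $ i $ i = \<mu>})"
  proof (rule vec.span_sum)
    fix i
    show "w $ i *s (g *v axis i 1) \<in> vec.span ((\<lambda>i. g *v axis i 1) ` {i. t $ i $ i = \<mu>})"
    proof (cases "t $ i $ i = \<mu>")
      case True
      then show ?thesis by (intro vec.span_scale vec.span_base) auto
    next
      case False
      then show ?thesis using w by (simp add: vec.span_zero)
    qed
  qed
  finally show "v \<in> vec.span ((\<lambda>i. g *v axis i 1) ` {i. t $ i $ i = \<mu>})" .
  show "\<exists>i. t $ i $ i = \<mu>" if "v \<noteq> 0"
  proof (rule ccontr)
    assume "\<nexists>i. t $ i $ i = \<mu>"
    then have "w = 0" using w by (simp add: vec_eq_iff)
    then show False using gw that by simp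
  qed
qed

lemma spec_conjugate:
  assumes g: "g \<in> SU" and t: "t \<in> torus"
  shows "spec (g ** t ** adj g) = range (\<lambda>i. t $ i $ i)"
proof
  show "spec (g ** t ** adj g) \<subseteq> range (\<lambda>i. t $ i $ i)"
    using eigenspace_conjugate(2)[OF g t] by (fastforce simp: spec_def)
  show "range (\<lambda>i. t $ i $ i) \<subseteq> spec (g ** t ** adj g)"
    using conjugate_column[OF g t] SU_column_nonzero[OF g] by (auto simp: spec_def eigenspace_def)
qed

definition arc_indices :: "complex \<Rightarrow> complex \<Rightarrow> ('n::finite) cmat \<Rightarrow> 'n set" where
  "arc_indices z w t = {i. z \<succ> t $ i $ i \<and> t $ i $ i \<succ> w}"

lemma eigenvalues_between_conjugate:
  assumes "g \<in> SU" and "t \<in> torus"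
  shows "eigenvalues_between z w (g ** t ** adj g) = (\<lambda>i. t $ i $ i) ` arc_indices z w t"
  by (auto simp: eigenvalues_between_def arc_indices_def spec_conjugate[OF assms])

lemma L_sum_conjugate:
  assumes g: "g \<in> SU" and t: "t \<in> torus"
  shows "L_sum z w (g ** t ** adj g) = vec.span ((\<lambda>i. g *v axis i 1) ` arc_indices z w t)"
proof
  let ?X = "g ** t ** adj g"
  show "L_sum z w ?X \<subseteq> vec.span ((\<lambda>i. g *v axis i 1) ` arc_indices z w t)"
    unfolding L_sum_def
  proof (rule vec.span_minimal[OF _ vec.subspace_span], rule UN_least)
    fix \<mu> assume "\<mu> \<in> eigenvalues_between z w ?X"
    then have "{i. t $ i $ i = \<mu>} \<subseteq> arc_indices z w t"
      by (auto simp: eigenvalues_between_def arc_indices_def)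
    then have "vec.span ((\<lambda>i. g *v axis i 1) ` {i. t $ i $ i = \<mu>}) \<subseteq>
        vec.span ((\<lambda>i. g *v axis i 1) ` arc_indices z w t)"
      by (intro vec.span_mono image_mono)
    then show "eigenspace ?X \<mu> \<subseteq> vec.span ((\<lambda>i. g *v axis i 1) ` arc_indices z w t)"
      using eigenspace_conjugate(1)[OF g t] by blast
  qed
  show "vec.span ((\<lambda>i. g *v axis i 1) ` arc_indices z w t) \<subseteq> L_sum z w ?X"
    unfolding L_sum_def
  proof (rule vec.span_mono, rule image_subsetI)
    fix i assume "i \<in> arc_indices z w t"
    then have "t $ i $ i \<in> eigenvalues_between z w ?X"
      unfolding eigenvalues_between_conjugate[OF g t] by blast
    moreover have "g *v axis i 1 \<in> eigenspace ?X (t $ i $ i)"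
      by (simp add: eigenspace_def conjugate_column[OF g t])
    ultimately show "g *v axis i 1 \<in> (\<Union>\<mu>\<in>eigenvalues_between z w ?X. eigenspace ?X \<mu>)" by blast
  qed
qed


section \<open>The phase\<close>

definition half_root :: "complex \<Rightarrow> complex \<Rightarrow> complex" where
  "half_root z a = csqrt (- z) * cnj (csqrt (- (z * cnj a)))"

lemma unit_exp_Arg2pi: "cmod w = 1 \<Longrightarrow> w = exp (\<i> * Arg2pi w)"
  using Arg2pi_eq[of w] by simp

lemma Arg2pi_inject: "cmod z = 1 \<Longrightarrow> cmod w = 1 \<Longrightarrow> Arg2pi z = Arg2pi w \<Longrightarrow> z = w"
  by (metis unit_exp_Arg2pi)

lemma csqrt_minus_unit:
  assumes w: "cmod w = 1" "w \<noteq> 1"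
  shows "csqrt (- w) = exp (\<i> * complex_of_real ((Arg2pi w - pi) / 2))"
proof -
  define b where "b = exp (\<i> * complex_of_real ((Arg2pi w - pi) / 2))"
  have "Arg2pi w \<noteq> 0" using unit_exp_Arg2pi[OF w(1)] w(2) by auto
  then have "0 < Arg2pi w" "Arg2pi w < 2 * pi" using Arg2pi_ge_0[of w] Arg2pi_lt_2pi[of w] by auto
  then have "0 < cos ((Arg2pi w - pi) / 2)" by (intro cos_gt_zero_pi) auto
  then have re: "0 < Re b" by (simp add: b_def exp_Euler Re_exp)
  have "2 * (\<i> * complex_of_real ((Arg2pi w - pi) / 2)) = \<i> * Arg2pi w - \<i> * pi"
    by (simp only: of_real_divide of_real_diff of_real_numeral) (simp add: right_diff_distrib)
  then have "b\<^sup>2 = exp (\<i> * Arg2pi w - \<i> * pi)" unfolding b_def exp_double[symmetric] by (rule arg_cong)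
  then have "b\<^sup>2 = - w" using unit_exp_Arg2pi[OF w(1)] by (simp add: exp_diff)
  then show ?thesis unfolding b_def[symmetric] using csqrt_square[of b] re by simp
qed

text \<open>
  For fixed \<open>z\<close>, \<open>half_root z\<close> is the square root of \<open>a\<close> with branch cut at \<open>z\<close>; moving \<open>z\<close> across \<open>a\<close>
  changes its sign, although it is smooth in both arguments where \<open>z \<noteq> a\<close>, also at \<open>a = 1\<close>.
\<close>

lemma half_root_eq:
  assumes z: "cmod z = 1" "z \<noteq> 1" and a: "cmod a = 1" and "z \<noteq> a"
  shows "half_root z a = (if z \<succ> a then 1 else - 1) * exp (\<i> * complex_of_real (Arg2pi a / 2))"
proof -
  have ne: "Arg2pi z \<noteq> Arg2pi a" using Arg2pi_inject[OF z(1) a] assms(4) by blast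
  have za: "cmod (z * cnj a) = 1" using z(1) a by (simp add: norm_mult)
  have "z * cnj a \<noteq> 1"
  proof
    assume "z * cnj a = 1"
    then have "z * (cnj a * a) = a" by (simp add: mult.assoc[symmetric])
    moreover have "cnj a * a = 1" using a by (metis complex_norm_square mult.commute of_real_1 power_one)
    ultimately show False using assms(4) by simp
  qed
  note root = csqrt_minus_unit[OF z] csqrt_minus_unit[OF za this]
  have cnj_a: "cnj a = exp (- (\<i> * Arg2pi a))"
    by (subst unit_exp_Arg2pi[OF a]) (simp add: exp_cnj)
  have prod: "z * cnj a = exp (\<i> * complex_of_real (Arg2pi z - Arg2pi a))"
  proof -
    have "z * cnj a = exp (\<i> * Arg2pi z) * exp (- (\<i> * Arg2pi a))"
      using unit_exp_Arg2pi[OF z(1)] cnj_a by simp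
    also have "\<dots> = exp (\<i> * complex_of_real (Arg2pi z - Arg2pi a))"
      unfolding exp_add[symmetric] by (simp add: algebra_simps)
    finally show ?thesis .
  qed
  have bounds: "0 \<le> Arg2pi z" "Arg2pi z < 2 * pi" "0 \<le> Arg2pi a" "Arg2pi a < 2 * pi"
    by (simp_all add: Arg2pi_ge_0 Arg2pi_lt_2pi)
  show ?thesis
  proof (cases "z \<succ> a")
    case True
    have "Arg2pi (z * cnj a) = Arg2pi z - Arg2pi a"
      by (rule Arg2pi_unique[of 1]) (use True bounds prod in \<open>auto simp: ccw_greater_def\<close>)
    then have "half_root z a = exp (\<i> * complex_of_real ((Arg2pi z - pi) / 2)) *
        exp (- (\<i> * complex_of_real ((Arg2pi z - Arg2pi a - pi) / 2)))"
      unfolding half_root_def root by (simp add: exp_cnj)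
    also have "\<dots> = exp (\<i> * complex_of_real (Arg2pi a / 2))"
      unfolding exp_add[symmetric] by (rule arg_cong[of _ _ exp]) (simp add: field_simps)
    finally show ?thesis using True by simp
  next
    case False
    have "exp (\<i> * complex_of_real (Arg2pi z - Arg2pi a + 2 * pi)) = z * cnj a"
      unfolding prod by (simp add: distrib_left exp_add mult.commute mult.left_commute)
    then have arg: "Arg2pi (z * cnj a) = Arg2pi z - Arg2pi a + 2 * pi"
      by (intro Arg2pi_unique[of 1]) (use False ne bounds in \<open>auto simp: ccw_greater_def\<close>)
    have shift: "Arg2pi z - Arg2pi a + 2 * pi - pi = Arg2pi z - Arg2pi a + pi" by simp
    have "half_root z a = exp (\<i> * complex_of_real ((Arg2pi z - pi) / 2)) *
        exp (- (\<i> * complex_of_real ((Arg2pi z - Arg2pi a + pi) / 2)))"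
      unfolding half_root_def root arg shift by (simp add: exp_cnj)
    also have "\<dots> = exp (\<i> * complex_of_real (Arg2pi a / 2)) * exp (- (\<i> * pi))"
      unfolding exp_add[symmetric] by (rule arg_cong[of _ _ exp]) (simp add: field_simps)
    finally show ?thesis using False by (simp add: exp_minus mult.commute)
  qed
qed

definition admissible :: "complex \<Rightarrow> ('n::finite) cmat \<Rightarrow> bool" where
  "admissible z t \<longleftrightarrow> z \<in> cut_circle \<and> t \<in> torus \<and> (\<forall>i. z \<noteq> t $ i $ i)"

lemma half_root_admissible:
  assumes "admissible z t"
  shows "half_root z (t $ i $ i) = (if z \<succ> t $ i $ i then 1 else - 1) * exp (\<i> * complex_of_real (Arg2pi (t $ i $ i) / 2))"
  using assms torus_entry_norm[of t i] by (intro half_root_eq) (auto simp: admissible_def cut_circle_def)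

lemma half_root_norm: "admissible z t \<Longrightarrow> cmod (half_root z (t $ i $ i)) = 1"
  by (simp add: half_root_admissible norm_mult)

lemma admissible_cases:
  assumes "admissible z t"
  shows "z \<succ> t $ i $ i \<or> t $ i $ i \<succ> z"
  using assms Arg2pi_inject[of z "t $ i $ i"] torus_entry_norm[of t i]
  by (force simp: admissible_def cut_circle_def ccw_greater_def)

text \<open>The sign of the square root records on which side of the branch cut the eigenvalue lies.\<close>

lemma half_root_jump:
  assumes "admissible z t" and "admissible w t" and "\<not> w \<succ> z"
  shows "half_root z (t $ i $ i) = (if i \<in> arc_indices z w t then - 1 else 1) * half_root w (t $ i $ i)"
  using assms admissible_cases[OF assms(2), of i]
  by (auto simp: half_root_admissible arc_indices_def ccw_greater_def)

lemma arc_indices_Un: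
  assumes "admissible z2 t" and "\<not> z2 \<succ> z1" and "\<not> z3 \<succ> z2"
  shows "arc_indices z1 z3 t = arc_indices z1 z2 t \<union> arc_indices z2 z3 t" and "arc_indices z1 z2 t \<inter> arc_indices z2 z3 t = {}"
  using admissible_cases[OF assms(1)] assms(2,3) by (auto simp: arc_indices_def ccw_greater_def)

lemma arc_indices_empty: "\<not> z \<succ> w \<Longrightarrow> arc_indices z w t = {}"
  by (auto simp: arc_indices_def ccw_greater_def)

text \<open>
  With \<open>I = arc_indices z w t\<close>, this is the function of \<open>(z, w, t)\<close> by which the frames are corrected. With
  \<open>f\<^sub>a(z)\<close> the logarithm of \<open>t\<^sub>a\<close> with branch cut at \<open>z\<close>, divided by \<open>2 \<pi> i\<close>, the cocycle of shuffle signs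
  is \<open>exp (i \<pi> \<Sum>\<^sub>b\<^sub><\<^sub>a \<epsilon>\<^sub>a \<union> \<epsilon>\<^sub>b)\<close> and \<open>\<epsilon>\<^sub>a\<close> is the coboundary of \<open>f\<^sub>a\<close>, so the cochain
  \<open>exp (i \<pi> \<Sum>\<^sub>b\<^sub><\<^sub>a f\<^sub>a \<epsilon>\<^sub>b)\<close> trivialises it.
\<close>

definition phase :: "complex \<Rightarrow> ('n::{finite,linorder}) cmat \<Rightarrow> 'n set \<Rightarrow> complex" where
  "phase z t I = (\<Prod>b\<in>I. \<Prod>a\<in>{b<..}. half_root z (t $ a $ a))"

lemma phase_empty [simp]: "phase z t {} = 1"
  by (simp add: phase_def)

lemma phase_norm: "admissible z t \<Longrightarrow> cmod (phase z t I) = 1"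
  by (simp add: phase_def half_root_norm flip: prod_norm)

text \<open>The sign as a product over pairs, in the same shape as \<^const>\<open>phase\<close>.\<close>

lemma shuffle_sign_prod:
  "shuffle_sign A B = (\<Prod>b\<in>B. \<Prod>a\<in>{b<..}. if a \<in> A then - 1 else 1)"
proof -
  have "(\<Prod>a\<in>{b<..}. if a \<in> A then - 1 else 1) = (- 1 :: complex) ^ card {a \<in> A. b < a}" for b
  proof -
    have "{b<..} \<inter> A = {a \<in> A. b < a}" by auto
    then show ?thesis by (simp add: prod.If_cases)
  qed
  moreover have "card {(a, b). a \<in> A \<and> b \<in> B \<and> b < a} = (\<Sum>b\<in>B. card {a \<in> A. b < a})"
  proof -
    have "card (SIGMA b:B. {a \<in> A. b < a}) = (\<Sum>b\<in>B. card {a \<in> A. b < a})" by (rule card_SigmaI) auto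
    moreover have "bij_betw (\<lambda>(a, b). (b, a)) {(a, b). a \<in> A \<and> b \<in> B \<and> b < a} (SIGMA b:B. {a \<in> A. b < a})"
      by (rule bij_betw_byWitness[where f' = "\<lambda>(b, a). (a, b)"]) auto
    note bij_betw_same_card[OF this]
    ultimately show ?thesis by (simp only:)
  qed
  ultimately show ?thesis by (simp add: shuffle_sign_def power_sum)
qed

text \<open>Replacing \<open>z\<^sub>1\<close> by \<open>z\<^sub>2\<close> in the factors that belong to the second arc changes the sign of exactly those
  square roots whose eigenvalue lies in the first arc: one sign for each inversion counted by the shuffle sign.\<close>

lemma phase_cocycle:
  assumes z1: "admissible z1 t" and z2: "admissible z2 t" and le: "\<not> z2 \<succ> z1" "\<not> z3 \<succ> z2"
  shows "phase z1 t (arc_indices z1 z2 t) * phase z2 t (arc_indices z2 z3 t) *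
      shuffle_sign (arc_indices z1 z2 t) (arc_indices z2 z3 t) = phase z1 t (arc_indices z1 z3 t)"
proof -
  let ?A = "arc_indices z1 z2 t" and ?B = "arc_indices z2 z3 t"
  have "phase z1 t ?B = (\<Prod>b\<in>?B. \<Prod>a\<in>{b<..}. (if a \<in> ?A then - 1 else 1) * half_root z2 (t $ a $ a))"
    unfolding phase_def using half_root_jump[OF z1 z2 le(1)] by simp
  also have "\<dots> = shuffle_sign ?A ?B * phase z2 t ?B"
    by (simp only: prod.distrib shuffle_sign_prod phase_def)
  finally have B: "phase z1 t ?B = shuffle_sign ?A ?B * phase z2 t ?B" .
  have "phase z1 t (?A \<union> ?B) = phase z1 t ?A * phase z1 t ?B"
    unfolding phase_def by (rule prod.union_disjoint) (simp_all add: arc_indices_Un(2)[OF z2 le])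
  then show ?thesis unfolding arc_indices_Un(1)[OF z2 le] B by (simp add: mult_ac)
qed

section \<open>The frame of the basic gerbe\<close>

lemma cline_scale: "c \<noteq> 0 \<Longrightarrow> cline (\<lambda>i. c * v i) = cline v"
proof
  assume c: "c \<noteq> 0"
  show "cline (\<lambda>i. c * v i) \<subseteq> cline v"
    by (auto simp: cline_def mult.assoc[symmetric])
  show "cline v \<subseteq> cline (\<lambda>i. c * v i)"
  proof
    fix p assume "p \<in> cline v"
    then obtain d where "p = (\<lambda>i. d * v i)" by (auto simp: cline_def)
    then have "p = (\<lambda>i. (d / c) * (c * v i))" using c by simp
    then show "p \<in> cline (\<lambda>i. c * v i)" by (simp only: cline_scale_mem)
  qed
qed

lemma unit_modulus_cnj: "cmod c = 1 \<Longrightarrow> c * cnj c = 1"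
  by (simp add: complex_norm_square[symmetric])

definition desc_frame ::
  "('n::{finite,linorder}) cmat \<Rightarrow> complex \<Rightarrow> complex \<Rightarrow> 'n cmat \<Rightarrow> 'n set cvec" where
  "desc_frame g z w t = (\<lambda>S. phase z t (arc_indices z w t) *
     wedge_family (\<lambda>i. g *v axis i 1) (arc_indices z w t) S)"

text \<open>The dual of a unit vector has conjugate coordinates.\<close>

definition basic_frame ::
  "('n::{finite,linorder}) cmat \<Rightarrow> complex \<Rightarrow> complex \<Rightarrow> 'n cmat \<Rightarrow> 'n set cvec" where
  "basic_frame g z w t = (if w \<succ> z then (\<lambda>S. cnj (desc_frame g w z t S)) else desc_frame g z w t)"

lemma desc_frame_trivial: "arc_indices z w t = {} \<Longrightarrow> desc_frame g z w t = ext_scalar 1"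
  by (simp add: desc_frame_def)

lemma cnj_ext_scalar_one: "(\<lambda>S. cnj (ext_scalar 1 S)) = ext_scalar 1"
  by (auto simp: ext_scalar_def)

lemma basic_frame_cnj: "basic_frame g z w t = (\<lambda>S. cnj (basic_frame g w z t S))"
proof -
  have "\<not> (w \<succ> z \<and> z \<succ> w)" by (simp add: ccw_greater_def)
  then consider "w \<succ> z" "\<not> z \<succ> w" | "z \<succ> w" "\<not> w \<succ> z" | "\<not> z \<succ> w" "\<not> w \<succ> z"
    by blast
  then show ?thesis
    by cases (simp_all add: basic_frame_def desc_frame_trivial arc_indices_empty cnj_ext_scalar_one)
qed

lemma unit_vector_desc_frame:
  assumes "unitary g" and "admissible z t"
  shows "unit_vector (desc_frame g z w t)"
  using wedge_family_unit_vector[OF assms(1)] unit_modulus_cnj[OF phase_norm[OF assms(2)]]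
  by (simp add: unit_vector_def desc_frame_def herm_scale)

lemma unit_vector_basic_frame:
  assumes "unitary g" and "admissible z t" and "admissible w t"
  shows "unit_vector (basic_frame g z w t)"
  using unit_vector_desc_frame[OF assms(1,2)] unit_vector_desc_frame[OF assms(1,3)]
  by (simp add: basic_frame_def unit_vector_cnj)

lemma wedge_basic_frame:
  assumes ad: "admissible z1 t" "admissible z2 t" and le: "\<not> z2 \<succ> z1" "\<not> z3 \<succ> z2"
  shows "wedge (basic_frame g z1 z2 t) (basic_frame g z2 z3 t) = basic_frame g z1 z3 t"
proof -
  have "\<not> z3 \<succ> z1" using le by (simp add: ccw_greater_def)
  moreover have "wedge (desc_frame g z1 z2 t) (desc_frame g z2 z3 t) = desc_frame g z1 z3 t"
  proof -
    let ?A = "arc_indices z1 z2 t" and ?B = "arc_indices z2 z3 t"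
    have "wedge (desc_frame g z1 z2 t) (desc_frame g z2 z3 t) =
        (\<lambda>S. (phase z1 t ?A * phase z2 t ?B * shuffle_sign ?A ?B) *
          wedge_family (\<lambda>i. g *v axis i 1) (?A \<union> ?B) S)"
      unfolding desc_frame_def wedge_scale_left wedge_scale_right wedge_family_wedge
      using arc_indices_Un(2)[OF ad(2) le] by (simp add: mult.assoc mult.left_commute)
    then show ?thesis
      unfolding phase_cocycle[OF ad le] arc_indices_Un(1)[OF ad(2) le, symmetric] by (simp only: desc_frame_def)
  qed
  ultimately show ?thesis using le by (simp add: basic_frame_def)
qed

lemma contract_right_scale:
  "contract_right (\<lambda>S. c * f S) (\<lambda>S. d * x S) = (\<lambda>S. c * d * contract_right f x S)"
  by (simp add: contract_right_def sum_distrib_left mult_ac)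

lemma contract_left_scale:
  "contract_left (\<lambda>S. d * x S) (\<lambda>S. c * f S) = (\<lambda>S. d * c * contract_left x f S)"
  by (simp add: contract_left_def sum_distrib_left mult_ac)

lemma contract_right_cnj:
  "contract_right (\<lambda>S. cnj (f S)) (\<lambda>S. cnj (x S)) = (\<lambda>S. cnj (contract_right f x S))"
  by (simp add: contract_right_def cnj_sum)

lemma contract_left_cnj:
  "contract_left (\<lambda>S. cnj (x S)) (\<lambda>S. cnj (f S)) = (\<lambda>S. cnj (contract_left x f S))"
  by (simp add: contract_left_def cnj_sum)

text \<open>Contraction undoes the wedge product of \<open>wedge_basic_frame\<close>.\<close>

lemma contract_basic_frame:
  assumes g: "unitary g" and ad: "admissible z1 t" "admissible z2 t"
    and le: "\<not> z2 \<succ> z1" "\<not> z3 \<succ> z2"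
  shows "contract_right (basic_frame g z1 z3 t) (basic_frame g z3 z2 t) = basic_frame g z1 z2 t"
    and "contract_left (basic_frame g z2 z1 t) (basic_frame g z1 z3 t) = basic_frame g z2 z3 t"
proof -
  let ?A = "arc_indices z1 z2 t" and ?B = "arc_indices z2 z3 t"
  let ?E = "wedge_family (\<lambda>i. g *v axis i 1)"
  have disj: "?A \<inter> ?B = {}" by (rule arc_indices_Un(2)[OF ad(2) le])
  have d: "basic_frame g z1 z2 t = (\<lambda>S. phase z1 t ?A * ?E ?A S)"
    "basic_frame g z2 z3 t = (\<lambda>S. phase z2 t ?B * ?E ?B S)"
    using le by (simp_all add: basic_frame_def desc_frame_def)
  have c: "basic_frame g z2 z1 t = (\<lambda>S. cnj (phase z1 t ?A) * cnj (?E ?A S))"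
    "basic_frame g z3 z2 t = (\<lambda>S. cnj (phase z2 t ?B) * cnj (?E ?B S))"
    unfolding basic_frame_cnj[of g z2 z1] basic_frame_cnj[of g z3 z2] d by simp_all
  have w: "basic_frame g z1 z3 t = (\<lambda>S. phase z1 t ?A * phase z2 t ?B * wedge (?E ?A) (?E ?B) S)"
    unfolding wedge_basic_frame[OF ad le, symmetric] d wedge_scale_left wedge_scale_right by (simp add: mult.assoc)
  have p: "phase z1 t ?A * cnj (phase z1 t ?A) = 1" "phase z2 t ?B * cnj (phase z2 t ?B) = 1"
    by (rule unit_modulus_cnj[OF phase_norm[OF ad(1)]], rule unit_modulus_cnj[OF phase_norm[OF ad(2)]])
  have "contract_right (basic_frame g z1 z3 t) (basic_frame g z3 z2 t) =
      (\<lambda>S. phase z1 t ?A * (phase z2 t ?B * cnj (phase z2 t ?B)) * ?E ?A S)"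
    unfolding w c contract_right_scale contract_wedge_family(1)[OF g disj] by (simp add: mult.assoc)
  then show "contract_right (basic_frame g z1 z3 t) (basic_frame g z3 z2 t) = basic_frame g z1 z2 t"
    unfolding p d by simp
  have disj': "?B \<inter> ?A = {}" using disj by blast
  have "contract_left (basic_frame g z2 z1 t) (basic_frame g z1 z3 t) =
      (\<lambda>S. phase z2 t ?B * (phase z1 t ?A * cnj (phase z1 t ?A)) * ?E ?B S)"
    unfolding w c contract_left_scale contract_wedge_family(2)[OF g disj'] by (simp add: mult_ac)
  then show "contract_left (basic_frame g z2 z1 t) (basic_frame g z1 z3 t) = basic_frame g z2 z3 t"
    unfolding p d by simp
qed

text \<open>Conjugation of coordinates exchanges a frame with the frame of the opposite pair. Up to this symmetry the
  six cases of the multiplication are the wedge product and the two contractions.\<close>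

lemma basic_mult_frame:
  assumes g: "unitary g" and ad: "admissible z1 t" "admissible z2 t" "admissible z3 t"
  shows "basic_mult z1 z2 z3 (\<lambda>S. c * basic_frame g z1 z2 t S) (\<lambda>S. d * basic_frame g z2 z3 t S) =
    (\<lambda>S. c * d * basic_frame g z1 z3 t S)"
proof -
  let ?F = "\<lambda>z w. basic_frame g z w t"
  have cnj: "(\<lambda>S. cnj (?F z w S)) = ?F w z" for z w by (rule basic_frame_cnj[symmetric])
  consider (1) "\<not> z2 \<succ> z1 \<and> \<not> z3 \<succ> z2"
    | (2) "\<not> (\<not> z2 \<succ> z1 \<and> \<not> z3 \<succ> z2)" "\<not> z3 \<succ> z1 \<and> \<not> z2 \<succ> z3"
    | (3) "\<not> (\<not> z2 \<succ> z1 \<and> \<not> z3 \<succ> z2)" "\<not> (\<not> z3 \<succ> z1 \<and> \<not> z2 \<succ> z3)" "\<not> z1 \<succ> z3 \<and> \<not> z2 \<succ> z1"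
    | (4) "\<not> (\<not> z2 \<succ> z1 \<and> \<not> z3 \<succ> z2)" "\<not> (\<not> z3 \<succ> z1 \<and> \<not> z2 \<succ> z3)" "\<not> (\<not> z1 \<succ> z3 \<and> \<not> z2 \<succ> z1)"
        "\<not> z1 \<succ> z2 \<and> \<not> z3 \<succ> z1"
    | (5) "\<not> (\<not> z2 \<succ> z1 \<and> \<not> z3 \<succ> z2)" "\<not> (\<not> z3 \<succ> z1 \<and> \<not> z2 \<succ> z3)" "\<not> (\<not> z1 \<succ> z3 \<and> \<not> z2 \<succ> z1)"
        "\<not> (\<not> z1 \<succ> z2 \<and> \<not> z3 \<succ> z1)" "\<not> z3 \<succ> z2 \<and> \<not> z1 \<succ> z3"
    | (6) "\<not> (\<not> z2 \<succ> z1 \<and> \<not> z3 \<succ> z2)" "\<not> (\<not> z3 \<succ> z1 \<and> \<not> z2 \<succ> z3)" "\<not> (\<not> z1 \<succ> z3 \<and> \<not> z2 \<succ> z1)"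
        "\<not> (\<not> z1 \<succ> z2 \<and> \<not> z3 \<succ> z1)" "\<not> (\<not> z3 \<succ> z2 \<and> \<not> z1 \<succ> z3)"
    by blast
  then show ?thesis
  proof cases
    case 1
    then have le: "\<not> z2 \<succ> z1" "\<not> z3 \<succ> z2" by simp_all
    show ?thesis
      unfolding basic_mult_def if_P[OF 1] wedge_scale_left wedge_scale_right wedge_basic_frame[OF ad(1,2) le]
      by (simp add: mult.assoc)
  next
    case 2
    then have le: "\<not> z3 \<succ> z1" "\<not> z2 \<succ> z3" by simp_all
    show ?thesis
      unfolding basic_mult_def if_not_P[OF 2(1)] if_P[OF 2(2)] contract_right_scale
        contract_basic_frame(1)[OF g ad(1,3) le] ..
  next
    case 3
    then have le: "\<not> z1 \<succ> z3" "\<not> z2 \<succ> z1" by simp_all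
    have "contract_right (?F z2 z3) (?F z1 z2) = ?F z1 z3"
      using arg_cong[OF contract_basic_frame(1)[OF g ad(3,1) le], of "\<lambda>f S. cnj (f S)"]
      unfolding contract_right_cnj[symmetric] cnj .
    then show ?thesis
      unfolding basic_mult_def if_not_P[OF 3(1)] if_not_P[OF 3(2)] if_P[OF 3(3)] contract_right_scale
      by (simp add: mult.commute)
  next
    case 4
    then have le: "\<not> z1 \<succ> z2" "\<not> z3 \<succ> z1" by simp_all
    show ?thesis
      unfolding basic_mult_def if_not_P[OF 4(1)] if_not_P[OF 4(2)] if_not_P[OF 4(3)] if_P[OF 4(4)]
        contract_left_scale contract_basic_frame(2)[OF g ad(2,1) le] ..
  next
    case 5
    then have le: "\<not> z3 \<succ> z2" "\<not> z1 \<succ> z3" by simp_all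
    have "contract_left (?F z2 z3) (?F z1 z2) = ?F z1 z3"
      using arg_cong[OF contract_basic_frame(2)[OF g ad(2,3) le], of "\<lambda>f S. cnj (f S)"]
      unfolding contract_left_cnj[symmetric] cnj .
    then show ?thesis
      unfolding basic_mult_def if_not_P[OF 5(1)] if_not_P[OF 5(2)] if_not_P[OF 5(3)] if_not_P[OF 5(4)]
        if_P[OF 5(5)] contract_left_scale
      by (simp add: mult.commute)
  next
    case 6
    then have le: "\<not> z2 \<succ> z3" "\<not> z1 \<succ> z2" by (auto simp: ccw_greater_def)
    have "wedge (?F z2 z3) (?F z1 z2) = ?F z1 z3"
      using arg_cong[OF wedge_basic_frame[OF ad(3,2) le, of g], of "\<lambda>f S. cnj (f S)"]
      unfolding wedge_cnj[symmetric] cnj .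
    then show ?thesis
      unfolding basic_mult_def if_not_P[OF 6(1)] if_not_P[OF 6(2)] if_not_P[OF 6(3)] if_not_P[OF 6(4)]
        if_not_P[OF 6(5)] wedge_scale_left wedge_scale_right
      by (simp add: mult_ac)
  qed
qed

lemma det_line_desc_frame:
  assumes g: "g \<in> SU" and ad: "admissible z t"
  shows "det_line (L_sum z w (g ** t ** adj g)) = cline (desc_frame g z w t)"
proof -
  have t: "t \<in> torus" using ad by (simp add: admissible_def)
  have "phase z t (arc_indices z w t) \<noteq> 0" using phase_norm[OF ad] by (metis norm_zero zero_neq_one)
  then show ?thesis
    unfolding L_sum_conjugate[OF g t] det_line_span[OF SU_unitary[OF g]] desc_frame_def by (rule cline_scale[symmetric])
qed

lemma basic_fibre_frame:
  assumes g: "g \<in> SU" and ad: "admissible z t" "admissible w t"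
  shows "basic_fibre z w (g ** t ** adj g) = cline (basic_frame g z w t)"
proof -
  let ?X = "g ** t ** adj g"
  have t: "t \<in> torus" using ad by (simp add: admissible_def)
  have trivial: "range ext_scalar = cline (ext_scalar 1 :: 'a set cvec)"
  proof -
    have "ext_scalar = (\<lambda>c S. c * ext_scalar 1 S :: complex)" by (auto simp: ext_scalar_def fun_eq_iff)
    then show ?thesis unfolding cline_def by (rule arg_cong[where f = range])
  qed
  have empty: "eigenvalues_between a b ?X = {} \<longleftrightarrow> arc_indices a b t = {}" for a b
    by (simp add: eigenvalues_between_conjugate[OF g t])
  show ?thesis
  proof (cases "z \<succ> w \<and> eigenvalues_between z w ?X \<noteq> {}")
    case True
    then have "\<not> w \<succ> z" by (auto simp: ccw_greater_def)
    then show ?thesis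
      unfolding basic_fibre_def if_P[OF True] det_line_desc_frame[OF g ad(1)] by (simp add: basic_frame_def)
  next
    case F1: False
    show ?thesis
    proof (cases "w \<succ> z \<and> eigenvalues_between w z ?X \<noteq> {}")
      case True
      then show ?thesis
        unfolding basic_fibre_def if_not_P[OF F1] if_P[OF True] det_line_desc_frame[OF g ad(2)]
          dual_line_cline[OF unit_vector_desc_frame[OF SU_unitary[OF g] ad(2)]]
        by (simp add: basic_frame_def)
    next
      case False
      have "arc_indices z w t = {} \<or> w \<succ> z"
        using F1 empty[of z w] arc_indices_empty[of z w t] by blast
      moreover have "arc_indices w z t = {}" if "w \<succ> z" using False empty that by blast
      ultimately have "basic_frame g z w t = ext_scalar 1"
        by (auto simp: basic_frame_def desc_frame_trivial cnj_ext_scalar_one)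
      then show ?thesis unfolding basic_fibre_def if_not_P[OF F1] if_not_P[OF False] trivial by simp
    qed
  qed
qed

lemma ext_map_desc_frame: "ext_map h (\<lambda>S. c * desc_frame g z w t S) = (\<lambda>S. c * desc_frame (h ** g) z w t S)"
  unfolding desc_frame_def ext_map_scale ext_map_wedge_family by (simp add: matrix_vector_mul_assoc)

lemma basic_act_frame:
  assumes h: "h \<in> SU" and g: "g \<in> SU" and ad: "admissible z t" "admissible w t"
  shows "(if w \<succ> z then dual_map (ext_map h) (det_line (L_sum w z (g ** t ** adj g)))
              (det_line (L_sum w z (h ** (g ** t ** adj g) ** adj h)))
          else ext_map h) (\<lambda>S. c * basic_frame g z w t S) = (\<lambda>S. c * basic_frame (h ** g) z w t S)"
proof (cases "w \<succ> z")
  case True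
  have hg: "h ** g \<in> SU" by (rule mult_in_SU[OF h g])
  have conj: "h ** (g ** t ** adj g) ** adj h = (h ** g) ** t ** adj (h ** g)"
    by (simp add: adj_mult matrix_mul_assoc)
  show ?thesis
    unfolding if_P[OF True] conj det_line_desc_frame[OF g ad(2)] det_line_desc_frame[OF hg ad(2)]
      basic_frame_def
    by (rule dual_map_cline[OF unit_vector_desc_frame[OF SU_unitary[OF g] ad(2)]
          unit_vector_desc_frame[OF SU_unitary[OF hg] ad(2)] ext_map_desc_frame])
next
  case False
  then show ?thesis by (simp add: basic_frame_def ext_map_desc_frame)
qed


section \<open>Transition functions\<close>

definition arc_sign :: "'n \<Rightarrow> complex \<Rightarrow> complex \<Rightarrow> ('n::finite) cmat \<Rightarrow> int" where
  "arc_sign i z w t = (if i \<in> arc_indices z w t then 1 else if i \<in> arc_indices w z t then - 1 else 0)"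

lemma eps_eq: "eps i ((z, t), C) ((w, t'), C') = arc_sign i z w t"
  by (simp add: eps_def arc_sign_def arc_indices_def)

text \<open>This gives the cocycle condition for \<open>\<epsilon>\<^sub>i\<close>.\<close>

lemma arc_sign_coboundary:
  assumes "admissible z t" and "admissible w t"
  shows "arc_sign i z w t = (if z \<succ> t $ i $ i then 1 else 0) - (if w \<succ> t $ i $ i then 1 else 0)"
  using admissible_cases[OF assms(1), of i] admissible_cases[OF assms(2), of i]
  by (auto simp: arc_sign_def arc_indices_def ccw_greater_def)

definition character_power :: "int \<Rightarrow> complex \<Rightarrow> complex" where
  "character_power e c = (if e = 1 then c else if e = - 1 then cnj c else 1)"

lemma column_mult_torus:
  assumes "s \<in> torus"
  shows "(g ** s) *v axis i 1 = s $ i $ i *s (g *v axis i 1)"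
  by (simp add: matrix_vector_mul_assoc[symmetric] torus_column[OF assms]
      vec.linear_scale[OF matrix_vector_mul_linear_gen])

lemma desc_frame_mult_torus:
  assumes "s \<in> torus"
  shows "desc_frame (g ** s) z w t = (\<lambda>S. (\<Prod>i\<in>arc_indices z w t. s $ i $ i) * desc_frame g z w t S)"
  unfolding desc_frame_def column_mult_torus[OF assms] wedge_family_scale by (simp add: mult.left_commute)

text \<open>The frames of the two gerbes transform by the same character of \<open>T\<close> under a change of lift. This is
  \<open>product_frame_mult_torus\<close> for the other one, and \<open>frame_transition\<close> draws the conclusion.\<close>

lemma basic_frame_mult_torus:
  assumes s: "s \<in> torus"
  shows "basic_frame (g ** s) z w t =
    (\<lambda>S. (\<Prod>i\<in>UNIV. character_power (arc_sign i z w t) (s $ i $ i)) * basic_frame g z w t S)"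
proof (cases "w \<succ> z")
  case True
  then have "arc_indices z w t = {}" by (intro arc_indices_empty) (simp add: ccw_greater_def)
  then have "character_power (arc_sign i z w t) (s $ i $ i) = (if i \<in> arc_indices w z t then cnj (s $ i $ i) else 1)" for i
    by (simp add: character_power_def arc_sign_def)
  then have "(\<Prod>i\<in>UNIV. character_power (arc_sign i z w t) (s $ i $ i)) = cnj (\<Prod>i\<in>arc_indices w z t. s $ i $ i)"
    by (simp add: prod.If_cases cnj_prod)
  then show ?thesis using True by (simp add: basic_frame_def desc_frame_mult_torus[OF s])
next
  case False
  then have "arc_indices w z t = {}" by (rule arc_indices_empty)
  then have "character_power (arc_sign i z w t) (s $ i $ i) = (if i \<in> arc_indices z w t then s $ i $ i else 1)" for i
    by (simp add: character_power_def arc_sign_def)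
  then have "(\<Prod>i\<in>UNIV. character_power (arc_sign i z w t) (s $ i $ i)) = (\<Prod>i\<in>arc_indices z w t. s $ i $ i)"
    by (simp add: prod.If_cases)
  then show ?thesis using False by (simp add: basic_frame_def desc_frame_mult_torus[OF s])
qed

definition column_vector :: "('n::finite) cmat \<Rightarrow> 'n \<Rightarrow> 'n cvec" where
  "column_vector g i = ($) (g *v axis i 1)"

definition product_frame ::
  "('n::finite) cmat \<Rightarrow> complex \<Rightarrow> complex \<Rightarrow> 'n cmat \<Rightarrow> ('n \<Rightarrow> 'n list) cvec" where
  "product_frame g z w t = pure_tensor (\<lambda>i. int_power_vector (arc_sign i z w t) (column_vector g i))"

lemma unit_vector_column:
  assumes "unitary g"
  shows "unit_vector (column_vector g i)"
  using unitary_columns[OF assms, of i i] by (simp add: unit_vector_def herm_UNIV column_vector_def)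

lemma product_frame_mult_torus:
  assumes s: "s \<in> torus"
  shows "product_frame (g ** s) z w t =
    (\<lambda>\<sigma>. (\<Prod>i\<in>UNIV. character_power (arc_sign i z w t) (s $ i $ i)) * product_frame g z w t \<sigma>)"
proof -
  have "column_vector (g ** s) i = (\<lambda>a. s $ i $ i * column_vector g i a)" for i
    by (simp add: column_vector_def column_mult_torus[OF s] fun_eq_iff)
  moreover have "arc_sign i z w t \<in> {-1, 0, 1}" for i by (simp add: arc_sign_def)
  ultimately have "int_power_vector (arc_sign i z w t) (column_vector (g ** s) i) =
      (\<lambda>xs. character_power (arc_sign i z w t) (s $ i $ i) *
        int_power_vector (arc_sign i z w t) (column_vector g i) xs)" for i
    by (simp only: int_power_vector_scale character_power_def)
  then show ?thesis unfolding product_frame_def by (simp only: pure_tensor_scale)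
qed

lemma unit_vector_product_frame:
  "unitary g \<Longrightarrow> unit_vector (product_frame g z w t)"
  unfolding product_frame_def
  by (intro unit_vector_pure_tensor unit_vector_int_power_vector unit_vector_column)

lemma frame_transition:
  assumes C: "C \<in> coset ` SU" "g \<in> C" "g' \<in> C" and ad: "admissible z t" "admissible w t"
  shows "herm (basic_frame g z w t) (basic_frame g' z w t) =
    herm (product_frame g z w t) (product_frame g' z w t)"
proof -
  have g': "g' \<in> SU" "C = coset g'" using flag_point[OF C(1,3)] by auto
  then obtain s where s: "s \<in> torus" "g = g' ** s" using C(2) by (auto simp: coset_def)
  show ?thesis
    unfolding s(2) basic_frame_mult_torus[OF s(1)] product_frame_mult_torus[OF s(1)] herm_scale_left
    using unit_vector_basic_frame[OF SU_unitary[OF g'(1)] ad] unit_vector_product_frame[OF SU_unitary[OF g'(1)], of z w t]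
    by (simp add: unit_vector_def)
qed


section \<open>Smoothness of the frames\<close>

lemma unit_not_nonneg_real: "cmod w = 1 \<Longrightarrow> w \<noteq> 1 \<Longrightarrow> w \<notin> \<real>\<^sub>\<ge>\<^sub>0"
proof
  assume w: "cmod w = 1" "w \<noteq> 1" "w \<in> \<real>\<^sub>\<ge>\<^sub>0"
  then have "0 \<le> Re w" "Im w = 0" by (auto simp: complex_nonneg_Reals_iff)
  then have "w = 1" using w(1) by (simp add: complex_eq_iff cmod_def)
  then show False using w(2) by simp
qed

lemma half_root_smooth:
  assumes z: "C_infinity_on k U z" and t: "C_infinity_on k U t"
    and ad: "\<forall>x\<in>U. admissible (z x) (t x)"
  shows "C_infinity_on k U (\<lambda>x. half_root (z x) (t x $ i $ i))"
proof -
  have a: "C_infinity_on k U (\<lambda>x. t x $ i $ i)" by (rule C_infinity_on_matrix_entry[OF t])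
  have zn: "cmod (z x) = 1" "z x \<noteq> 1" "cmod (t x $ i $ i) = 1" "z x \<noteq> t x $ i $ i" if "x \<in> U" for x
    using ad that torus_entry_norm[of "t x" i] by (auto simp: admissible_def cut_circle_def)
  have za: "cmod (z x * cnj (t x $ i $ i)) = 1" "z x * cnj (t x $ i $ i) \<noteq> 1" if "x \<in> U" for x
  proof -
    show "cmod (z x * cnj (t x $ i $ i)) = 1" using zn[OF that] by (simp add: norm_mult)
    show "z x * cnj (t x $ i $ i) \<noteq> 1"
    proof
      assume eq: "z x * cnj (t x $ i $ i) = 1"
      have "z x = z x * (cnj (t x $ i $ i) * t x $ i $ i)"
        using unit_modulus_cnj[OF zn(3)[OF that]] by (simp add: mult.commute)
      then have "z x = t x $ i $ i" using eq by (simp add: mult.assoc[symmetric])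
      then show False using zn(4)[OF that] by simp
    qed
  qed
  show ?thesis
    unfolding half_root_def
    by (intro C_infinity_on_mult C_infinity_on_cnj C_infinity_on_csqrt C_infinity_on_uminus z a)
       (simp_all add: unit_not_nonneg_real zn za)
qed

text \<open>The order of \<open>z\<close> and \<open>t\<^sub>i\<close> jumps when \<open>t\<^sub>i\<close> passes through \<open>1\<close>. The right-hand side is insensitive to this,
  as \<^const>\<open>half_root\<close> is smooth there.\<close>

lemma arc_indices_iff:
  assumes "admissible z t" and "admissible w t"
  shows "i \<in> arc_indices z w t \<longleftrightarrow>
    Re (half_root z (t $ i $ i) * cnj (half_root w (t $ i $ i))) < 0 \<and> z \<succ> w"
    and "Re (half_root z (t $ i $ i) * cnj (half_root w (t $ i $ i))) \<noteq> 0"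
proof -
  define e where "e = exp (\<i> * complex_of_real (Arg2pi (t $ i $ i) / 2))"
  have "cmod e = 1" by (simp add: e_def)
  then have e: "e * cnj e = 1" by (rule unit_modulus_cnj)
  have "half_root z (t $ i $ i) * cnj (half_root w (t $ i $ i)) =
      (if z \<succ> t $ i $ i then 1 else - 1) * (if w \<succ> t $ i $ i then 1 else - 1) * (e * cnj e)"
    unfolding half_root_admissible[OF assms(1)] half_root_admissible[OF assms(2)] e_def[symmetric] by simp
  then have K: "half_root z (t $ i $ i) * cnj (half_root w (t $ i $ i)) =
      (if z \<succ> t $ i $ i then 1 else - 1) * (if w \<succ> t $ i $ i then 1 else - 1)"
    unfolding e by simp
  show "i \<in> arc_indices z w t \<longleftrightarrow>
      Re (half_root z (t $ i $ i) * cnj (half_root w (t $ i $ i))) < 0 \<and> z \<succ> w"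
    unfolding K using admissible_cases[OF assms(1), of i] admissible_cases[OF assms(2), of i]
    by (auto simp: arc_indices_def ccw_greater_def)
  show "Re (half_root z (t $ i $ i) * cnj (half_root w (t $ i $ i))) \<noteq> 0" unfolding K by simp
qed

text \<open>The functions \<open>K i\<close> vanish nowhere, so their signs are locally constant; wherever one of them is negative,
  \<open>z \<noteq> w\<close>, so the order of these two is locally constant as well.\<close>

lemma arc_indices_locally_constant:
  assumes z: "C_infinity_on k U z" and w: "C_infinity_on k U w" and t: "C_infinity_on k U t"
    and ad: "\<forall>x\<in>U. admissible (z x) (t x)" "\<forall>x\<in>U. admissible (w x) (t x)" and u: "u \<in> U"
  shows "\<exists>V. u \<in> V \<and> V \<subseteq> U \<and> openin (Euclidean_space k) V \<and>
    (\<forall>x\<in>V. arc_indices (z x) (w x) (t x) = arc_indices (z u) (w u) (t u) \<and>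
      arc_indices (w x) (z x) (t x) = arc_indices (w u) (z u) (t u))"
proof -
  define K where "K i x = Re (half_root (z x) (t x $ i $ i) * cnj (half_root (w x) (t x $ i $ i)))" for i x
  define d where "d x = Arg2pi (z x) - Arg2pi (w x)" for x
  have K: "continuous_on U (K i)" for i
    unfolding K_def
    by (intro continuous_on_Re C_infinity_on_continuous[of k] C_infinity_on_mult C_infinity_on_cnj
        half_root_smooth z w t ad)
  have Arg: "continuous_on U (\<lambda>x. Arg2pi (y x))"
    if y: "C_infinity_on k U y" and cut: "\<forall>x\<in>U. y x \<in> cut_circle" for y
  proof (rule continuous_on_compose2[OF _ C_infinity_on_continuous[OF y] image_subset_iff[THEN iffD2, OF cut]])
    show "continuous_on cut_circle Arg2pi"
    proof (rule continuous_at_imp_continuous_on, rule ballI)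
      fix v :: complex assume v: "v \<in> cut_circle"
      have "v \<notin> \<real>\<^sub>\<ge>\<^sub>0"
        using unit_not_nonneg_real[of v] v by (simp add: cut_circle_def)
      then show "isCont Arg2pi v" by (rule continuous_at_Arg2pi)
    qed
  qed
  have d: "continuous_on U d"
    unfolding d_def using ad by (intro continuous_on_diff Arg z w) (auto simp: admissible_def)
  define V where "V = (\<Inter>i\<in>UNIV. U \<inter> K i -` {r. 0 < r * K i u}) \<inter>
    (U \<inter> d -` {r. d u = 0 \<or> 0 < r * d u})"
  have "openin (top_of_set U) (U \<inter> K i -` {r. 0 < r * K i u})" for i
    by (rule continuous_openin_preimage_gen[OF K]) (intro open_Collect_less continuous_intros)
  then have "openin (top_of_set U) (\<Inter>i\<in>UNIV. U \<inter> K i -` {r. 0 < r * K i u})"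
    by (intro openin_INT2) auto
  moreover have "openin (top_of_set U) (U \<inter> d -` {r. d u = 0 \<or> 0 < r * d u})"
    by (rule continuous_openin_preimage_gen[OF d]) (intro open_Collect_disj open_Collect_const open_Collect_less continuous_intros)
  ultimately have "openin (top_of_set U) V" unfolding V_def by (rule openin_Int)
  then have openV: "openin (Euclidean_space k) V"
    by (rule openin_Euclidean_space_trans[OF C_infinity_on_openin[OF z]])
  have K_nz: "K i x \<noteq> 0" if "x \<in> U" for i x
    unfolding K_def using arc_indices_iff(2) ad that by blast
  have uV: "u \<in> V"
    using u K_nz[OF u] by (auto simp: V_def zero_less_mult_iff linorder_neq_iff)
  have VU: "V \<subseteq> U" by (auto simp: V_def)
  have zw: "i \<in> arc_indices (z x) (w x) (t x) \<longleftrightarrow> K i x < 0 \<and> 0 < d x" if "x \<in> U" for i x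
    using arc_indices_iff(1)[of "z x" "t x" "w x" i] ad that by (auto simp: K_def d_def ccw_greater_def)
  have wz: "i \<in> arc_indices (w x) (z x) (t x) \<longleftrightarrow> K i x < 0 \<and> d x < 0" if "x \<in> U" for i x
    using arc_indices_iff(1)[of "w x" "t x" "z x" i] ad that by (auto simp: K_def d_def ccw_greater_def mult.commute)
  have K0: "K i u < 0 \<Longrightarrow> d u \<noteq> 0" for i
  proof
    assume "K i u < 0" "d u = 0"
    then have "Arg2pi (z u) = Arg2pi (w u)" by (simp add: d_def)
    then have "z u = w u"
      using Arg2pi_inject[of "z u" "w u"] ad u by (auto simp: admissible_def cut_circle_def)
    then have "K i u = (cmod (half_root (z u) (t u $ i $ i)))\<^sup>2"
      unfolding K_def by (simp add: complex_norm_square[symmetric])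
    then show False using \<open>K i u < 0\<close> by simp
  qed
  have sgn: "K i x < 0 \<longleftrightarrow> K i u < 0" "K i u < 0 \<Longrightarrow> (0 < d x \<longleftrightarrow> 0 < d u) \<and> (d x < 0 \<longleftrightarrow> d u < 0)"
    if "x \<in> V" for i x
  proof -
    have "0 < K i x * K i u" and d: "d u = 0 \<or> 0 < d x * d u" using that by (auto simp: V_def)
    then show "K i x < 0 \<longleftrightarrow> K i u < 0" by (auto simp: zero_less_mult_iff)
    show "(0 < d x \<longleftrightarrow> 0 < d u) \<and> (d x < 0 \<longleftrightarrow> d u < 0)" if "K i u < 0"
      using d K0[OF that] by (auto simp: zero_less_mult_iff)
  qed
  have "arc_indices (z x) (w x) (t x) = arc_indices (z u) (w u) (t u) \<and>
      arc_indices (w x) (z x) (t x) = arc_indices (w u) (z u) (t u)" if x: "x \<in> V" for x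
    using zw wz u x VU sgn[OF x] by (intro conjI set_eqI) (meson subsetD)+
  then show ?thesis using uV VU openV by blast
qed

lemma wedge_family_smooth:
  assumes U: "openin (Euclidean_space k) U" and v: "\<And>i a. C_infinity_on k U (\<lambda>x. v x i $ a)"
  shows "C_infinity_on k U (\<lambda>x. wedge_family (v x) A S)"
  using finite[of A]
proof (induction A arbitrary: S rule: finite_linorder_min_induct)
  case empty
  then show ?case using C_infinity_on_const[OF U] by simp
next
  case (insert b A)
  show ?case
    unfolding wedge_family_insert_min[OF insert.hyps(2)] wedge_ext_vector
    by (intro C_infinity_on_sum[OF U] C_infinity_on_mult v C_infinity_on_const[OF U] insert.IH)
qed

lemma column_smooth:
  fixes g :: "(nat \<Rightarrow> real) \<Rightarrow> ('n::finite) cmat"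
  assumes "C_infinity_on k U g"
  shows "C_infinity_on k U (\<lambda>x. (g x *v axis i 1) $ a)"
  unfolding column_entry by (rule C_infinity_on_matrix_entry[OF assms])

lemma desc_frame_smooth:
  assumes g: "C_infinity_on k U g" and z: "C_infinity_on k U z" and t: "C_infinity_on k U t"
    and ad: "\<forall>x\<in>U. admissible (z x) (t x)"
  shows "C_infinity_on k U (\<lambda>x. phase (z x) (t x) I * wedge_family (\<lambda>i. g x *v axis i 1) I S)"
  unfolding phase_def
  by (intro C_infinity_on_mult C_infinity_on_prod wedge_family_smooth half_root_smooth column_smooth
      C_infinity_on_openin[OF z] g z t ad)

lemma basic_frame_smooth:
  assumes g: "C_infinity_on k U g" and z: "C_infinity_on k U z" and w: "C_infinity_on k U w"
    and t: "C_infinity_on k U t"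
    and ad: "\<forall>x\<in>U. admissible (z x) (t x)" "\<forall>x\<in>U. admissible (w x) (t x)" and u: "u \<in> U"
  shows "\<exists>V. u \<in> V \<and> V \<subseteq> U \<and> plot coord_space k V (\<lambda>x. basic_frame (g x) (z x) (w x) (t x))"
proof -
  define I where "I = arc_indices (z u) (w u) (t u)"
  define J where "J = arc_indices (w u) (z u) (t u)"
  obtain V where V: "u \<in> V" "V \<subseteq> U" "openin (Euclidean_space k) V"
    and const: "\<forall>x\<in>V. arc_indices (z x) (w x) (t x) = I \<and> arc_indices (w x) (z x) (t x) = J"
    using arc_indices_locally_constant[OF z w t ad u] unfolding I_def J_def by (elim exE conjE)
  note sub = C_infinity_on_subset[OF _ V(3) V(2)]
  have adV: "\<forall>x\<in>V. admissible (z x) (t x)" "\<forall>x\<in>V. admissible (w x) (t x)" using ad V(2) by auto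
  have I: "C_infinity_on k V (\<lambda>x. phase (z x) (t x) I * wedge_family (\<lambda>i. g x *v axis i 1) I S)" for S
    by (rule desc_frame_smooth[OF sub[OF g] sub[OF z] sub[OF t] adV(1)])
  have J: "C_infinity_on k V (\<lambda>x. cnj (phase (w x) (t x) J * wedge_family (\<lambda>i. g x *v axis i 1) J S))" for S
    by (rule C_infinity_on_cnj[OF desc_frame_smooth[OF sub[OF g] sub[OF w] sub[OF t] adV(2)]])
  \<comment> \<open>Near points with \<open>z = w\<close> both orders occur, but there all arcs are empty and the frame is constant.\<close>
  have eq: "basic_frame (g x) (z x) (w x) (t x) =
      (if J = {} then (\<lambda>S. phase (z x) (t x) I * wedge_family (\<lambda>i. g x *v axis i 1) I S)
       else (\<lambda>S. cnj (phase (w x) (t x) J * wedge_family (\<lambda>i. g x *v axis i 1) J S)))" if "x \<in> V" for x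
  proof (cases "w x \<succ> z x")
    case True
    then have "I = {}" using const that arc_indices_empty[of "z x" "w x" "t x"] by (auto simp: ccw_greater_def)
    then show ?thesis
      using True const that by (simp add: basic_frame_def desc_frame_def cnj_ext_scalar_one)
  next
    case False
    then have "J = {}" using const that arc_indices_empty[of "w x" "z x" "t x"] by auto
    then show ?thesis using False const that by (simp add: basic_frame_def desc_frame_def)
  qed
  have "plot coord_space k V (\<lambda>x. if J = {} then (\<lambda>S. phase (z x) (t x) I * wedge_family (\<lambda>i. g x *v axis i 1) I S)
       else (\<lambda>S. cnj (phase (w x) (t x) J * wedge_family (\<lambda>i. g x *v axis i 1) J S)))"
    by (cases "J = {}") (simp_all only: plot_coord_space V(3) I J if_True if_False simp_thms)
  then have "plot coord_space k V (\<lambda>x. basic_frame (g x) (z x) (w x) (t x))"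
    by (rule plot_cong[OF diffeology_coord_space]) (simp only: eq)
  then show ?thesis using V(1,2) by blast
qed

lemma prod_list_smooth:
  assumes "openin (Euclidean_space k) U" and "\<And>a. C_infinity_on k U (\<lambda>x. v x a)"
  shows "C_infinity_on k U (\<lambda>x. prod_list (map (v x) xs) :: complex)"
  using assms by (induction xs) (simp_all add: C_infinity_on_const C_infinity_on_mult)

lemma int_power_vector_smooth:
  assumes U: "openin (Euclidean_space k) U" and v: "\<And>a. C_infinity_on k U (\<lambda>x. v x a)"
  shows "C_infinity_on k U (\<lambda>x. int_power_vector e (v x) xs)"
proof -
  have "C_infinity_on k U (\<lambda>x. prod_list (map (v x) xs))"
    "C_infinity_on k U (\<lambda>x. prod_list (map (\<lambda>i. cnj (v x i)) xs))"
    by (intro prod_list_smooth[OF U] v C_infinity_on_cnj)+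
  then show ?thesis
    using C_infinity_on_const[OF U, of 0]
    by (cases "length xs = nat \<bar>e\<bar>"; cases "e \<ge> 0") (simp_all add: int_power_vector_def power_vector_def)
qed

lemma product_frame_smooth:
  assumes g: "C_infinity_on k U g" and z: "C_infinity_on k U z" and w: "C_infinity_on k U w"
    and t: "C_infinity_on k U t"
    and ad: "\<forall>x\<in>U. admissible (z x) (t x)" "\<forall>x\<in>U. admissible (w x) (t x)" and u: "u \<in> U"
  shows "\<exists>V F. u \<in> V \<and> V \<subseteq> U \<and> plot coord_space k V (\<lambda>x. product_frame (g x) (z x) (w x) (t x)) \<and>
    finite F \<and> (\<forall>x\<in>V. \<forall>\<sigma>. \<sigma> \<notin> F \<longrightarrow> product_frame (g x) (z x) (w x) (t x) \<sigma> = 0)"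
proof -
  define e where "e i = arc_sign i (z u) (w u) (t u)" for i
  obtain V where V: "u \<in> V" "V \<subseteq> U" "openin (Euclidean_space k) V"
    and const: "\<forall>x\<in>V. arc_indices (z x) (w x) (t x) = arc_indices (z u) (w u) (t u) \<and>
      arc_indices (w x) (z x) (t x) = arc_indices (w u) (z u) (t u)"
    using arc_indices_locally_constant[OF z w t ad u] by (elim exE conjE)
  have eq: "product_frame (g x) (z x) (w x) (t x) = pure_tensor (\<lambda>i. int_power_vector (e i) (column_vector (g x) i))"
    if "x \<in> V" for x
    using const[rule_format, OF that] by (simp only: product_frame_def e_def arc_sign_def)
  have col: "C_infinity_on k V (\<lambda>x. column_vector (g x) i a)" for i a
    unfolding column_vector_def by (rule column_smooth[OF C_infinity_on_subset[OF g V(3,2)]])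
  have "plot coord_space k V (\<lambda>x. pure_tensor (\<lambda>i. int_power_vector (e i) (column_vector (g x) i)))"
    unfolding plot_coord_space pure_tensor_def
    by (intro conjI V(3) allI C_infinity_on_prod int_power_vector_smooth col)
  then have "plot coord_space k V (\<lambda>x. product_frame (g x) (z x) (w x) (t x))"
    by (rule plot_cong[OF diffeology_coord_space]) (simp only: eq)
  moreover define F :: "('a \<Rightarrow> 'a list) set" where "F = PiE UNIV (\<lambda>i. {xs. length xs = nat \<bar>e i\<bar>})"
  have "finite F" unfolding F_def by (intro finite_PiE) simp_all
  moreover have "product_frame (g x) (z x) (w x) (t x) \<sigma> = 0" if x: "x \<in> V" and \<sigma>: "\<sigma> \<notin> F" for x \<sigma>
  proof -
    obtain i where "length (\<sigma> i) \<noteq> nat \<bar>e i\<bar>" using \<sigma> by (auto simp: F_def PiE_def)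
    then have "int_power_vector (e i) (column_vector (g x) i) (\<sigma> i) = 0"
      by (simp add: int_power_vector_def power_vector_def)
    then show ?thesis unfolding eq[OF x] pure_tensor_def by (intro prod_zero) auto
  qed
  ultimately show ?thesis using V(1,2) by blast
qed

section \<open>The cover of the Weyl map\<close>

lemma diffeology_flag_space: "diffeology flag_space"
  unfolding flag_space_def by (intro diffeology_quotient_space diffeology_embedded)

lemma diffeology_weyl_domain: "diffeology weyl_domain"
  unfolding weyl_domain_def by (intro diffeology_prod_space diffeology_embedded diffeology_flag_space)

lemma local_flag_lift:
  assumes "plot flag_space k U C" and "u \<in> U"
  shows "\<exists>V \<beta>. u \<in> V \<and> V \<subseteq> U \<and> plot (embedded SU) k V \<beta> \<and> (\<forall>x\<in>V. \<beta> x \<in> C x)"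
proof -
  obtain V \<beta> where V: "u \<in> V" "V \<subseteq> U" "plot (embedded SU) k V \<beta>" "\<forall>x\<in>V. C x = coset (\<beta> x)"
    using assms unfolding flag_space_def plot_quotient_space by blast
  have "\<forall>x\<in>V. \<beta> x \<in> C x" using V(4) coset_self by metis
  then show ?thesis using V(1,2,3) by (intro exI[of _ V] exI[of _ \<beta>] conjI)
qed

lemma flag_act_plot:
  assumes h: "plot (embedded SU) k U h" and C: "plot flag_space k U C"
  shows "plot flag_space k U (\<lambda>x. (\<lambda>g. h x ** g) ` C x)"
proof (rule plot_locally[OF diffeology_flag_space plot_openin[OF diffeology_flag_space C]])
  fix u assume u: "u \<in> U"
  obtain V \<beta> where V: "u \<in> V" "V \<subseteq> U" "plot (embedded SU) k V \<beta>" "\<forall>x\<in>V. \<beta> x \<in> C x"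
    using local_flag_lift[OF C u] by (elim exE conjE)
  have openV: "openin (Euclidean_space k) V" by (rule plot_openin[OF diffeology_embedded V(3)])
  have hV: "plot (embedded SU) k V h" by (rule plot_subset[OF diffeology_embedded h V(2) openV])
  have prod: "plot (embedded SU) k V (\<lambda>x. h x ** \<beta> x)"
    using hV V(3) C_infinity_on_matrix_mult[of k V h \<beta>] mult_in_SU by (auto simp: image_subset_iff)
  have eq: "(\<lambda>g. h x ** g) ` C x = coset (h x ** \<beta> x)" if x: "x \<in> V" for x
  proof -
    have "C x \<in> coset ` SU" using plot_in_points[OF diffeology_flag_space C] V(2) x by auto
    then have "C x = coset (\<beta> x)" using flag_point(2) V(4) x by blast
    then show ?thesis by (simp add: coset_image)
  qed
  have "plot flag_space k V (\<lambda>x. (\<lambda>g. h x ** g) ` C x)"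
    unfolding flag_space_def plot_quotient_space
  proof (intro conjI openV ballI)
    fix v assume "v \<in> V"
    then show "\<exists>W \<gamma>. v \<in> W \<and> W \<subseteq> V \<and> plot (embedded SU) k W \<gamma> \<and>
        (\<forall>x\<in>W. (\<lambda>g. h x ** g) ` C x = coset (\<gamma> x))"
      using prod eq by (intro exI[of _ V] exI[of _ "\<lambda>x. h x ** \<beta> x"] conjI) simp_all
  qed
  then show "\<exists>V. u \<in> V \<and> V \<subseteq> U \<and> plot flag_space k V (\<lambda>x. (\<lambda>g. h x ** g) ` C x)"
    using V(1,2) by blast
qed

lemma flag_act_in: "h \<in> SU \<Longrightarrow> C \<in> coset ` SU \<Longrightarrow> (\<lambda>g. h ** g) ` C \<in> coset ` SU"
proof -
  assume h: "h \<in> SU" and "C \<in> coset ` SU"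
  then obtain x where x: "x \<in> SU" "C = coset x" by blast
  show "(\<lambda>g. h ** g) ` C \<in> coset ` SU"
    unfolding x(2) coset_image by (rule imageI[OF mult_in_SU[OF h x(1)]])
qed

lemma flag_act_mult: "(\<lambda>g. (h ** k) ** g) ` C = (\<lambda>g. h ** g) ` (\<lambda>g. k ** g) ` C"
  by (simp add: image_image matrix_mul_assoc)

lemma weyl_map_in_SU:
  assumes "t \<in> torus" and "C \<in> coset ` SU"
  shows "weyl_map (t, C) \<in> SU"
proof -
  obtain g where g: "g \<in> SU" "g \<in> C" using assms(2) coset_self by auto
  show ?thesis
    unfolding weyl_map_eq[OF assms g(2)]
    by (intro mult_in_SU g(1) torus_SU[OF assms(1)] adj_in_SU)
qed

lemma weyl_map_equivariant:
  assumes h: "h \<in> SU" and t: "t \<in> torus" and C: "C \<in> coset ` SU"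
  shows "weyl_map (t, (\<lambda>g. h ** g) ` C) = h ** weyl_map (t, C) ** adj h"
proof -
  obtain g where g: "g \<in> SU" "g \<in> C" using C coset_self by auto
  have hg: "h ** g \<in> (\<lambda>g. h ** g) ` C" using g(2) by blast
  show ?thesis
    unfolding weyl_map_eq[OF t C g(2)] weyl_map_eq[OF t flag_act_in[OF h C] hg]
    by (simp add: adj_mult matrix_mul_assoc)
qed

lemma weyl_map_smooth: "smooth_map weyl_domain (embedded SU) weyl_map"
proof (rule smooth_map_locallyI[OF diffeology_weyl_domain diffeology_embedded])
  show "weyl_map x \<in> points (embedded SU)" if "x \<in> points weyl_domain" for x
    using that by (cases x) (simp add: weyl_map_in_SU)
  fix k U and \<alpha> :: "(nat \<Rightarrow> real) \<Rightarrow> 'a cmat \<times> 'a cmat set" and u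
  assume \<alpha>: "plot weyl_domain k U \<alpha>" and u: "u \<in> U"
  have t: "C_infinity_on k U (\<lambda>x. fst (\<alpha> x))" and C: "plot flag_space k U (\<lambda>x. snd (\<alpha> x))"
    using \<alpha> by (simp_all add: weyl_domain_def)
  obtain V \<beta> where V: "u \<in> V" "V \<subseteq> U" "plot (embedded SU) k V \<beta>" "\<forall>x\<in>V. \<beta> x \<in> snd (\<alpha> x)"
    using local_flag_lift[OF C u] by (elim exE conjE)
  have openV: "openin (Euclidean_space k) V" by (rule plot_openin[OF diffeology_embedded V(3)])
  have \<beta>: "C_infinity_on k V \<beta>" using V(3) by simp
  have pts: "fst (\<alpha> x) \<in> torus" "snd (\<alpha> x) \<in> coset ` SU" if "x \<in> V" for x
    using plot_in_points[OF diffeology_weyl_domain \<alpha> subsetD[OF V(2) that]] by (simp_all add: mem_Times_iff)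
  have eq: "\<beta> x ** fst (\<alpha> x) ** adj (\<beta> x) = weyl_map (\<alpha> x)" if "x \<in> V" for x
    using weyl_map_eq[OF pts[OF that] V(4)[rule_format, OF that]] by simp
  have "C_infinity_on k V (\<lambda>x. \<beta> x ** fst (\<alpha> x) ** adj (\<beta> x))"
    by (intro C_infinity_on_matrix_mult C_infinity_on_adj \<beta> C_infinity_on_subset[OF t openV V(2)])
  then have "C_infinity_on k V (\<lambda>x. weyl_map (\<alpha> x))" by (rule C_infinity_on_cong) (rule eq)
  moreover have "weyl_map (\<alpha> x) \<in> SU" if "x \<in> V" for x
    using weyl_map_in_SU[OF pts[OF that]] by simp
  ultimately have "plot (embedded SU) k V (\<lambda>x. weyl_map (\<alpha> x))" by (simp add: image_subset_iff)
  then show "\<exists>V. u \<in> V \<and> V \<subseteq> U \<and> plot (embedded SU) k V (\<lambda>x. weyl_map (\<alpha> x))" using V(1,2) by blast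
qed

lemma smooth_action_weyl: "smooth_action (SU_group :: ('a::finite) cmat lie_group) weyl_domain weyl_act"
  unfolding smooth_action_def
proof (intro conjI ballI)
  show "smooth_map (group_space (SU_group :: 'a cmat lie_group) \<times>\<^sub>s weyl_domain) weyl_domain
      (\<lambda>(h, x). weyl_act h x)"
  proof (rule smooth_mapI)
    show "(case x of (h, x) \<Rightarrow> weyl_act h x) \<in> points weyl_domain"
      if "x \<in> points (group_space SU_group \<times>\<^sub>s weyl_domain)" for x :: "'a cmat \<times> 'a cmat \<times> 'a cmat set"
      using that by (cases x) (auto simp: SU_group_def weyl_act_def flag_act_in)
    fix k U and \<alpha> :: "(nat \<Rightarrow> real) \<Rightarrow> 'a cmat \<times> 'a cmat \<times> 'a cmat set"
    assume \<alpha>: "plot (group_space SU_group \<times>\<^sub>s weyl_domain) k U \<alpha>"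
    then have "plot (embedded SU) k U (\<lambda>x. fst (\<alpha> x))" "plot flag_space k U (\<lambda>x. snd (snd (\<alpha> x)))"
      and t: "plot (embedded torus) k U (\<lambda>x. fst (snd (\<alpha> x)))"
      by (simp_all add: SU_group_def weyl_domain_def)
    from flag_act_plot[OF this(1,2)] t
    show "plot weyl_domain k U (\<lambda>x. case \<alpha> x of (h, x) \<Rightarrow> weyl_act h x)"
      by (simp add: weyl_domain_def weyl_act_def split_beta)
  qed
qed (auto simp: SU_group_def weyl_act_def flag_act_mult)

lemma base_torus_cover [simp]: "base torus_cover = weyl_domain"
  and proj_torus_cover [simp]: "proj torus_cover ((z, t), C) = (t, C)"
  and act_base_torus_cover [simp]: "act_base torus_cover = weyl_act"
  and act_cover_torus_cover [simp]: "act_cover torus_cover h ((z, t), C) = ((z, t), (\<lambda>g. h ** g) ` C)"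
  by (simp_all add: torus_cover_def)

lemma torus_cover_point:
  "((z, t), C) \<in> points (cover torus_cover) \<longleftrightarrow> admissible z t \<and> C \<in> coset ` SU"
  by (auto simp: torus_cover_def admissible_def)

lemma diffeology_torus_cover: "diffeology (cover torus_cover)"
  unfolding torus_cover_def
  by (simp add: diffeology_prod_space diffeology_subspace_of diffeology_embedded diffeology_flag_space)

lemma plot_torus_cover:
  "plot (cover torus_cover) k U \<alpha> \<longleftrightarrow>
     C_infinity_on k U (\<lambda>x. fst (fst (\<alpha> x))) \<and> C_infinity_on k U (\<lambda>x. snd (fst (\<alpha> x))) \<and>
     plot flag_space k U (\<lambda>x. snd (\<alpha> x)) \<and> (\<forall>x\<in>U. admissible (fst (fst (\<alpha> x))) (snd (fst (\<alpha> x))))"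
  by (auto simp: torus_cover_def admissible_def image_subset_iff split_beta)

lemma infinite_cut_circle: "infinite cut_circle"
proof
  assume "finite cut_circle"
  then have "finite (Arg2pi ` cut_circle)" by (rule finite_imageI)
  moreover have "{0<..<2 * pi} \<subseteq> Arg2pi ` cut_circle"
  proof
    fix \<theta> :: real assume \<theta>: "\<theta> \<in> {0<..<2 * pi}"
    have arg: "Arg2pi (exp (\<i> * complex_of_real \<theta>)) = \<theta>"
      by (rule Arg2pi_unique[of 1]) (use \<theta> in auto)
    have "Arg2pi 1 = 0" by (rule Arg2pi_unique[of 1]) auto
    then have "exp (\<i> * complex_of_real \<theta>) \<noteq> 1" using arg \<theta> by auto
    then have "exp (\<i> * complex_of_real \<theta>) \<in> cut_circle" by (simp add: cut_circle_def)
    then show "\<theta> \<in> Arg2pi ` cut_circle" using arg by (metis imageI)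
  qed
  ultimately have "finite {0<..<2 * pi}" by (rule finite_subset[rotated])
  then show False using infinite_Ioo[of 0 "2 * pi"] pi_gt_zero by simp
qed

lemma admissible_exists:
  assumes "t \<in> torus"
  shows "\<exists>z. admissible z t"
proof -
  have "infinite (cut_circle - range (\<lambda>i. t $ i $ i))"
    by (rule Diff_infinite_finite[OF _ infinite_cut_circle]) simp
  then obtain z where "z \<in> cut_circle - range (\<lambda>i. t $ i $ i)" by (metis finite.emptyI ex_in_conv)
  then show ?thesis using assms by (auto simp: admissible_def)
qed

text \<open>Near a given point, \<open>z\<close> may be kept constant.\<close>

lemma torus_cover_submersion:
  "surjective_submersion (cover torus_cover) (weyl_domain :: (('a::finite) cmat \<times> _) smooth_space)
     (proj torus_cover)"
  unfolding surjective_submersion_def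
proof (intro conjI allI impI)
  have proj: "proj torus_cover y = (snd (fst y), snd y)" for y :: "(complex \<times> 'a cmat) \<times> 'a cmat set"
    by (metis prod.collapse proj_torus_cover)
  have in_points: "proj torus_cover y \<in> points weyl_domain" if "y \<in> points (cover torus_cover)"
    for y :: "(complex \<times> 'a cmat) \<times> 'a cmat set"
    using that by (cases y, cases "fst y") (auto simp: torus_cover_point admissible_def)
  show "smooth_map (cover torus_cover) (weyl_domain :: ('a cmat \<times> _) smooth_space) (proj torus_cover)"
  proof (rule smooth_mapI)
    show "proj torus_cover y \<in> points weyl_domain" if "y \<in> points (cover torus_cover)"
      for y :: "(complex \<times> 'a cmat) \<times> 'a cmat set" using that by (rule in_points)
    fix k U and \<alpha> :: "(nat \<Rightarrow> real) \<Rightarrow> (complex \<times> 'a cmat) \<times> 'a cmat set"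
    assume "plot (cover torus_cover) k U \<alpha>"
    then show "plot weyl_domain k U (\<lambda>x. proj torus_cover (\<alpha> x))"
      by (auto simp: plot_torus_cover proj weyl_domain_def admissible_def)
  qed
  show "proj torus_cover ` points (cover torus_cover) = points (weyl_domain :: ('a cmat \<times> _) smooth_space)"
  proof
    show "proj torus_cover ` points (cover torus_cover) \<subseteq> points (weyl_domain :: ('a cmat \<times> _) smooth_space)"
      using in_points by blast
    show "points (weyl_domain :: ('a cmat \<times> _) smooth_space) \<subseteq> proj torus_cover ` points (cover torus_cover)"
    proof
      fix m :: "'a cmat \<times> 'a cmat set" assume m: "m \<in> points weyl_domain"
      obtain t C where tC: "m = (t, C)" by (cases m)
      then obtain z where "admissible z t" using m admissible_exists by auto
      then have "((z, t), C) \<in> points (cover torus_cover)" using m tC by (simp add: torus_cover_point)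
      then show "m \<in> proj torus_cover ` points (cover torus_cover)"
        unfolding tC by (metis imageI proj_torus_cover)
    qed
  qed
  fix k U and \<alpha> :: "(nat \<Rightarrow> real) \<Rightarrow> 'a cmat \<times> 'a cmat set" and u y
  assume *: "plot weyl_domain k U \<alpha> \<and> u \<in> U \<and> y \<in> points (cover torus_cover) \<and> proj torus_cover y = \<alpha> u"
  then have \<alpha>: "plot weyl_domain k U \<alpha>" and u: "u \<in> U" by simp_all
  obtain z t C where y: "y = ((z, t), C)" by (metis prod.collapse)
  have ad: "admissible z t" and tC: "\<alpha> u = (t, C)" using * by (auto simp: y torus_cover_point)
  have tsm: "C_infinity_on k U (\<lambda>x. fst (\<alpha> x))" and Cpl: "plot flag_space k U (\<lambda>x. snd (\<alpha> x))"
    and tor: "fst (\<alpha> x) \<in> torus" if "x \<in> U" for x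
    using \<alpha> that by (auto simp: weyl_domain_def)
  note tsm = tsm[OF u] and Cpl = Cpl[OF u]
  define d where "d x = (\<Prod>i\<in>UNIV. z + - fst (\<alpha> x) $ i $ i)" for x
  define V where "V = U \<inter> d -` (- {0})"
  have U: "openin (Euclidean_space k) U" by (rule C_infinity_on_openin[OF tsm])
  have "C_infinity_on k U d"
    unfolding d_def
    by (intro C_infinity_on_prod[OF U] C_infinity_on_add C_infinity_on_const[OF U] C_infinity_on_uminus
        C_infinity_on_matrix_entry[OF tsm])
  then have "openin (top_of_set U) V"
    unfolding V_def by (intro continuous_openin_preimage_gen C_infinity_on_continuous) auto
  then have openV: "openin (Euclidean_space k) V" by (rule openin_Euclidean_space_trans[OF U])
  have VU: "V \<subseteq> U" by (auto simp: V_def)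
  have "u \<in> V" using u ad tC by (auto simp: V_def d_def admissible_def)
  moreover have "plot (cover torus_cover) k V (\<lambda>x. ((z, fst (\<alpha> x)), snd (\<alpha> x)))"
  proof -
    have "admissible z (fst (\<alpha> x))" if "x \<in> V" for x
      using that tor[of x] ad by (auto simp: V_def d_def admissible_def)
    then show ?thesis
      using C_infinity_on_subset[OF tsm openV VU] plot_subset[OF diffeology_flag_space Cpl VU openV]
      by (simp add: plot_torus_cover C_infinity_on_const[OF openV])
  qed
  ultimately show "\<exists>V \<beta>. u \<in> V \<and> V \<subseteq> U \<and> plot (cover torus_cover) k V \<beta> \<and> \<beta> u = y \<and>
      (\<forall>x\<in>V. proj torus_cover (\<beta> x) = \<alpha> x)"
    using VU by (intro exI[of _ V] exI[of _ "\<lambda>x. ((z, fst (\<alpha> x)), snd (\<alpha> x))"] conjI) (simp_all add: y tC)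
qed

lemma smooth_action_torus_cover:
  "smooth_action (SU_group :: ('a::finite) cmat lie_group) (cover torus_cover) (act_cover torus_cover)"
  unfolding smooth_action_def
proof (intro conjI ballI)
  have act: "act_cover torus_cover h y = (fst y, (\<lambda>g. h ** g) ` snd y)"
    for h and y :: "(complex \<times> 'a cmat) \<times> 'a cmat set"
    by (metis prod.collapse act_cover_torus_cover)
  show "smooth_map (group_space (SU_group :: 'a cmat lie_group) \<times>\<^sub>s cover torus_cover) (cover torus_cover)
      (\<lambda>(h, x). act_cover torus_cover h x)"
  proof (rule smooth_mapI)
    fix x :: "'a cmat \<times> (complex \<times> 'a cmat) \<times> 'a cmat set"
    assume x: "x \<in> points (group_space SU_group \<times>\<^sub>s cover torus_cover)"
    obtain h z t C where eq: "x = (h, (z, t), C)" by (metis prod.collapse)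
    show "(case x of (h, x) \<Rightarrow> act_cover torus_cover h x) \<in> points (cover torus_cover)"
      using x by (simp add: eq torus_cover_point SU_group_def flag_act_in)
  next
    fix k U and \<alpha> :: "(nat \<Rightarrow> real) \<Rightarrow> 'a cmat \<times> (complex \<times> 'a cmat) \<times> 'a cmat set"
    assume \<alpha>: "plot (group_space SU_group \<times>\<^sub>s cover torus_cover) k U \<alpha>"
    then have "plot (embedded SU) k U (\<lambda>x. fst (\<alpha> x))" "plot flag_space k U (\<lambda>x. snd (snd (\<alpha> x)))"
      by (simp_all add: SU_group_def plot_torus_cover)
    from flag_act_plot[OF this] \<alpha>
    show "plot (cover torus_cover) k U (\<lambda>x. case \<alpha> x of (h, x) \<Rightarrow> act_cover torus_cover h x)"
      by (simp add: plot_torus_cover act split_beta)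
  qed
  show "act_cover torus_cover (group_one SU_group) y = y" for y :: "(complex \<times> 'a cmat) \<times> 'a cmat set"
    by (simp add: act SU_group_def)
  show "act_cover torus_cover (group_mult SU_group h k) y = act_cover torus_cover h (act_cover torus_cover k y)"
    for h k and y :: "(complex \<times> 'a cmat) \<times> 'a cmat set"
    by (simp add: act SU_group_def flag_act_mult)
qed

lemma group_space_SU [simp]: "group_space SU_group = embedded SU"
  and group_mult_SU [simp]: "group_mult SU_group = (**)"
  and group_one_SU [simp]: "group_one SU_group = mat 1"
  by (simp_all add: SU_group_def)

lemma smooth_SU_mult: "smooth_map (embedded SU \<times>\<^sub>s embedded SU) (embedded SU) (\<lambda>(h, g). h ** g)"
proof (rule smooth_mapI)
  show "(case x of (h, g) \<Rightarrow> h ** g) \<in> points (embedded SU)" if "x \<in> points (embedded SU \<times>\<^sub>s embedded SU)"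
    for x :: "'a cmat \<times> 'a cmat"
    using that mult_in_SU by auto
  fix k U and \<alpha> :: "(nat \<Rightarrow> real) \<Rightarrow> 'a cmat \<times> 'a cmat"
  assume "plot (embedded SU \<times>\<^sub>s embedded SU) k U \<alpha>"
  then show "plot (embedded SU) k U (\<lambda>x. case \<alpha> x of (h, g) \<Rightarrow> h ** g)"
    using C_infinity_on_matrix_mult[of k U "\<lambda>x. fst (\<alpha> x)" "\<lambda>x. snd (\<alpha> x)"] mult_in_SU
    by (auto simp: image_subset_iff split_beta)
qed

lemma local_weyl_lift:
  assumes "plot weyl_domain k U \<alpha>" and "u \<in> U"
  shows "\<exists>V \<beta>. u \<in> V \<and> V \<subseteq> U \<and> plot (embedded SU) k V \<beta> \<and> (\<forall>x\<in>V. \<beta> x \<in> snd (\<alpha> x))"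
  by (rule local_flag_lift[OF _ assms(2)]) (use assms(1) in \<open>simp add: weyl_domain_def\<close>)

lemma weyl_domain_lifts:
  assumes "m \<in> points weyl_domain"
  shows "snd m \<subseteq> points (embedded SU)" and "snd m \<noteq> {}"
    and "g \<in> snd m \<Longrightarrow> h ** g \<in> snd (weyl_act h m)"
proof -
  obtain t C where m: "m = (t, C)" by (cases m)
  then have C: "C \<in> coset ` SU" using assms by simp
  show "snd m \<subseteq> points (embedded SU)" using flag_point(1)[OF C] by (auto simp: m)
  show "snd m \<noteq> {}" using C coset_self by (auto simp: m)
  show "g \<in> snd m \<Longrightarrow> h ** g \<in> snd (weyl_act h m)" by (simp add: m weyl_act_def)
qed


section \<open>The product of the cup product gerbes\<close>

definition flag_product ::
  "(('n::{finite,linorder}) cmat, 'n cmat \<times> 'n cmat set, (complex \<times> 'n cmat) \<times> 'n cmat set, 'n \<Rightarrow> 'n list) gerbe" where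
  "flag_product = reduced_product (\<lambda>i. cup_gerbe torus_cover (J_bundle i) J_act (eps i))"

lemma flag_product_submersion_fields [simp]:
  "base flag_product = weyl_domain" "cover flag_product = cover torus_cover"
  "proj flag_product = proj torus_cover" "act_base flag_product = weyl_act"
  "act_cover flag_product = act_cover torus_cover"
  by (simp_all add: flag_product_def reduced_product_def cup_gerbe_def Let_def)

lemma J_bundle_cline:
  assumes C: "C \<in> coset ` SU" "g \<in> C"
  shows "J_bundle i (t, C) = cline (column_vector g i)"
proof
  show "J_bundle i (t, C) \<subseteq> cline (column_vector g i)"
  proof
    fix p assume "p \<in> J_bundle i (t, C)"
    then obtain c g' where p: "p = ($) (c *s (g' *v axis i 1))" "g' \<in> C" by (auto simp: J_bundle_def)
    then obtain s where s: "s \<in> torus" "g' = g ** s" using flag_point(2)[OF C] by (auto simp: coset_def)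
    have "p = (\<lambda>a. (c * s $ i $ i) * column_vector g i a)"
      by (simp add: p(1) s(2) column_mult_torus[OF s(1)] column_vector_def fun_eq_iff)
    then show "p \<in> cline (column_vector g i)" by (simp only: cline_scale_mem)
  qed
  show "cline (column_vector g i) \<subseteq> J_bundle i (t, C)"
  proof
    fix p assume "p \<in> cline (column_vector g i)"
    then obtain c where "p = ($) (c *s (g *v axis i 1))"
      by (auto simp: cline_def column_vector_def fun_eq_iff)
    then show "p \<in> J_bundle i (t, C)" using C(2) by (auto simp: J_bundle_def)
  qed
qed

lemma J_act_column: "J_act h m (\<lambda>a. c * column_vector g i a) = (\<lambda>a. c * column_vector (h ** g) i a)"
proof -
  have "vec_lambda (\<lambda>a. c * column_vector g i a) = c *s (g *v axis i 1)"
    by (simp add: column_vector_def vec_eq_iff)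
  then show ?thesis
    by (simp add: J_act_def column_vector_def vec.linear_scale[OF matrix_vector_mul_linear_gen]
        matrix_vector_mul_assoc fun_eq_iff)
qed

lemma cup_fibre_frame:
  assumes C: "C \<in> coset ` SU" "g \<in> C"
  shows "fibre (cup_gerbe torus_cover (J_bundle i) J_act (eps i)) ((z, t), C) ((w, t), C) =
    cline (int_power_vector (arc_sign i z w t) (column_vector g i))"
  using unit_vector_column[OF SU_unitary[OF flag_point(1)[OF C]]]
  by (simp add: cup_gerbe_def eps_eq J_bundle_cline[OF C] line_power_cline)

lemma cup_frame_unit:
  "g \<in> SU \<Longrightarrow> unit_vector (int_power_vector (arc_sign i z w t) (column_vector g i))"
  by (rule unit_vector_int_power_vector[OF unit_vector_column[OF SU_unitary]])

lemma flag_product_fibre: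
  assumes "C \<in> coset ` SU" and "g \<in> C"
  shows "fibre flag_product ((z, t), C) ((w, t), C) = cline (product_frame g z w t)"
  unfolding flag_product_def product_frame_def
  by (rule reduced_product_fibre) (rule cup_fibre_frame[OF assms])

text \<open>No sign appears here, in contrast to \<open>wedge_family_wedge\<close>; this is what the phase in the other frame
  accounts for.\<close>

lemma flag_product_mult:
  assumes C: "C \<in> coset ` SU" "g \<in> C"
    and ad: "admissible z1 t" "admissible z2 t" "admissible z3 t"
  shows "mult flag_product ((z1, t), C) ((z2, t), C) ((z3, t), C)
      (\<lambda>\<sigma>. a * product_frame g z1 z2 t \<sigma>) (\<lambda>\<sigma>. b * product_frame g z2 z3 t \<sigma>) =
    (\<lambda>\<sigma>. a * b * product_frame g z1 z3 t \<sigma>)"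
  unfolding flag_product_def product_frame_def
proof (rule reduced_product_mult[OF cup_fibre_frame[OF C] cup_frame_unit cup_fibre_frame[OF C] cup_frame_unit])
  show g: "g \<in> SU" "g \<in> SU" by (rule flag_point(1)[OF C])+
  fix i c d
  have "arc_sign i z1 z3 t = arc_sign i z1 z2 t + arc_sign i z2 z3 t"
    by (simp add: arc_sign_coboundary ad)
  then show "mult (cup_gerbe torus_cover (J_bundle i) J_act (eps i)) ((z1, t), C) ((z2, t), C) ((z3, t), C)
      (\<lambda>j. c * int_power_vector (arc_sign i z1 z2 t) (column_vector g i) j)
      (\<lambda>j. d * int_power_vector (arc_sign i z2 z3 t) (column_vector g i) j) =
      (\<lambda>j. c * d * int_power_vector (arc_sign i z1 z3 t) (column_vector g i) j)"
    using line_power_mult_frame[OF unit_vector_column[OF SU_unitary[OF g(1)]]]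
    by (simp add: cup_gerbe_def eps_eq)
qed

lemma flag_product_act:
  assumes h: "h \<in> SU" and C: "C \<in> coset ` SU" "g \<in> C"
  shows "act_fibre flag_product h ((z, t), C) ((w, t), C) (\<lambda>\<sigma>. a * product_frame g z w t \<sigma>) =
    (\<lambda>\<sigma>. a * product_frame (h ** g) z w t \<sigma>)"
  unfolding flag_product_def product_frame_def
proof (rule reduced_product_act[OF cup_fibre_frame[OF C] cup_frame_unit])
  show g: "g \<in> SU" by (rule flag_point(1)[OF C])
  have hC: "(\<lambda>g. h ** g) ` C \<in> coset ` SU" "h ** g \<in> (\<lambda>g. h ** g) ` C"
    using flag_act_in[OF h C(1)] C(2) by blast+
  fix i c
  have "line_power_map (arc_sign i z w t) (J_act h (t, C)) (cline (column_vector g i)) (cline (column_vector (h ** g) i))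
      (\<lambda>xs. c * int_power_vector (arc_sign i z w t) (column_vector g i) xs) =
      (\<lambda>xs. c * int_power_vector (arc_sign i z w t) (column_vector (h ** g) i) xs)"
    by (rule line_power_map_cline[OF unit_vector_column[OF SU_unitary[OF g]]
          unit_vector_column[OF SU_unitary[OF mult_in_SU[OF h g]]] J_act_column])
  then show "act_fibre (cup_gerbe torus_cover (J_bundle i) J_act (eps i)) h ((z, t), C) ((w, t), C)
      (\<lambda>j. c * int_power_vector (arc_sign i z w t) (column_vector g i) j) =
      (\<lambda>j. c * int_power_vector (arc_sign i z w t) (column_vector (h ** g) i) j)"
    by (simp add: cup_gerbe_def eps_eq J_bundle_cline[OF C] weyl_act_def J_bundle_cline[OF hC])
qed

lemma torus_cover_same_fibre:
  assumes "same_fibre flag_product [y1, y2]"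
  obtains z1 z2 t C where "y1 = ((z1, t), C)" and "y2 = ((z2, t), C)" and "admissible z1 t"
    and "admissible z2 t" and "C \<in> coset ` SU"
proof -
  obtain z1 t C z2 t' C' where y: "y1 = ((z1, t), C)" "y2 = ((z2, t'), C')" by (metis prod.collapse)
  have "admissible z1 t" "admissible z2 t'" "C \<in> coset ` SU" "t' = t" "C' = C"
    using assms by (auto simp: y same_fibre_simps torus_cover_point)
  then show ?thesis using that[of z1 t C z2] y by simp
qed

definition product_frame_at ::
  "('n::{finite,linorder}) cmat \<Rightarrow> (complex \<times> 'n cmat) \<times> 'n cmat set \<Rightarrow> (complex \<times> 'n cmat) \<times> 'n cmat set \<Rightarrow>
   ('n \<Rightarrow> 'n list) cvec" where
  "product_frame_at g y1 y2 = product_frame g (fst (fst y1)) (fst (fst y2)) (snd (fst y1))"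

lemma framed_flag_product:
  "framed_gerbe SU_group (flag_product :: (('n::{finite,linorder}) cmat, _, _, _) gerbe)
     (embedded SU) snd (**) product_frame_at"
proof (unfold_locales, goal_cases)
  case (10 h y)
  obtain z t C where "y = ((z, t), C)" by (metis prod.collapse)
  then show ?case by (simp add: weyl_act_def)
next
  case (14 h g m)
  then show ?case by (simp only: flag_product_submersion_fields weyl_domain_lifts)
next
  case (15 m)
  then show ?case by (simp only: flag_product_submersion_fields weyl_domain_lifts)
next
  case (16 m)
  then show ?case by (simp only: flag_product_submersion_fields weyl_domain_lifts not_False_eq_True)
next
  case (17 k U \<alpha> u)
  then show ?case by (simp only: flag_product_submersion_fields local_weyl_lift)
next
  case (18 g y1 y2)
  from 18(1) obtain z1 z2 t C where y: "y1 = ((z1, t), C)" "y2 = ((z2, t), C)" "C \<in> coset ` SU"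
    by (rule torus_cover_same_fibre)
  then have "g \<in> SU" using 18(2) flag_point(1)[of C g] by simp
  then show ?case by (simp add: product_frame_at_def unit_vector_product_frame[OF SU_unitary])
next
  case (19 g y1 y2)
  from 19(1) obtain z1 z2 t C where y: "y1 = ((z1, t), C)" "y2 = ((z2, t), C)" "C \<in> coset ` SU"
    by (rule torus_cover_same_fibre)
  then show ?case using 19(2) flag_product_fibre[of C g] by (simp add: product_frame_at_def)
next
  case (20 k U \<alpha> \<beta> u)
  define z where "z = (\<lambda>x. fst (fst (fst (\<alpha> x))))"
  define w where "w = (\<lambda>x. fst (fst (snd (\<alpha> x))))"
  define t where "t = (\<lambda>x. snd (fst (fst (\<alpha> x))))"
  have plots: "plot (cover torus_cover) k U (\<lambda>x. fst (\<alpha> x))" "plot (cover torus_cover) k U (\<lambda>x. snd (\<alpha> x))"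
    and fib: "\<forall>x\<in>U. proj torus_cover (fst (\<alpha> x)) = proj torus_cover (snd (\<alpha> x))"
    using 20(1) by (auto simp: fibre_square_def split_beta)
  have "snd (fst (snd (\<alpha> x))) = t x" if "x \<in> U" for x
  proof -
    obtain a b c a' b' c' where "\<alpha> x = (((a, b), c), ((a', b'), c'))" by (metis prod.collapse)
    then show ?thesis using fib that by (auto simp: t_def)
  qed
  then have "\<forall>x\<in>U. admissible (z x) (t x)" "\<forall>x\<in>U. admissible (w x) (t x)"
    using plots by (auto simp: plot_torus_cover z_def w_def t_def)
  then show ?case
    using product_frame_smooth[of k U \<beta> z w t u] plots 20(2,4)
    by (simp add: product_frame_at_def plot_torus_cover z_def w_def t_def)
next
  case (21 y1 y2 y3 g c d)
  have "same_fibre flag_product [y1, y2]" "same_fibre flag_product [y1, y3]"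
    using 21(1) by (simp_all add: same_fibre_simps)
  then obtain z1 z2 z3 t C where y: "y1 = ((z1, t), C)" "y2 = ((z2, t), C)" "y3 = ((z3, t), C)" "C \<in> coset ` SU"
    and ad: "admissible z1 t" "admissible z2 t" "admissible z3 t"
    by (elim torus_cover_same_fibre) auto
  then show ?case using 21(2) flag_product_mult[of C g z1 t z2 z3 c d] by (simp add: product_frame_at_def)
next
  case (22 h y1 y2 g c)
  from 22(2) obtain z1 z2 t C where y: "y1 = ((z1, t), C)" "y2 = ((z2, t), C)" "C \<in> coset ` SU"
    by (rule torus_cover_same_fibre)
  then show ?case using 22(1,3) flag_product_act[of h C g z1 t z2 c] by (simp add: product_frame_at_def)
qed (simp_all add: diffeology_embedded diffeology_torus_cover diffeology_weyl_domain torus_cover_submersion smooth_action_weyl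
    smooth_action_torus_cover one_in_SU mult_in_SU smooth_SU_mult matrix_mul_assoc)


section \<open>The pullback of the basic gerbe\<close>

definition weyl_pullback ::
  "(('n::{finite,linorder}) cmat, 'n cmat \<times> 'n cmat set, ('n cmat \<times> 'n cmat set) \<times> complex \<times> 'n cmat, 'n set) gerbe" where
  "weyl_pullback = pullback_gerbe weyl_domain weyl_act weyl_map basic_gerbe"

lemma weyl_pullback_fields [simp]:
  "base weyl_pullback = weyl_domain" "proj weyl_pullback = fst" "act_base weyl_pullback = weyl_act"
  "act_cover weyl_pullback h (x, (z, X)) = (weyl_act h x, (z, h ** X ** adj h))"
  "fibre weyl_pullback (x, (z, X)) (x', (w, X')) = basic_fibre z w X"
  "mult weyl_pullback (x1, (z1, X1)) (x2, (z2, X2)) (x3, (z3, X3)) = basic_mult z1 z2 z3"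
  "act_fibre weyl_pullback h (x, (z, X)) (x', (w, X')) =
     (if w \<succ> z then dual_map (ext_map h) (det_line (L_sum w z X)) (det_line (L_sum w z (h ** X ** adj h)))
      else ext_map h)"
  by (simp_all add: weyl_pullback_def pullback_gerbe_def basic_gerbe_def)

lemma cover_weyl_pullback:
  "cover weyl_pullback = subspace_of (weyl_domain \<times>\<^sub>s
     subspace_of (embedded cut_circle \<times>\<^sub>s embedded SU) {(z, g). z \<notin> spec g}) {(x, y). weyl_map x = snd y}"
  by (simp add: weyl_pullback_def pullback_gerbe_def basic_gerbe_def)

lemma diffeology_weyl_pullback: "diffeology (cover weyl_pullback)"
  unfolding cover_weyl_pullback
  by (intro diffeology_subspace_of diffeology_prod_space diffeology_embedded diffeology_weyl_domain)

text \<open>The group element is the value of the Weyl map, so the cover of the pullback is \<open>Y\<^sub>T \<times> SU(n)/T\<close>.\<close>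

lemma weyl_pullback_point:
  "((t, C), (z, X)) \<in> points (cover weyl_pullback) \<longleftrightarrow>
     admissible z t \<and> C \<in> coset ` SU \<and> X = weyl_map (t, C)"
proof -
  have "z \<notin> spec (weyl_map (t, C)) \<longleftrightarrow> (\<forall>i. z \<noteq> t $ i $ i)" if t: "t \<in> torus" and C: "C \<in> coset ` SU"
  proof -
    obtain g where g: "g \<in> SU" "g \<in> C" using C coset_self by auto
    show ?thesis unfolding weyl_map_eq[OF t C g(2)] spec_conjugate[OF g(1) t] by auto
  qed
  then show ?thesis
    using weyl_map_in_SU[of t C] by (auto simp: cover_weyl_pullback admissible_def)
qed

definition to_torus_cover ::
  "(('n::{finite,linorder}) cmat \<times> 'n cmat set) \<times> complex \<times> 'n cmat \<Rightarrow> (complex \<times> 'n cmat) \<times> 'n cmat set" where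
  "to_torus_cover y = ((fst (snd y), fst (fst y)), snd (fst y))"

definition from_torus_cover ::
  "(complex \<times> ('n::{finite,linorder}) cmat) \<times> 'n cmat set \<Rightarrow> ('n cmat \<times> 'n cmat set) \<times> complex \<times> 'n cmat" where
  "from_torus_cover y = ((snd (fst y), snd y), (fst (fst y), weyl_map (snd (fst y), snd y)))"

lemma to_torus_cover_smooth: "smooth_map (cover weyl_pullback) (cover torus_cover) to_torus_cover"
proof (rule smooth_mapI)
  show in_points: "to_torus_cover y \<in> points (cover torus_cover)" if "y \<in> points (cover weyl_pullback)"
    for y :: "('a cmat \<times> 'a cmat set) \<times> complex \<times> 'a cmat"
  proof -
    obtain t C z X where "y = ((t, C), (z, X))" by (metis prod.collapse)
    then show ?thesis using that by (simp add: weyl_pullback_point torus_cover_point to_torus_cover_def)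
  qed
  fix k U and \<alpha> :: "(nat \<Rightarrow> real) \<Rightarrow> ('a cmat \<times> 'a cmat set) \<times> complex \<times> 'a cmat"
  assume \<alpha>: "plot (cover weyl_pullback) k U \<alpha>"
  have "admissible (fst (snd (\<alpha> x))) (fst (fst (\<alpha> x)))" if "x \<in> U" for x
    using in_points[OF plot_in_points[OF diffeology_weyl_pullback \<alpha> that]]
    by (simp add: to_torus_cover_def torus_cover_point)
  then show "plot (cover torus_cover) k U (\<lambda>x. to_torus_cover (\<alpha> x))"
    using \<alpha> by (simp add: cover_weyl_pullback plot_torus_cover to_torus_cover_def weyl_domain_def)
qed

lemma from_torus_cover_smooth: "smooth_map (cover torus_cover) (cover weyl_pullback) from_torus_cover"
proof (rule smooth_mapI)
  show in_points: "from_torus_cover y \<in> points (cover weyl_pullback)" if "y \<in> points (cover torus_cover)"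
    for y :: "(complex \<times> 'a cmat) \<times> 'a cmat set"
  proof -
    obtain z t C where "y = ((z, t), C)" by (metis prod.collapse)
    then show ?thesis using that by (simp add: weyl_pullback_point torus_cover_point from_torus_cover_def)
  qed
  fix k U and \<alpha> :: "(nat \<Rightarrow> real) \<Rightarrow> (complex \<times> 'a cmat) \<times> 'a cmat set"
  assume \<alpha>: "plot (cover torus_cover) k U \<alpha>"
  have domain: "plot weyl_domain k U (\<lambda>x. (snd (fst (\<alpha> x)), snd (\<alpha> x)))"
    using \<alpha> by (auto simp: plot_torus_cover weyl_domain_def admissible_def)
  have circle: "plot (embedded cut_circle) k U (\<lambda>x. fst (fst (\<alpha> x)))"
    using \<alpha> by (auto simp: plot_torus_cover admissible_def)
  have SU: "plot (embedded SU) k U (\<lambda>x. weyl_map (snd (fst (\<alpha> x)), snd (\<alpha> x)))"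
    by (rule smooth_map_plot[OF weyl_map_smooth domain])
  have "from_torus_cover (\<alpha> x) \<in> points (cover weyl_pullback)" if "x \<in> U" for x
    by (rule in_points[OF plot_in_points[OF diffeology_torus_cover \<alpha> that]])
  then show "plot (cover weyl_pullback) k U (\<lambda>x. from_torus_cover (\<alpha> x))"
    using domain circle SU by (auto simp: cover_weyl_pullback from_torus_cover_def)
qed

lemma from_to_torus_cover: "y \<in> points (cover weyl_pullback) \<Longrightarrow> from_torus_cover (to_torus_cover y) = y"
  by (cases y, cases "fst y", cases "snd y") (auto simp: weyl_pullback_point from_torus_cover_def to_torus_cover_def)

lemma to_from_torus_cover: "to_torus_cover (from_torus_cover y) = y"
  by (simp add: from_torus_cover_def to_torus_cover_def)

lemma to_torus_cover_diffeomorphism: "diffeomorphism (cover weyl_pullback) (cover torus_cover) to_torus_cover"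
  by (rule diffeomorphismI[OF diffeology_weyl_pullback diffeology_torus_cover to_torus_cover_smooth
        from_torus_cover_smooth from_to_torus_cover to_from_torus_cover])

lemma proj_to_torus_cover: "proj torus_cover (to_torus_cover y) = proj weyl_pullback y"
  by (simp add: to_torus_cover_def)

lemma act_cover_weyl_pullback:
  assumes "h \<in> SU" and "y \<in> points (cover weyl_pullback)"
  shows "act_cover weyl_pullback h y \<in> points (cover weyl_pullback)"
    and "to_torus_cover (act_cover weyl_pullback h y) = act_cover torus_cover h (to_torus_cover y)"
proof -
  obtain t C z X where y: "y = ((t, C), (z, X))" by (metis prod.collapse)
  have *: "admissible z t" "C \<in> coset ` SU" "X = weyl_map (t, C)" "t \<in> torus"
    using assms(2) by (simp_all add: y weyl_pullback_point admissible_def)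
  show "act_cover weyl_pullback h y \<in> points (cover weyl_pullback)"
    using * flag_act_in[OF assms(1)] weyl_map_equivariant[OF assms(1) *(4,2)]
    by (simp add: y weyl_act_def weyl_pullback_point)
  show "to_torus_cover (act_cover weyl_pullback h y) = act_cover torus_cover h (to_torus_cover y)"
    by (simp add: y to_torus_cover_def weyl_act_def)
qed

lemma weyl_pullback_submersion: "surjective_submersion (cover weyl_pullback) weyl_domain fst"
  using surjective_submersion_transfer[OF diffeology_weyl_pullback diffeology_torus_cover diffeology_weyl_domain
      to_torus_cover_diffeomorphism torus_cover_submersion proj_to_torus_cover] by simp

lemma smooth_action_weyl_pullback:
  "smooth_action SU_group (cover weyl_pullback) (act_cover weyl_pullback)"
  by (rule smooth_action_transfer[OF _ diffeology_weyl_pullback to_torus_cover_diffeomorphism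
        smooth_action_torus_cover])
     (simp_all add: diffeology_embedded act_cover_weyl_pullback one_in_SU mult_in_SU)

lemma weyl_pullback_same_fibre:
  assumes "same_fibre weyl_pullback [y1, y2]"
  obtains z1 z2 t C X where "y1 = ((t, C), (z1, X))" and "y2 = ((t, C), (z2, X))"
    and "X = weyl_map (t, C)" and "admissible z1 t" and "admissible z2 t" and "C \<in> coset ` SU"
proof -
  obtain t C z1 X t' C' z2 X' where y: "y1 = ((t, C), (z1, X))" "y2 = ((t', C'), (z2, X'))" by (metis prod.collapse)
  have "admissible z1 t" "admissible z2 t'" "C \<in> coset ` SU" "t' = t" "C' = C"
    "X = weyl_map (t, C)" "X' = weyl_map (t', C')"
    using assms by (auto simp: y same_fibre_simps weyl_pullback_point)
  then show ?thesis using that[of t C z1 X z2] y by simp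
qed

definition basic_frame_at ::
  "('n::{finite,linorder}) cmat \<Rightarrow> ('n cmat \<times> 'n cmat set) \<times> complex \<times> 'n cmat \<Rightarrow>
   ('n cmat \<times> 'n cmat set) \<times> complex \<times> 'n cmat \<Rightarrow> 'n set cvec" where
  "basic_frame_at g y1 y2 = basic_frame g (fst (snd y1)) (fst (snd y2)) (fst (fst y1))"

lemma framed_weyl_pullback:
  "framed_gerbe SU_group (weyl_pullback :: (('n::{finite,linorder}) cmat, _, _, _) gerbe)
     (embedded SU) snd (**) basic_frame_at"
proof (unfold_locales, goal_cases)
  case (10 h y)
  obtain x z X where "y = (x, (z, X))" by (metis prod.collapse)
  then show ?case by simp
next
  case (14 h g m)
  then show ?case by (simp only: weyl_pullback_fields weyl_domain_lifts)
next
  case (15 m)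
  then show ?case by (simp only: weyl_pullback_fields weyl_domain_lifts)
next
  case (16 m)
  then show ?case by (simp only: weyl_pullback_fields weyl_domain_lifts not_False_eq_True)
next
  case (17 k U \<alpha> u)
  then show ?case by (simp only: weyl_pullback_fields local_weyl_lift)
next
  case (18 g y1 y2)
  from 18(1) obtain z1 z2 t C X where y: "y1 = ((t, C), (z1, X))" "y2 = ((t, C), (z2, X))" "X = weyl_map (t, C)"
      "admissible z1 t" "admissible z2 t" "C \<in> coset ` SU"
    by (rule weyl_pullback_same_fibre)
  then have "g \<in> SU" using 18(2) flag_point(1)[of C g] by simp
  then show ?case using y by (simp add: basic_frame_at_def unit_vector_basic_frame[OF SU_unitary])
next
  case (19 g y1 y2)
  from 19(1) obtain z1 z2 t C X where y: "y1 = ((t, C), (z1, X))" "y2 = ((t, C), (z2, X))" "X = weyl_map (t, C)"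
      "admissible z1 t" "admissible z2 t" "C \<in> coset ` SU"
    by (rule weyl_pullback_same_fibre)
  have gC: "g \<in> C" using 19(2) y(1) by simp
  have t: "t \<in> torus" using y(4) by (simp add: admissible_def)
  show ?case
    using basic_fibre_frame[OF flag_point(1)[OF y(6) gC] y(4,5)]
    by (simp add: y(1,2) basic_frame_at_def y(3) weyl_map_eq[OF t y(6) gC])
next
  case (20 k U \<alpha> \<beta> u)
  define z where "z = (\<lambda>x. fst (snd (fst (\<alpha> x))))"
  define w where "w = (\<lambda>x. fst (snd (snd (\<alpha> x))))"
  define t where "t = (\<lambda>x. fst (fst (fst (\<alpha> x))))"
  have plots: "plot (cover weyl_pullback) k U (\<lambda>x. fst (\<alpha> x))" "plot (cover weyl_pullback) k U (\<lambda>x. snd (\<alpha> x))"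
    and fib: "\<forall>x\<in>U. fst (fst (\<alpha> x)) = fst (snd (\<alpha> x))"
    using 20(1) by (auto simp: fibre_square_def split_beta)
  note covers = smooth_map_plot[OF to_torus_cover_smooth plots(1)] smooth_map_plot[OF to_torus_cover_smooth plots(2)]
  have smooth: "C_infinity_on k U z" "C_infinity_on k U w" "C_infinity_on k U t"
    using covers by (simp_all add: plot_torus_cover to_torus_cover_def z_def w_def t_def)
  have ad: "\<forall>x\<in>U. admissible (z x) (t x)" "\<forall>x\<in>U. admissible (w x) (t x)"
    using covers fib by (auto simp: plot_torus_cover to_torus_cover_def z_def w_def t_def)
  have \<beta>: "C_infinity_on k U \<beta>" using 20(2) by simp
  obtain V where V: "u \<in> V" "V \<subseteq> U" "plot coord_space k V (\<lambda>x. basic_frame (\<beta> x) (z x) (w x) (t x))"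
    using basic_frame_smooth[OF \<beta> smooth ad 20(4)] by (elim exE conjE)
  then show ?case
    by (intro exI[of _ V] exI[of _ UNIV]) (simp add: basic_frame_at_def z_def w_def t_def)
next
  case (21 y1 y2 y3 g c d)
  have "same_fibre weyl_pullback [y1, y2]" "same_fibre weyl_pullback [y1, y3]"
    using 21(1) by (simp_all add: same_fibre_simps)
  then obtain z1 z2 z3 t C X where y: "y1 = ((t, C), (z1, X))" "y2 = ((t, C), (z2, X))" "y3 = ((t, C), (z3, X))"
      "C \<in> coset ` SU"
    and ad: "admissible z1 t" "admissible z2 t" "admissible z3 t"
    by (elim weyl_pullback_same_fibre) auto
  have "g \<in> SU" using 21(2) y flag_point(1)[of C g] by simp
  then show ?case using basic_mult_frame[OF SU_unitary ad] by (simp add: y basic_frame_at_def)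
next
  case (22 h y1 y2 g c)
  from 22(2) obtain z1 z2 t C X where y: "y1 = ((t, C), (z1, X))" "y2 = ((t, C), (z2, X))" "X = weyl_map (t, C)"
      "admissible z1 t" "admissible z2 t" "C \<in> coset ` SU"
    by (rule weyl_pullback_same_fibre)
  have gC: "g \<in> C" using 22(3) y(1) by simp
  have t: "t \<in> torus" using y(4) by (simp add: admissible_def)
  have h: "h \<in> SU" using 22(1) by simp
  have X: "X = g ** t ** adj g" unfolding y(3) by (rule weyl_map_eq[OF t y(6) gC])
  show ?case
    unfolding y(1,2) weyl_pullback_fields basic_frame_at_def fst_conv snd_conv weyl_act_def prod.case X
    by (rule basic_act_frame[OF h flag_point(1)[OF y(6) gC] y(4,5)])
qed (simp_all add: diffeology_embedded diffeology_weyl_pullback diffeology_weyl_domain weyl_pullback_submersion smooth_action_weyl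
    smooth_action_weyl_pullback one_in_SU mult_in_SU smooth_SU_mult matrix_mul_assoc)


section \<open>The isomorphism\<close>

theorem proposition5p3:
  "equivariant_gerbe_iso (SU_group :: ('n::{finite,linorder}) cmat lie_group)
     (pullback_gerbe weyl_domain weyl_act weyl_map basic_gerbe)
     (reduced_product (\<lambda>i::'n. cup_gerbe torus_cover (J_bundle i) J_act (eps i)))"
proof -
  have AB: "framed_gerbe_map SU_group (weyl_pullback :: ('n cmat, _, _, _) gerbe) flag_product
      (embedded SU) snd (**) basic_frame_at product_frame_at to_torus_cover"
  proof (intro framed_gerbe_map.intro framed_weyl_pullback framed_flag_product framed_gerbe_map_axioms.intro)
    show "smooth_map (cover weyl_pullback) (cover flag_product) to_torus_cover"
      by (simp add: to_torus_cover_smooth)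
    show "proj flag_product (to_torus_cover y) = proj weyl_pullback y" for y :: "('n cmat \<times> 'n cmat set) \<times> complex \<times> 'n cmat"
      using proj_to_torus_cover[of y] by simp
    fix y1 y2 :: "('n cmat \<times> 'n cmat set) \<times> complex \<times> 'n cmat" and g g' :: "'n cmat"
    assume "same_fibre weyl_pullback [y1, y2]" and g: "g \<in> snd (proj weyl_pullback y1)"
      "g' \<in> snd (proj weyl_pullback y1)"
    then obtain z1 z2 t C X where y: "y1 = ((t, C), (z1, X))" "y2 = ((t, C), (z2, X))"
        "admissible z1 t" "admissible z2 t" "C \<in> coset ` SU"
      by (elim weyl_pullback_same_fibre)
    then show "herm (basic_frame_at g y1 y2) (basic_frame_at g' y1 y2) =
        herm (product_frame_at g (to_torus_cover y1) (to_torus_cover y2))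
          (product_frame_at g' (to_torus_cover y1) (to_torus_cover y2))"
      using frame_transition[of C g g' z1 t z2] g
      by (simp add: basic_frame_at_def product_frame_at_def to_torus_cover_def)
  qed
  have BA: "framed_gerbe_map SU_group flag_product (weyl_pullback :: ('n cmat, _, _, _) gerbe)
      (embedded SU) snd (**) product_frame_at basic_frame_at from_torus_cover"
  proof (intro framed_gerbe_map.intro framed_weyl_pullback framed_flag_product framed_gerbe_map_axioms.intro)
    show "smooth_map (cover flag_product) (cover weyl_pullback) from_torus_cover"
      by (simp add: from_torus_cover_smooth)
    show "proj weyl_pullback (from_torus_cover y) = proj flag_product y" for y :: "(complex \<times> 'n cmat) \<times> 'n cmat set"
      using proj_to_torus_cover[of "from_torus_cover y"] by (simp add: to_from_torus_cover)
    fix y1 y2 :: "(complex \<times> 'n cmat) \<times> 'n cmat set" and g g' :: "'n cmat"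
    assume "same_fibre flag_product [y1, y2]" and g: "g \<in> snd (proj flag_product y1)"
      "g' \<in> snd (proj flag_product y1)"
    then obtain z1 z2 t C where y: "y1 = ((z1, t), C)" "y2 = ((z2, t), C)"
        "admissible z1 t" "admissible z2 t" "C \<in> coset ` SU"
      by (elim torus_cover_same_fibre)
    then show "herm (product_frame_at g y1 y2) (product_frame_at g' y1 y2) =
        herm (basic_frame_at g (from_torus_cover y1) (from_torus_cover y2))
          (basic_frame_at g' (from_torus_cover y1) (from_torus_cover y2))"
      using frame_transition[of C g g' z1 t z2] g
      by (simp add: basic_frame_at_def product_frame_at_def from_torus_cover_def)
  qed
  have "equivariant_gerbe_iso SU_group (weyl_pullback :: ('n cmat, _, _, _) gerbe) flag_product"
    by (rule framed_gerbe_iso[OF AB BA])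
       (simp_all add: from_to_torus_cover to_from_torus_cover act_cover_weyl_pullback)
  then show ?thesis unfolding weyl_pullback_def flag_product_def .
qed

end
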